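(* Let $C$ be a kernel configuration. If $\rho\in K[X]$ is a polynomial and $(\mathcal M,\theta)\models T^C_\theta$ is existentially closed, then one of the following holds: (i) $(\mathcal M,\operatorname{Im}(\rho[\theta]))=(\mathcal M,\{0\})$; (ii) $(\mathcal M,\operatorname{Im}(\rho[\theta]))=(\mathcal M,\mathbb V)$; (iii) $(\mathcal M,\operatorname{Im}(\rho[\theta]))$ is an existentially closed model of $T_V$.
   Context: **Setting.** $K$ is a field, $L$ a first-order language and $T$ a model-complete $L$-theory. Fix $L$-formulas without parameters which in every model $\mathcal M\models T$ define an infinite $K$-vector space $(\mathbb V,0,+,(\lambda\cdot)_{\lambda\in K})$ (the set $\mathbb V=\mathbb V^{\mathcal M}$ may consist of tuples, but its elements are treated as single elements). $L_\theta=L\cup\{\theta\}$ and $T_\theta$ is $T$ together with "$\theta$ restricted to $\mathbb V$ is a $K$-vector space endomorphism of $\mathbb V$" and "$\theta(x)=0$ for all $x\notin\mathbb V$". For $\rho=\sum_i\rho_iX^i\in K[X]$, $\rho[\theta]=\sum_i\rho_i\theta^i$ as an endomorphism of $\mathbb V$, with kernel $\operatorname{Ker}(\rho[\theta])$ and image $\operatorname{Im}(\rho[\theta])$ in $\mathbb V$. $T_V$ is the theory $T\cup\{\text{"}V\text{ is a vector subspace of }\mathbb V\text{"}\}$ in the language $L\cup\{V\}$, where $V$ is a predicate of the same arity as $\mathbb V$. For $A\subseteq\mathbb V$, $(\mathcal M,A)$ is the expansion of $\mathcal M$ interpreting $V$ by $A$. **Kernel configurations.** $K[X]_{\mathrm{irr}}$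 is the set of monic irreducible polynomials over $K$. A kernel configuration is a pair $C=(c,d)$ with $c:K[X]_{\mathrm{irr}}\to\mathbb N\cup\{\infty\}$ a function and $d\in\mathbb N_{>0}\cup\{\infty\}$ either equal to $\infty$ or equal to $\sum_f\deg(f)c(f)$. Write $C(f)=c(f)$, $\deg(C)=d$. $C$ is algebraic if $d<\infty$, and then $\operatorname{MiPo}(C)=\prod_f f^{C(f)}$; $C$ is transcendental if $d=\infty$. An endomorphism $\theta$ of $\mathbb V$ is a $C$-endomorphism if: $\operatorname{MiPo}(C)[\theta]=0$ (when $C$ is algebraic); $\operatorname{Ker}(f^{C(f)}[\theta])=\operatorname{Ker}(f^{C(f)+1}[\theta])$ for all $f\in K[X]_{\mathrm{irr}}$ with $C(f)<\infty$ (when $C$ is transcendental). $T^C_\theta$ is $T_\theta$ together with "$\theta$ is a $C$-endomorphism". *)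

theory Defs
  imports
    "HOL-Algebra.Algebraic_Closure_Type"
    "HOL-Library.Extended_Nat"
    "HOL-Library.Equipollence"
begin

section \<open>First-order logic\<close>

text \<open>
  A language consists of sets of symbols, not of whole types of symbols, so that, for
  example, purely relational languages are covered.  Constants are 0-ary function symbols.
\<close>

record ('f, 'r) lang =
  Funs :: "'f set"
  Rels :: "'r set"
  farity :: "'f \<Rightarrow> nat"
  rarity :: "'r \<Rightarrow> nat"

datatype 'f trm = Vr nat | Fn 'f "'f trm list"

datatype ('f, 'r) form =
    Equal "'f trm" "'f trm"
  | Rel 'r "'f trm list"
  | Neg "('f, 'r) form"
  | Conj "('f, 'r) form" "('f, 'r) form"
  | Ex nat "('f, 'r) form"

primrec fv_trm :: "'f trm \<Rightarrow> nat set" where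
  "fv_trm (Vr i) = {i}"
| "fv_trm (Fn f ts) = \<Union> (set (map fv_trm ts))"

primrec fv :: "('f, 'r) form \<Rightarrow> nat set" where
  "fv (Equal s t) = fv_trm s \<union> fv_trm t"
| "fv (Rel r ts) = (\<Union>t\<in>set ts. fv_trm t)"
| "fv (Neg \<phi>) = fv \<phi>"
| "fv (Conj \<phi> \<psi>) = fv \<phi> \<union> fv \<psi>"
| "fv (Ex i \<phi>) = fv \<phi> - {i}"

primrec trm_of :: "('f, 'r) lang \<Rightarrow> 'f trm \<Rightarrow> bool" where
  "trm_of L (Vr i) \<longleftrightarrow> True"
| "trm_of L (Fn f ts) \<longleftrightarrow>
     f \<in> Funs L \<and> length ts = farity L f \<and> list_all id (map (trm_of L) ts)"

primrec form_of :: "('f, 'r) lang \<Rightarrow> ('f, 'r) form \<Rightarrow> bool" where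
  "form_of L (Equal s t) \<longleftrightarrow> trm_of L s \<and> trm_of L t"
| "form_of L (Rel r ts) \<longleftrightarrow>
     r \<in> Rels L \<and> length ts = rarity L r \<and> (\<forall>t\<in>set ts. trm_of L t)"
| "form_of L (Neg \<phi>) \<longleftrightarrow> form_of L \<phi>"
| "form_of L (Conj \<phi> \<psi>) \<longleftrightarrow> form_of L \<phi> \<and> form_of L \<psi>"
| "form_of L (Ex i \<phi>) \<longleftrightarrow> form_of L \<phi>"

primrec quantifier_free :: "('f, 'r) form \<Rightarrow> bool" where
  "quantifier_free (Equal s t) \<longleftrightarrow> True"
| "quantifier_free (Rel r ts) \<longleftrightarrow> True"
| "quantifier_free (Neg \<phi>) \<longleftrightarrow> quantifier_free \<phi>"
| "quantifier_free (Conj \<phi> \<psi>) \<longleftrightarrow> quantifier_free \<phi> \<and> quantifier_free \<psi>"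
| "quantifier_free (Ex i \<phi>) \<longleftrightarrow> False"

inductive existential :: "('f, 'r) form \<Rightarrow> bool" where
  "quantifier_free \<phi> \<Longrightarrow> existential \<phi>"
| "existential \<phi> \<Longrightarrow> existential (Ex i \<phi>)"

record ('f, 'r, 'a) struct =
  dom :: "'a set"
  funI :: "'f \<Rightarrow> 'a list \<Rightarrow> 'a"
  relI :: "'r \<Rightarrow> 'a list \<Rightarrow> bool"

definition tuples :: "('f, 'r, 'a) struct \<Rightarrow> nat \<Rightarrow> 'a list set" where
  "tuples M n = {xs. length xs = n \<and> set xs \<subseteq> dom M}"

definition structure_of :: "('f, 'r) lang \<Rightarrow> ('f, 'r, 'a) struct \<Rightarrow> bool" where
  "structure_of L M \<longleftrightarrow> dom M \<noteq> {} \<and>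
     (\<forall>f\<in>Funs L. \<forall>xs\<in>tuples M (farity L f). funI M f xs \<in> dom M)"

primrec val :: "('f, 'r, 'a) struct \<Rightarrow> (nat \<Rightarrow> 'a) \<Rightarrow> 'f trm \<Rightarrow> 'a" where
  "val M e (Vr i) = e i"
| "val M e (Fn f ts) = funI M f (map (val M e) ts)"

primrec sat :: "('f, 'r, 'a) struct \<Rightarrow> (nat \<Rightarrow> 'a) \<Rightarrow> ('f, 'r) form \<Rightarrow> bool" where
  "sat M e (Equal s t) \<longleftrightarrow> val M e s = val M e t"
| "sat M e (Rel r ts) \<longleftrightarrow> relI M r (map (val M e) ts)"
| "sat M e (Neg \<phi>) \<longleftrightarrow> \<not> sat M e \<phi>"
| "sat M e (Conj \<phi> \<psi>) \<longleftrightarrow> sat M e \<phi> \<and> sat M e \<psi>"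
| "sat M e (Ex i \<phi>) \<longleftrightarrow> (\<exists>a\<in>dom M. sat M (e(i := a)) \<phi>)"

definition theory_of :: "('f, 'r) lang \<Rightarrow> ('f, 'r) form set \<Rightarrow> bool" where
  "theory_of L T \<longleftrightarrow> (\<forall>\<phi>\<in>T. form_of L \<phi> \<and> fv \<phi> = {})"

definition model_of ::
  "('f, 'r) lang \<Rightarrow> ('f, 'r) form set \<Rightarrow> ('f, 'r, 'a) struct \<Rightarrow> bool" where
  "model_of L T M \<longleftrightarrow> structure_of L M \<and>
     (\<forall>\<phi>\<in>T. \<forall>e. range e \<subseteq> dom M \<longrightarrow> sat M e \<phi>)"

definition embedding ::
  "('f, 'r) lang \<Rightarrow> ('f, 'r, 'a) struct \<Rightarrow> ('f, 'r, 'b) struct \<Rightarrow> ('a \<Rightarrow> 'b) \<Rightarrow> bool" where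
  "embedding L M N h \<longleftrightarrow> h ` dom M \<subseteq> dom N \<and> inj_on h (dom M) \<and>
     (\<forall>f\<in>Funs L. \<forall>xs\<in>tuples M (farity L f). h (funI M f xs) = funI N f (map h xs)) \<and>
     (\<forall>r\<in>Rels L. \<forall>xs\<in>tuples M (rarity L r). relI M r xs \<longleftrightarrow> relI N r (map h xs))"

definition elementary_embedding ::
  "('f, 'r) lang \<Rightarrow> ('f, 'r, 'a) struct \<Rightarrow> ('f, 'r, 'b) struct \<Rightarrow> ('a \<Rightarrow> 'b) \<Rightarrow> bool" where
  "elementary_embedding L M N h \<longleftrightarrow> embedding L M N h \<and>
     (\<forall>\<phi> e. form_of L \<phi> \<and> range e \<subseteq> dom M \<longrightarrow> (sat M e \<phi> \<longleftrightarrow> sat N (h \<circ> e) \<phi>))"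

text \<open>
  Notions which quantify over all models of a theory take an argument \<open>TYPE('b)\<close>: the
  models over which they range have their domains inside the type \<open>'b\<close>.  Extensions are
  given by embeddings, so models of the same size as \<open>'b\<close> cause no problem, and by the
  downward Loewenheim-Skolem theorem nothing is lost as soon as \<open>'b\<close> is infinite and has at
  least as many elements as the language has symbols (and, for existential closedness, as
  the given model has elements).
\<close>

definition model_complete ::
  "'b itself \<Rightarrow> ('f, 'r) lang \<Rightarrow> ('f, 'r) form set \<Rightarrow> bool" where
  "model_complete _ L T \<longleftrightarrow>
     (\<forall>(M :: ('f, 'r, 'b) struct) (N :: ('f, 'r, 'b) struct) h.
        model_of L T M \<and> model_of L T N \<and> embedding L M N h \<longrightarrow> elementary_embedding L M N h)"

definition ec_in ::
  "('f, 'r) lang \<Rightarrow> ('f, 'r, 'a) struct \<Rightarrow> ('f, 'r, 'b) struct \<Rightarrow> bool" where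
  "ec_in L M N \<longleftrightarrow> (\<forall>h \<phi> e. embedding L M N h \<and> form_of L \<phi> \<and> existential \<phi> \<and>
     range e \<subseteq> dom M \<and> sat N (h \<circ> e) \<phi> \<longrightarrow> sat M e \<phi>)"


section \<open>The definable vector space\<close>

text \<open>
  Vectors are tuples of length \<open>vdim\<close>.  The free variables \<open>0, 1, \<dots>\<close> of the formulas stand
  for the entries of the concatenation of the tuples in question: \<open>x\<close> for \<open>fV\<close> and
  \<open>fzero\<close>, \<open>x @ y @ z\<close> for \<open>fadd\<close> (the graph \<open>x + y = z\<close>) and \<open>x @ y\<close> for \<open>fscale a\<close>
  (the graph \<open>a x = y\<close>).
\<close>

record ('f, 'r, 'k) vs_formulas =
  vdim :: nat
  fV :: "('f, 'r) form"
  fzero :: "('f, 'r) form"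
  fadd :: "('f, 'r) form"
  fscale :: "'k \<Rightarrow> ('f, 'r) form"

definition vs_formulas_of :: "('f, 'r) lang \<Rightarrow> ('f, 'r, 'k) vs_formulas \<Rightarrow> bool" where
  "vs_formulas_of L D \<longleftrightarrow>
     form_of L (fV D) \<and> fv (fV D) \<subseteq> {..<vdim D} \<and>
     form_of L (fzero D) \<and> fv (fzero D) \<subseteq> {..<vdim D} \<and>
     form_of L (fadd D) \<and> fv (fadd D) \<subseteq> {..<3 * vdim D} \<and>
     (\<forall>a. form_of L (fscale D a) \<and> fv (fscale D a) \<subseteq> {..<2 * vdim D})"

text \<open>Only the variables below \<open>length xs\<close> matter when \<open>sat_at\<close> is used.\<close>

definition sat_at :: "('f, 'r, 'a) struct \<Rightarrow> ('f, 'r) form \<Rightarrow> 'a list \<Rightarrow> bool" where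
  "sat_at M \<phi> xs \<longleftrightarrow> sat M (\<lambda>i. xs ! i) \<phi>"

definition VV :: "('f, 'r, 'k) vs_formulas \<Rightarrow> ('f, 'r, 'a) struct \<Rightarrow> 'a list set" where
  "VV D M = {xs \<in> tuples M (vdim D). sat_at M (fV D) xs}"

text \<open>The ring multiplication and unit of the \<open>module\<close> record play no role.\<close>

definition vs :: "('f, 'r, 'k) vs_formulas \<Rightarrow> ('f, 'r, 'a) struct \<Rightarrow> ('k, 'a list) module" where
  "vs D M =
     \<lparr> carrier = VV D M,
       monoid.mult = undefined,
       one = undefined,
       ring.zero = (THE z. z \<in> VV D M \<and> sat_at M (fzero D) z),
       add = (\<lambda>x y. THE z. z \<in> VV D M \<and> sat_at M (fadd D) (x @ y @ z)),
       module.smult = (\<lambda>a x. THE y. y \<in> VV D M \<and> sat_at M (fscale D a) (x @ y)) \<rparr>"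

definition defines_infinite_vs ::
  "('f, 'r, 'k::field) vs_formulas \<Rightarrow> ('f, 'r, 'a) struct \<Rightarrow> bool" where
  "defines_infinite_vs D M \<longleftrightarrow>
     (\<exists>!z. z \<in> VV D M \<and> sat_at M (fzero D) z) \<and>
     (\<forall>x\<in>VV D M. \<forall>y\<in>VV D M. \<exists>!z. z \<in> VV D M \<and> sat_at M (fadd D) (x @ y @ z)) \<and>
     (\<forall>a. \<forall>x\<in>VV D M. \<exists>!y. y \<in> VV D M \<and> sat_at M (fscale D a) (x @ y)) \<and>
     module (ring_of_type_algebra :: 'k ring) (vs D M) \<and>
     infinite (VV D M)"


section \<open>Endomorphisms and kernel configurations\<close>

definition vs_endo ::
  "('f, 'r, 'k) vs_formulas \<Rightarrow> ('f, 'r, 'a) struct \<Rightarrow> ('a list \<Rightarrow> 'a list) \<Rightarrow> bool" where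
  "vs_endo D M \<theta> \<longleftrightarrow>
     (\<forall>x\<in>VV D M. \<theta> x \<in> VV D M) \<and>
     (\<forall>x\<in>VV D M. \<forall>y\<in>VV D M. \<theta> (x \<oplus>\<^bsub>vs D M\<^esub> y) = \<theta> x \<oplus>\<^bsub>vs D M\<^esub> \<theta> y) \<and>
     (\<forall>a. \<forall>x\<in>VV D M. \<theta> (a \<odot>\<^bsub>vs D M\<^esub> x) = a \<odot>\<^bsub>vs D M\<^esub> \<theta> x)"

definition poly_endo ::
  "('f, 'r, 'k::field) vs_formulas \<Rightarrow> ('f, 'r, 'a) struct \<Rightarrow> 'k poly \<Rightarrow>
     ('a list \<Rightarrow> 'a list) \<Rightarrow> 'a list \<Rightarrow> 'a list" where
  "poly_endo D M \<rho> \<theta> x =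
     (\<Oplus>\<^bsub>vs D M\<^esub>i\<in>{..Polynomial.degree \<rho>}. Polynomial.coeff \<rho> i \<odot>\<^bsub>vs D M\<^esub> (\<theta> ^^ i) x)"

definition Ker_poly ::
  "('f, 'r, 'k::field) vs_formulas \<Rightarrow> ('f, 'r, 'a) struct \<Rightarrow> 'k poly \<Rightarrow>
     ('a list \<Rightarrow> 'a list) \<Rightarrow> 'a list set" where
  "Ker_poly D M \<rho> \<theta> = {x \<in> VV D M. poly_endo D M \<rho> \<theta> x = \<zero>\<^bsub>vs D M\<^esub>}"

definition Im_poly ::
  "('f, 'r, 'k::field) vs_formulas \<Rightarrow> ('f, 'r, 'a) struct \<Rightarrow> 'k poly \<Rightarrow>
     ('a list \<Rightarrow> 'a list) \<Rightarrow> 'a list set" where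
  "Im_poly D M \<rho> \<theta> = poly_endo D M \<rho> \<theta> ` VV D M"

definition monic_irr :: "'k::field poly set" where
  "monic_irr = {f. Factorial_Ring.irreducible f \<and> Polynomial.lead_coeff f = 1}"

text \<open>
  Only the values of \<open>c\<close> on \<open>monic_irr\<close> matter.  If the support of \<open>c\<close> is infinite, the sum
  \<open>\<Sum>f. deg f * c f\<close> is \<open>\<infinity>\<close>; this case has to be kept away from HOL's finite sums.
\<close>

type_synonym 'k kernel_config = "('k poly \<Rightarrow> enat) \<times> enat"

definition kc_support :: "'k::field kernel_config \<Rightarrow> 'k poly set" where
  "kc_support C = {f \<in> monic_irr. fst C f \<noteq> 0}"

definition kernel_config :: "'k::field kernel_config \<Rightarrow> bool" where
  "kernel_config C \<longleftrightarrow> snd C \<noteq> 0 \<and>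
     (snd C = \<infinity> \<or>
      finite (kc_support C) \<and>
      snd C = (\<Sum>f\<in>kc_support C. enat (Polynomial.degree f) * fst C f))"

definition MiPo :: "'k::field kernel_config \<Rightarrow> 'k poly" where
  "MiPo C = (\<Prod>f\<in>kc_support C. f ^ the_enat (fst C f))"

definition C_endo ::
  "('f, 'r, 'k::field) vs_formulas \<Rightarrow> ('f, 'r, 'a) struct \<Rightarrow> 'k kernel_config \<Rightarrow>
     ('a list \<Rightarrow> 'a list) \<Rightarrow> bool" where
  "C_endo D M C \<theta> \<longleftrightarrow> vs_endo D M \<theta> \<and>
     (snd C < \<infinity> \<longrightarrow> (\<forall>x\<in>VV D M. poly_endo D M (MiPo C) \<theta> x = \<zero>\<^bsub>vs D M\<^esub>)) \<and>
     (snd C = \<infinity> \<longrightarrow> (\<forall>f\<in>monic_irr. \<forall>k. fst C f = enat k \<longrightarrow>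
        Ker_poly D M (f ^ k) \<theta> = Ker_poly D M (f ^ (k + 1)) \<theta>))"


section \<open>Expansions by an endomorphism\<close>

text \<open>
  Since vectors are \<open>n\<close>-tuples (with \<open>n = vdim D\<close>), the symbol \<open>\<theta>\<close> amounts to \<open>n\<close> new
  function symbols \<open>Inr 0, \<dots>, Inr (n - 1)\<close> of arity \<open>n\<close>, one for each entry of \<open>\<theta> x\<close>.
\<close>

definition lang_theta :: "('f, 'r) lang \<Rightarrow> nat \<Rightarrow> ('f + nat, 'r) lang" where
  "lang_theta L n =
     \<lparr> Funs = Inl ` Funs L \<union> Inr ` {..<n}, Rels = Rels L,
       farity = case_sum (farity L) (\<lambda>_. n), rarity = rarity L \<rparr>"

definition reduct_theta :: "('f + nat, 'r, 'a) struct \<Rightarrow> ('f, 'r, 'a) struct" where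
  "reduct_theta M = \<lparr> dom = dom M, funI = funI M \<circ> Inl, relI = relI M \<rparr>"

definition theta :: "nat \<Rightarrow> ('f + nat, 'r, 'a) struct \<Rightarrow> 'a list \<Rightarrow> 'a list" where
  "theta n M xs = map (\<lambda>i. funI M (Inr i) xs) [0..<n]"

text \<open>The models of \<open>T\<^sub>\<theta>\<close> and of \<open>T\<^sup>C\<^sub>\<theta>\<close>.\<close>

definition model_theta ::
  "('f, 'r) lang \<Rightarrow> ('f, 'r) form set \<Rightarrow> ('f, 'r, 'k::field) vs_formulas \<Rightarrow>
     ('f + nat, 'r, 'a) struct \<Rightarrow> bool" where
  "model_theta L T D M \<longleftrightarrow>
     structure_of (lang_theta L (vdim D)) M \<and>
     model_of L T (reduct_theta M) \<and>
     vs_endo D (reduct_theta M) (theta (vdim D) M) \<and>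
     (\<forall>x \<in> tuples M (vdim D) - VV D (reduct_theta M).
        theta (vdim D) M x = \<zero>\<^bsub>vs D (reduct_theta M)\<^esub>)"

definition model_C_theta ::
  "('f, 'r) lang \<Rightarrow> ('f, 'r) form set \<Rightarrow> ('f, 'r, 'k::field) vs_formulas \<Rightarrow>
     'k kernel_config \<Rightarrow> ('f + nat, 'r, 'a) struct \<Rightarrow> bool" where
  "model_C_theta L T D C M \<longleftrightarrow>
     model_theta L T D M \<and> C_endo D (reduct_theta M) C (theta (vdim D) M)"

definition ec_model_C_theta ::
  "'b itself \<Rightarrow> ('f, 'r) lang \<Rightarrow> ('f, 'r) form set \<Rightarrow> ('f, 'r, 'k::field) vs_formulas \<Rightarrow>
     'k kernel_config \<Rightarrow> ('f + nat, 'r, 'a) struct \<Rightarrow> bool" where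
  "ec_model_C_theta _ L T D C M \<longleftrightarrow>
     model_C_theta L T D C M \<and>
     (\<forall>N :: ('f + nat, 'r, 'b) struct.
        model_C_theta L T D C N \<longrightarrow> ec_in (lang_theta L (vdim D)) M N)"


section \<open>Expansions by a subspace\<close>

text \<open>The predicate \<open>V\<close> is the new relation symbol \<open>Inr ()\<close>.\<close>

definition lang_V :: "('f, 'r) lang \<Rightarrow> nat \<Rightarrow> ('f, 'r + unit) lang" where
  "lang_V L n =
     \<lparr> Funs = Funs L, Rels = Inl ` Rels L \<union> {Inr ()},
       farity = farity L, rarity = case_sum (rarity L) (\<lambda>_. n) \<rparr>"

definition reduct_V :: "('f, 'r + unit, 'a) struct \<Rightarrow> ('f, 'r, 'a) struct" where
  "reduct_V M = \<lparr> dom = dom M, funI = funI M, relI = relI M \<circ> Inl \<rparr>"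

definition V_of :: "nat \<Rightarrow> ('f, 'r + unit, 'a) struct \<Rightarrow> 'a list set" where
  "V_of n M = {xs \<in> tuples M n. relI M (Inr ()) xs}"

definition expand_V ::
  "('f, 'r, 'a) struct \<Rightarrow> 'a list set \<Rightarrow> ('f, 'r + unit, 'a) struct" where
  "expand_V M A =
     \<lparr> dom = dom M, funI = funI M, relI = case_sum (relI M) (\<lambda>_ xs. xs \<in> A) \<rparr>"

text \<open>The models of \<open>T\<^sub>V\<close>.\<close>

definition model_V ::
  "('f, 'r) lang \<Rightarrow> ('f, 'r) form set \<Rightarrow> ('f, 'r, 'k::field) vs_formulas \<Rightarrow>
     ('f, 'r + unit, 'a) struct \<Rightarrow> bool" where
  "model_V L T D M \<longleftrightarrow>
     structure_of (lang_V L (vdim D)) M \<and>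
     model_of L T (reduct_V M) \<and>
     submodule (V_of (vdim D) M) (ring_of_type_algebra :: 'k ring) (vs D (reduct_V M))"

definition ec_model_V ::
  "'b itself \<Rightarrow> ('f, 'r) lang \<Rightarrow> ('f, 'r) form set \<Rightarrow> ('f, 'r, 'k::field) vs_formulas \<Rightarrow>
     ('f, 'r + unit, 'a) struct \<Rightarrow> bool" where
  "ec_model_V _ L T D M \<longleftrightarrow>
     model_V L T D M \<and>
     (\<forall>N :: ('f, 'r + unit, 'b) struct.
        model_V L T D N \<longrightarrow> ec_in (lang_V L (vdim D)) M N)"

end

theory Submission
  imports Defs "HOL-Library.Poly_Mapping"
begin

text \<open>
  Call a vector space with a \<open>C\<close>-endomorphism a \<open>C\<close>-module; it is a \<open>K[X]\<close>-module. The
  two exceptional values of \<open>Im \<rho>[\<theta>]\<close> are \<open>{0}\<close> and the whole space; assume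
  that neither occurs. Let \<open>N\<close> be an extension of \<open>(M, Im \<rho>[\<theta>])\<close> to a model
  of \<open>T\<close> with a subspace. Everything quantifier-free that holds of finitely many elements
  of \<open>N\<close> has to be found in \<open>M\<close>. Facts in the language \<open>L\<close> alone are harmless, as
  \<open>T\<close> is model complete; the point is to keep vectors of the subspace inside the image,
  and the other vectors outside.

  Membership in the image is an existential statement about \<open>\<theta>\<close>. The idea is that,
  in an existentially closed \<open>C\<close>-module, non-membership is one as well. Adjoining a
  solution of \<open>f z = w\<close> to a \<open>C\<close>-module leads to a \<open>C\<close>-module in certain cases
  (\<open>root_extension\<close>), so in these cases a solution exists already (\<open>ec_root_closed\<close>). It
  follows that an irreducible \<open>f\<close> with \<open>C(f) = \<infinity>\<close> acts surjectively, that the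
  space is the sum of the kernel and the image of \<open>f ^ k\<close> for \<open>k = C(f) < \<infinity>\<close>,
  and that the kernel of \<open>f ^ (k - n)\<close> lies in the image of \<open>f ^ n\<close>. Consequently a
  vector \<open>w\<close> outside \<open>Im \<rho>[\<theta>]\<close> has the form \<open>w = x + f ^ n z\<close> where
  \<open>f ^ n\<close> divides \<open>\<rho>\<close>, \<open>0 < n \<le> k\<close>, \<open>f ^ k x = 0\<close> and
  \<open>f ^ (k - n) x \<noteq> 0\<close> (\<open>separated_if_not_in_image\<close>). In every \<open>C\<close>-module such a
  presentation shows that \<open>w\<close> is not in the image (\<open>not_in_image_if_separated\<close>): from
  \<open>x = f ^ n v\<close> one gets \<open>f ^ (k + n) v = 0\<close>, hence \<open>f ^ k v = 0\<close>, which is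
  \<open>f ^ (k - n) x = 0\<close>.

  Now enlarge \<open>N\<close> such that its vector space has infinite dimension over that of \<open>M\<close>
  (\<open>large_extension\<close>). On a complement of the old vector space the endomorphism may be
  prescribed freely, up to the dimension. It is chosen as a sum of copies of
  \<open>K[X]/(MiPo(C))\<close> (of \<open>K[X]\<close> in the transcendental case) and of \<open>K[X]/(f ^ k)\<close>, where
  \<open>f\<close> is one of the irreducible polynomials found above: finitely many given new basis
  vectors in the subspace become \<open>\<rho>\<close>-multiples of generators of summands of the first
  kind, finitely many given basis vectors outside become generators of summands of the
  second kind (\<open>free_extension\<close>). The vectors in question are then in the image if they
  belong to the subspace, and are separated from it otherwise.

  Existential closedness of \<open>(M, \<theta>)\<close> and model completeness of \<open>T\<close> turn this
  extension of \<open>M\<close> into maps back to \<open>M\<close> which asymptotically respect all \<open>L\<close>-formulas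
  and the endomorphism (\<open>extend_endomorphism\<close>). They carry the vectors to places inside or
  outside \<open>Im \<rho>[\<theta>]\<close> as desired, so they preserve the given quantifier-free
  formula (\<open>ec_image\<close>).

  The hypotheses on \<open>T\<close> concern models whose domains are sets of elements of one type
  \<open>'u\<close>. Large structures occur only as ultrapowers, and are replaced by elementary
  substructures of the size of \<open>'u\<close> at once (\<open>small_ultrapower\<close>). What remains of the
  ultrapower are coordinate maps; this is the notion \<open>asymp_elem\<close>.
\<close>

section \<open>Ultrafilters\<close>

definition ultrafilter :: "'i filter \<Rightarrow> bool" where
  "ultrafilter U \<longleftrightarrow> U \<noteq> bot \<and> (\<forall>P. eventually P U \<or> eventually (\<lambda>i. \<not> P i) U)"

lemma ultrafilter_eventually_not:
  assumes "ultrafilter U"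
  shows "eventually (\<lambda>i. \<not> P i) U \<longleftrightarrow> \<not> eventually P U"
proof -
  have "\<not> (eventually P U \<and> eventually (\<lambda>i. \<not> P i) U)"
    using assms eventually_conj[of P U "\<lambda>i. \<not> P i"] by (auto simp: ultrafilter_def trivial_limit_def)
  then show ?thesis using assms by (auto simp: ultrafilter_def)
qed

lemma ultrafilter_principal: "ultrafilter (principal {i})"
  by (auto simp: ultrafilter_def eventually_principal principal_eq_bot_iff)

text \<open>
  Zorn's lemma; smaller filters are finer, so a minimal proper filter is wanted.
\<close>

lemma ex_ultrafilter_le:
  assumes "F \<noteq> (bot :: 'i filter)"
  obtains U where "ultrafilter U" "U \<le> F"
proof -
  let ?A = "{G. G \<le> F \<and> G \<noteq> bot}"
  have "\<exists>m\<in>?A. \<forall>a\<in>?A. (\<lambda>x y. y \<le> x) m a \<longrightarrow> a = m"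
  proof (rule predicate_Zorn)
    show "partial_order_on ?A (relation_of (\<lambda>x y. y \<le> x) ?A)"
      by (auto simp: partial_order_on_def preorder_on_def refl_on_def trans_def antisym_def relation_of_def)
  next
    fix Ch assume Ch: "Ch \<in> Chains (relation_of (\<lambda>x y. y \<le> x) ?A)"
    then have sub: "Ch \<subseteq> ?A" by (auto simp: Chains_def relation_of_def)
    have dir: "x \<le> y \<or> y \<le> x" if "x \<in> Ch" "y \<in> Ch" for x y
      using Ch that by (auto simp: Chains_def relation_of_def)
    show "\<exists>u\<in>?A. \<forall>a\<in>Ch. u \<le> a"
    proof (cases "Ch = {}")
      case True
      then show ?thesis using assms by auto
    next
      case False
      have "Inf Ch \<noteq> bot"
      proof
        assume "Inf Ch = bot"
        then have ev: "eventually (\<lambda>_. False) (Inf Ch)" by simp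
        have "\<exists>x\<in>Ch. x \<le> inf F G" if "F \<in> Ch" "G \<in> Ch" for F G
          using dir[OF that] that by (auto intro: bexI[of _ F] bexI[of _ G])
        then obtain G where "G \<in> Ch" "eventually (\<lambda>_. False) G"
          using ev eventually_Inf_base[OF False] by metis
        then show False using sub by (auto simp: trivial_limit_def)
      qed
      moreover have "Inf Ch \<le> F" using False sub by (auto intro: Inf_lower2)
      ultimately show ?thesis by (auto intro: Inf_lower)
    qed
  qed
  then obtain U where U: "U \<le> F" "U \<noteq> bot" and max: "\<And>G. G \<le> F \<Longrightarrow> G \<noteq> bot \<Longrightarrow> G \<le> U \<Longrightarrow> G = U"
    by auto
  have "eventually P U \<or> eventually (\<lambda>i. \<not> P i) U" for P
  proof (rule disjCI)
    assume n: "\<not> eventually (\<lambda>i. \<not> P i) U"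
    have "inf U (principal {i. P i}) \<noteq> bot"
      using n by (simp add: trivial_limit_def eventually_inf_principal)
    then have "inf U (principal {i. P i}) = U"
      using max U by (meson inf_le1 order_trans)
    then show "eventually P U"
      using eventually_inf_principal[of P U "{i. P i}"] by simp
  qed
  with U that show thesis by (auto simp: ultrafilter_def)
qed

text \<open>
  The form in which ultrafilters are used: finitely many of the conditions \<open>Q z\<close> can be
  met at a time by some \<open>i\<close>, and the ultrafilter meets all of them almost everywhere. The
  condition \<open>B\<close> is met by all the \<open>i\<close> in question.
\<close>

lemma ex_ultrafilter_fip:
  assumes "\<And>Z. finite Z \<Longrightarrow> Z \<subseteq> V \<Longrightarrow> \<exists>i. B i \<and> (\<forall>z\<in>Z. Q z i)"
  obtains U where "ultrafilter U" "eventually B U" "\<And>z. z \<in> V \<Longrightarrow> eventually (Q z) U"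
proof -
  let ?I = "{Z. finite Z \<and> Z \<subseteq> V}"
  let ?S = "\<lambda>Z. {i. B i \<and> (\<forall>z\<in>Z. Q z i)}"
  define F where "F = (INF Z\<in>?I. principal (?S Z))"
  have ev: "eventually R F \<longleftrightarrow> (\<exists>Z\<in>?I. \<forall>i\<in>?S Z. R i)" for R
    unfolding F_def
  proof (subst eventually_INF_base)
    fix Z Z' assume "Z \<in> ?I" "Z' \<in> ?I"
    then show "\<exists>x\<in>?I. principal (?S x) \<le> inf (principal (?S Z)) (principal (?S Z'))"
      by (intro bexI[of _ "Z \<union> Z'"]) auto
  qed (auto simp: eventually_principal)
  have "F \<noteq> bot" unfolding trivial_limit_def ev using assms by fastforce
  then obtain U where U: "ultrafilter U" "U \<le> F" by (rule ex_ultrafilter_le)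
  have "eventually B F" unfolding ev by (intro bexI[of _ "{}"]) auto
  moreover have "eventually (Q z) F" if "z \<in> V" for z
    unfolding ev by (intro bexI[of _ "{z}"]) (use that in auto)
  ultimately show thesis using that U filter_leD[OF U(2)] by blast
qed

section \<open>Satisfaction depends on the free variables only\<close>

lemma finite_fv_trm: "finite (fv_trm t)"
  by (induction t) auto

lemma finite_fv: "finite (fv \<phi>)"
  by (induction \<phi>) (auto simp: finite_fv_trm)

lemma val_cong: "(\<And>i. i \<in> fv_trm t \<Longrightarrow> e i = e' i) \<Longrightarrow> val M e t = val M e' t"
proof (induction t)
  case (Fn f ts)
  then have "map (val M e) ts = map (val M e') ts" by (intro map_cong) auto
  then show ?case by (simp only: val.simps)
qed auto

lemma sat_cong: "(\<And>i. i \<in> fv \<phi> \<Longrightarrow> e i = e' i) \<Longrightarrow> sat M e \<phi> \<longleftrightarrow> sat M e' \<phi>"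
proof (induction \<phi> arbitrary: e e')
  case (Equal s t)
  then show ?case using val_cong[of s e e' M] val_cong[of t e e' M] by simp
next
  case (Rel r ts)
  then have "map (val M e) ts = map (val M e') ts" by (intro map_cong val_cong) auto
  then show ?case by (simp only: sat.simps)
next
  case (Neg \<phi>)
  then show ?case by (metis fv.simps(3) sat.simps(3))
next
  case (Conj \<phi> \<psi>)
  have "sat M e \<phi> \<longleftrightarrow> sat M e' \<phi>" by (rule Conj.IH) (simp add: Conj.prems)
  moreover have "sat M e \<psi> \<longleftrightarrow> sat M e' \<psi>" by (rule Conj.IH) (simp add: Conj.prems)
  ultimately show ?case by simp
next
  case (Ex i \<phi>)
  have "sat M (e(i := a)) \<phi> \<longleftrightarrow> sat M (e'(i := a)) \<phi>" for a
    by (rule Ex.IH) (use Ex.prems in auto)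
  then show ?case by simp
qed

lemma val_in_dom:
  assumes "structure_of L M" "range e \<subseteq> dom M" "trm_of L t"
  shows "val M e t \<in> dom M"
  using assms(3)
proof (induction t)
  case (Vr i)
  then show ?case using assms(2) by auto
next
  case (Fn f ts)
  then have "map (val M e) ts \<in> tuples M (farity L f)"
    by (auto simp: tuples_def list_all_iff)
  then show ?case using assms(1) Fn.prems by (auto simp: structure_of_def)
qed

lemma upd_range: "range e \<subseteq> A \<Longrightarrow> a \<in> A \<Longrightarrow> range (e(i := a)) \<subseteq> A"
  by auto

section \<open>Cardinalities\<close>

lemma prod_lepoll_infinite:
  assumes "infinite (UNIV :: 'u set)" "A \<lesssim> (UNIV :: 'u set)" "B \<lesssim> (UNIV :: 'u set)"
  shows "A \<times> B \<lesssim> (UNIV :: 'u set)"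
proof -
  have "A \<times> B \<lesssim> (UNIV :: 'u set) \<times> (UNIV :: 'u set)"
    using assms by (intro times_lepoll_mono)
  moreover have "(UNIV :: 'u set) \<times> (UNIV :: 'u set) \<lesssim> (UNIV :: 'u set)"
    using card_of_Times_same_infinite[OF assms(1)]
    by (simp add: eqpoll_imp_lepoll eqpoll_iff_card_of_ordIso)
  ultimately show ?thesis by (rule lepoll_trans)
qed

lemma lepoll_image_of: "A \<lesssim> (UNIV :: 'u set) \<Longrightarrow> B \<subseteq> f ` A \<Longrightarrow> B \<lesssim> (UNIV :: 'u set)"
  by (rule lepoll_trans[OF subset_image_lepoll])

lemma image_lepoll_of: "A \<lesssim> (UNIV :: 'u set) \<Longrightarrow> f ` A \<lesssim> (UNIV :: 'u set)"
  by (rule lepoll_trans[OF image_lepoll])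

lemma nat_lepoll: "infinite (UNIV :: 'u set) \<Longrightarrow> (A :: nat set) \<lesssim> (UNIV :: 'u set)"
  using infinite_le_lepoll subset_imp_lepoll lepoll_trans by (metis subset_UNIV)

lemma UN_lepoll_infinite:
  fixes A :: "'i \<Rightarrow> 'a set"
  assumes "infinite (UNIV :: 'u set)" "I \<lesssim> (UNIV :: 'u set)" "\<And>i. i \<in> I \<Longrightarrow> A i \<lesssim> (UNIV :: 'u set)"
  shows "(\<Union>i\<in>I. A i) \<lesssim> (UNIV :: 'u set)"
proof -
  have "\<forall>i\<in>I. \<exists>f :: 'a \<Rightarrow> 'u. inj_on f (A i)" using assms(3) by (auto simp: lepoll_def)
  then obtain f :: "'i \<Rightarrow> 'a \<Rightarrow> 'u" where f: "\<And>i. i \<in> I \<Longrightarrow> inj_on (f i) (A i)" by metis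
  define s where "s x = (SOME i. i \<in> I \<and> x \<in> A i)" for x
  have s: "s x \<in> I \<and> x \<in> A (s x)" if "x \<in> (\<Union>i\<in>I. A i)" for x
    unfolding s_def using that by (metis (mono_tags, lifting) UN_E someI_ex)
  have "inj_on (\<lambda>x. (s x, f (s x) x)) (\<Union>i\<in>I. A i)"
    using s f by (auto simp: inj_on_def) (metis UN_I)
  moreover have "(\<lambda>x. (s x, f (s x) x)) ` (\<Union>i\<in>I. A i) \<subseteq> I \<times> (UNIV :: 'u set)" using s by auto
  ultimately have "(\<Union>i\<in>I. A i) \<lesssim> I \<times> (UNIV :: 'u set)" unfolding lepoll_def by blast
  then show ?thesis
    by (rule lepoll_trans[OF _ prod_lepoll_infinite[OF assms(1,2) lepoll_refl]])
qed

lemma lists_lepoll_infinite: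
  assumes inf: "infinite (UNIV :: 'u set)" and A: "A \<lesssim> (UNIV :: 'u set)"
  shows "lists A \<lesssim> (UNIV :: 'u set)"
proof -
  have *: "{xs \<in> lists A. length xs = n} \<lesssim> (UNIV :: 'u set)" for n
  proof (induction n)
    case 0
    have "finite {xs \<in> lists A. length xs = 0}" by (rule finite_subset[of _ "{[]}"]) auto
    then show ?case by (rule finite_lepoll_infinite[OF inf])
  next
    case (Suc n)
    have "{xs \<in> lists A. length xs = Suc n} \<subseteq> (\<lambda>(x, xs). x # xs) ` (A \<times> {xs \<in> lists A. length xs = n})"
      by (auto simp: length_Suc_conv image_iff)
    then show ?case by (rule lepoll_image_of[OF prod_lepoll_infinite[OF inf A Suc]])
  qed
  have "lists A \<subseteq> (\<Union>n\<in>(UNIV :: nat set). {xs \<in> lists A. length xs = n})" by auto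
  then show ?thesis
    by (rule lepoll_trans[OF subset_imp_lepoll UN_lepoll_infinite[OF inf nat_lepoll[OF inf] *]])
qed

lemma Un_lepoll_infinite:
  assumes "infinite (UNIV :: 'u set)" "A \<lesssim> (UNIV :: 'u set)" "B \<lesssim> (UNIV :: 'u set)"
  shows "A \<union> B \<lesssim> (UNIV :: 'u set)"
proof -
  have "(\<Union>b\<in>(UNIV :: bool set). if b then A else B) \<lesssim> (UNIV :: 'u set)"
    using assms by (intro UN_lepoll_infinite) (auto intro: finite_lepoll_infinite)
  then show ?thesis by (simp add: UNIV_bool Un_commute)
qed

lemma terms_lepoll:
  assumes inf: "infinite (UNIV :: 'u set)" and F: "Funs L \<lesssim> (UNIV :: 'u set)"
  shows "{t. trm_of L t} \<lesssim> (UNIV :: 'u set)"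
proof -
  define S where "S = rec_nat (range Vr)
    (\<lambda>_ A. A \<union> (\<lambda>(f, ts). Fn f ts) ` (Funs L \<times> lists A))"
  have S0: "S 0 = range Vr" and SS: "\<And>n. S (Suc n) = S n \<union> (\<lambda>(f, ts). Fn f ts) ` (Funs L \<times> lists (S n))"
    by (simp_all add: S_def)
  have card: "S n \<lesssim> (UNIV :: 'u set)" for n
  proof (induction n)
    case 0
    show ?case unfolding S0 by (intro image_lepoll_of nat_lepoll inf)
  next
    case (Suc n)
    show ?case unfolding SS
      using Suc by (intro Un_lepoll_infinite inf)
        (auto intro!: image_lepoll_of prod_lepoll_infinite inf F lists_lepoll_infinite)
  qed
  have mono: "m \<le> n \<Longrightarrow> S m \<subseteq> S n" for m n
    by (rule lift_Suc_mono_le[of S]) (auto simp: SS)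
  have "trm_of L t \<Longrightarrow> \<exists>n. t \<in> S n" for t
  proof (induction t)
    case (Vr i)
    then show ?case by (intro exI[of _ 0]) (simp add: S0)
  next
    case (Fn f ts)
    then have "\<forall>t\<in>set ts. \<exists>n. t \<in> S n" by (auto simp: list_all_iff)
    then obtain n where n: "\<And>t. t \<in> set ts \<Longrightarrow> t \<in> S (n t)" by metis
    define N where "N = Max (insert 0 (n ` set ts))"
    have "n t \<le> N" if "t \<in> set ts" for t using that by (simp add: N_def)
    then have "ts \<in> lists (S N)" using n mono by blast
    then have "Fn f ts \<in> S (Suc N)" using Fn.prems by (auto simp: SS)
    then show ?case ..
  qed
  then have "{t. trm_of L t} \<subseteq> (\<Union>n\<in>UNIV. S n)" by auto
  then show ?thesis
    by (rule lepoll_trans[OF subset_imp_lepoll UN_lepoll_infinite[OF inf nat_lepoll[OF inf] card]])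
qed

text \<open>
  Formulas are reached in countably many stages, each of which is at most as large as the
  infinite type.
\<close>

lemma formulas_lepoll:
  assumes inf: "infinite (UNIV :: 'u set)" and F: "Funs L \<lesssim> (UNIV :: 'u set)"
    and R: "Rels L \<lesssim> (UNIV :: 'u set)"
  shows "{\<phi>. form_of L \<phi>} \<lesssim> (UNIV :: 'u set)"
proof -
  let ?T = "{t. trm_of L t}"
  note T = terms_lepoll[OF inf F]
  define A0 where "A0 = (\<lambda>(s, t). Equal s t) ` (?T \<times> ?T) \<union> (\<lambda>(r, ts). Rel r ts) ` (Rels L \<times> lists ?T)"
  define st where "st A = A \<union> Neg ` A \<union> (\<lambda>(\<phi>, \<psi>). Conj \<phi> \<psi>) ` (A \<times> A)
    \<union> (\<lambda>(i, \<phi>). Ex i \<phi>) ` (UNIV \<times> A)" for A :: "('a, 'b) form set"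
  define S where "S n = (st ^^ n) A0" for n
  have S0: "S 0 = A0" and SS: "\<And>n. S (Suc n) = st (S n)" by (simp_all add: S_def)
  have card: "S n \<lesssim> (UNIV :: 'u set)" for n
  proof (induction n)
    case 0
    show ?case unfolding S0 A0_def
      by (intro Un_lepoll_infinite image_lepoll_of prod_lepoll_infinite lists_lepoll_infinite inf R T)
  next
    case (Suc n)
    show ?case unfolding SS st_def
      by (intro Un_lepoll_infinite image_lepoll_of prod_lepoll_infinite nat_lepoll inf Suc)
  qed
  have mono: "m \<le> n \<Longrightarrow> S m \<subseteq> S n" for m n
    by (rule lift_Suc_mono_le[of S]) (auto simp: SS st_def)
  have "form_of L \<phi> \<Longrightarrow> \<exists>n. \<phi> \<in> S n" for \<phi>
  proof (induction \<phi>)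
    case (Equal s t)
    then show ?case by (intro exI[of _ 0]) (auto simp: S0 A0_def)
  next
    case (Rel r ts)
    then show ?case by (intro exI[of _ 0]) (auto simp: S0 A0_def)
  next
    case (Neg \<phi>)
    then obtain n where "\<phi> \<in> S n" by auto
    then show ?case by (intro exI[of _ "Suc n"]) (auto simp: SS st_def)
  next
    case (Conj \<phi> \<psi>)
    then obtain m n where "\<phi> \<in> S m" "\<psi> \<in> S n" by auto
    then have "\<phi> \<in> S (max m n)" "\<psi> \<in> S (max m n)" using mono by (meson max.cobounded1 max.cobounded2 subsetD)+
    then show ?case by (intro exI[of _ "Suc (max m n)"]) (auto simp: SS st_def)
  next
    case (Ex i \<phi>)
    then obtain n where "\<phi> \<in> S n" by auto
    then show ?case by (intro exI[of _ "Suc n"]) (auto simp: SS st_def)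
  qed
  then have "{\<phi>. form_of L \<phi>} \<subseteq> (\<Union>n\<in>UNIV. S n)" by auto
  then show ?thesis
    by (rule lepoll_trans[OF subset_imp_lepoll UN_lepoll_infinite[OF inf nat_lepoll[OF inf] card]])
qed

section \<open>Ultrapowers\<close>

text \<open>
  The elements of an ultrapower are represented by functions themselves, one for each class
  modulo the ultrafilter, so that their coordinates remain available.
\<close>

definition urep :: "'i filter \<Rightarrow> 'a set \<Rightarrow> ('i \<Rightarrow> 'a) \<Rightarrow> ('i \<Rightarrow> 'a)" where
  "urep U A f = (SOME g. range g \<subseteq> A \<and> eventually (\<lambda>i. g i = f i) U)"

lemma urep:
  assumes "range f \<subseteq> A"
  shows "range (urep U A f) \<subseteq> A" "eventually (\<lambda>i. urep U A f i = f i) U"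
proof -
  have "range (urep U A f) \<subseteq> A \<and> eventually (\<lambda>i. urep U A f i = f i) U"
    unfolding urep_def by (rule someI[of _ f]) (use assms in simp)
  then show "range (urep U A f) \<subseteq> A" "eventually (\<lambda>i. urep U A f i = f i) U" by auto
qed

lemma urep_eq:
  assumes "eventually (\<lambda>i. f i = g i) U"
  shows "urep U A f = urep U A g"
proof -
  have "eventually (\<lambda>i. h i = f i) U \<longleftrightarrow> eventually (\<lambda>i. h i = g i) U" for h
    using assms by (auto elim: eventually_elim2)
  then show ?thesis unfolding urep_def by simp
qed

definition ultrapower :: "'i filter \<Rightarrow> ('f, 'r, 'a) struct \<Rightarrow> ('f, 'r, 'i \<Rightarrow> 'a) struct" where
  "ultrapower U M =
     \<lparr> dom = urep U (dom M) ` {f. range f \<subseteq> dom M},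
       funI = (\<lambda>f xs. urep U (dom M) (\<lambda>i. funI M f (map (\<lambda>x. x i) xs))),
       relI = (\<lambda>r xs. eventually (\<lambda>i. relI M r (map (\<lambda>x. x i) xs)) U) \<rparr>"

lemma ultrapower_dom:
  assumes "a \<in> dom (ultrapower U M)"
  shows "a i \<in> dom M"
proof -
  obtain f where "a = urep U (dom M) f" "range f \<subseteq> dom M"
    using assms by (auto simp: ultrapower_def)
  then show ?thesis using urep(1)[of f "dom M" U] by (metis rangeI subsetD)
qed

lemma ultrapower_dom_eqI:
  assumes "a \<in> dom (ultrapower U M)" "b \<in> dom (ultrapower U M)" "eventually (\<lambda>i. a i = b i) U"
  shows "a = b"
proof -
  obtain f g where f: "a = urep U (dom M) f" "range f \<subseteq> dom M" and g: "b = urep U (dom M) g" "range g \<subseteq> dom M"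
    using assms(1,2) by (auto simp: ultrapower_def)
  have "eventually (\<lambda>i. f i = g i) U"
    using urep(2)[OF f(2), of U] urep(2)[OF g(2), of U] assms(3) unfolding f g
    by eventually_elim simp
  then show ?thesis unfolding f g by (rule urep_eq)
qed

lemma urep_in_ultrapower: "range f \<subseteq> dom M \<Longrightarrow> urep U (dom M) f \<in> dom (ultrapower U M)"
  by (auto simp: ultrapower_def)

lemma ultrapower_structure:
  assumes "structure_of L M"
  shows "structure_of L (ultrapower U M)"
proof -
  obtain d where d: "d \<in> dom M" using assms by (auto simp: structure_of_def)
  have "urep U (dom M) (\<lambda>_. d) \<in> dom (ultrapower U M)"
    using d by (intro urep_in_ultrapower) auto
  moreover have "funI (ultrapower U M) f xs \<in> dom (ultrapower U M)"
    if f: "f \<in> Funs L" and xs: "xs \<in> tuples (ultrapower U M) (farity L f)" for f xs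
  proof -
    have "map (\<lambda>x. x i) xs \<in> tuples M (farity L f)" for i
      using xs by (auto simp: tuples_def intro: ultrapower_dom)
    then have "range (\<lambda>i. funI M f (map (\<lambda>x. x i) xs)) \<subseteq> dom M"
      using assms f by (auto simp: structure_of_def)
    then show ?thesis using urep_in_ultrapower by (auto simp: ultrapower_def)
  qed
  ultimately show ?thesis unfolding structure_of_def by auto
qed

lemma ultrapower_val:
  assumes M: "structure_of L M" and e: "range e \<subseteq> dom (ultrapower U M)" and t: "trm_of L t"
  shows "eventually (\<lambda>i. val (ultrapower U M) e t i = val M (\<lambda>n. e n i) t) U"
  using t
proof (induction t)
  case (Fn f ts)
  let ?P = "ultrapower U M"
  have ts: "\<forall>t\<in>set ts. trm_of L t" and f: "f \<in> Funs L" "length ts = farity L f"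
    using Fn.prems by (auto simp: list_all_iff)
  have "eventually (\<lambda>i. \<forall>t\<in>set ts. val ?P e t i = val M (\<lambda>n. e n i) t) U"
    using Fn.IH ts by (intro eventually_ball_finite) auto
  moreover have "range (\<lambda>i. funI M f (map (\<lambda>x. x i) (map (val ?P e) ts))) \<subseteq> dom M"
  proof -
    have "val ?P e t i \<in> dom M" if "t \<in> set ts" for t i
      by (rule ultrapower_dom, rule val_in_dom[OF ultrapower_structure[OF M] e]) (use ts that in blast)
    then have "map (\<lambda>x. x i) (map (val ?P e) ts) \<in> tuples M (farity L f)" for i
      using f by (auto simp: tuples_def)
    then show ?thesis using M f by (auto simp: structure_of_def)
  qed
  note urep(2)[OF this, of U]
  ultimately show ?case
  proof eventually_elim
    case (elim i)
    have "val ?P e (Fn f ts) = urep U (dom M) (\<lambda>i. funI M f (map (\<lambda>x. x i) (map (val ?P e) ts)))"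
      by (simp add: ultrapower_def)
    moreover have "map (\<lambda>x. x i) (map (val ?P e) ts) = map (val M (\<lambda>n. e n i)) ts"
      using elim(1) by auto
    ultimately show ?case using elim(2) by (simp only: val.simps)
  qed
qed simp

text \<open>
  In the step for \<open>Ex\<close>, a witness in the ultrapower is assembled from witnesses in the
  coordinates.
\<close>

theorem Los:
  assumes U: "ultrafilter U" and M: "structure_of L M"
    and "form_of L \<phi>" and "range e \<subseteq> dom (ultrapower U M)"
  shows "sat (ultrapower U M) e \<phi> \<longleftrightarrow> eventually (\<lambda>i. sat M (\<lambda>n. e n i) \<phi>) U"
  using assms(3,4)
proof (induction \<phi> arbitrary: e)
  case (Equal s t)
  let ?P = "ultrapower U M"
  have st: "eventually (\<lambda>i. val ?P e s i = val M (\<lambda>n. e n i) s) U"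
    "eventually (\<lambda>i. val ?P e t i = val M (\<lambda>n. e n i) t) U"
    using Equal by (auto intro: ultrapower_val[OF M])
  have "val ?P e s = val ?P e t \<longleftrightarrow> eventually (\<lambda>i. val ?P e s i = val ?P e t i) U"
    using ultrapower_dom_eqI[of "val ?P e s" U M "val ?P e t"] Equal.prems
      val_in_dom[OF ultrapower_structure[OF M], of e U] by auto
  also have "\<dots> \<longleftrightarrow> eventually (\<lambda>i. val M (\<lambda>n. e n i) s = val M (\<lambda>n. e n i) t) U"
    by (rule eventually_subst) (use st in eventually_elim, simp)
  finally show ?case by simp
next
  case (Rel r ts)
  let ?P = "ultrapower U M"
  have "eventually (\<lambda>i. \<forall>t\<in>set ts. val ?P e t i = val M (\<lambda>n. e n i) t) U"
    using Rel.prems by (intro eventually_ball_finite) (auto intro: ultrapower_val[OF M])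
  then have "eventually (\<lambda>i. map (\<lambda>x. x i) (map (val ?P e) ts) = map (val M (\<lambda>n. e n i)) ts) U"
    by eventually_elim auto
  then have "eventually (\<lambda>i. relI M r (map (\<lambda>x. x i) (map (val ?P e) ts))
      \<longleftrightarrow> relI M r (map (val M (\<lambda>n. e n i)) ts)) U"
    by eventually_elim (simp only:)
  then have "eventually (\<lambda>i. relI M r (map (\<lambda>x. x i) (map (val ?P e) ts))) U
      \<longleftrightarrow> eventually (\<lambda>i. relI M r (map (val M (\<lambda>n. e n i)) ts)) U"
    by (rule eventually_subst)
  moreover have "sat ?P e (Rel r ts) \<longleftrightarrow> eventually (\<lambda>i. relI M r (map (\<lambda>x. x i) (map (val ?P e) ts))) U"
    by (simp add: ultrapower_def)
  ultimately show ?case by (simp only: sat.simps)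
next
  case (Neg \<phi>)
  then show ?case using ultrafilter_eventually_not[OF U] by simp
next
  case (Conj \<phi> \<psi>)
  then show ?case by (simp add: eventually_conj_iff)
next
  case (Ex n \<phi>)
  let ?P = "ultrapower U M"
  have IH: "sat ?P (e(n := a)) \<phi> \<longleftrightarrow> eventually (\<lambda>i. sat M ((\<lambda>m. e m i)(n := a i)) \<phi>) U"
    if "a \<in> dom ?P" for a
  proof -
    have "(\<lambda>m. (e(n := a)) m i) = (\<lambda>m. e m i)(n := a i)" for i by auto
    moreover have "form_of L \<phi>" "range (e(n := a)) \<subseteq> dom ?P"
      using Ex.prems that upd_range[of e "dom ?P" a n] by auto
    note Ex.IH[OF this]
    ultimately show ?thesis by (simp only:)
  qed
  show ?case
  proof
    assume "sat ?P e (Ex n \<phi>)"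
    then obtain a where a: "a \<in> dom ?P" "sat ?P (e(n := a)) \<phi>" by auto
    then have "eventually (\<lambda>i. sat M ((\<lambda>m. e m i)(n := a i)) \<phi>) U" using IH by simp
    then show "eventually (\<lambda>i. sat M (\<lambda>m. e m i) (Ex n \<phi>)) U"
      by eventually_elim (use ultrapower_dom[OF a(1)] in auto)
  next
    assume ev: "eventually (\<lambda>i. sat M (\<lambda>m. e m i) (Ex n \<phi>)) U"
    obtain d where d: "d \<in> dom M" using M by (auto simp: structure_of_def)
    have "\<forall>i. \<exists>b\<in>dom M. sat M (\<lambda>m. e m i) (Ex n \<phi>) \<longrightarrow> sat M ((\<lambda>m. e m i)(n := b)) \<phi>"
      using d by auto
    then obtain b where b: "\<And>i. b i \<in> dom M"
      "\<And>i. sat M (\<lambda>m. e m i) (Ex n \<phi>) \<Longrightarrow> sat M ((\<lambda>m. e m i)(n := b i)) \<phi>" by metis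
    define a where "a = urep U (dom M) b"
    have rb: "range b \<subseteq> dom M" using b by auto
    have "eventually (\<lambda>i. sat M ((\<lambda>m. e m i)(n := a i)) \<phi>) U"
      using ev urep(2)[OF rb, of U] unfolding a_def by eventually_elim (use b(2) in simp)
    then have "sat ?P (e(n := a)) \<phi>" using IH urep_in_ultrapower[OF rb] by (simp add: a_def)
    then show "sat ?P e (Ex n \<phi>)" using urep_in_ultrapower[OF rb] by (auto simp: a_def)
  qed
qed

section \<open>The downward Loewenheim-Skolem theorem\<close>

text \<open>
  The set \<open>Y\<close> is closed under Skolem functions. The result has at most as many elements as
  the type \<open>'u\<close>, whence it can be copied into this type.
\<close>

theorem downward_Loewenheim_Skolem:
  fixes P :: "('f, 'r, 'c) struct"
  assumes inf: "infinite (UNIV :: 'u set)" and F: "Funs L \<lesssim> (UNIV :: 'u set)"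
    and R: "Rels L \<lesssim> (UNIV :: 'u set)"
    and P: "structure_of L P" and Y: "Y \<subseteq> dom P" "Y \<lesssim> (UNIV :: 'u set)"
  shows "\<exists>(N :: ('f, 'r, 'u) struct) k. structure_of L N \<and> k ` dom N \<subseteq> dom P \<and> Y \<subseteq> k ` dom N \<and>
    (\<forall>\<phi> e. form_of L \<phi> \<longrightarrow> range e \<subseteq> dom N \<longrightarrow> (sat N e \<phi> \<longleftrightarrow> sat P (k \<circ> e) \<phi>))"
proof -
  obtain d where d: "d \<in> dom P" using P by (auto simp: structure_of_def)
  define ev where "ev xs = (\<lambda>n. if n < length xs then xs ! n else d)" for xs :: "'c list"
  \<comment> \<open>Skolem functions; \<open>ev xs\<close> assigns the parameters \<open>xs\<close> to the first variables.\<close>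
  define w where "w = (\<lambda>(\<phi>, i, xs). SOME a. a \<in> dom P \<and>
    ((\<exists>a\<in>dom P. sat P ((ev xs)(i := a)) \<phi>) \<longrightarrow> sat P ((ev xs)(i := a)) \<phi>))"
  have w: "w (\<phi>, i, xs) \<in> dom P \<and>
    ((\<exists>a\<in>dom P. sat P ((ev xs)(i := a)) \<phi>) \<longrightarrow> sat P ((ev xs)(i := w (\<phi>, i, xs))) \<phi>)" for \<phi> i xs
    unfolding w_def prod.case by (rule someI_ex) (use d in blast)
  define st where "st A = A \<union> w ` ({\<phi>. form_of L \<phi>} \<times> UNIV \<times> lists A)" for A
  define S where "S n = (st ^^ n) (insert d Y)" for n
  have S0: "S 0 = insert d Y" and SS: "\<And>n. S (Suc n) = st (S n)" by (simp_all add: S_def)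
  have card: "S n \<lesssim> (UNIV :: 'u set)" for n
  proof (induction n)
    case 0
    have "insert d Y = {d} \<union> Y" by simp
    then show ?case unfolding S0
      using Un_lepoll_infinite[OF inf finite_lepoll_infinite[OF inf] Y(2), of "{d}"] by simp
  next
    case (Suc n)
    show ?case unfolding SS st_def
      by (intro Un_lepoll_infinite image_lepoll_of prod_lepoll_infinite lists_lepoll_infinite
        nat_lepoll formulas_lepoll inf Suc F R)
  qed
  have mono: "m \<le> n \<Longrightarrow> S m \<subseteq> S n" for m n
    by (rule lift_Suc_mono_le[of S]) (auto simp: SS st_def)
  have Sdom: "S n \<subseteq> dom P" for n
    by (induction n) (use d Y w in \<open>auto simp: S0 SS st_def\<close>)
  define H where "H = (\<Union>n. S n)"
  have Hdom: "H \<subseteq> dom P" and dH: "d \<in> H" and XH: "Y \<subseteq> H"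
  proof -
    show "H \<subseteq> dom P" using Sdom by (auto simp: H_def)
    have "insert d Y \<subseteq> H" unfolding H_def S0[symmetric] by (rule UN_upper) simp
    then show "d \<in> H" "Y \<subseteq> H" by auto
  qed
  have Hcard: "H \<lesssim> (UNIV :: 'u set)"
    unfolding H_def by (rule UN_lepoll_infinite[OF inf nat_lepoll[OF inf] card])
  \<comment> \<open>The Tarski-Vaught criterion.\<close>
  have TV: "\<exists>b\<in>H. sat P (e(i := b)) \<phi>"
    if \<phi>: "form_of L \<phi>" and e: "range e \<subseteq> H" and a: "a \<in> dom P" "sat P (e(i := a)) \<phi>" for \<phi> e i a
  proof -
    obtain N where N: "\<And>n. n \<in> fv \<phi> \<Longrightarrow> n < N"
      using finite_fv[of \<phi>] unfolding finite_nat_set_iff_bounded by auto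
    have "\<forall>n. \<exists>m. e n \<in> S m" using e by (auto simp: H_def)
    then obtain m where m: "\<And>n. e n \<in> S (m n)" by metis
    define K where "K = Max (insert 0 (m ` {..<N}))"
    have "m n \<le> K" if "n < N" for n using that by (simp add: K_def)
    then have "e n \<in> S K" if "n < N" for n using mono[of "m n" K] m that by blast
    then have xs: "map e [0..<N] \<in> lists (S K)" by auto
    have c: "sat P (e(i := b)) \<phi> \<longleftrightarrow> sat P ((ev (map e [0..<N]))(i := b)) \<phi>" for b
      by (rule sat_cong) (use N in \<open>auto simp: ev_def\<close>)
    have "w (\<phi>, i, map e [0..<N]) \<in> S (Suc K)"
      using xs \<phi> by (auto simp: SS st_def intro!: imageI)
    moreover have "sat P (e(i := w (\<phi>, i, map e [0..<N]))) \<phi>"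
      using a w[of \<phi> i "map e [0..<N]"] unfolding c by blast
    ultimately show ?thesis by (auto simp: H_def)
  qed
  have Hfun: "funI P f xs \<in> H" if f: "f \<in> Funs L" and xs: "length xs = farity L f" "set xs \<subseteq> H" for f xs
  proof -
    let ?n = "farity L f"
    have e: "range (ev xs) \<subseteq> H" using xs dH by (auto simp: ev_def)
    have vs: "map (val P ((ev xs)(?n := b))) (map Vr [0..<?n]) = xs" for b
      using xs by (intro nth_equalityI) (auto simp: ev_def)
    have "xs \<in> tuples P ?n" using xs Hdom by (auto simp: tuples_def)
    then have "funI P f xs \<in> dom P" using P f by (auto simp: structure_of_def)
    moreover have "form_of L (Equal (Fn f (map Vr [0..<?n])) (Vr ?n))" using f by (auto simp: list_all_iff)
    ultimately obtain b where "b \<in> H" "sat P ((ev xs)(?n := b)) (Equal (Fn f (map Vr [0..<?n])) (Vr ?n))"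
      using TV[of "Equal (Fn f (map Vr [0..<?n])) (Vr ?n)" "ev xs" "funI P f xs" ?n] e vs[of "funI P f xs"]
      by (auto simp del: map_map)
    then show ?thesis using vs[of b] by (simp del: map_map)
  qed
  obtain g :: "'c \<Rightarrow> 'u" where g: "inj_on g H" using Hcard by (auto simp: lepoll_def)
  define k where "k = inv_into H g"
  have kg: "k (g a) = a" if "a \<in> H" for a using g that by (simp add: k_def)
  define N :: "('f, 'r, 'u) struct" where "N = \<lparr> dom = g ` H, funI = (\<lambda>f xs. g (funI P f (map k xs))),
    relI = (\<lambda>r xs. relI P r (map k xs)) \<rparr>"
  have dN: "dom N = g ` H" by (simp add: N_def)
  have kN: "k a \<in> H" "g (k a) = a" if "a \<in> dom N" for a using that kg by (auto simp: dN)
  have sN: "structure_of L N"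
    unfolding structure_of_def
  proof (intro conjI ballI)
    show "dom N \<noteq> {}" using dH by (auto simp: dN)
    fix f xs assume "f \<in> Funs L" "xs \<in> tuples N (farity L f)"
    then have "funI P f (map k xs) \<in> H" using kN by (intro Hfun) (auto simp: tuples_def)
    then show "funI N f xs \<in> dom N" by (simp add: N_def)
  qed
  have kval: "k (val N e t) = val P (k \<circ> e) t" if "trm_of L t" "range e \<subseteq> dom N" for t e
    using that(1)
  proof (induction t)
    case (Fn f ts)
    then have IH: "map k (map (val N e) ts) = map (val P (k \<circ> e)) ts"
      by (auto simp: list_all_iff comp_def)
    have "map (val N e) ts \<in> tuples N (farity L f)"
      using Fn.prems val_in_dom[OF sN that(2)] by (auto simp: list_all_iff tuples_def)
    then have "funI P f (map k (map (val N e) ts)) \<in> H"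
      using Fn.prems kN by (intro Hfun) (auto simp: tuples_def)
    then have "k (funI N f (map (val N e) ts)) = funI P f (map k (map (val N e) ts))"
      by (simp add: N_def kg)
    then show ?case using IH by (simp only: val.simps)
  qed simp
  have ksat: "sat N e \<phi> \<longleftrightarrow> sat P (k \<circ> e) \<phi>" if "form_of L \<phi>" "range e \<subseteq> dom N" for \<phi> e
    using that
  proof (induction \<phi> arbitrary: e)
    case (Equal s t)
    have "val N e s \<in> dom N" "val N e t \<in> dom N" using Equal val_in_dom[OF sN] by auto
    then have "val N e s = val N e t \<longleftrightarrow> k (val N e s) = k (val N e t)" using kN(2) by metis
    then show ?case using Equal.prems kval[of s e] kval[of t e] by (simp only: sat.simps form_of.simps)
  next
    case (Rel r ts)
    then have "map k (map (val N e) ts) = map (val P (k \<circ> e)) ts" using kval by auto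
    moreover have "relI N r xs = relI P r (map k xs)" for xs by (simp add: N_def)
    ultimately show ?case by (simp only: sat.simps)
  next
    case (Ex i \<phi>)
    have IH: "sat N (e(i := a)) \<phi> \<longleftrightarrow> sat P ((k \<circ> e)(i := k a)) \<phi>" if "a \<in> dom N" for a
    proof -
      have "k \<circ> e(i := a) = (k \<circ> e)(i := k a)" by (rule fun_upd_comp)
      moreover have "form_of L \<phi>" "range (e(i := a)) \<subseteq> dom N"
        using Ex.prems that upd_range[of e "dom N" a i] by auto
      note Ex.IH[OF this]
      ultimately show ?thesis by (simp only:)
    qed
    show ?case
    proof
      assume "sat N e (Ex i \<phi>)"
      then obtain a where "a \<in> dom N" "sat N (e(i := a)) \<phi>" by auto
      then show "sat P (k \<circ> e) (Ex i \<phi>)" using IH[of a] kN(1)[of a] Hdom by auto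
    next
      assume "sat P (k \<circ> e) (Ex i \<phi>)"
      then obtain a where "a \<in> dom P" "sat P ((k \<circ> e)(i := a)) \<phi>" by auto
      moreover have "range (k \<circ> e) \<subseteq> H" using Ex.prems(2) kN(1) by auto
      ultimately obtain b where b: "b \<in> H" "sat P ((k \<circ> e)(i := b)) \<phi>"
        using TV[of \<phi> "k \<circ> e" a i] Ex.prems by auto
      then have "sat N (e(i := g b)) \<phi>" using IH[of "g b"] kg[of b] by (simp add: dN)
      then show "sat N e (Ex i \<phi>)" using b(1) by (auto simp: dN)
    qed
  qed auto
  have "k ` dom N = H" using kg by (force simp: dN image_image)
  then show ?thesis using sN ksat Hdom XH by (intro exI[of _ N] exI[of _ k]) auto
qed

section \<open>Asymptotically elementary families\<close>

text \<open>
  An elementary embedding of \<open>N\<close> into an ultrapower of \<open>M\<close>, seen through its coordinates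
  \<open>g i\<close>. A single \<open>g i\<close> need not preserve anything, but each instance of a formula is
  preserved by almost all of them. For negated formulas this gives the converse, see
  \<open>asymp_elem_iff\<close>. Elementary embeddings are the case of the principal filter on a
  one-point set.
\<close>

definition asymp_elem :: "('f, 'r) lang \<Rightarrow> 'i filter \<Rightarrow> ('i \<Rightarrow> 'a \<Rightarrow> 'b) \<Rightarrow>
    ('f, 'r, 'a) struct \<Rightarrow> ('f, 'r, 'b) struct \<Rightarrow> bool" where
  "asymp_elem L F g N M \<longleftrightarrow> F \<noteq> bot \<and> (\<forall>i. \<forall>a\<in>dom N. g i a \<in> dom M) \<and>
     (\<forall>\<phi> e. form_of L \<phi> \<longrightarrow> range e \<subseteq> dom N \<longrightarrow> sat N e \<phi> \<longrightarrow> eventually (\<lambda>i. sat M (g i \<circ> e) \<phi>) F)"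

text \<open>
  The elements of \<open>Y\<close>, at most as many as the type \<open>'u\<close> has elements, are kept when
  passing from the ultrapower to an elementary substructure in the type \<open>'u\<close>.
\<close>

theorem small_ultrapower:
  fixes P :: "('f, 'r, 'c) struct" and U :: "'i filter"
  assumes inf: "infinite (UNIV :: 'u set)" and F: "Funs L \<lesssim> (UNIV :: 'u set)"
    and R: "Rels L \<lesssim> (UNIV :: 'u set)" and U: "ultrafilter U"
    and P: "structure_of L P" and Y: "Y \<lesssim> (UNIV :: 'u set)" "\<And>x i. x \<in> Y \<Longrightarrow> x i \<in> dom P"
  obtains N :: "('f, 'r, 'u) struct" and g where "structure_of L N" "asymp_elem L U g N P"
    "\<And>x. x \<in> Y \<Longrightarrow> \<exists>a\<in>dom N. eventually (\<lambda>i. g i a = x i) U"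
proof -
  let ?Q = "ultrapower U P"
  have "urep U (dom P) ` Y \<subseteq> dom ?Q"
  proof (rule image_subsetI)
    fix x assume "x \<in> Y"
    then have "range x \<subseteq> dom P" using Y(2) by auto
    then show "urep U (dom P) x \<in> dom ?Q" by (rule urep_in_ultrapower)
  qed
  then obtain N :: "('f, 'r, 'u) struct" and k where N: "structure_of L N" and k: "k ` dom N \<subseteq> dom ?Q"
    "urep U (dom P) ` Y \<subseteq> k ` dom N"
    and sat: "\<And>\<phi> e. form_of L \<phi> \<Longrightarrow> range e \<subseteq> dom N \<Longrightarrow> sat N e \<phi> \<longleftrightarrow> sat ?Q (k \<circ> e) \<phi>"
    using downward_Loewenheim_Skolem[OF inf F R ultrapower_structure[OF P] _ image_lepoll_of[OF Y(1)]]
    by metis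
  have "asymp_elem L U (\<lambda>i a. k a i) N P"
    unfolding asymp_elem_def
  proof (intro conjI allI impI ballI)
    show "U \<noteq> bot" using U by (simp add: ultrafilter_def)
    fix i a assume "a \<in> dom N" then show "k a i \<in> dom P" using k(1) by (intro ultrapower_dom[of "k a"]) auto
  next
    fix \<phi> e assume \<phi>: "form_of L \<phi>" and e: "range e \<subseteq> dom N" and s: "sat N e \<phi>"
    have "range (k \<circ> e) \<subseteq> dom ?Q" using e k(1) by auto
    then have "eventually (\<lambda>i. sat P (\<lambda>n. (k \<circ> e) n i) \<phi>) U"
      using s sat[OF \<phi> e] Los[OF U P \<phi>, of "k \<circ> e"] by simp
    then show "eventually (\<lambda>i. sat P ((\<lambda>a. k a i) \<circ> e) \<phi>) U" by (simp add: comp_def)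
  qed
  moreover have "\<exists>a\<in>dom N. eventually (\<lambda>i. k a i = x i) U" if x: "x \<in> Y" for x
  proof -
    obtain a where "a \<in> dom N" "k a = urep U (dom P) x" using k(2) x by force
    moreover have "range x \<subseteq> dom P" using Y(2)[OF x] by auto
    ultimately show ?thesis using urep(2)[of x "dom P" U] by metis
  qed
  ultimately show thesis using that N by blast
qed

lemma asymp_elem_iff:
  assumes "asymp_elem L F g N M" "form_of L \<phi>" "range e \<subseteq> dom N"
  shows "sat N e \<phi> \<longleftrightarrow> eventually (\<lambda>i. sat M (g i \<circ> e) \<phi>) F"
proof
  assume "sat N e \<phi>"
  then show "eventually (\<lambda>i. sat M (g i \<circ> e) \<phi>) F" using assms by (simp add: asymp_elem_def)
next
  assume ev: "eventually (\<lambda>i. sat M (g i \<circ> e) \<phi>) F"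
  have bot: "F \<noteq> bot" using assms(1) by (simp add: asymp_elem_def)
  show "sat N e \<phi>"
  proof (rule ccontr)
    assume "\<not> sat N e \<phi>"
    then have "sat N e (Neg \<phi>)" "form_of L (Neg \<phi>)" using assms(2) by auto
    then have "eventually (\<lambda>i. sat M (g i \<circ> e) (Neg \<phi>)) F"
      using assms(1,3) unfolding asymp_elem_def by blast
    then have "eventually (\<lambda>i. False) F" using ev by eventually_elim simp
    then show False using bot by (simp add: trivial_limit_def)
  qed
qed

lemma asymp_elem_model:
  fixes N :: "('f, 'r, 'c) struct"
  assumes a: "asymp_elem L F g N M" and "theory_of L T" "model_of L T M" "structure_of L N"
  shows "model_of L T N"
  unfolding model_of_def
proof (intro conjI ballI allI impI)
  fix \<phi> and e :: "nat \<Rightarrow> 'c" assume "\<phi> \<in> T" and e: "range e \<subseteq> dom N"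
  moreover have "range (g i \<circ> e) \<subseteq> dom M" for i
    using a e unfolding asymp_elem_def by auto
  ultimately have "eventually (\<lambda>i. sat M (g i \<circ> e) \<phi>) F" "form_of L \<phi>"
    using assms(2,3) by (auto simp: model_of_def theory_of_def)
  then show "sat N e \<phi>" using asymp_elem_iff[OF a _ e] by simp
qed (fact assms)

lemma asymp_elem_comp:
  assumes g: "asymp_elem L F g N M" and h: "elementary_embedding L N' N h"
  shows "asymp_elem L F (\<lambda>i. g i \<circ> h) N' M"
  unfolding asymp_elem_def
proof (intro conjI allI impI ballI)
  have hd: "h ` dom N' \<subseteq> dom N" using h by (simp add: elementary_embedding_def embedding_def)
  show "F \<noteq> bot" using g by (simp add: asymp_elem_def)
  show "(g i \<circ> h) a \<in> dom M" if "a \<in> dom N'" for i a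
    using g hd that unfolding asymp_elem_def by auto
  fix \<phi> e assume \<phi>: "form_of L \<phi>" and e: "range e \<subseteq> dom N'" and s: "sat N' e \<phi>"
  have "sat N (h \<circ> e) \<phi>" using h \<phi> e s unfolding elementary_embedding_def by blast
  moreover have "range (h \<circ> e) \<subseteq> dom N" using e hd by auto
  ultimately have "eventually (\<lambda>i. sat M (g i \<circ> (h \<circ> e)) \<phi>) F"
    using g \<phi> unfolding asymp_elem_def by blast
  then show "eventually (\<lambda>i. sat M ((g i \<circ> h) \<circ> e) \<phi>) F" by (simp only: comp_assoc)
qed

lemma asymp_elem_elementary:
  assumes h: "elementary_embedding L N M h"
  shows "asymp_elem L (principal {()}) (\<lambda>_. h) N M"
  using h unfolding asymp_elem_def elementary_embedding_def embedding_def
  by (auto simp: eventually_principal principal_eq_bot_iff)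

text \<open>
  The value of a term is named by a fresh variable, which turns the claim into one about a
  formula.
\<close>

lemma asymp_elem_val:
  assumes a: "asymp_elem L F g N M" and N: "structure_of L N" and t: "trm_of L t" and e: "range e \<subseteq> dom N"
  shows "eventually (\<lambda>i. g i (val N e t) = val M (g i \<circ> e) t) F"
proof -
  obtain n where n: "\<forall>m\<in>fv_trm t. m < n"
    using finite_fv_trm[of t] unfolding finite_nat_set_iff_bounded by auto
  let ?e = "e(n := val N e t)"
  have r: "range ?e \<subseteq> dom N" using val_in_dom[OF N e t] e by auto
  have "val N ?e t = val N e t" by (rule val_cong) (use n in auto)
  then have "sat N ?e (Equal (Vr n) t)" by simp
  then have "eventually (\<lambda>i. sat M (g i \<circ> ?e) (Equal (Vr n) t)) F"
    using asymp_elem_iff[OF a _ r, of "Equal (Vr n) t"] t by simp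
  then show ?thesis
  proof eventually_elim
    case (elim i)
    have "val M (g i \<circ> ?e) t = val M (g i \<circ> e) t" by (rule val_cong) (use n in auto)
    then show ?case using elim by simp
  qed
qed

lemma asymp_elem_neq:
  assumes a: "asymp_elem L F g N M" and "x \<in> dom N" "y \<in> dom N" "x \<noteq> y"
  shows "eventually (\<lambda>i. g i x \<noteq> g i y) F"
  using asymp_elem_iff[OF a, of "Neg (Equal (Vr 0) (Vr 1))" "\<lambda>n. if n = 0 then x else y"] assms(2-4)
  by auto

lemma dom_reduct_theta [simp]: "dom (reduct_theta M) = dom M"
  by (simp add: reduct_theta_def)

lemma dom_reduct_V [simp]: "dom (reduct_V M) = dom M"
  by (simp add: reduct_V_def)

lemma trm_of_map: "trm_of (lang_theta L n) (map_trm Inl t) \<longleftrightarrow> trm_of L t"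
  by (induction t) (auto simp: lang_theta_def list_all_iff)

lemma form_of_map_theta: "form_of (lang_theta L n) (map_form Inl (\<lambda>r. r) \<phi>) \<longleftrightarrow> form_of L \<phi>"
  by (induction \<phi>) (auto simp: trm_of_map, auto simp: lang_theta_def)

lemma val_reduct_theta: "val (reduct_theta M) e t = val M e (map_trm Inl t)"
proof (induction t)
  case (Fn f ts)
  then have "map (val (reduct_theta M) e) ts = map (val M e) (map (map_trm Inl) ts)" by simp
  moreover have "funI (reduct_theta M) f xs = funI M (Inl f) xs" for xs by (simp add: reduct_theta_def)
  ultimately show ?case by (simp only: val.simps trm.map)
qed simp

lemma sat_reduct_theta: "sat (reduct_theta M) e \<phi> \<longleftrightarrow> sat M e (map_form Inl (\<lambda>r. r) \<phi>)"
proof (induction \<phi> arbitrary: e)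
  case (Rel r ts)
  have "map (val (reduct_theta M) e) ts = map (val M e) (map (map_trm Inl) ts)"
    by (simp add: val_reduct_theta)
  moreover have "relI (reduct_theta M) r xs = relI M r xs" for xs by (simp add: reduct_theta_def)
  ultimately show ?case by (simp only: sat.simps form.map)
next
  case (Ex i \<phi>)
  then show ?case by (simp only: sat.simps form.map dom_reduct_theta)
qed (simp_all add: val_reduct_theta)

lemma asymp_elem_reduct_theta:
  assumes "asymp_elem (lang_theta L n) F g N M"
  shows "asymp_elem L F g (reduct_theta N) (reduct_theta M)"
  using assms form_of_map_theta unfolding asymp_elem_def sat_reduct_theta dom_reduct_theta by blast

lemma trm_of_lang_V: "trm_of (lang_V L n) t \<longleftrightarrow> trm_of L t"
  by (induction t) (auto simp: lang_V_def list_all_iff)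

lemma form_of_map_V: "form_of (lang_V L n) (map_form (\<lambda>f. f) Inl \<phi>) \<longleftrightarrow> form_of L \<phi>"
  by (induction \<phi>) (auto simp: trm_of_lang_V trm.map_ident, auto simp: lang_V_def)

lemma val_reduct_V: "val (reduct_V M) e t = val M e t"
proof (induction t)
  case (Fn f ts)
  then have "map (val (reduct_V M) e) ts = map (val M e) ts" by simp
  moreover have "funI (reduct_V M) f xs = funI M f xs" for xs by (simp add: reduct_V_def)
  ultimately show ?case by (simp only: val.simps)
qed simp

lemma sat_reduct_V: "sat (reduct_V M) e \<phi> \<longleftrightarrow> sat M e (map_form (\<lambda>f. f) Inl \<phi>)"
proof (induction \<phi> arbitrary: e)
  case (Rel r ts)
  have "map (val (reduct_V M) e) ts = map (val M e) (map (map_trm (\<lambda>f. f)) ts)"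
    by (simp add: val_reduct_V trm.map_ident)
  moreover have "relI (reduct_V M) r xs = relI M (Inl r) xs" for xs by (simp add: reduct_V_def)
  ultimately show ?case by (simp only: sat.simps form.map)
next
  case (Ex i \<phi>)
  then show ?case by (simp only: sat.simps form.map dom_reduct_V)
qed (simp_all add: val_reduct_V trm.map_ident)

lemma asymp_elem_reduct_V:
  assumes "asymp_elem (lang_V L n) F g N M"
  shows "asymp_elem L F g (reduct_V N) (reduct_V M)"
  using assms form_of_map_V unfolding asymp_elem_def sat_reduct_V dom_reduct_V by blast

section \<open>The vector space operations under asymptotically elementary families\<close>

lemma asymp_elem_sat_at:
  assumes a: "asymp_elem L F g N M" and \<phi>: "form_of L \<phi>" "fv \<phi> \<subseteq> {..<length xs}"
    and xs: "set xs \<subseteq> dom N" and d: "dom N \<noteq> {}"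
  shows "sat_at N \<phi> xs \<longleftrightarrow> eventually (\<lambda>i. sat_at M \<phi> (map (g i) xs)) F"
proof -
  obtain d where d: "d \<in> dom N" using d by auto
  let ?e = "\<lambda>n. if n < length xs then xs ! n else d"
  have r: "range ?e \<subseteq> dom N" using xs d by auto
  have "sat_at N \<phi> xs \<longleftrightarrow> sat N ?e \<phi>"
    unfolding sat_at_def by (rule sat_cong) (use \<phi> in auto)
  also have "\<dots> \<longleftrightarrow> eventually (\<lambda>i. sat M (g i \<circ> ?e) \<phi>) F" by (rule asymp_elem_iff[OF a \<phi>(1) r])
  also have "(\<lambda>i. sat M (g i \<circ> ?e) \<phi>) = (\<lambda>i. sat_at M \<phi> (map (g i) xs))"
  proof
    fix i show "sat M (g i \<circ> ?e) \<phi> = sat_at M \<phi> (map (g i) xs)"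
      unfolding sat_at_def by (rule sat_cong) (use \<phi> in auto)
  qed
  finally show ?thesis .
qed

text \<open>
  The part of \<open>defines_infinite_vs\<close> which says that the operations are well defined. It is
  all that is available at first in models outside the type \<open>'u\<close>.
\<close>

definition vs_ops :: "('f, 'r, 'k) vs_formulas \<Rightarrow> ('f, 'r, 'a) struct \<Rightarrow> bool" where
  "vs_ops D M \<longleftrightarrow> dom M \<noteq> {} \<and>
     (\<exists>!z. z \<in> VV D M \<and> sat_at M (fzero D) z) \<and>
     (\<forall>x\<in>VV D M. \<forall>y\<in>VV D M. \<exists>!z. z \<in> VV D M \<and> sat_at M (fadd D) (x @ y @ z)) \<and>
     (\<forall>a. \<forall>x\<in>VV D M. \<exists>!y. y \<in> VV D M \<and> sat_at M (fscale D a) (x @ y))"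

lemma carrier_vs [simp]: "carrier (vs D M) = VV D M"
  by (simp add: vs_def)

lemma VV_len: "x \<in> VV D M \<Longrightarrow> length x = vdim D \<and> set x \<subseteq> dom M"
  by (simp add: VV_def tuples_def)

lemma vs_ops_zero:
  assumes "vs_ops D M"
  shows "\<zero>\<^bsub>vs D M\<^esub> \<in> VV D M" "sat_at M (fzero D) \<zero>\<^bsub>vs D M\<^esub>"
    "z \<in> VV D M \<Longrightarrow> sat_at M (fzero D) z \<Longrightarrow> z = \<zero>\<^bsub>vs D M\<^esub>"
proof -
  have *: "\<exists>!z. z \<in> VV D M \<and> sat_at M (fzero D) z" using assms by (simp add: vs_ops_def)
  have z: "\<zero>\<^bsub>vs D M\<^esub> = (THE z. z \<in> VV D M \<and> sat_at M (fzero D) z)" by (simp add: vs_def)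
  show "\<zero>\<^bsub>vs D M\<^esub> \<in> VV D M" "sat_at M (fzero D) \<zero>\<^bsub>vs D M\<^esub>" using theI'[OF *] z by auto
  then show "z \<in> VV D M \<Longrightarrow> sat_at M (fzero D) z \<Longrightarrow> z = \<zero>\<^bsub>vs D M\<^esub>" using * by blast
qed

lemma vs_ops_add:
  assumes "vs_ops D M" "x \<in> VV D M" "y \<in> VV D M"
  shows "x \<oplus>\<^bsub>vs D M\<^esub> y \<in> VV D M" "sat_at M (fadd D) (x @ y @ (x \<oplus>\<^bsub>vs D M\<^esub> y))"
    "z \<in> VV D M \<Longrightarrow> sat_at M (fadd D) (x @ y @ z) \<Longrightarrow> z = x \<oplus>\<^bsub>vs D M\<^esub> y"
proof -
  have *: "\<exists>!z. z \<in> VV D M \<and> sat_at M (fadd D) (x @ y @ z)" using assms by (simp add: vs_ops_def)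
  have z: "x \<oplus>\<^bsub>vs D M\<^esub> y = (THE z. z \<in> VV D M \<and> sat_at M (fadd D) (x @ y @ z))" by (simp add: vs_def)
  show "x \<oplus>\<^bsub>vs D M\<^esub> y \<in> VV D M" "sat_at M (fadd D) (x @ y @ (x \<oplus>\<^bsub>vs D M\<^esub> y))"
    using theI'[OF *] z by auto
  then show "z \<in> VV D M \<Longrightarrow> sat_at M (fadd D) (x @ y @ z) \<Longrightarrow> z = x \<oplus>\<^bsub>vs D M\<^esub> y" using * by blast
qed

lemma vs_ops_smult:
  assumes "vs_ops D M" "x \<in> VV D M"
  shows "a \<odot>\<^bsub>vs D M\<^esub> x \<in> VV D M" "sat_at M (fscale D a) (x @ (a \<odot>\<^bsub>vs D M\<^esub> x))"
    "z \<in> VV D M \<Longrightarrow> sat_at M (fscale D a) (x @ z) \<Longrightarrow> z = a \<odot>\<^bsub>vs D M\<^esub> x"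
proof -
  have *: "\<exists>!y. y \<in> VV D M \<and> sat_at M (fscale D a) (x @ y)" using assms by (simp add: vs_ops_def)
  have z: "a \<odot>\<^bsub>vs D M\<^esub> x = (THE y. y \<in> VV D M \<and> sat_at M (fscale D a) (x @ y))" by (simp add: vs_def)
  show "a \<odot>\<^bsub>vs D M\<^esub> x \<in> VV D M" "sat_at M (fscale D a) (x @ (a \<odot>\<^bsub>vs D M\<^esub> x))"
    using theI'[OF *] z by auto
  then show "z \<in> VV D M \<Longrightarrow> sat_at M (fscale D a) (x @ z) \<Longrightarrow> z = a \<odot>\<^bsub>vs D M\<^esub> x" using * by blast
qed

lemma asymp_elem_VV:
  assumes a: "asymp_elem L F g N M" and D: "vs_formulas_of L D"
    and x: "x \<in> tuples N (vdim D)" and d: "dom N \<noteq> {}"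
  shows "x \<in> VV D N \<longleftrightarrow> eventually (\<lambda>i. map (g i) x \<in> VV D M) F"
proof -
  have x': "length x = vdim D" "set x \<subseteq> dom N" using x by (auto simp: tuples_def)
  have "map (g i) x \<in> tuples M (vdim D)" for i
    using a x' unfolding asymp_elem_def by (auto simp: tuples_def)
  moreover have "sat_at N (fV D) x \<longleftrightarrow> eventually (\<lambda>i. sat_at M (fV D) (map (g i) x)) F"
    using D x' d by (intro asymp_elem_sat_at[OF a]) (auto simp: vs_formulas_of_def)
  ultimately show ?thesis using x by (simp add: VV_def)
qed

lemma asymp_elem_VV_ev:
  assumes "asymp_elem L F g N M" "vs_formulas_of L D" "vs_ops D N" "x \<in> VV D N"
  shows "eventually (\<lambda>i. map (g i) x \<in> VV D M) F"
  using asymp_elem_VV[OF assms(1,2), of x] assms(3,4) by (auto simp: VV_def vs_ops_def)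

lemma asymp_elem_zero:
  assumes a: "asymp_elem L F g N M" and D: "vs_formulas_of L D" and ops: "vs_ops D N" "vs_ops D M"
  shows "eventually (\<lambda>i. map (g i) \<zero>\<^bsub>vs D N\<^esub> = \<zero>\<^bsub>vs D M\<^esub>) F"
proof -
  note z = vs_ops_zero[OF ops(1)]
  have "eventually (\<lambda>i. sat_at M (fzero D) (map (g i) \<zero>\<^bsub>vs D N\<^esub>)) F"
    using asymp_elem_sat_at[OF a, of "fzero D" "\<zero>\<^bsub>vs D N\<^esub>"] z(1,2) VV_len[OF z(1)] D ops(1)
    by (auto simp: vs_formulas_of_def vs_ops_def)
  with asymp_elem_VV_ev[OF a D ops(1) z(1)] show ?thesis
    by eventually_elim (rule vs_ops_zero(3)[OF ops(2)])
qed

lemma asymp_elem_add: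
  assumes a: "asymp_elem L F g N M" and D: "vs_formulas_of L D" and ops: "vs_ops D N" "vs_ops D M"
    and x: "x \<in> VV D N" and y: "y \<in> VV D N"
  shows "eventually (\<lambda>i. map (g i) (x \<oplus>\<^bsub>vs D N\<^esub> y) = map (g i) x \<oplus>\<^bsub>vs D M\<^esub> map (g i) y) F"
proof -
  note z = vs_ops_add[OF ops(1) x y]
  have "3 * vdim D = vdim D + (vdim D + vdim D)" by simp
  moreover have "fv (fadd D) \<subseteq> {..<3 * vdim D}"
    using D by (simp add: vs_formulas_of_def)
  ultimately have "fv (fadd D) \<subseteq> {..<vdim D + (vdim D + vdim D)}" by (simp only:)
  then have "eventually (\<lambda>i. sat_at M (fadd D) (map (g i) (x @ y @ (x \<oplus>\<^bsub>vs D N\<^esub> y)))) F"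
    using asymp_elem_sat_at[OF a, of "fadd D" "x @ y @ (x \<oplus>\<^bsub>vs D N\<^esub> y)"] z(2)
      VV_len[OF z(1)] VV_len[OF x] VV_len[OF y] D ops(1)
    by (auto simp: vs_formulas_of_def vs_ops_def)
  with asymp_elem_VV_ev[OF a D ops(1) z(1)] asymp_elem_VV_ev[OF a D ops(1) x] asymp_elem_VV_ev[OF a D ops(1) y]
  show ?thesis
    by eventually_elim (simp add: vs_ops_add(3)[OF ops(2)])
qed

lemma asymp_elem_smult:
  assumes a: "asymp_elem L F g N M" and D: "vs_formulas_of L D" and ops: "vs_ops D N" "vs_ops D M"
    and x: "x \<in> VV D N"
  shows "eventually (\<lambda>i. map (g i) (c \<odot>\<^bsub>vs D N\<^esub> x) = c \<odot>\<^bsub>vs D M\<^esub> map (g i) x) F"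
proof -
  note z = vs_ops_smult[OF ops(1) x, where a = c]
  have "eventually (\<lambda>i. sat_at M (fscale D c) (map (g i) (x @ (c \<odot>\<^bsub>vs D N\<^esub> x)))) F"
    using asymp_elem_sat_at[OF a, of "fscale D c" "x @ (c \<odot>\<^bsub>vs D N\<^esub> x)"] z(2)
      VV_len[OF z(1)] VV_len[OF x] D ops(1)
    by (auto simp: vs_formulas_of_def vs_ops_def mult_2)
  with asymp_elem_VV_ev[OF a D ops(1) z(1)] asymp_elem_VV_ev[OF a D ops(1) x]
  show ?thesis
    by eventually_elim (simp add: vs_ops_smult(3)[OF ops(2)])
qed

lemma asymp_elem_neq_list:
  assumes a: "asymp_elem L F g N M" and x: "set x \<subseteq> dom N" "set y \<subseteq> dom N" "x \<noteq> y"
  shows "eventually (\<lambda>i. map (g i) x \<noteq> map (g i) y) F"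
proof (cases "length x = length y")
  case True
  then obtain j where j: "j < length x" "x ! j \<noteq> y ! j" using x(3) nth_equalityI by blast
  have "eventually (\<lambda>i. g i (x ! j) \<noteq> g i (y ! j)) F"
    using j x True by (intro asymp_elem_neq[OF a]) auto
  then show ?thesis
  proof eventually_elim
    case (elim i)
    show ?case
    proof
      assume "map (g i) x = map (g i) y"
      then have "map (g i) x ! j = map (g i) y ! j" by simp
      then show False using elim j(1) True by simp
    qed
  qed
next
  case False
  then have "map (g i) x \<noteq> map (g i) y" for i by (metis length_map)
  then show ?thesis by simp
qed

text \<open>
  A recursive form of \<open>\<Sum>n<m. k n * x n\<close>: finite sums in \<open>vs D M\<close> are usable only
  once this is known to be a module, and here the asymptotic statements pass through one
  operation at a time.
\<close>

primrec lincomb :: "('f, 'r, 'k) vs_formulas \<Rightarrow> ('f, 'r, 'a) struct \<Rightarrow> (nat \<Rightarrow> 'k) \<Rightarrow>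
    (nat \<Rightarrow> 'a list) \<Rightarrow> nat \<Rightarrow> 'a list" where
  "lincomb D M k x 0 = \<zero>\<^bsub>vs D M\<^esub>"
| "lincomb D M k x (Suc n) = lincomb D M k x n \<oplus>\<^bsub>vs D M\<^esub> (k n \<odot>\<^bsub>vs D M\<^esub> x n)"

lemma lincomb_in_VV:
  assumes "vs_ops D M" "\<And>n. n < m \<Longrightarrow> x n \<in> VV D M"
  shows "lincomb D M k x m \<in> VV D M"
  using assms(2)
  by (induction m) (auto intro!: vs_ops_zero(1) vs_ops_add(1) vs_ops_smult(1) assms(1))

lemma lincomb_cong: "(\<And>n. n < m \<Longrightarrow> x n = y n) \<Longrightarrow> lincomb D M k x m = lincomb D M k y m"
  by (induction m) auto

lemma asymp_elem_lincomb:
  assumes a: "asymp_elem L F g N M" and D: "vs_formulas_of L D" and ops: "vs_ops D N" "vs_ops D M"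
    and x: "\<And>n. n < m \<Longrightarrow> x n \<in> VV D N"
  shows "eventually (\<lambda>i. map (g i) (lincomb D N k x m) = lincomb D M k (\<lambda>n. map (g i) (x n)) m) F"
  using x
proof (induction m)
  case 0
  show ?case using asymp_elem_zero[OF a D ops] by simp
next
  case (Suc m)
  have l: "lincomb D N k x m \<in> VV D N" using lincomb_in_VV[OF ops(1)] Suc.prems by simp
  have xm: "x m \<in> VV D N" using Suc.prems by simp
  have IH: "eventually (\<lambda>i. map (g i) (lincomb D N k x m) = lincomb D M k (\<lambda>n. map (g i) (x n)) m) F"
    by (rule Suc.IH) (use Suc.prems in simp)
  show ?case
    using IH asymp_elem_add[OF a D ops l vs_ops_smult(1)[OF ops(1) xm, where a = "k m"]]
      asymp_elem_smult[OF a D ops xm, of "k m"]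
    by eventually_elim simp
qed

lemma defines_vs_ops:
  assumes "defines_infinite_vs D M"
  shows "vs_ops D M"
proof -
  have "infinite (VV D M)" using assms by (simp add: defines_infinite_vs_def)
  moreover have "VV D M \<subseteq> {xs. set xs \<subseteq> dom M \<and> length xs = vdim D}" by (auto simp: VV_def tuples_def)
  ultimately have "dom M \<noteq> {}" using finite_lists_length_eq[of "dom M" "vdim D"] finite_subset
    by (metis finite.emptyI)
  then show ?thesis using assms by (simp add: defines_infinite_vs_def vs_ops_def)
qed

lemma defines_vs_infinite_dom:
  assumes "defines_infinite_vs D M"
  shows "infinite (dom M)"
proof
  assume "finite (dom M)"
  moreover have "VV D M \<subseteq> {xs. set xs \<subseteq> dom M \<and> length xs = vdim D}" by (auto simp: VV_def tuples_def)
  ultimately have "finite (VV D M)" using finite_lists_length_eq[of "dom M" "vdim D"] finite_subset by blast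
  then show False using assms by (simp add: defines_infinite_vs_def)
qed

lemma poly_endo_lincomb:
  fixes D :: "('f, 'r, 'k::field) vs_formulas"
  assumes D: "defines_infinite_vs D M" and \<theta>: "\<And>x. x \<in> VV D M \<Longrightarrow> \<theta> x \<in> VV D M" and x: "x \<in> VV D M"
  shows "poly_endo D M \<rho> \<theta> x =
    lincomb D M (Polynomial.coeff \<rho>) (\<lambda>i. (\<theta> ^^ i) x) (Suc (Polynomial.degree \<rho>))"
proof -
  interpret module "ring_of_type_algebra :: 'k ring" "vs D M"
    using D by (simp add: defines_infinite_vs_def)
  note ops = defines_vs_ops[OF D]
  have pow: "(\<theta> ^^ i) x \<in> VV D M" for i by (induction i) (use x \<theta> in auto)
  have sc: "Polynomial.coeff \<rho> i \<odot>\<^bsub>vs D M\<^esub> (\<theta> ^^ i) x \<in> VV D M" for i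
    by (rule vs_ops_smult(1)[OF ops pow])
  have "(\<Oplus>\<^bsub>vs D M\<^esub>i\<in>{..m}. Polynomial.coeff \<rho> i \<odot>\<^bsub>vs D M\<^esub> (\<theta> ^^ i) x) =
    lincomb D M (Polynomial.coeff \<rho>) (\<lambda>i. (\<theta> ^^ i) x) (Suc m)" for m
  proof (induction m)
    case 0
    show ?case using sc[of 0] by simp
  next
    case (Suc m)
    have "(\<Oplus>\<^bsub>vs D M\<^esub>i\<in>{..Suc m}. Polynomial.coeff \<rho> i \<odot>\<^bsub>vs D M\<^esub> (\<theta> ^^ i) x)
      = (Polynomial.coeff \<rho> (Suc m) \<odot>\<^bsub>vs D M\<^esub> (\<theta> ^^ Suc m) x) \<oplus>\<^bsub>vs D M\<^esub>
        (\<Oplus>\<^bsub>vs D M\<^esub>i\<in>{..m}. Polynomial.coeff \<rho> i \<odot>\<^bsub>vs D M\<^esub> (\<theta> ^^ i) x)"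
      by (rule M.finsum_Suc) (use sc in auto)
    also have "\<dots> = lincomb D M (Polynomial.coeff \<rho>) (\<lambda>i. (\<theta> ^^ i) x) (Suc (Suc m))"
      unfolding Suc.IH lincomb.simps(2)[of D M _ _ "Suc m"]
      by (rule M.a_comm) (use sc[of "Suc m"] lincomb_in_VV[OF ops, of "Suc m"] pow in \<open>auto simp del: lincomb.simps\<close>)
    finally show ?case .
  qed
  then show ?thesis unfolding poly_endo_def .
qed

lemma asymp_elem_poly_endo:
  fixes D :: "('f, 'r, 'k::field) vs_formulas"
  assumes a: "asymp_elem L F g N M" and D: "vs_formulas_of L D"
    and def: "defines_infinite_vs D N" "defines_infinite_vs D M"
    and \<theta>N: "\<And>x. x \<in> VV D N \<Longrightarrow> \<theta>N x \<in> VV D N" and \<theta>M: "\<And>x. x \<in> VV D M \<Longrightarrow> \<theta>M x \<in> VV D M"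
    and comm: "\<And>x. x \<in> VV D N \<Longrightarrow> eventually (\<lambda>i. map (g i) (\<theta>N x) = \<theta>M (map (g i) x)) F"
    and x: "x \<in> VV D N"
  shows "eventually (\<lambda>i. map (g i) (poly_endo D N \<rho> \<theta>N x) = poly_endo D M \<rho> \<theta>M (map (g i) x)) F"
proof -
  note ops = defines_vs_ops[OF def(1)] defines_vs_ops[OF def(2)]
  let ?m = "Suc (Polynomial.degree \<rho>)"
  have pow: "(\<theta>N ^^ n) x \<in> VV D N" for n by (induction n) (use x \<theta>N in auto)
  have "eventually (\<lambda>i. map (g i) ((\<theta>N ^^ n) x) = (\<theta>M ^^ n) (map (g i) x)) F" for n
  proof (induction n)
    case (Suc n)
    show ?case using Suc comm[OF pow[of n]] by eventually_elim simp
  qed simp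
  then have "eventually (\<lambda>i. \<forall>n\<in>{..<?m}. map (g i) ((\<theta>N ^^ n) x) = (\<theta>M ^^ n) (map (g i) x)) F"
    by (intro eventually_ball_finite) auto
  with asymp_elem_lincomb[OF a D ops, where m = ?m and x = "\<lambda>n. (\<theta>N ^^ n) x" and k = "Polynomial.coeff \<rho>", OF pow]
    asymp_elem_VV_ev[OF a D ops(1) x]
  show ?thesis
  proof eventually_elim
    case (elim i)
    have "lincomb D M (Polynomial.coeff \<rho>) (\<lambda>n. map (g i) ((\<theta>N ^^ n) x)) ?m
      = lincomb D M (Polynomial.coeff \<rho>) (\<lambda>n. (\<theta>M ^^ n) (map (g i) x)) ?m"
      by (rule lincomb_cong) (use elim(3) in auto)
    then show ?case
      using elim(1) poly_endo_lincomb[OF def(1) \<theta>N x, where \<rho> = \<rho>]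
        poly_endo_lincomb[OF def(2) \<theta>M elim(2), where \<rho> = \<rho>]
      by (simp only:)
  qed
qed

section \<open>Polynomials acting on a vector space\<close>

lemma infinite_times_nat_lepoll:
  assumes "infinite A"
  shows "A \<times> (UNIV :: nat set) \<lesssim> A"
proof -
  have "A \<times> (UNIV :: nat set) \<lesssim> A \<times> A"
    using assms infinite_le_lepoll by (intro times_lepoll_mono) auto
  moreover have "A \<times> A \<lesssim> A"
    using card_of_Times_same_infinite[OF assms] by (simp add: eqpoll_imp_lepoll eqpoll_iff_card_of_ordIso)
  ultimately show ?thesis by (rule lepoll_trans)
qed

lemma infinite_minus_finite_eqpoll:
  assumes "infinite A" "finite B"
  shows "A - B \<approx> A"
  using assms(2)
proof (induction B)
  case (insert b B)
  have inf: "infinite (A - insert b B)" using assms(1) insert.hyps(1) by (simp add: Diff_infinite_finite)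
  show ?case
  proof (cases "b \<in> A - B")
    case True
    then have "A - B = insert b (A - insert b B)" by auto
    then have "A - insert b B \<approx> A - B" using infinite_insert_eqpoll[OF inf, of b] eqpoll_sym by simp
    then show ?thesis using insert.IH eqpoll_trans by blast
  next
    case False
    then have "A - insert b B = A - B" by auto
    then show ?thesis using insert.IH by simp
  qed
qed simp

text \<open>
  The ambient vector space fills a type, whereas the operators considered below are linear
  on a subspace only, with arbitrary values elsewhere.
\<close>

locale kspace = vector_space scale
  for scale :: "'a::field \<Rightarrow> 'b::ab_group_add \<Rightarrow> 'b" (infixr "*s" 75)
begin

definition pact :: "'a poly \<Rightarrow> ('b \<Rightarrow> 'b) \<Rightarrow> 'b \<Rightarrow> 'b" where
  "pact p T x = (\<Sum>i\<le>Polynomial.degree p. Polynomial.coeff p i *s (T ^^ i) x)"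

definition endo_on :: "'b set \<Rightarrow> ('b \<Rightarrow> 'b) \<Rightarrow> bool" where
  "endo_on Y T \<longleftrightarrow> subspace Y \<and> (\<forall>x\<in>Y. T x \<in> Y) \<and>
     (\<forall>x\<in>Y. \<forall>y\<in>Y. T (x + y) = T x + T y) \<and> (\<forall>c. \<forall>x\<in>Y. T (c *s x) = c *s T x)"

lemma pact_bound:
  fixes p :: "'a poly"
  assumes "Polynomial.degree p < n"
  shows "pact p T x = (\<Sum>i<n. Polynomial.coeff p i *s (T ^^ i) x)"
  unfolding pact_def
  by (rule sum.mono_neutral_left) (use assms in \<open>auto simp: coeff_eq_0 not_le\<close>)

lemma pact_0 [simp]: "pact 0 T x = 0"
  by (simp add: pact_def)

lemma pact_pCons: "pact (pCons a p) T x = a *s x + pact p T (T x)"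
proof -
  have "pact (pCons a p) T x = (\<Sum>i<Suc (Suc (Polynomial.degree p)). Polynomial.coeff (pCons a p) i *s (T ^^ i) x)"
    by (rule pact_bound) (simp add: Polynomial.degree_pCons_le le_imp_less_Suc)
  also have "\<dots> = a *s x + (\<Sum>i<Suc (Polynomial.degree p). Polynomial.coeff p i *s (T ^^ i) (T x))"
    by (subst sum.lessThan_Suc_shift) (simp add: funpow_swap1)
  also have "\<dots> = a *s x + pact p T (T x)" by (subst pact_bound[of p "Suc (Polynomial.degree p)"]) auto
  finally show ?thesis .
qed

lemma pact_1 [simp]: "pact 1 T x = x"
  by (simp add: one_pCons pact_pCons)

lemma pact_add: "pact (p + q) T x = pact p T x + pact q T x"
proof -
  define n where "n = Suc (max (Polynomial.degree p) (Polynomial.degree q))"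
  have "Polynomial.degree (p + q) < n" "Polynomial.degree p < n" "Polynomial.degree q < n"
    using Polynomial.degree_add_le_max[of p q] by (auto simp: n_def)
  then show ?thesis by (simp add: pact_bound sum.distrib scale_left_distrib)
qed

lemma pact_smult: "pact (Polynomial.smult c p) T x = c *s pact p T x"
proof -
  define n where "n = Suc (Polynomial.degree p)"
  have "Polynomial.degree (Polynomial.smult c p) < n" "Polynomial.degree p < n"
    using Polynomial.degree_smult_le[of c p] by (auto simp: n_def)
  then show ?thesis by (simp add: pact_bound scale_sum_right)
qed

lemma endo_onD:
  assumes "endo_on Y T"
  shows "subspace Y" "x \<in> Y \<Longrightarrow> T x \<in> Y" "x \<in> Y \<Longrightarrow> y \<in> Y \<Longrightarrow> T (x + y) = T x + T y"
    "x \<in> Y \<Longrightarrow> T (c *s x) = c *s T x"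
  using assms by (auto simp: endo_on_def)

lemma endo_on_zero: "endo_on Y T \<Longrightarrow> T 0 = 0"
  using endo_onD(4)[of Y T 0 0] subspace_0[of Y] by (simp add: endo_onD)

lemma pact_in:
  assumes "endo_on Y T" "x \<in> Y"
  shows "pact p T x \<in> Y"
  using assms(2)
proof (induction p arbitrary: x)
  case 0
  then show ?case using subspace_0 endo_onD(1)[OF assms(1)] by simp
next
  case (pCons a p)
  then show ?case using endo_onD(1,2)[OF assms(1)]
    by (simp add: pact_pCons subspace_add subspace_scale)
qed

lemma pact_plus:
  assumes "endo_on Y T" "x \<in> Y" "y \<in> Y"
  shows "pact p T (x + y) = pact p T x + pact p T y"
  using assms(2,3)
proof (induction p arbitrary: x y)
  case (pCons a p)
  then show ?case using endo_onD[OF assms(1)]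
    by (simp add: pact_pCons scale_right_distrib)
qed simp

lemma pact_scale:
  assumes "endo_on Y T" "x \<in> Y"
  shows "pact p T (c *s x) = c *s pact p T x"
  using assms(2)
proof (induction p arbitrary: x)
  case (pCons a p)
  then show ?case using endo_onD[OF assms(1)]
    by (simp add: pact_pCons scale_right_distrib mult.commute)
qed simp

lemma pact_zero [simp]: "endo_on Y T \<Longrightarrow> pact p T 0 = 0"
  using pact_scale[of Y T 0 p 0] subspace_0[of Y] by (simp add: endo_onD)

lemma pact_minus:
  assumes "endo_on Y T" "x \<in> Y" "y \<in> Y"
  shows "pact p T (x - y) = pact p T x - pact p T y"
proof -
  have "pact p T (x - y) = pact p T (x + (-1) *s y)" by simp
  also have "\<dots> = pact p T x + pact p T ((-1) *s y)"
    by (rule pact_plus[OF assms(1,2)]) (use assms endo_onD(1) subspace_scale in blast)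
  also have "\<dots> = pact p T x - pact p T y" unfolding pact_scale[OF assms(1,3)] by simp
  finally show ?thesis .
qed

lemma pact_commute_T:
  assumes "endo_on Y T" "x \<in> Y"
  shows "pact p T (T x) = T (pact p T x)"
  using assms(2)
proof (induction p arbitrary: x)
  case 0
  then show ?case using endo_on_zero[OF assms(1)] by simp
next
  case (pCons a p)
  have T: "T x \<in> Y" using endo_onD(2)[OF assms(1)] pCons.prems .
  have "T (a *s x + pact p T (T x)) = T (a *s x) + T (pact p T (T x))"
    by (rule endo_onD(3)[OF assms(1)])
      (use pCons.prems pact_in[OF assms(1) T] endo_onD(1)[OF assms(1)] subspace_scale in auto)
  also have "\<dots> = a *s T x + pact p T (T (T x))"
    using pCons.IH[OF T] endo_onD(4)[OF assms(1) pCons.prems] by simp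
  finally show ?case by (simp add: pact_pCons)
qed

lemma pact_mult:
  assumes "endo_on Y T" "x \<in> Y"
  shows "pact (p * q) T x = pact p T (pact q T x)"
  using assms(2)
proof (induction p arbitrary: x)
  case (pCons a p)
  have T: "T x \<in> Y" using endo_onD(2)[OF assms(1)] pCons.prems .
  have "pact (pCons a p * q) T x = a *s pact q T x + pact (p * q) T (T x)"
    by (simp add: pact_add pact_smult pact_pCons)
  also have "\<dots> = a *s pact q T x + pact p T (T (pact q T x))"
    using pCons.IH[OF T] pact_commute_T[OF assms(1) pCons.prems] by simp
  finally show ?case by (simp add: pact_pCons)
qed simp

lemma pact_cong:
  assumes "endo_on Y S" "\<And>x. x \<in> Y \<Longrightarrow> T x = S x" "x \<in> Y"
  shows "pact p T x = pact p S x"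
  using assms(3)
proof (induction p arbitrary: x)
  case (pCons a p)
  then show ?case using assms(1,2) endo_onD(2) by (simp add: pact_pCons)
qed simp

lemma independent_by_functionals:
  assumes "\<And>v. v \<in> B \<Longrightarrow> \<exists>c :: 'b \<Rightarrow> 'a. (\<forall>x y. c (x + y) = c x + c y) \<and> (\<forall>k x. c (k *s x) = k * c x) \<and>
    c v \<noteq> 0 \<and> (\<forall>w\<in>B. w \<noteq> v \<longrightarrow> c w = 0)"
  shows "independent B"
proof
  assume "dependent B"
  then obtain v where v: "v \<in> B" "v \<in> span (B - {v})" by (auto simp: dependent_def)
  then obtain c :: "'b \<Rightarrow> 'a" where c: "\<And>x y. c (x + y) = c x + c y" "\<And>k x. c (k *s x) = k * c x"
    "c v \<noteq> 0" "\<And>w. w \<in> B \<Longrightarrow> w \<noteq> v \<Longrightarrow> c w = 0" using assms[OF v(1)] by metis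
  have "c 0 = 0" using c(2)[of 0 0] by simp
  then have "subspace {x. c x = 0}" using c by (auto simp: subspace_def)
  moreover have "B - {v} \<subseteq> {x. c x = 0}" using c(4) by auto
  ultimately have "span (B - {v}) \<subseteq> {x. c x = 0}" by (rule span_minimal[rotated])
  then show False using v(2) c(3) by auto
qed

end

section \<open>Finitely supported families of polynomials\<close>

definition fscal :: "'k::field \<Rightarrow> ('j \<Rightarrow>\<^sub>0 'k poly) \<Rightarrow> ('j \<Rightarrow>\<^sub>0 'k poly)" where
  "fscal k = Poly_Mapping.map (Polynomial.smult k)"

definition fmul :: "'k::field poly \<Rightarrow> ('j \<Rightarrow>\<^sub>0 'k poly) \<Rightarrow> ('j \<Rightarrow>\<^sub>0 'k poly)" where
  "fmul p = Poly_Mapping.map ((*) p)"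

text \<open>
  Reduction of the \<open>j\<close>-th entry modulo \<open>mm j\<close>; reduction modulo \<open>0\<close> changes nothing,
  so the value \<open>0\<close> stands for a free summand. The reduced families supported in \<open>G\<close> form
  the direct sum of the modules \<open>K[X]/(mm j)\<close>.
\<close>

definition fred :: "('j \<Rightarrow> 'k::field poly) \<Rightarrow> ('j \<Rightarrow>\<^sub>0 'k poly) \<Rightarrow> ('j \<Rightarrow>\<^sub>0 'k poly)" where
  "fred mm = Poly_Mapping.mapp (\<lambda>j p. p mod mm j)"

lemma lookup_fscal [simp]: "Poly_Mapping.lookup (fscal k q) j = Polynomial.smult k (Poly_Mapping.lookup q j)"
  by (simp add: fscal_def Poly_Mapping.map.rep_eq when_def)

lemma lookup_fmul [simp]: "Poly_Mapping.lookup (fmul p q) j = p * Poly_Mapping.lookup q j"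
  by (simp add: fmul_def Poly_Mapping.map.rep_eq when_def)

lemma lookup_fred [simp]: "Poly_Mapping.lookup (fred mm q) j = Poly_Mapping.lookup q j mod mm j"
  by (simp add: fred_def Poly_Mapping.lookup_mapp when_def in_keys_iff)

lemma keys_fscal: "Poly_Mapping.keys (fscal k q) \<subseteq> Poly_Mapping.keys q"
  by (auto simp: in_keys_iff)

lemma keys_fmul: "Poly_Mapping.keys (fmul k q) \<subseteq> Poly_Mapping.keys q"
  by (auto simp: in_keys_iff)

lemma keys_fred: "Poly_Mapping.keys (fred mm q) \<subseteq> Poly_Mapping.keys q"
  by (auto simp: in_keys_iff)

lemma vector_space_fscal: "vector_space (fscal :: 'k::field \<Rightarrow> ('j \<Rightarrow>\<^sub>0 'k poly) \<Rightarrow> _)"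
  by unfold_locales
    (auto intro!: poly_mapping_eqI simp: lookup_add smult_add_right smult_add_left)

lemma fred_add: "fred mm (q + q') = fred mm q + fred mm q'"
  by (rule poly_mapping_eqI) (simp add: lookup_add poly_mod_add_left)

lemma fred_fscal: "fred mm (fscal k q) = fscal k (fred mm q)"
  by (rule poly_mapping_eqI) (simp add: mod_smult_left)

lemma fmul_add: "fmul p (q + q') = fmul p q + fmul p q'"
  by (rule poly_mapping_eqI) (simp add: lookup_add algebra_simps)

lemma fred_fmul_fred: "fred mm (fmul p (fred mm q)) = fred mm (fmul p q)"
  by (rule poly_mapping_eqI) (simp add: mod_mult_right_eq)

context kspace
begin

text \<open>
  The space \<open>Q\<close> of reduced families has the same dimension as \<open>span G\<close>. Its dimension is
  at least the cardinality of \<open>G\<close> as no \<open>mm j\<close> is a unit, and at most that of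
  \<open>G \<times> nat\<close>, the number of monomials, because a basis of \<open>Q\<close> extends to one of
  all families. As \<open>G\<close> is infinite, there is enough room to prescribe the images of
  finitely many nonzero vectors in different summands.
\<close>

lemma ex_reduced_family_iso:
  fixes G :: "'b set" and mm :: "'b \<Rightarrow> 'a poly" and r :: "'b \<Rightarrow> 'a poly"
  assumes G: "independent G" "infinite G" and mm: "\<And>j. j \<in> G \<Longrightarrow> \<not> mm j dvd 1"
    and Gs: "finite Gs" "Gs \<subseteq> G" and r: "\<And>j. j \<in> Gs \<Longrightarrow> \<not> mm j dvd r j"
  defines "Q \<equiv> {q :: 'b \<Rightarrow>\<^sub>0 'a poly. Poly_Mapping.keys q \<subseteq> G \<and> fred mm q = q}"
  shows "\<exists>\<Lambda>. Vector_Spaces.linear fscal scale \<Lambda> \<and> inj_on \<Lambda> Q \<and> \<Lambda> ` Q = span G \<and>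
    (\<forall>j\<in>Gs. \<Lambda> (Poly_Mapping.single j (r j mod mm j)) = j)"
proof -
  interpret F: kspace "fscal :: 'a \<Rightarrow> ('b \<Rightarrow>\<^sub>0 'a poly) \<Rightarrow> _"
    unfolding kspace_def by (rule vector_space_fscal)
  interpret VP: vector_space_pair "fscal :: 'a \<Rightarrow> ('b \<Rightarrow>\<^sub>0 'a poly) \<Rightarrow> _" scale ..
  \<comment> \<open>One nonzero vector in each summand, the prescribed ones among them.\<close>
  define u where "u j = Poly_Mapping.single j ((if j \<in> Gs then r j else 1) mod mm j)" for j
  have u_nz: "(if j \<in> Gs then r j else 1) mod mm j \<noteq> 0" if "j \<in> G" for j
    using that mm r by (auto simp: mod_eq_0_iff_dvd)
  have look_u: "Poly_Mapping.lookup (u j) i = (if i = j then (if j \<in> Gs then r j else 1) mod mm j else 0)" for i j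
    by (simp add: u_def lookup_single when_def)
  have inj_u: "inj_on u G"
  proof (rule inj_onI)
    fix i j assume "i \<in> G" "j \<in> G" "u i = u j"
    then have "Poly_Mapping.lookup (u i) i = Poly_Mapping.lookup (u j) i" by simp
    then show "i = j" using u_nz[OF \<open>i \<in> G\<close>] by (auto simp: look_u split: if_splits)
  qed
  have subQ: "F.subspace Q"
    unfolding F.subspace_def
  proof (intro conjI ballI allI)
    show "0 \<in> Q" by (auto simp: Q_def intro!: poly_mapping_eqI)
    show "x + y \<in> Q" if "x \<in> Q" "y \<in> Q" for x y
      using that Poly_Mapping.keys_add[of x y] by (auto simp: Q_def fred_add)
    show "fscal c x \<in> Q" if "x \<in> Q" for c x
      using that keys_fscal[of c x] by (auto simp: Q_def fred_fscal)
  qed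
  have uQ: "u ` G \<subseteq> Q"
    by (auto simp: Q_def u_def intro!: poly_mapping_eqI split: if_splits)
      (auto simp: lookup_single when_def)
  have indep_u: "F.independent (u ` G)"
  proof (rule F.independent_by_functionals)
    fix v assume "v \<in> u ` G"
    then obtain j where j: "j \<in> G" "v = u j" by auto
    let ?p = "(if j \<in> Gs then r j else 1) mod mm j"
    let ?c = "\<lambda>q. Polynomial.coeff (Poly_Mapping.lookup q j) (Polynomial.degree ?p)"
    show "\<exists>c :: ('b \<Rightarrow>\<^sub>0 'a poly) \<Rightarrow> 'a. (\<forall>x y. c (x + y) = c x + c y) \<and> (\<forall>k x. c (fscal k x) = k * c x) \<and>
      c v \<noteq> 0 \<and> (\<forall>w\<in>u ` G. w \<noteq> v \<longrightarrow> c w = 0)"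
    proof (intro exI[of _ ?c] conjI allI ballI impI)
      have "Poly_Mapping.lookup v j = ?p" by (simp add: j(2) look_u)
      then show "?c v \<noteq> 0" using u_nz[OF j(1)] leading_coeff_0_iff[of ?p] by (simp only:) simp
      fix w assume "w \<in> u ` G" "w \<noteq> v"
      then show "?c w = 0" by (auto simp: j(2) look_u)
    qed (simp_all add: lookup_add)
  qed
  obtain H where H: "u ` G \<subseteq> H" "H \<subseteq> Q" "F.independent H" "Q \<subseteq> F.span H"
    using F.maximal_independent_subset_extend[OF uQ indep_u] .
  have spanH: "F.span H = Q" using H(2,4) F.span_minimal[OF H(2) subQ] by auto
  \<comment> \<open>The monomials form a basis of the space of all families, which bounds the size of \<open>H\<close>.\<close>
  define B where "B = (\<lambda>(j, i). Poly_Mapping.single j (Polynomial.monom (1::'a) i)) ` (G \<times> UNIV)"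
  define W where "W = {q :: 'b \<Rightarrow>\<^sub>0 'a poly. Poly_Mapping.keys q \<subseteq> G}"
  have subW: "F.subspace W"
    unfolding F.subspace_def
  proof (intro conjI ballI allI)
    show "0 \<in> W" by (simp add: W_def)
    show "x + y \<in> W" if "x \<in> W" "y \<in> W" for x y
      using that Poly_Mapping.keys_add[of x y] by (auto simp: W_def)
    show "fscal c x \<in> W" if "x \<in> W" for c x
      using that keys_fscal[of c x] by (auto simp: W_def)
  qed
  have indB: "F.independent B"
  proof (rule F.independent_by_functionals)
    fix v assume "v \<in> B"
    then obtain j i where v: "v = Poly_Mapping.single j (Polynomial.monom (1::'a) i)" by (auto simp: B_def)
    let ?c = "\<lambda>q. Polynomial.coeff (Poly_Mapping.lookup q j) i"
    show "\<exists>c :: ('b \<Rightarrow>\<^sub>0 'a poly) \<Rightarrow> 'a. (\<forall>x y. c (x + y) = c x + c y) \<and> (\<forall>k x. c (fscal k x) = k * c x) \<and>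
      c v \<noteq> 0 \<and> (\<forall>w\<in>B. w \<noteq> v \<longrightarrow> c w = 0)"
      by (intro exI[of _ ?c]) (auto simp: lookup_add v B_def lookup_single when_def)
  qed
  have "W \<subseteq> F.span B"
  proof
    fix q assume q: "q \<in> W"
    have "q = (\<Sum>j\<in>Poly_Mapping.keys q. Poly_Mapping.single j (Poly_Mapping.lookup q j))"
      by (rule poly_mapping_eqI) (auto simp: lookup_sum lookup_single when_def in_keys_iff)
    also have "\<dots> \<in> F.span B"
    proof (rule F.span_sum)
      fix j assume "j \<in> Poly_Mapping.keys q"
      then have j: "j \<in> G" using q by (auto simp: W_def)
      let ?p = "Poly_Mapping.lookup q j"
      have "Poly_Mapping.single j ?p
        = (\<Sum>i\<le>Polynomial.degree ?p. fscal (Polynomial.coeff ?p i) (Poly_Mapping.single j (Polynomial.monom 1 i)))"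
      proof (rule poly_mapping_eqI)
        fix k
        show "Poly_Mapping.lookup (Poly_Mapping.single j ?p) k
          = Poly_Mapping.lookup (\<Sum>i\<le>Polynomial.degree ?p. fscal (Polynomial.coeff ?p i) (Poly_Mapping.single j (Polynomial.monom 1 i))) k"
          by (auto simp: lookup_sum lookup_single when_def smult_monom poly_as_sum_of_monoms)
      qed
      also have "\<dots> \<in> F.span B"
        by (intro F.span_sum F.span_scale F.span_base) (use j in \<open>auto simp: B_def\<close>)
      finally show "Poly_Mapping.single j ?p \<in> F.span B" .
    qed
    finally show "q \<in> F.span B" .
  qed
  moreover have BW: "B \<subseteq> W" by (auto simp: B_def W_def split: if_splits)
  ultimately have spanB: "F.span B = W" using F.span_minimal[OF BW subW] by auto
  have HW: "H \<subseteq> W" using H(2) by (auto simp: Q_def W_def)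
  obtain H' where H': "H \<subseteq> H'" "H' \<subseteq> W" "F.independent H'" "W \<subseteq> F.span H'"
    using F.maximal_independent_subset_extend[OF HW H(3)] .
  have "F.span H' = F.span B" using H' F.span_minimal[OF H'(2) subW] spanB by auto
  then obtain b where "bij_betw b H' B" using F.bij_if_span_eq_span_bases[OF H'(3) indB] by auto
  then have "H' \<approx> B" by (auto simp: eqpoll_def)
  have "H \<lesssim> H'" using H'(1) by (rule subset_imp_lepoll)
  also have "H' \<lesssim> B" using \<open>H' \<approx> B\<close> by (rule eqpoll_imp_lepoll)
  also have "B \<lesssim> G \<times> (UNIV :: nat set)" unfolding B_def by (rule image_lepoll)
  also have "G \<times> (UNIV :: nat set) \<lesssim> G" by (rule infinite_times_nat_lepoll[OF G(2)])
  finally have HG: "H \<lesssim> G" .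
  have "H - u ` Gs \<lesssim> G"
    using HG lepoll_trans[OF subset_imp_lepoll[of "H - u ` Gs" H]] by blast
  also have "G \<lesssim> G - Gs" using infinite_minus_finite_eqpoll[OF G(2) Gs(1)] by (simp add: eqpoll_sym eqpoll_imp_lepoll)
  finally have 1: "H - u ` Gs \<lesssim> G - Gs" .
  have "u ` (G - Gs) \<subseteq> H - u ` Gs" using H(1) inj_u Gs(2) by (auto dest: inj_onD)
  then have 2: "G - Gs \<lesssim> H - u ` Gs"
    unfolding lepoll_def by (intro exI[of _ u] conjI inj_on_subset[OF inj_u]) auto
  obtain \<beta> where \<beta>: "bij_betw \<beta> (H - u ` Gs) (G - Gs)"
    using lepoll_antisym[OF 1 2] by (auto simp: eqpoll_def)
  \<comment> \<open>The bijection between the bases takes the prescribed values on \<open>u ` Gs\<close>.\<close>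
  define c where "c h = (if h \<in> u ` Gs then inv_into G u h else \<beta> h)" for h
  have "bij_betw (inv_into G u) (u ` Gs) Gs"
    using bij_betw_inv_into_subset[of u G "u ` G" Gs "u ` Gs"] inj_u Gs(2) by (auto simp: bij_betw_def)
  then have c1: "bij_betw c (u ` Gs) Gs" by (rule bij_betw_cong[THEN iffD1, rotated]) (simp add: c_def)
  have c2: "bij_betw c (H - u ` Gs) (G - Gs)"
    using \<beta> by (rule bij_betw_cong[THEN iffD1, rotated]) (simp add: c_def)
  have "bij_betw c (u ` Gs \<union> (H - u ` Gs)) (Gs \<union> (G - Gs))"
    by (rule bij_betw_combine[OF c1 c2]) auto
  moreover have "u ` Gs \<union> (H - u ` Gs) = H" "Gs \<union> (G - Gs) = G" using H(1) Gs(2) by auto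
  ultimately have c: "bij_betw c H G" by simp
  define \<Lambda> where "\<Lambda> = VP.construct H c"
  have lin: "Vector_Spaces.linear fscal scale \<Lambda>"
    unfolding \<Lambda>_def by (rule VP.linear_construct[OF H(3)])
  have \<Lambda>H: "\<Lambda> h = c h" if "h \<in> H" for h
    unfolding \<Lambda>_def by (rule VP.construct_basis[OF H(3) that])
  then have im: "\<Lambda> ` H = G" using c by (simp add: bij_betw_def)
  have "inj_on \<Lambda> H" using c inj_on_cong[of H \<Lambda> c] \<Lambda>H by (simp add: bij_betw_def)
  then have "inj_on \<Lambda> (F.span H)"
    using VP.linear_inj_on_span_independent_image[OF lin, of H] im G(1) by simp
  moreover have "\<Lambda> ` Q = span G" using VP.linear_span_image[OF lin, of H] im spanH by simp
  moreover have "\<Lambda> (Poly_Mapping.single j (r j mod mm j)) = j" if j: "j \<in> Gs" for j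
  proof -
    have "u j \<in> H" using H(1) Gs(2) j by auto
    then have "\<Lambda> (u j) = j" using \<Lambda>H[of "u j"] inv_into_f_f[OF inj_u, of j] j Gs(2) by (auto simp: c_def)
    then show ?thesis using j by (simp add: u_def)
  qed
  ultimately show ?thesis using lin spanH by (intro exI[of _ \<Lambda>]) simp
qed

end

section \<open>Extending a module by generators and relations\<close>

lemma poly_mult_div_step:
  fixes p q m :: "'a::field poly"
  shows "(p * q) div m = p * (q div m) + (p * (q mod m)) div m"
proof (cases "m = 0")
  case False
  have "p * q = p * (q mod m) + m * (p * (q div m))"
    by (metis add.commute distrib_left mult.left_commute mult_div_mod_eq)
  then show ?thesis using False by simp
qed simp

context kspace
begin

text \<open>
  If a family \<open>q\<close> is to stand for \<open>\<Sum>j. q j * z j\<close>, where the generators satisfy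
  \<open>mm j * z j = ww j\<close>, then division with remainder splits this sum into
  \<open>\<Sum>j. (q j mod mm j) * z j\<close> and the element \<open>tau mm ww S q\<close> of the module of the
  \<open>ww j\<close>.
\<close>

definition tau :: "('b \<Rightarrow> 'a poly) \<Rightarrow> ('b \<Rightarrow> 'b) \<Rightarrow> ('b \<Rightarrow> 'b) \<Rightarrow> ('b \<Rightarrow>\<^sub>0 'a poly) \<Rightarrow> 'b" where
  "tau mm ww S q = (\<Sum>j\<in>Poly_Mapping.keys q. pact (Poly_Mapping.lookup q j div mm j) S (ww j))"

lemma tau_superset:
  assumes "finite A" "Poly_Mapping.keys q \<subseteq> A"
  shows "tau mm ww S q = (\<Sum>j\<in>A. pact (Poly_Mapping.lookup q j div mm j) S (ww j))"
  unfolding tau_def by (rule sum.mono_neutral_left) (use assms in \<open>auto simp: in_keys_iff\<close>)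

lemma tau_add: "tau mm ww S (q + q') = tau mm ww S q + tau mm ww S q'"
proof -
  let ?A = "Poly_Mapping.keys q \<union> Poly_Mapping.keys q'"
  show ?thesis
    using Poly_Mapping.keys_add[of q q']
    by (simp add: tau_superset[of ?A] lookup_add poly_div_add_left pact_add sum.distrib)
qed

lemma tau_in:
  assumes "endo_on Y S" "\<And>j. j \<in> G \<Longrightarrow> ww j \<in> Y" "Poly_Mapping.keys q \<subseteq> G"
  shows "tau mm ww S q \<in> Y"
  unfolding tau_def by (rule subspace_sum[OF endo_onD(1)[OF assms(1)]]) (use assms in \<open>auto intro!: pact_in\<close>)

lemma tau_single: "tau mm ww S (Poly_Mapping.single j p) = pact (p div mm j) S (ww j)"
  by (cases "p = 0") (simp_all add: tau_def)

lemma pact_sum: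
  assumes S: "endo_on Y S" and f: "\<And>j. j \<in> A \<Longrightarrow> f j \<in> Y"
  shows "pact p S (\<Sum>j\<in>A. f j) = (\<Sum>j\<in>A. pact p S (f j))"
  using f
proof (induction A rule: infinite_finite_induct)
  case (insert a A)
  have "(\<Sum>j\<in>A. f j) \<in> Y" by (rule subspace_sum[OF endo_onD(1)[OF S]]) (use insert.prems in auto)
  then show ?case using insert pact_plus[OF S] by simp
qed (use S in auto)

lemma tau_fmul:
  assumes S: "endo_on Y S" and ww: "\<And>j. j \<in> G \<Longrightarrow> ww j \<in> Y" and q: "Poly_Mapping.keys q \<subseteq> G"
  shows "tau mm ww S (fmul p q) = pact p S (tau mm ww S q) + tau mm ww S (fmul p (fred mm q))"
proof -
  let ?A = "Poly_Mapping.keys q"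
  have sub: "Poly_Mapping.keys (fmul p q) \<subseteq> ?A" "Poly_Mapping.keys (fmul p (fred mm q)) \<subseteq> ?A"
    using keys_fmul[of p q] order_trans[OF keys_fmul[of p "fred mm q"] keys_fred] by auto
  have "pact p S (tau mm ww S q) = (\<Sum>j\<in>?A. pact p S (pact (Poly_Mapping.lookup q j div mm j) S (ww j)))"
    unfolding tau_def by (rule pact_sum[OF S], rule pact_in[OF S ww]) (use q in auto)
  also have "\<dots> = (\<Sum>j\<in>?A. pact (p * (Poly_Mapping.lookup q j div mm j)) S (ww j))"
    by (rule sum.cong) (use q ww in \<open>auto simp: pact_mult[OF S]\<close>)
  finally show ?thesis
    unfolding tau_superset[OF finite_keys sub(1)] tau_superset[OF finite_keys sub(2)]
    by (simp add: sum.distrib[symmetric] pact_add[symmetric] poly_mult_div_step[symmetric])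
qed

text \<open>
  The module generated by \<open>Y0\<close> and new elements \<open>z j\<close> subject to \<open>mm j * z j = ww j\<close>,
  realised on a given space \<open>Y\<close>, the direct sum of \<open>Y0\<close> and \<open>span G\<close>. The element
  \<open>y + (\<Sum>j. q j * z j)\<close> is \<open>\<Phi> y q\<close>. All that is needed to compute in this
  module is the action of \<open>K[X]\<close> on these elements and the description of the pairs
  \<open>(y, q)\<close> which represent \<open>0\<close>. The last property says that a multiple \<open>r j * z j\<close> of
  a generator may be made equal to the given basis vector \<open>j\<close> modulo \<open>Y0\<close>, for finitely
  many \<open>j\<close>.
\<close>

theorem module_extension:
  fixes G :: "'b set" and mm r :: "'b \<Rightarrow> 'a poly"
  assumes S: "endo_on Y0 S"
    and G: "independent G" "infinite G" "span G \<inter> Y0 \<subseteq> {0}"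
    and mm: "\<And>j. j \<in> G \<Longrightarrow> \<not> mm j dvd 1"
    and ww: "\<And>j. j \<in> G \<Longrightarrow> ww j \<in> Y0"
    and Gs: "finite Gs" "Gs \<subseteq> G" and r: "\<And>j. j \<in> Gs \<Longrightarrow> \<not> mm j dvd r j"
  defines "Y \<equiv> {y + g |y g. y \<in> Y0 \<and> g \<in> span G}"
  obtains T \<Phi> where "endo_on Y T" "\<And>y. y \<in> Y0 \<Longrightarrow> T y = S y" "\<And>y. y \<in> Y0 \<Longrightarrow> \<Phi> y 0 = y"
    "\<And>x. x \<in> Y \<Longrightarrow> \<exists>y\<in>Y0. \<exists>q. Poly_Mapping.keys q \<subseteq> G \<and> fred mm q = q \<and> x = \<Phi> y q"
    "\<And>y q. y \<in> Y0 \<Longrightarrow> Poly_Mapping.keys q \<subseteq> G \<Longrightarrow> \<Phi> y q \<in> Y"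
    "\<And>y q p. y \<in> Y0 \<Longrightarrow> Poly_Mapping.keys q \<subseteq> G \<Longrightarrow> pact p T (\<Phi> y q) = \<Phi> (pact p S y) (fmul p q)"
    "\<And>y q. y \<in> Y0 \<Longrightarrow> Poly_Mapping.keys q \<subseteq> G \<Longrightarrow>
      \<Phi> y q = 0 \<longleftrightarrow> (\<forall>j\<in>G. mm j dvd Poly_Mapping.lookup q j) \<and> y + tau mm ww S q = 0"
    "\<And>y y' q q'. \<Phi> (y + y') (q + q') = \<Phi> y q + \<Phi> y' q'"
    "\<And>j. j \<in> Gs \<Longrightarrow> \<Phi> 0 (Poly_Mapping.single j (r j)) = pact (r j div mm j) S (ww j) + j"
proof -
  define Q where "Q = {q :: 'b \<Rightarrow>\<^sub>0 'a poly. Poly_Mapping.keys q \<subseteq> G \<and> fred mm q = q}"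
  obtain \<Lambda> where lin: "Vector_Spaces.linear fscal scale \<Lambda>" and inj: "inj_on \<Lambda> Q" and im: "\<Lambda> ` Q = span G"
    and sp: "\<And>j. j \<in> Gs \<Longrightarrow> \<Lambda> (Poly_Mapping.single j (r j mod mm j)) = j"
    using ex_reduced_family_iso[of G mm Gs r, OF G(1,2) mm Gs r] unfolding Q_def by auto
  interpret \<Lambda>: Vector_Spaces.linear fscal scale \<Lambda> by (rule lin)
  let ?\<tau> = "tau mm ww S"
  let ?red = "fred mm"
  have redQ: "?red q \<in> Q" if "Poly_Mapping.keys q \<subseteq> G" for q
    using that keys_fred[of mm q] by (auto simp: Q_def intro!: poly_mapping_eqI)
  have subY0: "subspace Y0" by (rule endo_onD(1)[OF S])
  have subY: "subspace Y" unfolding Y_def by (rule subspace_sums[OF subY0 subspace_span])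
  have \<tau>in: "?\<tau> q \<in> Y0" if "Poly_Mapping.keys q \<subseteq> G" for q
    using tau_in[OF S ww that] by auto
  define \<Phi> where "\<Phi> y q = y + ?\<tau> q + \<Lambda> (?red q)" for y q
  have \<Phi>add: "\<Phi> (y + y') (q + q') = \<Phi> y q + \<Phi> y' q'" for y y' q q'
    by (simp add: \<Phi>_def tau_add fred_add \<Lambda>.add)
  have \<Phi>Y: "\<Phi> y q \<in> Y" if "y \<in> Y0" "Poly_Mapping.keys q \<subseteq> G" for y q
    unfolding Y_def \<Phi>_def 
    using subspace_add[OF subY0 that(1) \<tau>in[OF that(2)]] imageI[OF redQ[OF that(2)], of \<Lambda>] im by auto
  have uniq: "y = y' \<and> q = q'" if "y \<in> Y0" "y' \<in> Y0" "q \<in> Q" "q' \<in> Q" "y + \<Lambda> q = y' + \<Lambda> q'" for y y' q q'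
  proof -
    have e: "\<Lambda> q - \<Lambda> q' = y' - y" using that(5) by (simp add: algebra_simps)
    have "\<Lambda> q - \<Lambda> q' \<in> span G" 
      by (rule span_diff) (use that(3,4) im in auto)
    moreover have "y' - y \<in> Y0" by (rule subspace_diff[OF subY0 that(2,1)])
    ultimately have "y' - y = 0" using e G(3) by auto
    then show ?thesis using e inj_onD[OF inj _ that(3,4)] by auto
  qed
  have red_rep: "\<Phi> y q = \<Phi> (y + ?\<tau> q) (?red q)" if "Poly_Mapping.keys q \<subseteq> G" for y q
  proof -
    have "?\<tau> (?red q) = 0" unfolding tau_def
    proof (rule sum.neutral, rule ballI)
      fix j assume "j \<in> Poly_Mapping.keys (?red q)"
      have "(Poly_Mapping.lookup q j mod mm j) div mm j = 0" by (cases "mm j = 0") simp_all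
      then show "pact (Poly_Mapping.lookup (?red q) j div mm j) S (ww j) = 0" by simp
    qed
    moreover have "?red (?red q) = ?red q" using redQ[OF that] by (simp add: Q_def)
    ultimately show ?thesis by (simp add: \<Phi>_def)
  qed
  have \<Phi>red: "\<Phi> y q = y + \<Lambda> q" if "q \<in> Q" for y q
  proof -
    have "?\<tau> q = ?\<tau> (?red q)" "?red q = q" using that by (simp_all add: Q_def)
    moreover have "?\<tau> (?red q) = 0" unfolding tau_def
    proof (rule sum.neutral, rule ballI)
      fix j
      have "(Poly_Mapping.lookup q j mod mm j) div mm j = 0" by (cases "mm j = 0") simp_all
      then show "pact (Poly_Mapping.lookup (?red q) j div mm j) S (ww j) = 0" by simp
    qed
    ultimately show ?thesis by (simp add: \<Phi>_def)
  qed
  have surj: "\<exists>y\<in>Y0. \<exists>q\<in>Q. x = \<Phi> y q" if xY: "x \<in> Y" for x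
  proof -
    obtain y g where "y \<in> Y0" "g \<in> span G" "x = y + g" using xY unfolding Y_def by blast
    moreover from this obtain q where q: "q \<in> Q" "g = \<Lambda> q" using im by blast
    ultimately have "y \<in> Y0" "x = \<Phi> y q" using \<Phi>red[OF q(1), of y] by simp_all
    then show ?thesis using q(1) by blast
  qed
  have zero: "\<Phi> y q = 0 \<longleftrightarrow> (\<forall>j\<in>G. mm j dvd Poly_Mapping.lookup q j) \<and> y + ?\<tau> q = 0"
    if y: "y \<in> Y0" and q: "Poly_Mapping.keys q \<subseteq> G" for y q
  proof -
    have "(\<forall>j\<in>G. mm j dvd Poly_Mapping.lookup q j) \<longleftrightarrow> ?red q = 0"
    proof
      assume a: "\<forall>j\<in>G. mm j dvd Poly_Mapping.lookup q j"
      show "?red q = 0"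
      proof (rule poly_mapping_eqI)
        fix j show "Poly_Mapping.lookup (?red q) j = Poly_Mapping.lookup 0 j"
        proof (cases "j \<in> G")
          case False
          then have "Poly_Mapping.lookup q j = 0" using q by (auto simp: in_keys_iff)
          then show ?thesis by simp
        qed (use a in simp)
      qed
    next
      assume "?red q = 0"
      then have "Poly_Mapping.lookup (?red q) j = 0" for j by simp
      then show "\<forall>j\<in>G. mm j dvd Poly_Mapping.lookup q j" by (simp add: dvd_eq_mod_eq_0)
    qed
    moreover have "\<Phi> y q = 0 \<longleftrightarrow> ?red q = 0 \<and> y + ?\<tau> q = 0"
    proof
      assume "\<Phi> y q = 0"
      then have "(y + ?\<tau> q) + \<Lambda> (?red q) = 0 + \<Lambda> 0" by (simp add: \<Phi>_def)
      moreover have "0 \<in> Q" by (auto simp: Q_def intro!: poly_mapping_eqI)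
      ultimately show "?red q = 0 \<and> y + ?\<tau> q = 0"
        using uniq[of "y + ?\<tau> q" 0 "?red q" 0] subspace_add[OF subY0 y \<tau>in[OF q]] subspace_0[OF subY0] redQ[OF q]
        by auto
    qed (simp add: \<Phi>_def)
    ultimately show ?thesis by blast
  qed
  define ix where "ix = [:0, 1::'a:]"
  have pact_ix: "pact ix R x = R x" for R x by (simp add: ix_def pact_pCons)
  \<comment> \<open>Reduced families represent elements uniquely, and \<open>T\<close> multiplies by \<open>X\<close>.\<close>
  define T where "T x = (let (y, q) = (SOME (y, q). y \<in> Y0 \<and> q \<in> Q \<and> x = \<Phi> y q) in \<Phi> (S y) (fmul ix q))" for x
  have T0: "T (\<Phi> y q) = \<Phi> (S y) (fmul ix q)" if y: "y \<in> Y0" and q: "q \<in> Q" for y q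
  proof -
    have "(SOME (y', q'). y' \<in> Y0 \<and> q' \<in> Q \<and> \<Phi> y q = \<Phi> y' q') = (y, q)"
    proof (rule some_equality)
      fix z assume z: "case z of (y', q') \<Rightarrow> y' \<in> Y0 \<and> q' \<in> Q \<and> \<Phi> y q = \<Phi> y' q'"
      obtain y' q' where "z = (y', q')" by force
      then show "z = (y, q)" using z uniq[OF y _ q, of y' q'] \<Phi>red q by auto
    qed (use y q in auto)
    then show ?thesis by (simp add: T_def)
  qed
  have T\<Phi>: "T (\<Phi> y q) = \<Phi> (S y) (fmul ix q)" if y: "y \<in> Y0" and q: "Poly_Mapping.keys q \<subseteq> G" for y q
  proof -
    have "T (\<Phi> y q) = \<Phi> (S (y + ?\<tau> q)) (fmul ix (?red q))"
      unfolding red_rep[OF q] by (rule T0) (use subspace_add[OF subY0 y \<tau>in[OF q]] redQ[OF q] in auto)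
    also have "\<dots> = S y + (pact ix S (?\<tau> q) + ?\<tau> (fmul ix (?red q))) + \<Lambda> (?red (fmul ix (?red q)))"
      using endo_onD(3)[OF S y \<tau>in[OF q]] by (simp add: \<Phi>_def pact_ix add.assoc)
    also have "\<dots> = \<Phi> (S y) (fmul ix q)"
      using tau_fmul[OF S ww q, where mm = mm and p = ix] by (simp add: \<Phi>_def fred_fmul_fred)
    finally show ?thesis .
  qed
  have act: "pact p T (\<Phi> y q) = \<Phi> (pact p S y) (fmul p q)" if "y \<in> Y0" "Poly_Mapping.keys q \<subseteq> G" for y q p
    using that
  proof (induction p arbitrary: y q)
    case 0
    have "fmul 0 q = 0" by (rule poly_mapping_eqI) simp
    moreover have "?red 0 = 0" by (rule poly_mapping_eqI) simp
    ultimately show ?case by (simp add: \<Phi>_def tau_def)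
  next
    case (pCons a p)
    have k: "Poly_Mapping.keys (fmul ix q) \<subseteq> G" by (rule order_trans[OF keys_fmul pCons.prems(2)])
    have sc: "a *s \<Phi> y q = \<Phi> (a *s y) (fscal a q)"
    proof -
      have "?\<tau> (fscal a q) = a *s ?\<tau> q"
        using tau_superset[OF finite_keys keys_fscal[of a q], of mm ww S]
        by (simp add: tau_def scale_sum_right div_smult_left pact_smult)
      then show ?thesis by (simp add: \<Phi>_def scale_right_distrib fred_fscal \<Lambda>.scale)
    qed
    have "pact (pCons a p) T (\<Phi> y q) = a *s \<Phi> y q + pact p T (\<Phi> (S y) (fmul ix q))"
      by (simp add: pact_pCons T\<Phi>[OF pCons.prems])
    also have "\<dots> = \<Phi> (a *s y) (fscal a q) + \<Phi> (pact p S (S y)) (fmul p (fmul ix q))"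
      using pCons.IH[OF endo_onD(2)[OF S pCons.prems(1)] k] sc by simp
    also have "\<dots> = \<Phi> (pact (pCons a p) S y) (fscal a q + fmul p (fmul ix q))"
      by (simp add: \<Phi>add[symmetric] pact_pCons)
    also have "fscal a q + fmul p (fmul ix q) = fmul (pCons a p) q"
      by (rule poly_mapping_eqI) (simp add: lookup_add ix_def)
    finally show ?case .
  qed
  have \<Phi>0: "\<Phi> y 0 = y" for y
  proof -
    have "?red 0 = 0" by (rule poly_mapping_eqI) simp
    then show ?thesis using \<Phi>red[of 0 y] by (simp add: Q_def)
  qed
  have TS: "T y = S y" if "y \<in> Y0" for y
  proof -
    have "fmul ix 0 = (0 :: 'b \<Rightarrow>\<^sub>0 'a poly)" by (rule poly_mapping_eqI) simp
    then show ?thesis using T\<Phi>[OF that, of 0] by (simp add: \<Phi>0)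
  qed
  have kQ: "Poly_Mapping.keys q \<subseteq> G" if "q \<in> Q" for q using that by (simp add: Q_def)
  have "endo_on Y T"
    unfolding endo_on_def
  proof (intro conjI ballI allI)
    fix x assume x: "x \<in> Y"
    obtain y q where yq: "y \<in> Y0" "q \<in> Q" "x = \<Phi> y q" using surj[OF x] by auto
    have kx: "Poly_Mapping.keys (fmul ix q) \<subseteq> G" by (rule order_trans[OF keys_fmul kQ[OF yq(2)]])
    show "T x \<in> Y" unfolding yq(3) T\<Phi>[OF yq(1) kQ[OF yq(2)]] by (rule \<Phi>Y[OF endo_onD(2)[OF S yq(1)] kx])
    fix c
    have "c *s x = pact [:c:] T x" by (simp add: pact_pCons)
    also have "\<dots> = \<Phi> (c *s y) (fmul [:c:] q)"
      unfolding yq(3) act[OF yq(1) kQ[OF yq(2)]] by (simp add: pact_pCons)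
    finally have "T (c *s x) = T (\<Phi> (c *s y) (fmul [:c:] q))" by simp
    also have "\<dots> = \<Phi> (S (c *s y)) (fmul ix (fmul [:c:] q))"
    proof (rule T\<Phi>)
      show "c *s y \<in> Y0" by (rule subspace_scale[OF subY0 yq(1)])
      show "Poly_Mapping.keys (fmul [:c:] q) \<subseteq> G" by (rule order_trans[OF keys_fmul kQ[OF yq(2)]])
    qed
    also have "\<dots> = \<Phi> (pact [:c:] S (S y)) (fmul [:c:] (fmul ix q))"
    proof -
      have "fmul ix (fmul [:c:] q) = fmul [:c:] (fmul ix q)" by (rule poly_mapping_eqI) (simp add: mult.left_commute)
      then show ?thesis using endo_onD(4)[OF S yq(1)] by (simp add: pact_pCons)
    qed
    also have "\<dots> = c *s T x"
      using act[OF endo_onD(2)[OF S yq(1)] kx, of "[:c:]"] T\<Phi>[OF yq(1) kQ[OF yq(2)]] yq(3) by (simp add: pact_pCons)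
    finally show "T (c *s x) = c *s T x" .
  next
    fix x x' assume x: "x \<in> Y" "x' \<in> Y"
    obtain y q where yq: "y \<in> Y0" "q \<in> Q" "x = \<Phi> y q" using surj[OF x(1)] by auto
    obtain y' q' where yq': "y' \<in> Y0" "q' \<in> Q" "x' = \<Phi> y' q'" using surj[OF x(2)] by auto
    have "Poly_Mapping.keys (q + q') \<subseteq> G" using kQ[OF yq(2)] kQ[OF yq'(2)] Poly_Mapping.keys_add[of q q'] by auto
    then have "T (x + x') = \<Phi> (S (y + y')) (fmul ix (q + q'))"
      unfolding yq(3) yq'(3) \<Phi>add[symmetric] by (rule T\<Phi>[OF subspace_add[OF subY0 yq(1) yq'(1)]])
    then show "T (x + x') = T x + T x'"
      using endo_onD(3)[OF S yq(1) yq'(1)] T\<Phi>[OF yq(1) kQ[OF yq(2)]] T\<Phi>[OF yq'(1) kQ[OF yq'(2)]] yq(3) yq'(3)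
      by (simp add: fmul_add \<Phi>add)
  qed (fact subY)
  moreover have "\<Phi> 0 (Poly_Mapping.single j (r j)) = pact (r j div mm j) S (ww j) + j" if "j \<in> Gs" for j
  proof -
    have "?red (Poly_Mapping.single j (r j)) = Poly_Mapping.single j (r j mod mm j)"
      by (rule poly_mapping_eqI) (auto simp: lookup_single when_def)
    then show ?thesis using sp[OF that] by (simp add: \<Phi>_def tau_single)
  qed
  moreover have "\<exists>y\<in>Y0. \<exists>q. Poly_Mapping.keys q \<subseteq> G \<and> ?red q = q \<and> x = \<Phi> y q" if "x \<in> Y" for x
    using surj[OF that] by (auto simp: Q_def)
  ultimately show thesis using that[of T \<Phi>] TS \<Phi>0 \<Phi>Y act zero \<Phi>add by blast
qed

end

section \<open>Irreducible polynomials\<close>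

lemma poly_bezout_gcd:
  fixes p q :: "'k::field poly"
  shows "\<exists>d a b. d dvd p \<and> d dvd q \<and> d = a * p + b * q"
proof (induction "if p = 0 then 0 else Suc (Polynomial.degree p)" arbitrary: p q rule: less_induct)
  case less
  show ?case
  proof (cases "p = 0")
    case True
    then show ?thesis by (intro exI[of _ q] exI[of _ 0] exI[of _ 1]) simp
  next
    case False
    have "(if q mod p = 0 then 0 else Suc (Polynomial.degree (q mod p))) < Suc (Polynomial.degree p)"
      using degree_mod_less[OF False, of q] by auto
    then obtain d a b where d: "d dvd q mod p" "d dvd p" "d = a * (q mod p) + b * p"
      using less.hyps[of "q mod p" p] False by auto
    have "d dvd q" using d(1,2) by (simp add: dvd_mod_iff)
    moreover have "d = (b - a * (q div p)) * p + a * q"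
      using d(3) by (simp add: minus_div_mult_eq_mod[symmetric] algebra_simps)
    ultimately show ?thesis using d(2) by blast
  qed
qed

lemma monic_irr_bezout:
  fixes f :: "'k::field poly"
  assumes f: "f \<in> monic_irr" and q: "\<not> f dvd q"
  shows "\<exists>a b. a * q + b * f = 1"
proof -
  obtain d a b where d: "d dvd f" "d dvd q" "d = a * f + b * q" using poly_bezout_gcd[of f q] by auto
  obtain e where e: "f = d * e" using d(1) by auto
  have irr: "Factorial_Ring.irreducible f" using f by (simp add: monic_irr_def)
  have "\<not> e dvd 1"
  proof
    assume "e dvd 1"
    then obtain e' where "1 = e * e'" by auto
    then have "d = f * e'" using e by (metis mult.assoc mult_1_right)
    then show False using d(2) q by auto
  qed
  then have "d dvd 1" using irr e by (auto simp: irreducible_def)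
  then obtain d' where "1 = d * d'" by auto
  then have "1 = (d' * b) * q + (d' * a) * f" using d(3) by (simp add: algebra_simps)
  then show ?thesis by metis
qed

lemma monic_irr_bezout_power:
  fixes f :: "'k::field poly"
  assumes f: "f \<in> monic_irr" and q: "\<not> f dvd q"
  shows "\<exists>a b. a * q + b * f ^ n = 1"
proof (induction n)
  case 0
  show ?case by (intro exI[of _ 0] exI[of _ 1]) simp
next
  case (Suc n)
  obtain a b where ab: "a * q + b * f ^ n = 1" using Suc by auto
  obtain c d where cd: "c * q + d * f = 1" using monic_irr_bezout[OF f q] by auto
  have "(a * q + b * f ^ n) * (c * q + d * f) = 1" using ab cd by simp
  then have "(a * (c * q + d * f) + b * f ^ n * c) * q + (b * d) * f ^ Suc n = 1" by (simp add: algebra_simps)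
  then show ?case by blast
qed

lemma monic_irr_prime:
  fixes f :: "'k::field poly"
  assumes f: "f \<in> monic_irr" and "f dvd p * q"
  shows "f dvd p \<or> f dvd q"
proof (rule disjCI)
  assume "\<not> f dvd q"
  then obtain a b where "a * q + b * f = 1" using monic_irr_bezout[OF f] by blast
  then have "p = p * (a * q + b * f)" by simp
  then have "p = a * (p * q) + (b * p) * f" by (simp add: algebra_simps)
  then show "f dvd p" using assms(2) by (metis dvd_add dvd_mult dvd_triv_right)
qed

lemma monic_irr_not_unit: "f \<in> monic_irr \<Longrightarrow> \<not> (f :: 'k::field poly) dvd 1"
  by (auto simp: monic_irr_def irreducible_def)

lemma monic_irr_nz: "f \<in> monic_irr \<Longrightarrow> (f :: 'k::field poly) \<noteq> 0"
  by (auto simp: monic_irr_def)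

lemma monic_irr_dvd_eq:
  fixes f g :: "'k::field poly"
  assumes f: "f \<in> monic_irr" and g: "g \<in> monic_irr" and d: "f dvd g"
  shows "f = g"
proof -
  obtain e where e: "g = f * e" using d by auto
  have "e dvd 1" using g e monic_irr_not_unit[OF f] by (auto simp: monic_irr_def irreducible_def)
  then have "Polynomial.degree e = 0" using is_unit_iff_degree[of e] by (metis dvd_0_left one_neq_zero)
  then obtain a where a: "e = [:a:]" by (auto elim: degree_eq_zeroE)
  have "Polynomial.lead_coeff g = Polynomial.lead_coeff f * Polynomial.lead_coeff e"
    unfolding e by (rule lead_coeff_mult)
  then have "a = 1" using f g a by (simp add: monic_irr_def)
  then show ?thesis using e a by (simp add: one_pCons[symmetric])
qed

lemma monic_irr_dvd_power: "f \<in> monic_irr \<Longrightarrow> (f :: 'k::field poly) dvd p ^ n \<Longrightarrow> f dvd p"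
proof (induction n)
  case 0
  then show ?case using monic_irr_not_unit by auto
next
  case (Suc n)
  then show ?case using monic_irr_prime[of f p "p ^ n"] by auto
qed

lemma ex_monic_irr_factor:
  fixes p :: "'k::field poly"
  assumes "p \<noteq> 0" "\<not> p dvd 1"
  shows "\<exists>f\<in>monic_irr. f dvd p"
  using assms
proof (induction "Polynomial.degree p" arbitrary: p rule: less_induct)
  case less
  show ?case
  proof (cases "Factorial_Ring.irreducible p")
    case True
    define c where "c = inverse (Polynomial.lead_coeff p)"
    have c: "c \<noteq> 0" using less.prems by (simp add: c_def)
    have "Factorial_Ring.irreducible (Polynomial.smult c p)"
      unfolding irreducible_def
    proof (intro conjI allI impI)
      show "Polynomial.smult c p \<noteq> 0" using c less.prems by simp
      show "\<not> Polynomial.smult c p dvd 1" using c less.prems by (simp add: smult_dvd_iff)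
      fix a b assume "Polynomial.smult c p = a * b"
      then have "p = Polynomial.smult (inverse c) a * b" using c by (metis mult_smult_left smult_smult left_inverse smult_1_left)
      then have "Polynomial.smult (inverse c) a dvd 1 \<or> b dvd 1" using True by (auto simp: irreducible_def)
      then show "a dvd 1 \<or> b dvd 1" using c by (simp add: smult_dvd_iff)
    qed
    moreover have "Polynomial.lead_coeff (Polynomial.smult c p) = 1" using less.prems by (simp add: c_def)
    moreover have "Polynomial.smult c p dvd p" using c by (simp add: smult_dvd_iff)
    ultimately show ?thesis by (auto simp: monic_irr_def)
  next
    case False
    then obtain a b where ab: "p = a * b" "\<not> a dvd 1" "\<not> b dvd 1" using less.prems by (auto simp: irreducible_def)
    have nz: "a \<noteq> 0" "b \<noteq> 0" using ab(1) less.prems(1) by auto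
    have "Polynomial.degree b \<noteq> 0" using ab(3) nz(2) is_unit_iff_degree[of b] by auto
    then have "Polynomial.degree a < Polynomial.degree p" using nz by (simp add: ab(1) degree_mult_eq)
    then obtain f where "f \<in> monic_irr" "f dvd a" using less.hyps[of a] nz ab(2) by auto
    then show ?thesis unfolding ab(1) by (intro bexI[of _ f] dvd_mult2)
  qed
qed

lemma monic_irr_split:
  fixes f p :: "'k::field poly"
  assumes f: "f \<in> monic_irr" and p: "p \<noteq> 0"
  shows "\<exists>n q. p = f ^ n * q \<and> \<not> f dvd q"
  using p
proof (induction "Polynomial.degree p" arbitrary: p rule: less_induct)
  case less
  show ?case
  proof (cases "f dvd p")
    case False
    then show ?thesis by (intro exI[of _ 0] exI[of _ p]) simp
  next
    case True
    then obtain p' where p': "p = f * p'" by auto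
    then have nz: "p' \<noteq> 0" using less.prems by auto
    have "Polynomial.degree f \<noteq> 0" using monic_irr_not_unit[OF f] monic_irr_nz[OF f] is_unit_iff_degree[of f] by auto
    then have "Polynomial.degree p' < Polynomial.degree p" using nz monic_irr_nz[OF f] by (simp add: p' degree_mult_eq)
    then obtain n q where "p' = f ^ n * q" "\<not> f dvd q" using less.hyps[of p'] nz by auto
    then show ?thesis using p' by (intro exI[of _ "Suc n"] exI[of _ q]) (simp add: mult.assoc)
  qed
qed

section \<open>Kernel configurations\<close>

text \<open>
  The polynomial \<open>mo\<close> stands for \<open>MiPo(C)\<close> in the algebraic case and for \<open>0\<close> in the
  transcendental case. In both cases \<open>C\<close>-endomorphisms are those killed by \<open>mo\<close> and
  satisfying the kernel conditions, which follow from the former if \<open>mo \<noteq> 0\<close>. What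
  matters about \<open>mo\<close> is that it is \<open>0\<close> or contains each irreducible \<open>f\<close> exactly
  \<open>c f\<close> times.
\<close>

definition config_mod :: "('k::field poly \<Rightarrow> enat) \<Rightarrow> 'k poly \<Rightarrow> bool" where
  "config_mod c mo \<longleftrightarrow> \<not> mo dvd 1 \<and>
     (\<forall>f\<in>monic_irr. c f = \<infinity> \<longrightarrow> mo = 0) \<and>
     (\<forall>f\<in>monic_irr. \<forall>k. c f = enat k \<longrightarrow> mo = 0 \<or> (\<exists>m. mo = f ^ k * m \<and> \<not> f dvd m))"

lemma config_mod_split:
  "config_mod c mo \<Longrightarrow> mo \<noteq> 0 \<Longrightarrow> f \<in> monic_irr \<Longrightarrow> c f = enat k \<Longrightarrow> \<exists>m. mo = f ^ k * m \<and> \<not> f dvd m"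
  unfolding config_mod_def by blast

lemma config_mod_dvd:
  "config_mod c mo \<Longrightarrow> f \<in> monic_irr \<Longrightarrow> c f = enat k \<Longrightarrow> f ^ k dvd mo"
  unfolding config_mod_def by (metis dvd_0_right dvd_triv_left)

text \<open>
  The kernel condition for \<open>f\<close> in the module \<open>K[X]/(mo)\<close>.
\<close>

lemma config_mod_tame:
  assumes cm: "config_mod c mo" and f: "f \<in> monic_irr" and k: "c f = enat k" and d: "mo dvd f ^ Suc k * q"
  shows "mo dvd f ^ k * q"
proof (cases "mo = 0")
  case True
  then have "f ^ Suc k * q = 0" using d by simp
  then show ?thesis using monic_irr_nz[OF f] by simp
next
  case False
  then obtain m where m: "mo = f ^ k * m" "\<not> f dvd m" using config_mod_split[OF cm False f k] by blast
  obtain t where "f ^ Suc k * q = f ^ k * m * t" using d m(1) by auto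
  then have "f ^ k * (f * q) = f ^ k * (m * t)" by (simp add: mult_ac)
  then have t: "f * q = m * t" using monic_irr_nz[OF f] by simp
  then have "f dvd m * t" by (metis dvd_triv_left)
  then have "f dvd t" using monic_irr_prime[OF f] m(2) by blast
  then obtain t' where "t = f * t'" by auto
  then have "f * q = f * (m * t')" using t by (simp add: mult_ac)
  then have "q = m * t'" using monic_irr_nz[OF f] by simp
  then show ?thesis using m(1) by (simp add: mult.assoc)
qed

definition config_poly :: "'k::field kernel_config \<Rightarrow> 'k poly" where
  "config_poly C = (if snd C = \<infinity> then 0 else MiPo C)"

lemma config_mod_config_poly:
  assumes C: "kernel_config C"
  shows "config_mod (fst C) (config_poly C)"
proof (cases "snd C = \<infinity>")
  case True
  then show ?thesis by (simp add: config_mod_def config_poly_def)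
next
  case False
  let ?S = "kc_support C"
  have fin: "finite ?S" and sum: "snd C = (\<Sum>f\<in>?S. enat (Polynomial.degree f) * fst C f)" and nz: "snd C \<noteq> 0"
    using C False unfolding kernel_config_def by blast+
  have mono: "f \<in> monic_irr" if "f \<in> ?S" for f using that by (simp add: kc_support_def)
  have deg: "Polynomial.degree f > 0" if "f \<in> monic_irr" for f :: "'a poly"
    using monic_irr_not_unit[OF that] monic_irr_nz[OF that] is_unit_iff_degree[of f] by auto
  have cfin: "fst C f \<noteq> \<infinity>" if f: "f \<in> monic_irr" for f
  proof
    assume inf: "fst C f = \<infinity>"
    then have fS: "f \<in> ?S" using f by (simp add: kc_support_def)
    have "enat (Polynomial.degree f) * fst C f = \<infinity>"
      using deg[OF f] by (simp add: inf enat_0_iff imult_infinity_right)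
    moreover have "enat (Polynomial.degree f) * fst C f \<le> snd C"
      unfolding sum by (rule member_le_sum[OF fS _ fin]) simp
    ultimately show False using False by simp
  qed
  have mo: "config_poly C = (\<Prod>f\<in>?S. f ^ the_enat (fst C f))" 
    using if_not_P[OF False, of 0 "MiPo C"] unfolding config_poly_def MiPo_def .
  have "?S \<noteq> {}" using sum nz by auto
  then obtain f0 where f0: "f0 \<in> ?S" by auto
  have split: "\<exists>m. config_poly C = f ^ k * m \<and> \<not> f dvd m" if f: "f \<in> monic_irr" and k: "fst C f = enat k" for f k
  proof -
    have nd: "\<not> f dvd (\<Prod>g\<in>A. g ^ the_enat (fst C g))" if "finite A" "A \<subseteq> ?S - {f}" for A
      using that
    proof (induction A rule: finite_induct)
      case empty
      then show ?case using monic_irr_not_unit[OF f] by simp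
    next
      case (insert a A)
      have a: "a \<in> monic_irr" "a \<noteq> f" using insert.prems mono by auto
      show ?case
      proof
        assume "f dvd (\<Prod>g\<in>insert a A. g ^ the_enat (fst C g))"
        then have "f dvd a ^ the_enat (fst C a) * (\<Prod>g\<in>A. g ^ the_enat (fst C g))" using insert.hyps by simp
        then have "f dvd a ^ the_enat (fst C a)" using monic_irr_prime[OF f] insert by blast
        then have "f dvd a" by (rule monic_irr_dvd_power[OF f])
        then show False using monic_irr_dvd_eq[OF f a(1)] a(2) by simp
      qed
    qed
    show ?thesis
    proof (cases "f \<in> ?S")
      case True
      have "\<not> f dvd (\<Prod>g\<in>?S - {f}. g ^ the_enat (fst C g))" by (rule nd) (use fin in auto)
      moreover have "config_poly C = f ^ k * (\<Prod>g\<in>?S - {f}. g ^ the_enat (fst C g))"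
        by (simp add: mo prod.remove[OF fin True] k)
      ultimately show ?thesis by blast
    next
      case False
      then have "k = 0" using f k by (auto simp: kc_support_def zero_enat_def)
      then show ?thesis using nd[of ?S] False fin by (simp add: mo)
    qed
  qed
  have "\<not> config_poly C dvd 1"
  proof
    assume u: "config_poly C dvd 1"
    obtain k where k: "fst C f0 = enat k" using cfin[OF mono[OF f0]] by auto
    then have "k \<noteq> 0" using f0 by (auto simp: kc_support_def zero_enat_def)
    then have "f0 dvd f0 ^ k" by simp
    moreover have "f0 ^ k dvd config_poly C" using split[OF mono[OF f0] k] by auto
    ultimately have "f0 dvd 1" using u dvd_trans by blast
    then show False using monic_irr_not_unit[OF mono[OF f0]] by simp
  qed
  then show ?thesis using split cfin unfolding config_mod_def by blast
qed

context kspace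
begin

text \<open>
  For \<open>mo = config_poly C\<close> and \<open>c = fst C\<close>: \<open>T\<close> is a \<open>C\<close>-endomorphism of \<open>Y\<close>.
\<close>

definition C_op :: "'a poly \<Rightarrow> ('a poly \<Rightarrow> enat) \<Rightarrow> 'b set \<Rightarrow> ('b \<Rightarrow> 'b) \<Rightarrow> bool" where
  "C_op mo c Y T \<longleftrightarrow> endo_on Y T \<and> (\<forall>x\<in>Y. pact mo T x = 0) \<and>
     (\<forall>f\<in>monic_irr. \<forall>k. c f = enat k \<longrightarrow> (\<forall>x\<in>Y. pact (f ^ Suc k) T x = 0 \<longrightarrow> pact (f ^ k) T x = 0))"

text \<open>
  If \<open>mo = f ^ k * m\<close> with \<open>m\<close> prime to \<open>f\<close>, then \<open>f ^ k\<close> is a combination of \<open>mo\<close>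
  and \<open>f ^ (k + 1)\<close>.
\<close>

lemma C_op_algebraic:
  assumes cm: "config_mod c mo" and nz: "mo \<noteq> 0" and T: "endo_on Y T" and 0: "\<And>x. x \<in> Y \<Longrightarrow> pact mo T x = 0"
  shows "C_op mo c Y T"
  unfolding C_op_def
proof (intro conjI ballI allI impI T 0)
  fix f k x assume f: "f \<in> monic_irr" and k: "c f = enat k" and x: "x \<in> Y" and fx: "pact (f ^ Suc k) T x = 0"
  obtain m where m: "mo = f ^ k * m" "\<not> f dvd m" using config_mod_split[OF cm nz f k] by blast
  obtain a b where ab: "a * m + b * f = 1" using monic_irr_bezout[OF f m(2)] by auto
  have "f ^ k = f ^ k * (a * m + b * f)" by (simp only: ab mult_1_right)
  then have "f ^ k = a * mo + b * f ^ Suc k" by (simp add: m(1) algebra_simps)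
  then have "pact (f ^ k) T x = pact (a * mo) T x + pact (b * f ^ Suc k) T x" by (simp only: pact_add)
  also have "\<dots> = 0" using fx 0[OF x] T by (simp only: pact_mult[OF T x] pact_zero[OF T] add_0_right)
  finally show "pact (f ^ k) T x = 0" .
qed

section \<open>Two extensions of operators\<close>

text \<open>
  The new space \<open>span G\<close> becomes a direct sum of copies of \<open>K[X]/(mo)\<close> and, for the
  elements of \<open>G2\<close>, of \<open>K[X]/(f ^ k)\<close>. The basis vectors in \<open>G1\<close> are \<open>\<rho>\<close> times
  the generators of their summands, which is possible as \<open>\<rho>\<close> is not zero in
  \<open>K[X]/(mo)\<close>; the basis vectors in \<open>G2\<close> are the generators themselves. A linear
  combination of the latter therefore has annihilator \<open>f ^ k\<close>, even modulo \<open>Y0\<close>, unless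
  it is zero.
\<close>

theorem free_extension:
  fixes G :: "'b set"
  assumes cm: "config_mod c mo" and S: "C_op mo c Y0 S"
    and G: "independent G" "infinite G" "span G \<inter> Y0 \<subseteq> {0}"
    and f: "f \<in> monic_irr" "c f = enat k" "k > 0"
    and G1: "finite G1" "G1 \<subseteq> G" "\<not> mo dvd \<rho>" and G2: "finite G2" "G2 \<subseteq> G" "G1 \<inter> G2 = {}"
  defines "Y \<equiv> {y + g |y g. y \<in> Y0 \<and> g \<in> span G}"
  obtains T where "C_op mo c Y T" "\<And>y. y \<in> Y0 \<Longrightarrow> T y = S y"
    "\<And>b. b \<in> span G1 \<Longrightarrow> \<exists>z\<in>Y. pact \<rho> T z = b"
    "\<And>b. b \<in> span G2 \<Longrightarrow> pact (f ^ k) T b = 0"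
    "\<And>b p. b \<in> span G2 \<Longrightarrow> \<not> f ^ k dvd p \<Longrightarrow> pact p T b \<in> Y0 \<Longrightarrow> b = 0"
proof -
  have S': "endo_on Y0 S" using S by (simp add: C_op_def)
  have sub0: "subspace Y0" by (rule endo_onD(1)[OF S'])
  define mm where "mm j = (if j \<in> G2 then f ^ k else mo)" for j
  define r where "r j = (if j \<in> G2 then 1 else \<rho>)" for j
  have fk: "\<not> f ^ k dvd 1"
  proof
    assume "f ^ k dvd 1"
    then have "f dvd 1" using f(3) dvd_trans[of f "f ^ k" 1] by auto
    then show False using monic_irr_not_unit[OF f(1)] by simp
  qed
  have mm: "\<not> mm j dvd 1" for j using cm fk by (simp add: mm_def config_mod_def)
  have r: "\<not> mm j dvd r j" if "j \<in> G1 \<union> G2" for j using that fk G1(3) G2(3) by (auto simp: mm_def r_def)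
  have ww: "(0::'b) \<in> Y0" using subspace_0[OF sub0] .
  have fin: "finite (G1 \<union> G2)" "G1 \<union> G2 \<subseteq> G" using G1 G2 by auto
  obtain T \<Phi> where T: "endo_on Y T" and TS: "\<And>y. y \<in> Y0 \<Longrightarrow> T y = S y" and \<Phi>0: "\<And>y. y \<in> Y0 \<Longrightarrow> \<Phi> y 0 = y"
    and surj: "\<And>x. x \<in> Y \<Longrightarrow> \<exists>y\<in>Y0. \<exists>q. Poly_Mapping.keys q \<subseteq> G \<and> fred mm q = q \<and> x = \<Phi> y q"
    and \<Phi>Y: "\<And>y q. y \<in> Y0 \<Longrightarrow> Poly_Mapping.keys q \<subseteq> G \<Longrightarrow> \<Phi> y q \<in> Y"
    and act: "\<And>y q p. y \<in> Y0 \<Longrightarrow> Poly_Mapping.keys q \<subseteq> G \<Longrightarrow> pact p T (\<Phi> y q) = \<Phi> (pact p S y) (fmul p q)"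
    and zero: "\<And>y q. y \<in> Y0 \<Longrightarrow> Poly_Mapping.keys q \<subseteq> G \<Longrightarrow>
      \<Phi> y q = 0 \<longleftrightarrow> (\<forall>j\<in>G. mm j dvd Poly_Mapping.lookup q j) \<and> y + tau mm (\<lambda>_. 0) S q = 0"
    and add: "\<And>y y' q q'. \<Phi> (y + y') (q + q') = \<Phi> y q + \<Phi> y' q'"
    and sp: "\<And>j. j \<in> G1 \<union> G2 \<Longrightarrow> \<Phi> 0 (Poly_Mapping.single j (r j)) = pact (r j div mm j) S 0 + j"
    by (rule module_extension[OF S' G mm ww fin r, folded Y_def]) blast+
  have tau0: "tau mm (\<lambda>_. 0) S q = 0" for q by (simp add: tau_def pact_zero[OF S'])
  have subY: "subspace Y" by (rule endo_onD(1)[OF T])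
  have kf: "Poly_Mapping.keys (fmul p q) \<subseteq> G" if "Poly_Mapping.keys q \<subseteq> G" for p and q :: "'b \<Rightarrow>\<^sub>0 'a poly"
    by (rule order_trans[OF keys_fmul that])
  have zero': "pact p T (\<Phi> y q) = 0 \<longleftrightarrow> (\<forall>j\<in>G. mm j dvd p * Poly_Mapping.lookup q j) \<and> pact p S y = 0"
    if "y \<in> Y0" "Poly_Mapping.keys q \<subseteq> G" for p y q
    using act[OF that] zero[OF pact_in[OF S' that(1)] kf[OF that(2)]] by (simp add: tau0)
  \<comment> \<open>Both kinds of summands are \<open>C\<close>-modules: this and the next step.\<close>
  have mmo: "mm j dvd mo" for j using config_mod_dvd[OF cm f(1,2)] by (simp add: mm_def)
  have tame: "mm j dvd g ^ l * q" if g: "g \<in> monic_irr" "c g = enat l" and d: "mm j dvd g ^ Suc l * q" for g l q j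
  proof (cases "j \<in> G2")
    case False
    then show ?thesis using config_mod_tame[OF cm g, of q] d by (simp add: mm_def)
  next
    case True
    show ?thesis
    proof (cases "g = f")
      case True
      then show ?thesis using g(2) f(2) \<open>j \<in> G2\<close> by (simp add: mm_def)
    next
      case False
      have "\<not> f dvd g ^ Suc l"
        using monic_irr_dvd_power[OF f(1)] monic_irr_dvd_eq[OF f(1) g(1)] False by blast
      then obtain a b where ab: "a * g ^ Suc l + b * f ^ k = 1" using monic_irr_bezout_power[OF f(1)] by blast
      have "q = q * (a * g ^ Suc l + b * f ^ k)" by (simp only: ab mult_1_right)
      then have "q = a * (g ^ Suc l * q) + (b * q) * f ^ k" by (simp add: algebra_simps)
      moreover have "f ^ k dvd g ^ Suc l * q" using d True by (simp add: mm_def)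
      ultimately have "f ^ k dvd q" by (metis dvd_add dvd_mult dvd_triv_right)
      then show ?thesis using True by (simp add: mm_def)
    qed
  qed
  have C: "C_op mo c Y T"
    unfolding C_op_def
  proof (intro conjI ballI allI impI T)
    fix x assume "x \<in> Y"
    then obtain y q where yq: "y \<in> Y0" "Poly_Mapping.keys q \<subseteq> G" "x = \<Phi> y q" using surj by blast
    show "pact mo T x = 0" unfolding yq(3) zero'[OF yq(1,2)] using S mmo yq(1) by (auto simp: C_op_def)
  next
    fix g l x assume g: "g \<in> monic_irr" "c g = enat l" and "x \<in> Y" and 0: "pact (g ^ Suc l) T x = 0"
    then obtain y q where yq: "y \<in> Y0" "Poly_Mapping.keys q \<subseteq> G" "x = \<Phi> y q" using surj by blast
    show "pact (g ^ l) T x = 0"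
      using 0 S yq(1) g tame[OF g] unfolding yq(3) zero'[OF yq(1,2)] C_op_def by blast
  qed
  have b1: "\<exists>z\<in>Y. pact \<rho> T z = b" if b: "b \<in> span G1" for b
  proof -
    have "subspace {b \<in> Y. \<exists>z\<in>Y. pact \<rho> T z = b}"
      unfolding subspace_def
    proof (intro conjI ballI allI)
      show "0 \<in> {b \<in> Y. \<exists>z\<in>Y. pact \<rho> T z = b}" using subspace_0[OF subY] pact_zero[OF T] by force
      fix x assume x: "x \<in> {b \<in> Y. \<exists>z\<in>Y. pact \<rho> T z = b}"
      then obtain z where z: "z \<in> Y" "pact \<rho> T z = x" by auto
      show "a *s x \<in> {b \<in> Y. \<exists>z\<in>Y. pact \<rho> T z = b}" for a
        using x z subspace_scale[OF subY] pact_scale[OF T z(1)] by force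
      fix x' assume x': "x' \<in> {b \<in> Y. \<exists>z\<in>Y. pact \<rho> T z = b}"
      then obtain z' where z': "z' \<in> Y" "pact \<rho> T z' = x'" by auto
      show "x + x' \<in> {b \<in> Y. \<exists>z\<in>Y. pact \<rho> T z = b}"
        using x x' z z' subspace_add[OF subY] pact_plus[OF T z(1) z'(1)] by force
    qed
    moreover have "G1 \<subseteq> {b \<in> Y. \<exists>z\<in>Y. pact \<rho> T z = b}"
    proof
      fix j assume j: "j \<in> G1"
      then have jG: "Poly_Mapping.keys (Poly_Mapping.single j q) \<subseteq> G" for q :: "'a poly" using G1(2) by auto
      let ?z = "\<Phi> 0 (Poly_Mapping.single j 1)"
      have "r j = \<rho>" using j G2(3) by (auto simp: r_def)
      have "fmul \<rho> (Poly_Mapping.single j 1) = Poly_Mapping.single j \<rho>"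
        by (rule poly_mapping_eqI) (simp add: lookup_single when_def)
      then have "pact \<rho> T ?z = \<Phi> 0 (Poly_Mapping.single j \<rho>)"
        using act[OF ww jG, of \<rho> 1] pact_zero[OF S'] by simp
      also have "\<dots> = j" using sp[of j] j \<open>r j = \<rho>\<close> pact_zero[OF S'] by simp
      finally have "pact \<rho> T ?z = j" .
      moreover have "?z \<in> Y" by (rule \<Phi>Y[OF ww jG])
      ultimately show "j \<in> {b \<in> Y. \<exists>z\<in>Y. pact \<rho> T z = b}" using pact_in[OF T, of ?z \<rho>] by auto
    qed
    ultimately show ?thesis using span_minimal[of G1] b by blast
  qed
  \<comment> \<open>The elements of \<open>span G2\<close> have constant coefficients with respect to the generators.\<close>
  have b2: "\<exists>q. Poly_Mapping.keys q \<subseteq> G2 \<and> (\<forall>j. \<exists>a. Poly_Mapping.lookup q j = [:a:]) \<and> b = \<Phi> 0 q"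
    if b: "b \<in> span G2" for b
  proof -
    let ?V = "{b. \<exists>q. Poly_Mapping.keys q \<subseteq> G2 \<and> (\<forall>j. \<exists>a. Poly_Mapping.lookup q j = [:a:]) \<and> b = \<Phi> 0 q}"
    have "subspace ?V"
      unfolding subspace_def
    proof (intro conjI ballI allI)
      show "0 \<in> ?V" using \<Phi>0[OF ww] by (auto intro!: exI[of _ 0])
      fix x assume "x \<in> ?V"
      then obtain q where q: "Poly_Mapping.keys q \<subseteq> G2" "\<And>j. \<exists>a. Poly_Mapping.lookup q j = [:a:]" "x = \<Phi> 0 q" by auto
      have qG: "Poly_Mapping.keys q \<subseteq> G" using q(1) G2(2) by auto
      show "a *s x \<in> ?V" for a
      proof -
        have "a *s x = pact [:a:] T x" by (simp add: pact_pCons)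
        also have "\<dots> = \<Phi> 0 (fmul [:a:] q)" unfolding q(3) act[OF ww qG] pact_zero[OF S'] ..
        finally have "a *s x = \<Phi> 0 (fmul [:a:] q)" .
        moreover have "\<exists>b. Poly_Mapping.lookup (fmul [:a:] q) j = [:b:]" for j using q(2)[of j] by auto
        ultimately show ?thesis using order_trans[OF keys_fmul q(1), of "[:a:]"] by blast
      qed
      fix x' assume "x' \<in> ?V"
      then obtain q' where q': "Poly_Mapping.keys q' \<subseteq> G2" "\<And>j. \<exists>a. Poly_Mapping.lookup q' j = [:a:]" "x' = \<Phi> 0 q'" by auto
      have "x + x' = \<Phi> 0 (q + q')" using add[of 0 0 q q'] q(3) q'(3) by simp
      moreover have "\<exists>b. Poly_Mapping.lookup (q + q') j = [:b:]" for j using q(2)[of j] q'(2)[of j] by (auto simp: lookup_add)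
      moreover have "Poly_Mapping.keys (q + q') \<subseteq> G2" using q(1) q'(1) Poly_Mapping.keys_add[of q q'] by auto
      ultimately show "x + x' \<in> ?V" by blast
    qed
    moreover have "G2 \<subseteq> ?V"
    proof
      fix j assume j: "j \<in> G2"
      have "\<Phi> 0 (Poly_Mapping.single j 1) = j" using sp[of j] j pact_zero[OF S'] by (simp add: r_def)
      moreover have "\<exists>a. Poly_Mapping.lookup (Poly_Mapping.single j (1::'a poly)) i = [:a:]" for i
        by (auto simp: lookup_single when_def one_pCons)
      ultimately show "j \<in> ?V" using j by (intro CollectI exI[of _ "Poly_Mapping.single j 1"]) auto
    qed
    ultimately show ?thesis using span_minimal[of G2 ?V] b by blast
  qed
  have c1: "pact (f ^ k) T b = 0" if b: "b \<in> span G2" for b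
  proof -
    obtain q where q: "Poly_Mapping.keys q \<subseteq> G2" "b = \<Phi> 0 q" using b2[OF b] by auto
    have qG: "Poly_Mapping.keys q \<subseteq> G" using q(1) G2(2) by auto
    have "mm j dvd f ^ k * Poly_Mapping.lookup q j" for j
    proof (cases "j \<in> G2")
      case False
      then have "Poly_Mapping.lookup q j = 0" using q(1) by (auto simp: in_keys_iff)
      then show ?thesis by simp
    qed (simp add: mm_def)
    then show ?thesis unfolding q(2) zero'[OF ww qG] by (simp add: pact_zero[OF S'])
  qed
  have c2: "b = 0" if b: "b \<in> span G2" and p: "\<not> f ^ k dvd p" and pb: "pact p T b \<in> Y0" for b p
  proof -
    obtain q where q: "Poly_Mapping.keys q \<subseteq> G2" "\<And>j. \<exists>a. Poly_Mapping.lookup q j = [:a:]" "b = \<Phi> 0 q"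
      using b2[OF b] by auto
    have qG: "Poly_Mapping.keys q \<subseteq> G" using q(1) G2(2) by auto
    let ?y = "pact p T b"
    have y: "- ?y \<in> Y0" using subspace_neg[OF sub0 pb] .
    have "\<Phi> (- ?y) (fmul p q) = \<Phi> (- ?y) 0 + \<Phi> 0 (fmul p q)" using add[of "- ?y" 0 0 "fmul p q"] by simp
    also have "\<Phi> 0 (fmul p q) = ?y" using act[OF ww qG, of p] pact_zero[OF S'] q(3) by simp
    finally have "\<Phi> (- ?y) (fmul p q) = 0" using \<Phi>0[OF y] by simp
    then have d: "mm j dvd p * Poly_Mapping.lookup q j" if "j \<in> G" for j
      using zero[OF y kf[OF qG, of p]] that by simp
    have "Poly_Mapping.lookup q j = 0" for j
    proof (cases "j \<in> G2")
      case True
      obtain a where a: "Poly_Mapping.lookup q j = [:a:]" using q(2) by auto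
      have "f ^ k dvd Polynomial.smult a p" using d[of j] True G2(2) a by (auto simp: mm_def)
      then have "a = 0" using p dvd_smult_cancel by blast
      then show ?thesis using a by simp
    qed (use q(1) in \<open>auto simp: in_keys_iff\<close>)
    then have "q = 0" by (intro poly_mapping_eqI) simp
    then show ?thesis using q(3) \<Phi>0[OF ww] by simp
  qed
  show thesis by (rule that) (fact C TS b1 c1 c2)+
qed

text \<open>
  Sufficient conditions for adjoining a solution \<open>z\<close> of \<open>f z = w\<close>. For
  \<open>c f = k < \<infinity>\<close> a new vector in the kernel of a power of \<open>f\<close> may arise. In the
  second case there is none, since it would give \<open>f ^ k w \<in> Im (f ^ (k + 1))\<close>; in the
  third one, where \<open>c f = k + 1\<close>, it is killed by \<open>f ^ (k + 1)\<close> already.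
\<close>

definition root_adjoinable :: "'a poly \<Rightarrow> ('a poly \<Rightarrow> enat) \<Rightarrow> 'b set \<Rightarrow> ('b \<Rightarrow> 'b) \<Rightarrow> 'a poly \<Rightarrow> 'b \<Rightarrow> bool" where
  "root_adjoinable mo c Y S f w \<longleftrightarrow> c f = \<infinity> \<or>
     (\<exists>k. c f = enat k \<and> mo = 0 \<and> (\<forall>z\<in>Y. pact (f ^ Suc k) S z \<noteq> pact (f ^ k) S w)) \<or>
     (\<exists>k. c f = enat (Suc k) \<and> pact (f ^ k) S w = 0)"

text \<open>
  One new generator is subject to \<open>f z = w\<close>; all the others generate summands
  \<open>K[X]/(mo)\<close> and merely fill up the given space.
\<close>

theorem root_extension:
  fixes G :: "'b set"
  assumes cm: "config_mod c mo" and S: "C_op mo c Y0 S"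
    and G: "independent G" "infinite G" "span G \<inter> Y0 \<subseteq> {0}"
    and f: "f \<in> monic_irr" and w: "w \<in> Y0" and adj: "root_adjoinable mo c Y0 S f w"
  defines "Y \<equiv> {y + g |y g. y \<in> Y0 \<and> g \<in> span G}"
  obtains T where "C_op mo c Y T" "\<And>y. y \<in> Y0 \<Longrightarrow> T y = S y" "\<exists>z\<in>Y. pact f T z = w"
proof -
  have S': "endo_on Y0 S" using S by (simp add: C_op_def)
  have sub0: "subspace Y0" by (rule endo_onD(1)[OF S'])
  have G_ne: "G \<noteq> {}" using G(2) by auto
  then obtain j0 where j0: "j0 \<in> G" by auto
  \<comment> \<open>The generator with index \<open>j0\<close> is the root.\<close>
  define mm where "mm j = (if j = j0 then f else mo)" for j
  define ww where "ww j = (if j = j0 then w else 0)" for j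
  have mm: "\<not> mm j dvd 1" for j using cm monic_irr_not_unit[OF f] by (simp add: mm_def config_mod_def)
  have ww: "ww j \<in> Y0" for j using subspace_0[OF sub0] w by (simp add: ww_def)
  obtain T \<Phi> where T: "endo_on Y T" and TS: "\<And>y. y \<in> Y0 \<Longrightarrow> T y = S y" and \<Phi>0: "\<And>y. y \<in> Y0 \<Longrightarrow> \<Phi> y 0 = y"
    and surj: "\<And>x. x \<in> Y \<Longrightarrow> \<exists>y\<in>Y0. \<exists>q. Poly_Mapping.keys q \<subseteq> G \<and> fred mm q = q \<and> x = \<Phi> y q"
    and \<Phi>Y: "\<And>y q. y \<in> Y0 \<Longrightarrow> Poly_Mapping.keys q \<subseteq> G \<Longrightarrow> \<Phi> y q \<in> Y"
    and act: "\<And>y q p. y \<in> Y0 \<Longrightarrow> Poly_Mapping.keys q \<subseteq> G \<Longrightarrow> pact p T (\<Phi> y q) = \<Phi> (pact p S y) (fmul p q)"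
    and zero: "\<And>y q. y \<in> Y0 \<Longrightarrow> Poly_Mapping.keys q \<subseteq> G \<Longrightarrow>
      \<Phi> y q = 0 \<longleftrightarrow> (\<forall>j\<in>G. mm j dvd Poly_Mapping.lookup q j) \<and> y + tau mm ww S q = 0"
    and add: "\<And>y y' q q'. \<Phi> (y + y') (q + q') = \<Phi> y q + \<Phi> y' q'"
    by (rule module_extension[where mm = mm and ww = ww and r = "\<lambda>_. 1" and Gs = "{}", OF S' G mm ww finite.emptyI empty_subsetI, folded Y_def]) blast+
  have tau_eq: "tau mm ww S q = pact (Poly_Mapping.lookup q j0 div f) S w" for q
  proof -
    have "tau mm ww S q = (\<Sum>j\<in>insert j0 (Poly_Mapping.keys q). pact (Poly_Mapping.lookup q j div mm j) S (ww j))"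
      by (rule tau_superset) auto
    also have "\<dots> = (\<Sum>j\<in>{j0}. pact (Poly_Mapping.lookup q j div mm j) S (ww j))"
      by (rule sum.mono_neutral_right) (auto simp: ww_def pact_zero[OF S'])
    finally show ?thesis by (simp add: mm_def ww_def)
  qed
  have kf: "Poly_Mapping.keys (fmul p q) \<subseteq> G" if "Poly_Mapping.keys q \<subseteq> G" for p and q :: "'b \<Rightarrow>\<^sub>0 'a poly"
    by (rule order_trans[OF keys_fmul that])
  have zero': "pact p T (\<Phi> y q) = 0 \<longleftrightarrow> (\<forall>j\<in>G. mm j dvd p * Poly_Mapping.lookup q j) \<and>
      pact p S y + pact ((p * Poly_Mapping.lookup q j0) div f) S w = 0"
    if "y \<in> Y0" "Poly_Mapping.keys q \<subseteq> G" for p y q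
    using act[OF that] zero[OF pact_in[OF S' that(1)] kf[OF that(2)]] by (simp add: tau_eq)
  have fnz: "f \<noteq> 0" by (rule monic_irr_nz[OF f])
  have mo0: "pact mo S y = 0" if "y \<in> Y0" for y using S that by (simp add: C_op_def)
  have mo_case: "mo = 0 \<or> (\<exists>k. c f = enat (Suc k) \<and> pact (f ^ k) S w = 0)"
    using adj cm f by (auto simp: root_adjoinable_def config_mod_def)
  \<comment> \<open>\<open>mo\<close> kills the root: if \<open>mo \<noteq> 0\<close>, then \<open>mo\<close> is a multiple of \<open>f ^ (k + 1)\<close>, and
    \<open>f ^ (k + 1) z = f ^ k w = 0\<close>.\<close>
  have Cmo: "pact mo T x = 0" if xY: "x \<in> Y" for x
  proof -
    obtain y q where yq: "y \<in> Y0" "Poly_Mapping.keys q \<subseteq> G" "x = \<Phi> y q" using surj[OF xY] by blast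
    let ?q = "Poly_Mapping.lookup q j0"
    have "f dvd mo * ?q \<and> pact ((mo * ?q) div f) S w = 0"
    proof (cases "mo = 0")
      case False
      then obtain k where k: "c f = enat (Suc k)" "pact (f ^ k) S w = 0" using mo_case by auto
      obtain m where "mo = f ^ Suc k * m" using config_mod_dvd[OF cm f k(1)] by auto
      then have e: "mo * ?q = f * ((m * ?q) * f ^ k)" by (simp add: mult_ac)
      have "(mo * ?q) div f = (m * ?q) * f ^ k" unfolding e by (rule nonzero_mult_div_cancel_left[OF fnz])
      moreover have "pact ((m * ?q) * f ^ k) S w = 0"
        unfolding pact_mult[OF S' w, of "m * ?q" "f ^ k"] k(2) by (rule pact_zero[OF S'])
      moreover have "f dvd mo * ?q" unfolding e by (rule dvd_triv_left)
      ultimately show ?thesis by simp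
    qed simp
    then show ?thesis unfolding yq(3) zero'[OF yq(1,2)] using mo0[OF yq(1)] by (auto simp: mm_def)
  qed
  \<comment> \<open>If the root occurs in \<open>x\<close>, then \<open>f\<close> divides \<open>g ^ (l + 1)\<close>, so only \<open>g = f\<close> is in
    question.\<close>
  have Ctame: "pact (g ^ l) T x = 0"
    if g: "g \<in> monic_irr" "c g = enat l" and x: "x \<in> Y" and 0: "pact (g ^ Suc l) T x = 0" for g l x
  proof -
    obtain y q where yq: "y \<in> Y0" "Poly_Mapping.keys q \<subseteq> G" "fred mm q = q" "x = \<Phi> y q"
      using surj[OF x] by blast
    let ?q = "Poly_Mapping.lookup q j0"
    have d: "\<And>j. j \<in> G \<Longrightarrow> mm j dvd g ^ Suc l * Poly_Mapping.lookup q j"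
      and e: "pact (g ^ Suc l) S y + pact ((g ^ Suc l * ?q) div f) S w = 0"
      using 0 unfolding yq(4) zero'[OF yq(1,2)] by auto
    have red: "?q mod f = ?q" using arg_cong[OF yq(3), of "\<lambda>q. Poly_Mapping.lookup q j0"] by (simp add: mm_def)
    have dj: "mm j dvd g ^ l * Poly_Mapping.lookup q j" if "j \<in> G" "j \<noteq> j0" for j
      using d[OF that(1)] config_mod_tame[OF cm g] that(2) by (simp add: mm_def)
    have fin: ?thesis if "f dvd g ^ l * ?q" "pact (g ^ l) S y + pact ((g ^ l * ?q) div f) S w = 0"
      unfolding yq(4) zero'[OF yq(1,2)] using dj that by (auto simp: mm_def)
    have Sy: "pact (g ^ l) S y = 0" if "pact (g ^ Suc l) S y = 0"
      using S g yq(1) that unfolding C_op_def by blast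
    show ?thesis
    proof (cases "?q = 0")
      case True
      then show ?thesis using fin Sy e by simp
    next
      case False
      have nd: "\<not> f dvd ?q" using red False by (auto simp: dvd_eq_mod_eq_0)
      have "f dvd g ^ Suc l * ?q" using d[OF j0] by (simp add: mm_def)
      then have "f dvd g ^ Suc l" using monic_irr_prime[OF f] nd by blast
      then have "f dvd g" by (rule monic_irr_dvd_power[OF f])
      then have gf: "g = f" using monic_irr_dvd_eq[OF f g(1)] by simp
      have "f ^ Suc l * ?q = f * (?q * f ^ l)" by (simp add: mult_ac)
      then have dv: "(f ^ Suc l * ?q) div f = ?q * f ^ l" using nonzero_mult_div_cancel_left[OF fnz] by simp
      have Yl: "pact (f ^ l) S w \<in> Y0" by (rule pact_in[OF S' w])
      have e': "pact (f ^ Suc l) S y + pact ?q S (pact (f ^ l) S w) = 0"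
        using e unfolding gf dv pact_mult[OF S' w, of ?q "f ^ l"] .
      from adj g(2) gf consider
          (a) "mo = 0" "\<And>z. z \<in> Y0 \<Longrightarrow> pact (f ^ Suc l) S z \<noteq> pact (f ^ l) S w"
        | (b) k where "l = Suc k" "pact (f ^ k) S w = 0"
        by (auto simp: root_adjoinable_def)
      then show ?thesis
      proof cases
        case a
        \<comment> \<open>Solving for \<open>f ^ l w\<close> exhibits it as a value of \<open>f ^ (l + 1)\<close>, which is excluded.\<close>
        obtain u v where uv: "u * ?q + v * f = 1" using monic_irr_bezout[OF f nd] by auto
        let ?w = "pact (f ^ l) S w"
        have "?w = pact (u * ?q + v * f) S ?w" by (simp add: uv)
        also have "\<dots> = pact u S (pact ?q S ?w) + pact (v * f) S ?w"
          by (simp only: pact_add pact_mult[OF S' Yl])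
        also have "pact ?q S ?w = pact (f ^ Suc l) S (- y)"
        proof -
          have "pact (f ^ Suc l) S (- y) = - pact (f ^ Suc l) S y"
            using pact_minus[OF S' subspace_0[OF sub0] yq(1), of "f ^ Suc l"] pact_zero[OF S', of "f ^ Suc l"]
            by (simp only: diff_0)
          then show ?thesis using e' by (simp only: add_eq_0_iff)
        qed
        also have "pact u S (pact (f ^ Suc l) S (- y)) = pact (f ^ Suc l) S (pact u S (- y))"
          using pact_mult[OF S' subspace_neg[OF sub0 yq(1)]] by (metis mult.commute)
        also have "pact (v * f) S ?w = pact (f ^ Suc l) S (pact v S w)"
        proof -
          have "pact (v * f) S ?w = pact (v * f * f ^ l) S w" by (simp only: pact_mult[OF S' w, of "v * f"])
          also have "v * f * f ^ l = f ^ Suc l * v" by (simp add: mult_ac)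
          finally show ?thesis by (simp only: pact_mult[OF S' w])
        qed
        also have "pact (f ^ Suc l) S (pact u S (- y)) + pact (f ^ Suc l) S (pact v S w)
          = pact (f ^ Suc l) S (pact u S (- y) + pact v S w)"
          by (rule pact_plus[OF S', symmetric]) (use pact_in[OF S'] w subspace_neg[OF sub0 yq(1)] in auto)
        finally have "pact (f ^ Suc l) S (pact u S (- y) + pact v S w) = ?w" by simp
        moreover have "pact u S (- y) + pact v S w \<in> Y0"
          by (rule subspace_add[OF sub0]) (use pact_in[OF S'] w subspace_neg[OF sub0 yq(1)] in auto)
        ultimately show ?thesis using a(2) by blast
      next
        case b
        have "pact (f ^ l) S w = 0" using pact_mult[OF S' w, of f "f ^ k"] b pact_zero[OF S'] by simp
        then have "pact (f ^ l) S y = 0" using e' Sy pact_zero[OF S'] by (simp add: gf)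
        moreover have "g ^ l * ?q = f * (?q * f ^ k)" by (simp add: gf b(1) mult_ac)
        then have "(g ^ l * ?q) div f = ?q * f ^ k" by (simp only: nonzero_mult_div_cancel_left[OF fnz])
        then have "pact ((g ^ l * ?q) div f) S w = 0" using pact_mult[OF S' w, of ?q "f ^ k"] b(2) pact_zero[OF S'] by simp
        ultimately show ?thesis using fin by (simp add: gf b(1) mult.assoc)
      qed
    qed
  qed
  have "C_op mo c Y T" unfolding C_op_def using T Cmo Ctame by blast
  moreover have "\<exists>z\<in>Y. pact f T z = w"
  proof
    have k: "Poly_Mapping.keys (Poly_Mapping.single j0 (1::'a poly)) \<subseteq> G" using j0 by auto
    let ?s = "Poly_Mapping.single j0 f"
    have 00: "0 \<in> Y0" by (rule subspace_0[OF sub0])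
    show "\<Phi> 0 (Poly_Mapping.single j0 1) \<in> Y" by (rule \<Phi>Y[OF 00 k])
    have "fmul f (Poly_Mapping.single j0 1) = ?s" by (rule poly_mapping_eqI) (simp add: lookup_single when_def)
    then have "pact f T (\<Phi> 0 (Poly_Mapping.single j0 1)) = \<Phi> 0 ?s"
      using act[OF 00 k, of f] pact_zero[OF S'] by simp
    moreover have "\<Phi> (- w) ?s = 0"
    proof -
      have "tau mm ww S ?s = w" unfolding tau_eq using fnz by simp
      moreover have "Poly_Mapping.keys ?s \<subseteq> G" using j0 by auto
      ultimately show ?thesis using zero[OF subspace_neg[OF sub0 w], of ?s] by (auto simp: lookup_single when_def mm_def)
    qed
    moreover have "\<Phi> (- w) ?s = - w + \<Phi> 0 ?s" using add[of "- w" 0 0 ?s] \<Phi>0[OF subspace_neg[OF sub0 w]] by simp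
    ultimately show "pact f T (\<Phi> 0 (Poly_Mapping.single j0 1)) = w" by (simp add: add_eq_0_iff)
  qed
  ultimately show thesis using that TS by blast
qed

section \<open>Images of polynomials in existentially closed modules\<close>

text \<open>
  The closure properties of existentially closed \<open>C\<close>-modules which come from the three
  cases of \<open>root_adjoinable\<close>.
\<close>

definition root_closed :: "('a poly \<Rightarrow> enat) \<Rightarrow> 'b set \<Rightarrow> ('b \<Rightarrow> 'b) \<Rightarrow> bool" where
  "root_closed c Y S \<longleftrightarrow> (\<forall>f\<in>monic_irr. \<forall>w\<in>Y.
     (c f = \<infinity> \<longrightarrow> (\<exists>z\<in>Y. pact f S z = w)) \<and>
     (\<forall>k. c f = enat k \<longrightarrow> (\<exists>z\<in>Y. pact (f ^ Suc k) S z = pact (f ^ k) S w)) \<and>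
     (\<forall>k. c f = enat (Suc k) \<longrightarrow> pact (f ^ k) S w = 0 \<longrightarrow> (\<exists>z\<in>Y. pact f S z = w)))"

text \<open>
  In the second property, a vector \<open>f ^ k w\<close> outside \<open>Im (f ^ (k + 1))\<close> permits
  adjoining a root of \<open>f z = w\<close>, which puts it into this image. If \<open>mo \<noteq> 0\<close>, the
  property holds because \<open>mo\<close> contains \<open>f\<close> exactly \<open>k\<close> times.
\<close>

lemma root_closedI:
  assumes cm: "config_mod c mo" and S: "C_op mo c Y S"
    and roots: "\<And>f w. f \<in> monic_irr \<Longrightarrow> w \<in> Y \<Longrightarrow> root_adjoinable mo c Y S f w \<Longrightarrow> \<exists>z\<in>Y. pact f S z = w"
  shows "root_closed c Y S"
  unfolding root_closed_def
proof (intro ballI conjI allI impI)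
  have S': "endo_on Y S" using S by (simp add: C_op_def)
  fix f :: "'a poly" and w assume f: "f \<in> monic_irr" and w: "w \<in> Y"
  show "\<exists>z\<in>Y. pact f S z = w" if "c f = \<infinity>" using roots[OF f w] that by (simp add: root_adjoinable_def)
  show "\<exists>z\<in>Y. pact f S z = w" if "c f = enat (Suc k)" "pact (f ^ k) S w = 0" for k
    using roots[OF f w] that by (simp add: root_adjoinable_def)
  fix k assume k: "c f = enat k"
  show "\<exists>z\<in>Y. pact (f ^ Suc k) S z = pact (f ^ k) S w"
  proof (cases "mo = 0")
    case True
    show ?thesis
    proof (rule ccontr)
      assume n: "\<not> ?thesis"
      then have "root_adjoinable mo c Y S f w" using True k by (auto simp: root_adjoinable_def)
      then obtain z where z: "z \<in> Y" "pact f S z = w" using roots[OF f w] by auto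
      have "pact (f ^ Suc k) S z = pact (f ^ k) S w"
        using pact_mult[OF S' z(1), of "f ^ k" f] z(2) by (simp add: mult.commute)
      then show False using n z(1) by blast
    qed
  next
    case False
    obtain m where m: "mo = f ^ k * m" "\<not> f dvd m" using config_mod_split[OF cm False f k] by blast
    obtain a b where ab: "a * m + b * f = 1" using monic_irr_bezout[OF f m(2)] by auto
    have "f ^ k = f ^ k * (a * m + b * f)" by (simp only: ab mult_1_right)
    then have e: "f ^ k = a * mo + f ^ Suc k * b" by (simp add: m(1) algebra_simps)
    have "pact (a * mo) S w = 0"
      using S w pact_mult[OF S' w, of a mo] pact_zero[OF S'] by (simp add: C_op_def)
    then have "pact (f ^ k) S w = pact (f ^ Suc k * b) S w"
      by (subst e) (simp only: pact_add add_0_left)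
    also have "\<dots> = pact (f ^ Suc k) S (pact b S w)" by (rule pact_mult[OF S' w])
    finally show ?thesis using pact_in[OF S' w] by metis
  qed
qed

lemma image_pact_mult:
  assumes S: "endo_on Y S" and "w \<in> pact (p * q) S ` Y"
  shows "w \<in> pact p S ` Y"
  using assms(2) pact_mult[OF S] pact_in[OF S] by force

lemma image_pact_dvd:
  assumes S: "endo_on Y S" and "p dvd r" "w \<in> pact r S ` Y"
  shows "w \<in> pact p S ` Y"
proof -
  obtain q where "r = p * q" using assms(2) by auto
  then show ?thesis using image_pact_mult[OF S, of w p q] assms(3) by simp
qed

lemma image_pact_plus:
  assumes S: "endo_on Y S" and "v \<in> pact p S ` Y" "w \<in> pact p S ` Y"
  shows "v + w \<in> pact p S ` Y"
proof -
  obtain x y where "x \<in> Y" "v = pact p S x" "y \<in> Y" "w = pact p S y" using assms by auto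
  then have "v + w = pact p S (x + y)" "x + y \<in> Y"
    using pact_plus[OF S] subspace_add[OF endo_onD(1)[OF S]] by auto
  then show ?thesis by blast
qed

lemma root_closed_stable:
  assumes S: "endo_on Y S" and rc: "root_closed c Y S" and f: "f \<in> monic_irr" and k: "c f = enat k" and w: "w \<in> Y"
  shows "pact (f ^ k) S w \<in> pact (f ^ (k + n)) S ` Y"
proof (induction n)
  case 0
  then show ?case using w by simp
next
  case (Suc n)
  then obtain z where z: "z \<in> Y" "pact (f ^ k) S w = pact (f ^ (k + n)) S z" by auto
  obtain z' where z': "z' \<in> Y" "pact (f ^ Suc k) S z' = pact (f ^ k) S z"
    using rc f k z(1) unfolding root_closed_def by blast
  have "pact (f ^ (k + n)) S z = pact (f ^ n) S (pact (f ^ k) S z)"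
    using pact_mult[OF S z(1), of "f ^ n" "f ^ k"] by (simp add: power_add mult.commute)
  also have "\<dots> = pact (f ^ n * f ^ Suc k) S z'"
    unfolding z'(2)[symmetric] by (rule pact_mult[OF S z'(1), symmetric])
  also have "f ^ n * f ^ Suc k = f ^ (k + Suc n)" by (simp add: power_add mult_ac)
  finally show ?case using z(2) z'(1) by auto
qed

lemma root_closed_decompose:
  assumes S: "endo_on Y S" and rc: "root_closed c Y S" and f: "f \<in> monic_irr" and k: "c f = enat k" and w: "w \<in> Y"
  shows "\<exists>x\<in>Y. \<exists>z\<in>Y. w = x + pact (f ^ k) S z \<and> pact (f ^ k) S x = 0"
proof -
  obtain z where z: "z \<in> Y" "pact (f ^ k) S w = pact (f ^ (k + k)) S z"
    using root_closed_stable[OF assms, of k] by auto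
  have zi: "pact (f ^ k) S z \<in> Y" by (rule pact_in[OF S z(1)])
  have "pact (f ^ (k + k)) S z = pact (f ^ k) S (pact (f ^ k) S z)"
    using pact_mult[OF S z(1)] by (simp add: power_add)
  then have "pact (f ^ k) S (w - pact (f ^ k) S z) = 0" using pact_minus[OF S w zi] z(2) by simp
  moreover have "w - pact (f ^ k) S z \<in> Y" by (rule subspace_diff[OF endo_onD(1)[OF S] w zi])
  ultimately show ?thesis using z(1) by (intro bexI[of _ "w - pact (f ^ k) S z"] bexI[of _ z]) auto
qed

lemma root_closed_kernel_image:
  assumes S: "endo_on Y S" and rc: "root_closed c Y S" and f: "f \<in> monic_irr" and k: "c f = enat k"
    and w: "w \<in> Y" "n \<le> k" "pact (f ^ (k - n)) S w = 0"
  shows "w \<in> pact (f ^ n) S ` Y"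
  using w
proof (induction n arbitrary: w)
  case 0
  then show ?case by simp
next
  case (Suc n)
  obtain l where l: "k = Suc l" using Suc.prems(2) by (cases k) auto
  have "f ^ l = f ^ n * f ^ (k - Suc n)" using Suc.prems(2) l by (simp add: power_add[symmetric])
  then have "pact (f ^ l) S w = 0"
    using pact_mult[OF S Suc.prems(1), of "f ^ n" "f ^ (k - Suc n)"] Suc.prems(3) pact_zero[OF S] by simp
  then obtain z where z: "z \<in> Y" "pact f S z = w"
    using rc f k l Suc.prems(1) unfolding root_closed_def by blast
  have "f ^ (k - n) = f ^ (k - Suc n) * f" using Suc.prems(2) by (metis Suc_diff_le Suc_le_lessD Suc_diff_Suc power_Suc2)
  then have "pact (f ^ (k - n)) S z = 0" using pact_mult[OF S z(1), of "f ^ (k - Suc n)" f] z(2) Suc.prems(3) by simp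
  then have "z \<in> pact (f ^ n) S ` Y" using Suc.IH[OF z(1)] Suc.prems(2) by simp
  then obtain v where v: "v \<in> Y" "z = pact (f ^ n) S v" by auto
  have "w = pact (f ^ Suc n) S v" using pact_mult[OF S v(1), of f "f ^ n"] z(2) v(2) by simp
  then show ?case using v(1) by blast
qed

lemma root_closed_surj_power:
  assumes S: "endo_on Y S" and rc: "root_closed c Y S" and f: "f \<in> monic_irr" and k: "c f = \<infinity>" and w: "w \<in> Y"
  shows "w \<in> pact (f ^ n) S ` Y"
  using w
proof (induction n arbitrary: w)
  case (Suc n)
  obtain z where z: "z \<in> Y" "pact f S z = w" using rc f k Suc.prems unfolding root_closed_def by blast
  obtain v where v: "v \<in> Y" "z = pact (f ^ n) S v" using Suc.IH[OF z(1)] by auto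
  have "w = pact (f ^ Suc n) S v" using pact_mult[OF S v(1), of f "f ^ n"] z(2) v(2) by simp
  then show ?case using v(1) by blast
qed simp

text \<open>
  For coprime \<open>p\<close> and \<open>q\<close>, Bezout's identity shows that the image of \<open>p * q\<close> is the
  intersection of the images of \<open>p\<close> and \<open>q\<close>.
\<close>

lemma not_in_image_prime_power:
  assumes S: "endo_on Y S" and w: "w \<in> Y" "w \<notin> pact \<rho> S ` Y" and nz: "\<rho> \<noteq> 0"
  shows "\<exists>f\<in>monic_irr. \<exists>n. f ^ n dvd \<rho> \<and> w \<notin> pact (f ^ n) S ` Y"
  using nz w(2)
proof (induction "Polynomial.degree \<rho>" arbitrary: \<rho> rule: less_induct)
  case less
  have "\<not> \<rho> dvd 1"
  proof
    assume "\<rho> dvd 1"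
    then have "w \<in> pact \<rho> S ` Y" using image_pact_dvd[OF S, of \<rho> 1 w] w(1) by (simp add: image_iff)
    then show False using less.prems by simp
  qed
  then obtain f where f: "f \<in> monic_irr" "f dvd \<rho>" using ex_monic_irr_factor[OF less.prems(1)] by auto
  obtain n q where q: "\<rho> = f ^ n * q" "\<not> f dvd q" using monic_irr_split[OF f(1) less.prems(1)] by auto
  show ?case
  proof (cases "w \<in> pact (f ^ n) S ` Y")
    case False
    then show ?thesis using f(1) q(1) by (intro bexI[of _ f] exI[of _ n]) auto
  next
    case True
    then obtain x where x: "x \<in> Y" "w = pact (f ^ n) S x" by auto
    have "w \<notin> pact q S ` Y"
    proof
      assume "w \<in> pact q S ` Y"
      then obtain y where y: "y \<in> Y" "w = pact q S y" by auto
      obtain a b where ab: "a * q + b * f ^ n = 1" using monic_irr_bezout_power[OF f(1) q(2)] by blast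
      have "w = pact (a * q) S w + pact (b * f ^ n) S w" by (simp only: pact_add[symmetric] ab pact_1)
      also have "pact (a * q) S w = pact (\<rho> * a) S x"
        unfolding x(2) pact_mult[OF S x(1), symmetric] by (simp add: q(1) mult_ac)
      also have "pact (b * f ^ n) S w = pact (\<rho> * b) S y"
        unfolding y(2) pact_mult[OF S y(1), symmetric] by (simp add: q(1) mult_ac)
      finally have e: "w = pact (\<rho> * a) S x + pact (\<rho> * b) S y" .
      have "w \<in> pact \<rho> S ` Y"
        unfolding e
        by (rule image_pact_plus[OF S image_pact_mult[OF S, of _ \<rho> a] image_pact_mult[OF S, of _ \<rho> b]])
          (use x(1) y(1) in auto)
      then show False using less.prems by simp
    qed
    moreover have "q \<noteq> 0" using q(2) by auto
    moreover have "n > 0"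
    proof (rule ccontr)
      assume "\<not> n > 0"
      then show False using q f(2) by simp
    qed
    have "Polynomial.degree q < Polynomial.degree \<rho>"
    proof -
      have "Polynomial.degree f \<noteq> 0"
        using monic_irr_not_unit[OF f(1)] monic_irr_nz[OF f(1)] is_unit_iff_degree[of f] by auto
      then show ?thesis using \<open>n > 0\<close> \<open>q \<noteq> 0\<close> monic_irr_nz[OF f(1)] by (simp add: q(1) degree_mult_eq degree_power_eq)
    qed
    ultimately obtain g m where "g \<in> monic_irr" "g ^ m dvd q" "w \<notin> pact (g ^ m) S ` Y" using less.hyps[of q] by blast
    then show ?thesis using q(1) by (intro bexI[of _ g] exI[of _ m]) auto
  qed
qed

text \<open>
  A presentation of \<open>w\<close> which shows that it is not in the image of \<open>\<rho>\<close> and which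
  persists in all extensions that are \<open>C\<close>-modules. It is an existential condition on
  \<open>w\<close>, and refers to finitely many vectors.
\<close>

definition separated :: "('a poly \<Rightarrow> enat) \<Rightarrow> 'a poly \<Rightarrow> 'b set \<Rightarrow> ('b \<Rightarrow> 'b) \<Rightarrow> 'b \<Rightarrow> bool" where
  "separated c \<rho> Y S w \<longleftrightarrow> (\<exists>f\<in>monic_irr. \<exists>n k. \<exists>x\<in>Y. \<exists>z\<in>Y. c f = enat k \<and> 0 < n \<and> n \<le> k \<and> f ^ n dvd \<rho> \<and>
     w = x + pact (f ^ n) S z \<and> pact (f ^ k) S x = 0 \<and> pact (f ^ (k - n)) S x \<noteq> 0)"

text \<open>
  Some prime power \<open>f ^ n\<close> dividing \<open>\<rho>\<close> has \<open>w\<close> outside its image, and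
  \<open>n \<le> c f = k\<close> may be assumed since the images of the powers of \<open>f\<close> are constant
  from \<open>f ^ k\<close> on. The space is the sum of the kernel and the image of \<open>f ^ k\<close>, and the
  component of \<open>w\<close> in this kernel is not killed by \<open>f ^ (k - n)\<close>, since otherwise it
  would be in the image of \<open>f ^ n\<close>.
\<close>

theorem separated_if_not_in_image:
  assumes S: "endo_on Y S" and rc: "root_closed c Y S"
    and w: "w \<in> Y" "w \<notin> pact \<rho> S ` Y" and nz: "\<rho> \<noteq> 0"
  shows "separated c \<rho> Y S w"
proof -
  obtain f n where f: "f \<in> monic_irr" and n: "f ^ n dvd \<rho>" "w \<notin> pact (f ^ n) S ` Y"
    using not_in_image_prime_power[OF S w nz] by auto
  obtain k where k: "c f = enat k"
    using root_closed_surj_power[OF S rc f _ w(1)] n(2) by (cases "c f") auto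
  define m where "m = min n k"
  have nm: "w \<notin> pact (f ^ m) S ` Y"
  proof
    assume a: "w \<in> pact (f ^ m) S ` Y"
    show False
    proof (cases "n \<le> k")
      case True
      then show False using a n(2) by (simp add: m_def)
    next
      case False
      then obtain z where z: "z \<in> Y" "w = pact (f ^ k) S z" using a by (auto simp: m_def)
      have "w \<in> pact (f ^ (k + (n - k))) S ` Y" unfolding z(2) by (rule root_closed_stable[OF S rc f k z(1)])
      then show False using False n(2) by simp
    qed
  qed
  have m0: "0 < m" using nm w(1) by (cases m) auto
  have mk: "m \<le> k" by (simp add: m_def)
  have "f ^ m dvd f ^ n" by (rule le_imp_power_dvd) (simp add: m_def)
  then have md: "f ^ m dvd \<rho>" using n(1) by (rule dvd_trans)
  obtain x z where x: "x \<in> Y" and z: "z \<in> Y" and wx: "w = x + pact (f ^ k) S z" "pact (f ^ k) S x = 0"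
    using root_closed_decompose[OF S rc f k w(1)] by auto
  have e: "pact (f ^ k) S z = pact (f ^ m) S (pact (f ^ (k - m)) S z)"
    using pact_mult[OF S z, of "f ^ m" "f ^ (k - m)"] mk by (simp add: power_add[symmetric])
  have zi: "pact (f ^ (k - m)) S z \<in> Y" by (rule pact_in[OF S z])
  have "pact (f ^ (k - m)) S x \<noteq> 0"
  proof
    assume "pact (f ^ (k - m)) S x = 0"
    then have "x \<in> pact (f ^ m) S ` Y" by (rule root_closed_kernel_image[OF S rc f k x mk])
    then have "w \<in> pact (f ^ m) S ` Y" unfolding wx(1) e using zi by (intro image_pact_plus[OF S]) auto
    then show False using nm by simp
  qed
  then show ?thesis unfolding separated_def using f k m0 mk md x zi wx e by metis
qed

text \<open>
  If \<open>w\<close> were in the image, then \<open>x = f ^ n v\<close> for some \<open>v\<close>; now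
  \<open>f ^ (k + n) v = 0\<close>, so the kernel condition yields \<open>f ^ (k - n) x = f ^ k v = 0\<close>.
\<close>

theorem not_in_image_if_separated:
  assumes S: "C_op mo c Y S" and sep: "separated c \<rho> Y S w"
  shows "w \<notin> pact \<rho> S ` Y"
proof
  assume wr: "w \<in> pact \<rho> S ` Y"
  have S': "endo_on Y S" using S by (simp add: C_op_def)
  obtain f n k x z where f: "f \<in> monic_irr" and x: "x \<in> Y" and z: "z \<in> Y" and k: "c f = enat k" and n: "n \<le> k" "f ^ n dvd \<rho>"
    and w: "w = x + pact (f ^ n) S z" and x0: "pact (f ^ k) S x = 0" "pact (f ^ (k - n)) S x \<noteq> 0"
    using sep unfolding separated_def by blast
  obtain u where u: "u \<in> Y" "w = pact (f ^ n) S u" using image_pact_dvd[OF S' n(2) wr] by auto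
  define v where "v = u - z"
  have v: "v \<in> Y" unfolding v_def by (rule subspace_diff[OF endo_onD(1)[OF S'] u(1) z])
  have xv: "x = pact (f ^ n) S v" unfolding v_def pact_minus[OF S' u(1) z] using w u(2) by (simp add: algebra_simps)
  \<comment> \<open>The kernels of the powers of \<open>f\<close> are constant from \<open>f ^ k\<close> on.\<close>
  have "pact (f ^ (k + m)) S v = 0 \<Longrightarrow> pact (f ^ k) S v = 0" for m
  proof (induction m)
    case (Suc m)
    let ?v = "pact (f ^ m) S v"
    have vi: "?v \<in> Y" by (rule pact_in[OF S' v])
    have "pact (f ^ Suc k) S ?v = 0"
      using Suc.prems pact_mult[OF S' v, of "f ^ Suc k" "f ^ m"] by (simp add: power_add mult_ac)
    then have "pact (f ^ k) S ?v = 0" using S f k vi unfolding C_op_def by blast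
    then have "pact (f ^ (k + m)) S v = 0" using pact_mult[OF S' v, of "f ^ k" "f ^ m"] by (simp add: power_add)
    then show ?case by (rule Suc.IH)
  qed simp
  moreover have "pact (f ^ (k + n)) S v = 0"
    using x0(1) xv pact_mult[OF S' v, of "f ^ k" "f ^ n"] by (simp add: power_add)
  ultimately have "pact (f ^ k) S v = 0" by blast
  then have "pact (f ^ (k - n)) S x = 0"
    using xv pact_mult[OF S' v, of "f ^ (k - n)" "f ^ n"] n(1) by (simp add: power_add[symmetric])
  then show False using x0(2) by simp
qed

end

section \<open>Bases adapted to subspaces\<close>

context kspace
begin

lemma span_disjoint_basis:
  assumes B: "independent B" and "A \<subseteq> B" "C \<subseteq> B" "A \<inter> C = {}" and x: "x \<in> span A" "x \<in> span C"
  shows "x = 0"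
proof -
  interpret VP: vector_space_pair scale scale ..
  let ?f = "VP.construct B (\<lambda>b. if b \<in> A then b else 0)"
  have lin: "Vector_Spaces.linear scale scale ?f" by (rule VP.linear_construct[OF B])
  interpret f: Vector_Spaces.linear scale scale ?f by (rule lin)
  have fb: "?f b = (if b \<in> A then b else 0)" if "b \<in> B" for b by (rule VP.construct_basis[OF B that])
  have "?f x = id x"
  proof (rule VP.linear_eq_on[OF lin _ x(1)])
    show "Vector_Spaces.linear scale scale id" by (rule linear_id)
  qed (use fb assms in auto)
  moreover have "?f b = 0" if b: "b \<in> C" for b
  proof -
    have "b \<in> B" "b \<notin> A" using b assms(3,4) by blast+
    then show ?thesis using fb[of b] by simp
  qed
  then have "?f x = 0" by (rule f.eq_0_on_span[OF _ x(2)])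
  ultimately show ?thesis by simp
qed

text \<open>
  A substitute for the projection to the quotient by \<open>Z\<close>: a projection onto a complement
  of \<open>Z\<close>.
\<close>

lemma ex_linear_with_kernel:
  assumes Z: "subspace Z"
  shows "\<exists>f. Vector_Spaces.linear scale scale f \<and> (\<forall>a. f a = 0 \<longleftrightarrow> a \<in> Z)"
proof -
  interpret VP: vector_space_pair scale scale ..
  obtain B where B: "B \<subseteq> Z" "independent B" "Z \<subseteq> span B"
    using maximal_independent_subset[of Z] by auto
  obtain B' where B': "B \<subseteq> B'" "independent B'" "UNIV \<subseteq> span B'"
    using maximal_independent_subset_extend[OF subset_UNIV B(2)] by auto
  let ?f = "VP.construct B' (\<lambda>b. if b \<in> B then 0 else b)"
  have lin: "Vector_Spaces.linear scale scale ?f" by (rule VP.linear_construct[OF B'(2)])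
  interpret f: Vector_Spaces.linear scale scale ?f by (rule lin)
  have fb: "?f b = (if b \<in> B then 0 else b)" if "b \<in> B'" for b by (rule VP.construct_basis[OF B'(2) that])
  have spanB: "span B = Z" using B(3) span_minimal[OF B(1) Z] by auto
  have f0: "?f z = 0" if "z \<in> Z" for z
    by (rule f.eq_0_on_span[of B]) (use fb B'(1) that spanB in auto)
  have f1: "?f v = v" if "v \<in> span (B' - B)" for v
  proof -
    have "?f v = id v"
    proof (rule VP.linear_eq_on[OF lin _ that])
      show "Vector_Spaces.linear scale scale id" by (rule linear_id)
    qed (use fb in auto)
    then show ?thesis by simp
  qed
  have "a \<in> Z" if a: "?f a = 0" for a
  proof -
    have "B' = B \<union> (B' - B)" using B'(1) by auto
    then have "a \<in> span (B \<union> (B' - B))" using B'(3) by auto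
    then obtain u v where uv: "u \<in> span B" "v \<in> span (B' - B)" "a = u + v" unfolding span_Un by auto
    have "?f a = ?f u + ?f v" using uv(3) f.add by simp
    then have "v = 0" using a f0[of u] f1[OF uv(2)] uv(1) spanB by simp
    then show ?thesis using uv spanB by simp
  qed
  then show ?thesis using lin f0 by blast
qed

lemma infinite_if_independent_seq:
  assumes Y0: "subspace Y0" and x: "\<And>n. x n \<in> {y + g |y g. y \<in> Y0 \<and> g \<in> span G}"
    and indep: "\<And>m k. k m \<noteq> 0 \<Longrightarrow> (\<Sum>n<Suc m. k n *s x n) \<notin> Y0"
  shows "infinite G"
proof
  assume fin: "finite G"
  obtain p where lin: "Vector_Spaces.linear scale scale p" and p0: "\<And>a. p a = 0 \<longleftrightarrow> a \<in> Y0"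
    using ex_linear_with_kernel[OF Y0] by blast
  interpret p: Vector_Spaces.linear scale scale p by (rule lin)
  define v where "v n = p (x n)" for n
  have vnz: "(\<Sum>n<Suc m. k n *s v n) \<noteq> 0" if "k m \<noteq> 0" for m k
  proof -
    have "p (\<Sum>n<Suc m. k n *s x n) = (\<Sum>n<Suc m. k n *s v n)" unfolding v_def p.sum p.scale ..
    then show ?thesis using indep[of k m, OF that] p0 by metis
  qed
  have "independent (v ` {..<m}) \<and> inj_on v {..<m}" for m
  proof (induction m)
    case 0
    then show ?case by (simp add: independent_empty)
  next
    case (Suc m)
    have "v m \<notin> span (v ` {..<m})"
    proof
      assume "v m \<in> span (v ` {..<m})"
      then obtain u where u: "v m = (\<Sum>w\<in>v ` {..<m}. u w *s w)" by (auto simp: span_finite)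
      then have u': "v m = (\<Sum>n<m. u (v n) *s v n)" using Suc by (simp add: sum.reindex)
      have "(\<Sum>n<Suc m. (if n = m then - 1 else u (v n)) *s v n)
        = (\<Sum>n<m. (if n = m then - 1 else u (v n)) *s v n) - v m" by simp
      also have "(\<Sum>n<m. (if n = m then - 1 else u (v n)) *s v n) = (\<Sum>n<m. u (v n) *s v n)"
        by (rule sum.cong) auto
      finally have "(\<Sum>n<Suc m. (if n = m then - 1 else u (v n)) *s v n) = 0" using u' by simp
      then show False using vnz[of "\<lambda>n. if n = m then - 1 else u (v n)" m] by simp
    qed
    then show ?case
      using Suc span_base[of "v m" "v ` {..<m}"]
      by (auto simp: lessThan_Suc independent_insertI)
  qed
  then have i: "independent (v ` {..<m})" "inj_on v {..<m}" for m by blast+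
  have "v n \<in> span (p ` G)" for n
  proof -
    obtain y g where "y \<in> Y0" "g \<in> span G" "x n = y + g" using x[of n] by blast
    moreover then have "v n = p g" using p0[of y] by (simp add: v_def p.add)
    ultimately show ?thesis using p.span_image[of G] by auto
  qed
  then have "v ` {..<Suc (card (p ` G))} \<subseteq> span (p ` G)" by auto
  then have "card (v ` {..<Suc (card (p ` G))}) \<le> card (p ` G)"
    using independent_span_bound[of "p ` G" "v ` {..<Suc (card (p ` G))}"] fin i(1) by blast
  then show False using card_image[OF i(2)[of "Suc (card (p ` G))"]] by simp
qed

text \<open>
  A basis of \<open>Y0\<close> is extended first by elements of \<open>A\<close> to one of the span of
  \<open>Y0 \<union> A\<close>, and then to one of \<open>Y\<close>; \<open>GA\<close> and \<open>GB\<close> are the elements added. The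
  vectors \<open>x n\<close> are linearly independent modulo \<open>Y0\<close>, so infinitely many elements are
  added.
\<close>

theorem adapted_basis:
  assumes Y0: "subspace Y0" and Y: "subspace Y" "Y0 \<subseteq> Y" and A: "A \<subseteq> Y"
    and x: "\<And>n. x n \<in> Y" and indep: "\<And>m k. k m \<noteq> 0 \<Longrightarrow> (\<Sum>n<Suc m. k n *s x n) \<notin> Y0"
  obtains GA GB where "GA \<subseteq> A" "GA \<inter> GB = {}" "independent (GA \<union> GB)" "infinite (GA \<union> GB)"
    "span (GA \<union> GB) \<inter> Y0 \<subseteq> {0}" "Y = {y + g |y g. y \<in> Y0 \<and> g \<in> span (GA \<union> GB)}"
    "\<And>a. a \<in> A \<Longrightarrow> a \<in> {y + g |y g. y \<in> Y0 \<and> g \<in> span GA}"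
proof -
  obtain B0 where B0: "B0 \<subseteq> Y0" "independent B0" "Y0 \<subseteq> span B0"
    using maximal_independent_subset[of Y0] by auto
  obtain B1 where B1: "B0 \<subseteq> B1" "B1 \<subseteq> B0 \<union> A" "independent B1" "B0 \<union> A \<subseteq> span B1"
    using maximal_independent_subset_extend[OF Un_upper1 B0(2)] .
  have "B1 \<subseteq> Y" using B1(2) B0(1) Y(2) A by auto
  from maximal_independent_subset_extend[OF this B1(3)]
  obtain B2 where B2: "B1 \<subseteq> B2" "B2 \<subseteq> Y" "independent B2" "Y \<subseteq> span B2" .
  have sp0: "span B0 = Y0" using B0(3) span_minimal[OF B0(1) Y0] by auto
  have sp2: "span B2 = Y" using B2(4) span_minimal[OF B2(2) Y(1)] by auto
  define GA where "GA = B1 - B0"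
  define GB where "GB = B2 - B1"
  have G: "GA \<union> GB = B2 - B0" using B1(1) B2(1) by (auto simp: GA_def GB_def)
  have B2e: "B2 = B0 \<union> (GA \<union> GB)" and B1e: "B1 = B0 \<union> GA" using B1(1) B2(1) by (auto simp: GA_def GB_def)
  have Ye: "Y = {y + g |y g. y \<in> Y0 \<and> g \<in> span (GA \<union> GB)}"
    unfolding sp2[symmetric] sp0[symmetric] B2e by (rule span_Un)
  show thesis
  proof (rule that)
    show "GA \<subseteq> A" using B1(2) by (auto simp: GA_def)
    show "GA \<inter> GB = {}" by (auto simp: GA_def GB_def)
    show "independent (GA \<union> GB)" unfolding G by (rule independent_mono[OF B2(3)]) auto
    show "span (GA \<union> GB) \<inter> Y0 \<subseteq> {0}"
      using span_disjoint_basis[OF B2(3), of "GA \<union> GB" B0] B1(1) B2(1) unfolding G sp0[symmetric] by auto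
    show "Y = {y + g |y g. y \<in> Y0 \<and> g \<in> span (GA \<union> GB)}" by (rule Ye)
    show "infinite (GA \<union> GB)" by (rule infinite_if_independent_seq[OF Y0 _ indep]) (use x Ye in blast)
    fix a assume "a \<in> A"
    then have "a \<in> span (B0 \<union> GA)" using B1(4) unfolding B1e[symmetric] by auto
    then show "a \<in> {y + g |y g. y \<in> Y0 \<and> g \<in> span GA}" unfolding span_Un sp0 .
  qed
qed

text \<open>
  The \<open>M\<close>-th vector has to avoid one value for each condition in which it has the last
  nonzero coefficient. This needs an infinite space only, even if its dimension is finite.
\<close>

lemma ex_generic_sequence:
  assumes Y: "subspace Y" "infinite Y" and Z: "finite Z" "\<And>m k w. (m, k, w) \<in> Z \<Longrightarrow> k m \<noteq> 0"
  shows "\<exists>i. range i \<subseteq> Y \<and> (\<forall>(m, k, w)\<in>Z. (\<Sum>n<Suc m. k n *s i n) \<noteq> w)"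
proof -
  have "\<exists>i. range i \<subseteq> Y \<and> (\<forall>(m, k, w)\<in>Z. m < M \<longrightarrow> (\<Sum>n<Suc m. k n *s i n) \<noteq> w)" for M
  proof (induction M)
    case 0
    show ?case using subspace_0[OF Y(1)] by (intro exI[of _ "\<lambda>_. 0"]) auto
  next
    case (Suc M)
    then obtain i where i1: "range i \<subseteq> Y" "\<forall>(m, k, w)\<in>Z. m < M \<longrightarrow> (\<Sum>n<Suc m. k n *s i n) \<noteq> w"
      by auto
    have i: "range i \<subseteq> Y" "\<And>m k w. (m, k, w) \<in> Z \<Longrightarrow> m < M \<Longrightarrow> (\<Sum>n<Suc m. k n *s i n) \<noteq> w"
      using i1(1) bspec[OF i1(2)] by (simp, force)
    define bad where "bad = (\<lambda>(m, k, w). inverse (k M) *s (w - (\<Sum>n<M. k n *s i n))) ` Z"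
    have "finite bad" using Z(1) by (simp add: bad_def)
    then obtain v where v: "v \<in> Y" "v \<notin> bad" using Y(2) by (meson finite_subset subsetI)
    let ?i = "i(M := v)"
    have "(\<Sum>n<Suc m. k n *s ?i n) \<noteq> w" if z: "(m, k, w) \<in> Z" and m: "m < Suc M" for m k w
    proof (cases "m = M")
      case True
      have "(\<Sum>n<M. k n *s ?i n) = (\<Sum>n<M. k n *s i n)" by (rule sum.cong) auto
      then have e: "(\<Sum>n<Suc m. k n *s ?i n) = (\<Sum>n<M. k n *s i n) + k M *s v" by (simp add: True)
      show ?thesis
      proof
        assume "(\<Sum>n<Suc m. k n *s ?i n) = w"
        then have "k M *s v = w - (\<Sum>n<M. k n *s i n)" using e by (simp add: algebra_simps)
        then have "inverse (k M) *s (k M *s v) = inverse (k M) *s (w - (\<Sum>n<M. k n *s i n))" by simp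
        moreover have "inverse (k M) *s (k M *s v) = v" using Z(2)[OF z] True by simp
        ultimately have "v \<in> bad" using z unfolding bad_def by force
        then show False using v(2) by simp
      qed
    next
      case False
      have "(\<Sum>n<Suc m. k n *s ?i n) = (\<Sum>n<Suc m. k n *s i n)" by (rule sum.cong) (use False m in auto)
      then show ?thesis using i(2)[OF z] m False by simp
    qed
    moreover have "range ?i \<subseteq> Y" using i(1) v(1) by auto
    ultimately show ?case by (intro exI[of _ ?i]) blast
  qed
  note seq = this
  obtain M where M: "\<And>m k w. (m, k, w) \<in> Z \<Longrightarrow> m < M"
  proof -
    have "finite (fst ` Z)" using Z(1) by simp
    then obtain M where "\<forall>m\<in>fst ` Z. m < M" unfolding finite_nat_set_iff_bounded by auto
    then show thesis using that by force
  qed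
  obtain i where i: "range i \<subseteq> Y" "\<forall>(m, k, w)\<in>Z. m < M \<longrightarrow> (\<Sum>n<Suc m. k n *s i n) \<noteq> w"
    using seq[of M] by auto
  have "(\<Sum>n<Suc m. k n *s i n) \<noteq> w" if "(m, k, w) \<in> Z" for m k w
    using bspec[OF i(2) that] M[OF that] by simp
  then show ?thesis using i(1) by (intro exI[of _ i]) (auto simp del: sum.lessThan_Suc)
qed

end

section \<open>Linearization\<close>

text \<open>
  The definable vector space is a set of tuples with operations of its own. To use the
  linear algebra of the preceding sections, it is embedded as a subspace into a vector space
  that fills a type.
\<close>

definition pmscale :: "'k::field \<Rightarrow> ('x \<Rightarrow>\<^sub>0 'k) \<Rightarrow> ('x \<Rightarrow>\<^sub>0 'k)" where
  "pmscale k = Poly_Mapping.map ((*) k)"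

lemma lookup_pmscale [simp]: "Poly_Mapping.lookup (pmscale k a) x = k * Poly_Mapping.lookup a x"
  by (simp add: pmscale_def Poly_Mapping.map.rep_eq when_def)

interpretation E: kspace "pmscale :: 'k::field \<Rightarrow> ('x \<Rightarrow>\<^sub>0 'k) \<Rightarrow> ('x \<Rightarrow>\<^sub>0 'k)"
  by unfold_locales (auto intro!: poly_mapping_eqI simp: lookup_add algebra_simps)

definition linearization ::
  "('f, 'r, 'k::field) vs_formulas \<Rightarrow> ('f, 'r, 'a) struct \<Rightarrow> ('a list \<Rightarrow> ('x \<Rightarrow>\<^sub>0 'k)) \<Rightarrow> bool" where
  "linearization D M \<iota> \<longleftrightarrow> inj_on \<iota> (VV D M) \<and>
     (\<forall>x\<in>VV D M. \<forall>y\<in>VV D M. \<iota> (x \<oplus>\<^bsub>vs D M\<^esub> y) = \<iota> x + \<iota> y) \<and>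
     (\<forall>k. \<forall>x\<in>VV D M. \<iota> (k \<odot>\<^bsub>vs D M\<^esub> x) = pmscale k (\<iota> x))"

text \<open>
  The free vector space on all tuples maps linearly onto \<open>VV D M\<close>; a linear map \<open>p\<close> with
  the same kernel embeds the image into the free space itself.
\<close>

lemma ex_linearization:
  fixes D :: "('f, 'r, 'k::field) vs_formulas" and M :: "('f, 'r, 'a) struct"
  assumes D: "defines_infinite_vs D M"
  shows "\<exists>\<iota> :: 'a list \<Rightarrow> ('a list \<Rightarrow>\<^sub>0 'k). linearization D M \<iota>"
proof -
  interpret module "ring_of_type_algebra :: 'k ring" "vs D M"
    using D by (simp add: defines_infinite_vs_def)
  note ops = defines_vs_ops[OF D]
  have carR: "carrier (ring_of_type_algebra :: 'k ring) = UNIV" by (simp add: ring_of_type_algebra_def)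
  let ?W = "vs D M"
  define \<pi> where "\<pi> a = (\<Oplus>\<^bsub>?W\<^esub>x\<in>Poly_Mapping.keys a \<inter> VV D M. Poly_Mapping.lookup a x \<odot>\<^bsub>?W\<^esub> x)" for a :: "'a list \<Rightarrow>\<^sub>0 'k"
  have sc: "k \<odot>\<^bsub>?W\<^esub> x \<in> VV D M" if "x \<in> VV D M" for k x using vs_ops_smult(1)[OF ops that] .
  have sc0: "0 \<odot>\<^bsub>?W\<^esub> x = \<zero>\<^bsub>?W\<^esub>" if "x \<in> VV D M" for x
    using smult_l_null[of x] that by (simp add: ring_of_type_algebra_def)
  have \<pi>_sup: "\<pi> a = (\<Oplus>\<^bsub>?W\<^esub>x\<in>S \<inter> VV D M. Poly_Mapping.lookup a x \<odot>\<^bsub>?W\<^esub> x)"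
    if "finite S" "Poly_Mapping.keys a \<subseteq> S" for a S
    unfolding \<pi>_def
    by (rule M.add.finprod_mono_neutral_cong_left) (use that sc sc0 in \<open>auto simp: in_keys_iff\<close>)
  have \<pi>_in: "\<pi> a \<in> VV D M" for a
    using M.finsum_closed[of "\<lambda>x. Poly_Mapping.lookup a x \<odot>\<^bsub>?W\<^esub> x" "Poly_Mapping.keys a \<inter> VV D M"] sc by (auto simp: \<pi>_def)
  have \<pi>_add: "\<pi> (a + b) = \<pi> a \<oplus>\<^bsub>?W\<^esub> \<pi> b" for a b
  proof -
    let ?S = "Poly_Mapping.keys a \<union> Poly_Mapping.keys b"
    have "\<pi> (a + b) = (\<Oplus>\<^bsub>?W\<^esub>x\<in>?S \<inter> VV D M. Poly_Mapping.lookup (a + b) x \<odot>\<^bsub>?W\<^esub> x)"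
      by (rule \<pi>_sup) (use Poly_Mapping.keys_add[of a b] in auto)
    also have "\<dots> = (\<Oplus>\<^bsub>?W\<^esub>x\<in>?S \<inter> VV D M. (Poly_Mapping.lookup a x \<odot>\<^bsub>?W\<^esub> x) \<oplus>\<^bsub>?W\<^esub> (Poly_Mapping.lookup b x \<odot>\<^bsub>?W\<^esub> x))"
    proof (rule M.finsum_cong')
      fix x assume "x \<in> ?S \<inter> VV D M"
      then show "Poly_Mapping.lookup (a + b) x \<odot>\<^bsub>?W\<^esub> x = (Poly_Mapping.lookup a x \<odot>\<^bsub>?W\<^esub> x) \<oplus>\<^bsub>?W\<^esub> (Poly_Mapping.lookup b x \<odot>\<^bsub>?W\<^esub> x)"
        using smult_l_distr[of "Poly_Mapping.lookup a x" "Poly_Mapping.lookup b x" x]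
        by (simp add: lookup_add ring_of_type_algebra_def)
    qed (use sc vs_ops_add(1)[OF ops] in auto)
    also have "\<dots> = \<pi> a \<oplus>\<^bsub>?W\<^esub> \<pi> b"
      by (subst M.finsum_addf) (use sc \<pi>_sup[of ?S a] \<pi>_sup[of ?S b] in auto)
    finally show ?thesis .
  qed
  have \<pi>_scale: "\<pi> (pmscale k a) = k \<odot>\<^bsub>?W\<^esub> \<pi> a" for k a
  proof -
    have "\<pi> (pmscale k a) = (\<Oplus>\<^bsub>?W\<^esub>x\<in>Poly_Mapping.keys a \<inter> VV D M. Poly_Mapping.lookup (pmscale k a) x \<odot>\<^bsub>?W\<^esub> x)"
      by (rule \<pi>_sup) (auto simp: in_keys_iff)
    also have "\<dots> = (\<Oplus>\<^bsub>?W\<^esub>x\<in>Poly_Mapping.keys a \<inter> VV D M. k \<odot>\<^bsub>?W\<^esub> (Poly_Mapping.lookup a x \<odot>\<^bsub>?W\<^esub> x))"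
    proof (rule M.finsum_cong')
      fix x assume "x \<in> Poly_Mapping.keys a \<inter> VV D M"
      then show "Poly_Mapping.lookup (pmscale k a) x \<odot>\<^bsub>?W\<^esub> x = k \<odot>\<^bsub>?W\<^esub> (Poly_Mapping.lookup a x \<odot>\<^bsub>?W\<^esub> x)"
        using smult_assoc1[of k "Poly_Mapping.lookup a x" x] by (simp add: ring_of_type_algebra_def)
    qed (use sc in auto)
    also have "\<dots> = k \<odot>\<^bsub>?W\<^esub> \<pi> a"
      unfolding \<pi>_def by (rule finsum_smult_ldistr[symmetric]) (use sc in \<open>auto simp: carR\<close>)
    finally show ?thesis .
  qed
  have \<pi>_single: "\<pi> (Poly_Mapping.single x 1) = x" if x: "x \<in> VV D M" for x
  proof -
    have "\<pi> (Poly_Mapping.single x 1) = (\<Oplus>\<^bsub>?W\<^esub>y\<in>{x}. Poly_Mapping.lookup (Poly_Mapping.single x 1) y \<odot>\<^bsub>?W\<^esub> y)"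
      using x by (simp add: \<pi>_def)
    also have "\<dots> = Poly_Mapping.lookup (Poly_Mapping.single x 1) x \<odot>\<^bsub>?W\<^esub> x"
      by (subst M.finsum_insert) (use x sc in auto)
    also have "\<dots> = x" using smult_one[of x] x by (simp add: ring_of_type_algebra_def)
    finally show ?thesis .
  qed
  have \<pi>_0: "\<pi> 0 = \<zero>\<^bsub>?W\<^esub>" by (simp add: \<pi>_def)
  define Z where "Z = {a. \<pi> a = \<zero>\<^bsub>?W\<^esub>}"
  have zin: "\<zero>\<^bsub>?W\<^esub> \<in> VV D M" by (rule vs_ops_zero(1)[OF ops])
  have "E.subspace Z"
    unfolding E.subspace_def Z_def using \<pi>_0 \<pi>_add \<pi>_scale M.l_zero[of "\<zero>\<^bsub>?W\<^esub>"] smult_r_null zin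
    by (auto simp: carR)
  then obtain p :: "('a list \<Rightarrow>\<^sub>0 'k) \<Rightarrow> ('a list \<Rightarrow>\<^sub>0 'k)" where lin: "Vector_Spaces.linear pmscale pmscale p" and p0: "\<And>a. p a = 0 \<longleftrightarrow> a \<in> Z"
    using E.ex_linear_with_kernel by blast
  interpret p: Vector_Spaces.linear pmscale pmscale p by (rule lin)
  have peq: "p a = p b \<longleftrightarrow> \<pi> a = \<pi> b" for a b
  proof
    assume "p a = p b"
    then have "p (a - b) = 0" by (simp add: p.diff)
    then have z: "\<pi> (a - b) = \<zero>\<^bsub>?W\<^esub>" using p0 by (simp add: Z_def)
    have "\<pi> a = \<pi> ((a - b) + b)" by simp
    also have "\<dots> = \<pi> b" unfolding \<pi>_add z using M.l_zero \<pi>_in by simp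
    finally show "\<pi> a = \<pi> b" .
  next
    assume e: "\<pi> a = \<pi> b"
    have "\<pi> (a - b) = \<pi> (a + pmscale (- 1) b)" by (rule arg_cong[of _ _ \<pi>]) (rule poly_mapping_eqI, simp add: lookup_add lookup_minus)
    also have "\<dots> = \<pi> (b + pmscale (- 1) b)" unfolding \<pi>_add e ..
    also have "b + pmscale (- 1) b = 0" by (rule poly_mapping_eqI) (simp add: lookup_add)
    finally have "p (a - b) = 0" using p0 \<pi>_0 by (simp add: Z_def)
    then show "p a = p b" by (simp add: p.diff)
  qed
  define \<iota> where "\<iota> x = p (Poly_Mapping.single x (1::'k))" for x
  have "linearization D M \<iota>"
    unfolding linearization_def
  proof (intro conjI ballI allI)
    show "inj_on \<iota> (VV D M)" by (rule inj_onI) (simp add: \<iota>_def peq \<pi>_single)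
    fix x assume x: "x \<in> VV D M"
    show "\<iota> (k \<odot>\<^bsub>?W\<^esub> x) = pmscale k (\<iota> x)" for k
      unfolding \<iota>_def p.scale[symmetric] peq using x sc by (simp add: \<pi>_single \<pi>_scale)
    fix y assume y: "y \<in> VV D M"
    show "\<iota> (x \<oplus>\<^bsub>?W\<^esub> y) = \<iota> x + \<iota> y"
      unfolding \<iota>_def p.add[symmetric] peq using x y vs_ops_add(1)[OF ops] by (simp add: \<pi>_single \<pi>_add)
  qed
  then show ?thesis by blast
qed

text \<open>
  The operator \<open>\<theta>\<close> transported along the linearization.
\<close>

definition lin_op :: "('f, 'r, 'k::field) vs_formulas \<Rightarrow> ('f, 'r, 'a) struct \<Rightarrow>
    ('a list \<Rightarrow> ('x \<Rightarrow>\<^sub>0 'k)) \<Rightarrow> ('a list \<Rightarrow> 'a list) \<Rightarrow> ('x \<Rightarrow>\<^sub>0 'k) \<Rightarrow> ('x \<Rightarrow>\<^sub>0 'k)" where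
  "lin_op D M \<iota> \<theta> e = \<iota> (\<theta> (inv_into (VV D M) \<iota> e))"

lemma lin_op_eq: "linearization D M \<iota> \<Longrightarrow> x \<in> VV D M \<Longrightarrow> lin_op D M \<iota> \<theta> (\<iota> x) = \<iota> (\<theta> x)"
  by (simp add: lin_op_def linearization_def)

lemma linearization_zero:
  assumes D: "vs_ops D M" and z: "\<zero>\<^bsub>vs D M\<^esub> \<oplus>\<^bsub>vs D M\<^esub> \<zero>\<^bsub>vs D M\<^esub> = \<zero>\<^bsub>vs D M\<^esub>" and l: "linearization D M \<iota>"
  shows "\<iota> \<zero>\<^bsub>vs D M\<^esub> = 0"
proof -
  have "\<iota> (\<zero>\<^bsub>vs D M\<^esub> \<oplus>\<^bsub>vs D M\<^esub> \<zero>\<^bsub>vs D M\<^esub>) = \<iota> \<zero>\<^bsub>vs D M\<^esub> + \<iota> \<zero>\<^bsub>vs D M\<^esub>"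
    using l vs_ops_zero(1)[OF D] unfolding linearization_def by blast
  then show ?thesis unfolding z by simp
qed

lemma defines_zero_add:
  fixes D :: "('f, 'r, 'k::field) vs_formulas"
  assumes D: "defines_infinite_vs D M"
  shows "\<zero>\<^bsub>vs D M\<^esub> \<oplus>\<^bsub>vs D M\<^esub> \<zero>\<^bsub>vs D M\<^esub> = \<zero>\<^bsub>vs D M\<^esub>"
proof -
  interpret module "ring_of_type_algebra :: 'k ring" "vs D M"
    using D by (simp add: defines_infinite_vs_def)
  show ?thesis using M.l_zero[of "\<zero>\<^bsub>vs D M\<^esub>"] vs_ops_zero(1)[OF defines_vs_ops[OF D]] by simp
qed

lemma linearization_subspace:
  assumes D: "defines_infinite_vs D M" and l: "linearization D M \<iota>"
  shows "E.subspace (\<iota> ` VV D M)"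
  unfolding E.subspace_def
proof (intro conjI ballI allI)
  note ops = defines_vs_ops[OF D]
  show "0 \<in> \<iota> ` VV D M" using linearization_zero[OF ops defines_zero_add[OF D] l] vs_ops_zero(1)[OF ops] by (metis imageI)
  show "x + y \<in> \<iota> ` VV D M" if "x \<in> \<iota> ` VV D M" "y \<in> \<iota> ` VV D M" for x y
    using that l vs_ops_add(1)[OF ops] unfolding linearization_def by (smt (verit) image_iff)
  show "pmscale k x \<in> \<iota> ` VV D M" if "x \<in> \<iota> ` VV D M" for k x
    using that l vs_ops_smult(1)[OF ops] unfolding linearization_def by (smt (verit) image_iff)
qed

lemma linearization_lincomb:
  assumes D: "defines_infinite_vs D M" and l: "linearization D M \<iota>" and x: "\<And>n. n < m \<Longrightarrow> x n \<in> VV D M"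
  shows "\<iota> (lincomb D M k x m) = (\<Sum>n<m. pmscale (k n) (\<iota> (x n)))"
  using x
proof (induction m)
  case 0
  show ?case using linearization_zero[OF defines_vs_ops[OF D] defines_zero_add[OF D] l] by simp
next
  case (Suc m)
  note ops = defines_vs_ops[OF D]
  have a: "lincomb D M k x m \<in> VV D M" by (rule lincomb_in_VV[OF ops]) (use Suc.prems in auto)
  have b: "x m \<in> VV D M" using Suc.prems by simp
  have "\<iota> (lincomb D M k x m \<oplus>\<^bsub>vs D M\<^esub> (k m \<odot>\<^bsub>vs D M\<^esub> x m)) = \<iota> (lincomb D M k x m) + \<iota> (k m \<odot>\<^bsub>vs D M\<^esub> x m)"
    using l a vs_ops_smult(1)[OF ops b] unfolding linearization_def by blast
  also have "\<iota> (k m \<odot>\<^bsub>vs D M\<^esub> x m) = pmscale (k m) (\<iota> (x m))" using l b unfolding linearization_def by blast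
  finally show ?case using Suc by simp
qed

lemma lin_op_endo:
  assumes D: "defines_infinite_vs D M" and l: "linearization D M \<iota>" and \<theta>: "vs_endo D M \<theta>"
  shows "E.endo_on (\<iota> ` VV D M) (lin_op D M \<iota> \<theta>)"
  unfolding E.endo_on_def
proof (intro conjI ballI allI)
  note ops = defines_vs_ops[OF D]
  show "E.subspace (\<iota> ` VV D M)" by (rule linearization_subspace[OF D l])
  fix x assume "x \<in> \<iota> ` VV D M"
  then obtain u where u: "u \<in> VV D M" "x = \<iota> u" by auto
  have \<theta>u: "\<theta> u \<in> VV D M" using \<theta> u by (simp add: vs_endo_def)
  show "lin_op D M \<iota> \<theta> x \<in> \<iota> ` VV D M" using lin_op_eq[OF l u(1)] u(2) \<theta>u by simp
  fix k
  have "pmscale k x = \<iota> (k \<odot>\<^bsub>vs D M\<^esub> u)" using l u by (simp add: linearization_def)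
  then have "lin_op D M \<iota> \<theta> (pmscale k x) = \<iota> (\<theta> (k \<odot>\<^bsub>vs D M\<^esub> u))"
    using lin_op_eq[OF l vs_ops_smult(1)[OF ops u(1)]] by simp
  also have "\<dots> = pmscale k (lin_op D M \<iota> \<theta> x)"
    using \<theta> u l \<theta>u lin_op_eq[OF l u(1), of \<theta>] by (simp add: vs_endo_def linearization_def)
  finally show "lin_op D M \<iota> \<theta> (pmscale k x) = pmscale k (lin_op D M \<iota> \<theta> x)" .
next
  note ops = defines_vs_ops[OF D]
  fix x y assume "x \<in> \<iota> ` VV D M" "y \<in> \<iota> ` VV D M"
  then obtain u v where u: "u \<in> VV D M" "x = \<iota> u" and v: "v \<in> VV D M" "y = \<iota> v" by auto
  have \<theta>u: "\<theta> u \<in> VV D M" "\<theta> v \<in> VV D M" using \<theta> u v by (simp_all add: vs_endo_def)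
  have "x + y = \<iota> (u \<oplus>\<^bsub>vs D M\<^esub> v)" using l u v by (simp add: linearization_def)
  then have "lin_op D M \<iota> \<theta> (x + y) = \<iota> (\<theta> (u \<oplus>\<^bsub>vs D M\<^esub> v))"
    using lin_op_eq[OF l vs_ops_add(1)[OF ops u(1) v(1)]] by simp
  also have "\<theta> (u \<oplus>\<^bsub>vs D M\<^esub> v) = \<theta> u \<oplus>\<^bsub>vs D M\<^esub> \<theta> v" using \<theta> u v by (simp add: vs_endo_def)
  also have "\<iota> \<dots> = \<iota> (\<theta> u) + \<iota> (\<theta> v)" using l \<theta>u by (simp add: linearization_def)
  finally show "lin_op D M \<iota> \<theta> (x + y) = lin_op D M \<iota> \<theta> x + lin_op D M \<iota> \<theta> y"
    using lin_op_eq[OF l u(1), of \<theta>] lin_op_eq[OF l v(1), of \<theta>] u(2) v(2) by simp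
qed

lemma linearization_poly_endo:
  assumes D: "defines_infinite_vs D M" and l: "linearization D M \<iota>" and \<theta>: "vs_endo D M \<theta>" and x: "x \<in> VV D M"
  shows "\<iota> (poly_endo D M \<rho> \<theta> x) = E.pact \<rho> (lin_op D M \<iota> \<theta>) (\<iota> x)"
proof -
  have \<theta>V: "\<theta> y \<in> VV D M" if "y \<in> VV D M" for y using \<theta> that by (simp add: vs_endo_def)
  have pow: "(\<theta> ^^ n) x \<in> VV D M" for n by (induction n) (use x \<theta>V in auto)
  have e: "poly_endo D M \<rho> \<theta> x = lincomb D M (Polynomial.coeff \<rho>) (\<lambda>i. (\<theta> ^^ i) x) (Suc (Polynomial.degree \<rho>))"
    by (rule poly_endo_lincomb[OF D _ x]) (rule \<theta>V)
  have \<iota>pow: "\<iota> ((\<theta> ^^ n) x) = (lin_op D M \<iota> \<theta> ^^ n) (\<iota> x)" for n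
  proof (induction n)
    case (Suc n)
    then show ?case using lin_op_eq[OF l pow[of n], of \<theta>] by simp
  qed simp
  have "\<iota> (poly_endo D M \<rho> \<theta> x)
    = (\<Sum>n<Suc (Polynomial.degree \<rho>). pmscale (Polynomial.coeff \<rho> n) (\<iota> ((\<theta> ^^ n) x)))"
    unfolding e by (rule linearization_lincomb[OF D l pow])
  then show ?thesis by (simp only: \<iota>pow E.pact_def lessThan_Suc_atMost)
qed

lemma poly_endo_in_VV:
  assumes D: "defines_infinite_vs D M" and \<theta>: "vs_endo D M \<theta>" and x: "x \<in> VV D M"
  shows "poly_endo D M \<rho> \<theta> x \<in> VV D M"
proof -
  have \<theta>V: "\<theta> y \<in> VV D M" if "y \<in> VV D M" for y using \<theta> that by (simp add: vs_endo_def)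
  have pow: "(\<theta> ^^ n) x \<in> VV D M" for n by (induction n) (use x \<theta>V in auto)
  have e: "poly_endo D M \<rho> \<theta> x = lincomb D M (Polynomial.coeff \<rho>) (\<lambda>i. (\<theta> ^^ i) x) (Suc (Polynomial.degree \<rho>))"
    by (rule poly_endo_lincomb[OF D _ x]) (rule \<theta>V)
  show ?thesis unfolding e by (rule lincomb_in_VV[OF defines_vs_ops[OF D] pow])
qed

lemma linearization_poly_zero:
  assumes D: "defines_infinite_vs D M" and l: "linearization D M \<iota>" and \<theta>: "vs_endo D M \<theta>" and x: "x \<in> VV D M"
  shows "poly_endo D M \<rho> \<theta> x = \<zero>\<^bsub>vs D M\<^esub> \<longleftrightarrow> E.pact \<rho> (lin_op D M \<iota> \<theta>) (\<iota> x) = 0"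
proof -
  note ops = defines_vs_ops[OF D]
  have "poly_endo D M \<rho> \<theta> x = \<zero>\<^bsub>vs D M\<^esub> \<longleftrightarrow> \<iota> (poly_endo D M \<rho> \<theta> x) = \<iota> \<zero>\<^bsub>vs D M\<^esub>"
    using l poly_endo_in_VV[OF D \<theta> x] vs_ops_zero(1)[OF ops] unfolding linearization_def by (metis inj_onD)
  then show ?thesis
    unfolding linearization_poly_endo[OF D l \<theta> x] linearization_zero[OF ops defines_zero_add[OF D] l] .
qed

lemma C_endo_iff_C_op:
  assumes D: "defines_infinite_vs D M" and l: "linearization D M \<iota>" and C: "kernel_config C"
  shows "C_endo D M C \<theta> \<longleftrightarrow> vs_endo D M \<theta> \<and> E.C_op (config_poly C) (fst C) (\<iota> ` VV D M) (lin_op D M \<iota> \<theta>)"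
proof (cases "vs_endo D M \<theta>")
  case False
  then show ?thesis by (simp add: C_endo_def)
next
  case \<theta>: True
  note T = lin_op_endo[OF D l \<theta>]
  note zero = linearization_poly_zero[OF D l \<theta>]
  show ?thesis
  proof (cases "snd C = \<infinity>")
    case True
    have mult: "E.pact (f ^ (k + 1)) (lin_op D M \<iota> \<theta>) (\<iota> x) = 0"
      if "x \<in> VV D M" "E.pact (f ^ k) (lin_op D M \<iota> \<theta>) (\<iota> x) = 0" for f k x
      using E.pact_mult[OF T, of "\<iota> x" f "f ^ k"] that E.pact_zero[OF T] by simp
    have "Ker_poly D M (f ^ k) \<theta> = Ker_poly D M (f ^ (k + 1)) \<theta> \<longleftrightarrow>
      (\<forall>x\<in>\<iota> ` VV D M. E.pact (f ^ Suc k) (lin_op D M \<iota> \<theta>) x = 0 \<longrightarrow> E.pact (f ^ k) (lin_op D M \<iota> \<theta>) x = 0)" for f k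
    proof -
      have "Ker_poly D M (f ^ k) \<theta> = Ker_poly D M (f ^ (k + 1)) \<theta> \<longleftrightarrow>
        (\<forall>x\<in>VV D M. E.pact (f ^ k) (lin_op D M \<iota> \<theta>) (\<iota> x) = 0 \<longleftrightarrow> E.pact (f ^ (k + 1)) (lin_op D M \<iota> \<theta>) (\<iota> x) = 0)"
        unfolding Ker_poly_def set_eq_iff mem_Collect_eq using zero by blast
      then show ?thesis using mult by auto
    qed
    then show ?thesis using \<theta> T True by (auto simp: C_endo_def E.C_op_def config_poly_def)
  next
    case False
    have cp: "config_poly C = MiPo C" using False unfolding config_poly_def by (rule if_not_P)
    have fin: "snd C < \<infinity>" using False by (simp add: less_le)
    note cm = config_mod_config_poly[OF C]
    have "C_endo D M C \<theta> \<longleftrightarrow> (\<forall>x\<in>VV D M. poly_endo D M (MiPo C) \<theta> x = \<zero>\<^bsub>vs D M\<^esub>)"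
      using \<theta> fin False unfolding C_endo_def by blast
    also have "\<dots> \<longleftrightarrow> (\<forall>x\<in>\<iota> ` VV D M. E.pact (config_poly C) (lin_op D M \<iota> \<theta>) x = 0)"
      using zero unfolding cp by auto
    also have "\<dots> \<longleftrightarrow> E.C_op (config_poly C) (fst C) (\<iota> ` VV D M) (lin_op D M \<iota> \<theta>)"
    proof
      assume a: "\<forall>x\<in>\<iota> ` VV D M. E.pact (config_poly C) (lin_op D M \<iota> \<theta>) x = 0"
      have "config_poly C \<noteq> 0"
      proof -
        have "f \<noteq> 0" if "f \<in> kc_support C" for f using that monic_irr_nz by (auto simp: kc_support_def)
        moreover have "finite (kc_support C)" using C False by (auto simp: kernel_config_def)
        ultimately show ?thesis unfolding cp MiPo_def by simp
      qed
      then show "E.C_op (config_poly C) (fst C) (\<iota> ` VV D M) (lin_op D M \<iota> \<theta>)"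
        using E.C_op_algebraic[OF cm _ T] a by blast
    qed (simp add: E.C_op_def)
    finally show ?thesis using \<theta> by simp
  qed
qed

lemma ex_endo_of_operator:
  assumes D: "defines_infinite_vs D M" and l: "linearization D M \<iota>" and T: "E.endo_on (\<iota> ` VV D M) T"
  shows "\<exists>\<theta>. vs_endo D M \<theta> \<and> (\<forall>x\<in>VV D M. \<iota> (\<theta> x) = T (\<iota> x)) \<and> (\<forall>e\<in>\<iota> ` VV D M. lin_op D M \<iota> \<theta> e = T e)"
proof -
  note ops = defines_vs_ops[OF D]
  define \<theta> where "\<theta> x = inv_into (VV D M) \<iota> (T (\<iota> x))" for x
  have Tin: "T (\<iota> x) \<in> \<iota> ` VV D M" if "x \<in> VV D M" for x using E.endo_onD(2)[OF T] that by simp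
  have \<theta>in: "\<theta> x \<in> VV D M" and \<iota>\<theta>: "\<iota> (\<theta> x) = T (\<iota> x)" if "x \<in> VV D M" for x
    using Tin[OF that] unfolding \<theta>_def by (auto intro: inv_into_into f_inv_into_f)
  have inj: "x = y" if "x \<in> VV D M" "y \<in> VV D M" "\<iota> x = \<iota> y" for x y
    using l that unfolding linearization_def by (metis inj_onD)
  have "vs_endo D M \<theta>"
    unfolding vs_endo_def
  proof (intro conjI ballI allI)
    fix x assume x: "x \<in> VV D M"
    show "\<theta> x \<in> VV D M" by (rule \<theta>in[OF x])
    show "\<theta> (a \<odot>\<^bsub>vs D M\<^esub> x) = a \<odot>\<^bsub>vs D M\<^esub> \<theta> x" for a
    proof (rule inj)
      show "\<iota> (\<theta> (a \<odot>\<^bsub>vs D M\<^esub> x)) = \<iota> (a \<odot>\<^bsub>vs D M\<^esub> \<theta> x)"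
        using l x \<theta>in[OF x] \<iota>\<theta>[OF x] \<iota>\<theta>[OF vs_ops_smult(1)[OF ops x]] E.endo_onD(4)[OF T, of "\<iota> x" a]
        by (simp add: linearization_def)
    qed (auto intro: vs_ops_smult(1)[OF ops] \<theta>in x)
    fix y assume y: "y \<in> VV D M"
    show "\<theta> (x \<oplus>\<^bsub>vs D M\<^esub> y) = \<theta> x \<oplus>\<^bsub>vs D M\<^esub> \<theta> y"
    proof (rule inj)
      show "\<iota> (\<theta> (x \<oplus>\<^bsub>vs D M\<^esub> y)) = \<iota> (\<theta> x \<oplus>\<^bsub>vs D M\<^esub> \<theta> y)"
        using l x y \<theta>in[OF x] \<theta>in[OF y] \<iota>\<theta>[OF x] \<iota>\<theta>[OF y] \<iota>\<theta>[OF vs_ops_add(1)[OF ops x y]]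
          E.endo_onD(3)[OF T, of "\<iota> x" "\<iota> y"]
        by (simp add: linearization_def)
    qed (auto intro: vs_ops_add(1)[OF ops] \<theta>in x y)
  qed
  moreover have "lin_op D M \<iota> \<theta> e = T e" if "e \<in> \<iota> ` VV D M" for e
    using that lin_op_eq[OF l] \<iota>\<theta> by auto
  ultimately show ?thesis using \<iota>\<theta> by blast
qed

section \<open>Embeddings from asymptotic information\<close>

lemma asymp_elem_eqI:
  assumes a: "asymp_elem L F g N P" and "x \<in> dom N" "y \<in> dom N" and e: "eventually (\<lambda>i. g i x = g i y) F"
  shows "x = y"
proof (rule ccontr)
  assume "x \<noteq> y"
  then have "eventually (\<lambda>i. g i x \<noteq> g i y) F" using asymp_elem_neq[OF a] assms by blast
  with e have "eventually (\<lambda>i. False) F" by eventually_elim simp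
  then show False using a by (simp add: asymp_elem_def trivial_limit_def)
qed

lemma asymp_elem_fun:
  assumes a: "asymp_elem L F g N P" and N: "structure_of L N" and f: "f \<in> Funs L" and ys: "ys \<in> tuples N (farity L f)"
  shows "eventually (\<lambda>i. g i (funI N f ys) = funI P f (map (g i) ys)) F"
proof -
  obtain d where d: "d \<in> dom N" using N by (auto simp: structure_of_def)
  let ?e = "\<lambda>n. if n < length ys then ys ! n else d"
  let ?t = "Fn f (map Vr [0..<length ys])"
  have r: "range ?e \<subseteq> dom N" using ys d by (auto simp: tuples_def)
  have t: "trm_of L ?t" using f ys by (auto simp: tuples_def list_all_iff)
  have v: "map (val N ?e) (map Vr [0..<length ys]) = ys" by (rule nth_equalityI) auto
  have w: "map (val P (g i \<circ> ?e)) (map Vr [0..<length ys]) = map (g i) ys" for i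
    by (rule nth_equalityI) auto
  show ?thesis using asymp_elem_val[OF a N t r] unfolding val.simps v w .
qed

lemma asymp_elem_rel:
  assumes a: "asymp_elem L F g N P" and N: "structure_of L N" and r: "r \<in> Rels L" and ys: "ys \<in> tuples N (rarity L r)"
  shows "relI N r ys \<longleftrightarrow> eventually (\<lambda>i. relI P r (map (g i) ys)) F"
proof -
  obtain d where d: "d \<in> dom N" using N by (auto simp: structure_of_def)
  let ?e = "\<lambda>n. if n < length ys then ys ! n else d"
  let ?t = "Rel r (map Vr [0..<length ys])"
  have rg: "range ?e \<subseteq> dom N" using ys d by (auto simp: tuples_def)
  have t: "form_of L ?t" using r ys by (auto simp: tuples_def)
  have v: "map (val N ?e) (map Vr [0..<length ys]) = ys" by (rule nth_equalityI) auto
  have w: "map (val P (g i \<circ> ?e)) (map Vr [0..<length ys]) = map (g i) ys" for i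
    by (rule nth_equalityI) auto
  show ?thesis using asymp_elem_iff[OF a t rg] unfolding sat.simps v w .
qed

text \<open>
  Atomic formulas are decided in \<open>N\<close> by their asymptotic behaviour, so it suffices to
  check that \<open>k\<close> is an embedding after applying almost all of the maps \<open>g i\<close>.
\<close>

lemma embedding_from_asymp:
  assumes a: "asymp_elem L F g N P" and N: "structure_of L N" and Q: "structure_of L Q"
    and k: "\<And>a. a \<in> dom Q \<Longrightarrow> k a \<in> dom N"
    and funs: "\<And>f xs. f \<in> Funs L \<Longrightarrow> xs \<in> tuples Q (farity L f) \<Longrightarrow>
      eventually (\<lambda>i. g i (k (funI Q f xs)) = funI P f (map (g i) (map k xs))) F"
    and rels: "\<And>r xs. r \<in> Rels L \<Longrightarrow> xs \<in> tuples Q (rarity L r) \<Longrightarrow>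
      eventually (\<lambda>i. relI P r (map (g i) (map k xs)) \<longleftrightarrow> relI Q r xs) F"
    and neq: "\<And>a b. a \<in> dom Q \<Longrightarrow> b \<in> dom Q \<Longrightarrow> a \<noteq> b \<Longrightarrow> eventually (\<lambda>i. g i (k a) \<noteq> g i (k b)) F"
  shows "embedding L Q N k"
  unfolding embedding_def
proof (intro conjI ballI)
  have bot: "F \<noteq> bot" using a by (simp add: asymp_elem_def)
  have kt: "map k xs \<in> tuples N n" if "xs \<in> tuples Q n" for xs n using that k by (auto simp: tuples_def)
  show "k ` dom Q \<subseteq> dom N" using k by auto
  show "inj_on k (dom Q)"
  proof (rule inj_onI, rule ccontr)
    fix x y assume "x \<in> dom Q" "y \<in> dom Q" "k x = k y" "x \<noteq> y"
    then have "eventually (\<lambda>i. False) F" using neq[of x y] by simp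
    then show False using bot by (simp add: trivial_limit_def)
  qed
  fix f xs assume f: "f \<in> Funs L" and xs: "xs \<in> tuples Q (farity L f)"
  show "k (funI Q f xs) = funI N f (map k xs)"
  proof (rule asymp_elem_eqI[OF a])
    show "k (funI Q f xs) \<in> dom N" using Q f xs k by (auto simp: structure_of_def)
    show "funI N f (map k xs) \<in> dom N" using N f kt[OF xs] by (auto simp: structure_of_def)
    show "eventually (\<lambda>i. g i (k (funI Q f xs)) = g i (funI N f (map k xs))) F"
      using funs[OF f xs] asymp_elem_fun[OF a N f kt[OF xs]] by eventually_elim simp
  qed
next
  have bot: "F \<noteq> bot" using a by (simp add: asymp_elem_def)
  fix r xs assume r: "r \<in> Rels L" and xs: "xs \<in> tuples Q (rarity L r)"
  have "map k xs \<in> tuples N (rarity L r)" using xs k by (auto simp: tuples_def)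
  note iff = asymp_elem_rel[OF a N r this]
  show "relI Q r xs \<longleftrightarrow> relI N r (map k xs)"
  proof
    assume "relI Q r xs"
    then show "relI N r (map k xs)" using rels[OF r xs] iff by simp
  next
    assume "relI N r (map k xs)"
    then have "eventually (\<lambda>i. relI P r (map (g i) (map k xs))) F" using iff by simp
    then have "eventually (\<lambda>i. relI Q r xs) F" using rels[OF r xs] by eventually_elim simp
    then show "relI Q r xs" using bot by (simp add: eventually_const_iff)
  qed
qed

section \<open>Existential closedness and finite sets of facts\<close>

lemma sat_foldr_Ex:
  "sat M e (foldr Ex ns \<chi>) \<longleftrightarrow>
    (\<exists>e'. (\<forall>n. n \<notin> set ns \<longrightarrow> e' n = e n) \<and> (\<forall>n\<in>set ns. e' n \<in> dom M) \<and> sat M e' \<chi>)"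
proof (induction ns arbitrary: e)
  case Nil
  have "e' = e" if "\<forall>n. e' n = e n" for e' using that by auto
  then show ?case by auto
next
  case (Cons n ns)
  show ?case
  proof
    assume "sat M e (foldr Ex (n # ns) \<chi>)"
    then obtain a where a: "a \<in> dom M" "sat M (e(n := a)) (foldr Ex ns \<chi>)" by auto
    then obtain e' where e': "\<And>m. m \<notin> set ns \<Longrightarrow> e' m = (e(n := a)) m" "\<forall>m\<in>set ns. e' m \<in> dom M" "sat M e' \<chi>"
      using Cons.IH[of "e(n := a)"] by auto
    have "e' n \<in> dom M" using e'(1,2) a(1) by (cases "n \<in> set ns") auto
    then show "\<exists>e'. (\<forall>m. m \<notin> set (n # ns) \<longrightarrow> e' m = e m) \<and> (\<forall>m\<in>set (n # ns). e' m \<in> dom M) \<and> sat M e' \<chi>"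
      using e' by (intro exI[of _ e']) auto
  next
    assume "\<exists>e'. (\<forall>m. m \<notin> set (n # ns) \<longrightarrow> e' m = e m) \<and> (\<forall>m\<in>set (n # ns). e' m \<in> dom M) \<and> sat M e' \<chi>"
    then obtain e' where e': "\<forall>m. m \<notin> set (n # ns) \<longrightarrow> e' m = e m" "\<forall>m\<in>set (n # ns). e' m \<in> dom M" "sat M e' \<chi>"
      by blast
    then have "sat M (e(n := e' n)) (foldr Ex ns \<chi>)"
      unfolding Cons.IH by (intro exI[of _ e']) auto
    moreover have "e' n \<in> dom M" using e'(2) by simp
    ultimately show "sat M e (foldr Ex (n # ns) \<chi>)" by auto
  qed
qed

lemma existential_prenex: "existential \<phi> \<Longrightarrow> \<exists>ns \<chi>. quantifier_free \<chi> \<and> \<phi> = foldr Ex ns \<chi>"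
proof (induction rule: existential.induct)
  case (1 \<phi>)
  then show ?case by (intro exI[of _ "[]"] exI[of _ \<phi>]) simp
next
  case (2 \<phi> i)
  then obtain ns \<chi> where "quantifier_free \<chi>" "\<phi> = foldr Ex ns \<chi>" by auto
  then show ?case by (intro exI[of _ "i # ns"] exI[of _ \<chi>]) simp
qed

lemma existential_foldr_Ex: "quantifier_free \<chi> \<Longrightarrow> existential (foldr Ex ns \<chi>)"
  by (induction ns) (auto intro: existential.intros)

lemma form_of_foldr_Ex: "form_of L (foldr Ex ns \<chi>) \<longleftrightarrow> form_of L \<chi>"
  by (induction ns) auto

lemma fv_foldr_Ex: "fv (foldr Ex ns \<chi>) = fv \<chi> - set ns"
  by (induction ns) auto

text \<open>
  The diagram of a structure, as statements about its elements: a value of a function, the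
  truth value of a relation, and the difference of two elements.
\<close>

datatype ('f, 'r, 'a) fact = FunFact 'f "'a list" | RelFact 'r "'a list" | NeqFact 'a 'a

primrec valid_fact :: "('f, 'r) lang \<Rightarrow> ('f, 'r, 'a) struct \<Rightarrow> ('f, 'r, 'a) fact \<Rightarrow> bool" where
  "valid_fact L N (FunFact f xs) \<longleftrightarrow> f \<in> Funs L \<and> xs \<in> tuples N (farity L f)"
| "valid_fact L N (RelFact r xs) \<longleftrightarrow> r \<in> Rels L \<and> xs \<in> tuples N (rarity L r)"
| "valid_fact L N (NeqFact a b) \<longleftrightarrow> a \<in> dom N \<and> b \<in> dom N \<and> a \<noteq> b"

primrec fact_holds :: "('f, 'r, 'a) struct \<Rightarrow> ('f, 'r, 'b) struct \<Rightarrow> ('a \<Rightarrow> 'b) \<Rightarrow> ('f, 'r, 'a) fact \<Rightarrow> bool" where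
  "fact_holds N M g (FunFact f xs) \<longleftrightarrow> g (funI N f xs) = funI M f (map g xs)"
| "fact_holds N M g (RelFact r xs) \<longleftrightarrow> (relI M r (map g xs) \<longleftrightarrow> relI N r xs)"
| "fact_holds N M g (NeqFact a b) \<longleftrightarrow> g a \<noteq> g b"

primrec fact_elems :: "('f, 'r, 'a) struct \<Rightarrow> ('f, 'r, 'a) fact \<Rightarrow> 'a set" where
  "fact_elems N (FunFact f xs) = insert (funI N f xs) (set xs)"
| "fact_elems N (RelFact r xs) = set xs"
| "fact_elems N (NeqFact a b) = {a, b}"

primrec fact_form :: "('f, 'r, 'a) struct \<Rightarrow> ('a \<Rightarrow> nat) \<Rightarrow> ('f, 'r, 'a) fact \<Rightarrow> ('f, 'r) form" where
  "fact_form N idx (FunFact f xs) = Equal (Vr (idx (funI N f xs))) (Fn f (map (\<lambda>x. Vr (idx x)) xs))"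
| "fact_form N idx (RelFact r xs) =
    (if relI N r xs then Rel r (map (\<lambda>x. Vr (idx x)) xs) else Neg (Rel r (map (\<lambda>x. Vr (idx x)) xs)))"
| "fact_form N idx (NeqFact a b) = Neg (Equal (Vr (idx a)) (Vr (idx b)))"

lemma sat_fact_form:
  assumes "\<And>b. b \<in> fact_elems N s \<Longrightarrow> e (idx b) = g b"
  shows "sat M e (fact_form N idx s) \<longleftrightarrow> fact_holds N M g s"
proof (cases s)
  case (FunFact f xs)
  then have "map (val M e) (map (\<lambda>x. Vr (idx x)) xs) = map g xs" using assms by auto
  moreover have "e (idx (funI N f xs)) = g (funI N f xs)" using assms FunFact by simp
  ultimately show ?thesis unfolding FunFact by (simp only: fact_form.simps sat.simps val.simps fact_holds.simps)
next
  case (RelFact r xs)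
  then have "map (val M e) (map (\<lambda>x. Vr (idx x)) xs) = map g xs" using assms by auto
  then have "sat M e (Rel r (map (\<lambda>x. Vr (idx x)) xs)) \<longleftrightarrow> relI M r (map g xs)" by (simp only: sat.simps)
  then show ?thesis unfolding RelFact by simp
next
  case (NeqFact a b)
  then show ?thesis using assms by simp
qed

lemma fact_form_wf:
  assumes "valid_fact L N s"
  shows "form_of L (fact_form N idx s)" "quantifier_free (fact_form N idx s)"
  by (cases s; use assms in \<open>auto simp: tuples_def list_all_iff\<close>)+

lemma sat_foldr_Conj: "sat M e (foldr Conj \<phi>s (Equal (Vr 0) (Vr 0))) \<longleftrightarrow> (\<forall>\<phi>\<in>set \<phi>s. sat M e \<phi>)"
  by (induction \<phi>s) auto

lemma form_of_foldr_Conj: "form_of L (foldr Conj \<phi>s (Equal (Vr 0) (Vr 0))) \<longleftrightarrow> (\<forall>\<phi>\<in>set \<phi>s. form_of L \<phi>)"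
  by (induction \<phi>s) auto

lemma qf_foldr_Conj: "quantifier_free (foldr Conj \<phi>s (Equal (Vr 0) (Vr 0))) \<longleftrightarrow> (\<forall>\<phi>\<in>set \<phi>s. quantifier_free \<phi>)"
  by (induction \<phi>s) auto

text \<open>
  The elements mentioned in the facts become variables; those from \<open>M\<close> remain parameters
  and the others are quantified existentially.
\<close>

lemma ec_in_finite_facts:
  fixes M :: "('f, 'r, 'a) struct" and N :: "('f, 'r, 'b) struct"
  assumes ec: "ec_in L M N" and M: "structure_of L M" and N: "structure_of L N" and h: "embedding L M N h"
    and S: "finite S" "\<And>s. s \<in> S \<Longrightarrow> valid_fact L N s"
  shows "\<exists>g. (\<forall>b. g b \<in> dom M) \<and> (\<forall>a\<in>dom M. g (h a) = a) \<and> (\<forall>s\<in>S. fact_holds N M g s)"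
proof -
  have hd: "h ` dom M \<subseteq> dom N" and hinj: "inj_on h (dom M)" using h by (auto simp: embedding_def)
  define E0 where "E0 = (\<Union>s\<in>S. fact_elems N s)"
  have "finite (fact_elems N s)" for s by (cases s) auto
  then have fin: "finite E0" using S(1) by (simp add: E0_def)
  have "fact_elems N s \<subseteq> dom N" if "valid_fact L N s" for s
    using that N by (cases s) (auto simp: tuples_def structure_of_def)
  then have E0d: "E0 \<subseteq> dom N" using S(2) unfolding E0_def by blast
  \<comment> \<open>\<open>idx\<close> names the elements in question by variables.\<close>
  obtain idx :: "'b \<Rightarrow> nat" where idx: "inj_on idx E0" using finite_imp_inj_to_nat_seg[OF fin] by blast
  obtain a0 where a0: "a0 \<in> dom M" using M by (auto simp: structure_of_def)
  define hi where "hi b = (if b \<in> h ` dom M then inv_into (dom M) h b else a0)" for b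
  have hid: "hi b \<in> dom M" for b using a0 by (auto simp: hi_def intro: inv_into_into)
  have hih: "hi (h a) = a" if "a \<in> dom M" for a using that hinj by (simp add: hi_def)
  have hhi: "h (hi b) = b" if "b \<in> h ` dom M" for b using that by (simp add: hi_def f_inv_into_f)
  define ie where "ie = inv_into E0 idx"
  have ie: "ie (idx b) = b" if "b \<in> E0" for b using that idx by (simp add: ie_def)
  define e where "e n = (if n \<in> idx ` E0 then hi (ie n) else a0)" for n
  obtain ns where ns: "set ns = idx ` (E0 - h ` dom M)" using finite_list[of "idx ` (E0 - h ` dom M)"] fin by auto
  obtain ss where ss: "set ss = S" using finite_list[OF S(1)] by auto
  define \<chi> where "\<chi> = foldr Conj (map (fact_form N idx) ss) (Equal (Vr 0) (Vr 0))"
  have \<chi>: "form_of L \<chi>" "quantifier_free \<chi>"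
    unfolding \<chi>_def form_of_foldr_Conj qf_foldr_Conj by (auto simp: ss intro: fact_form_wf S(2))
  define e1 where "e1 n = (if n \<in> idx ` E0 then ie n else h a0)" for n
  have "fact_holds N N id s" if "valid_fact L N s" for s using that by (cases s) auto
  moreover have e1: "e1 (idx b) = id b" if "s \<in> S" "b \<in> fact_elems N s" for s b
  proof -
    have "b \<in> E0" using that by (auto simp: E0_def)
    then show ?thesis using ie[of b] by (simp add: e1_def)
  qed
  ultimately have "sat N e1 (fact_form N idx s)" if "s \<in> S" for s
    using sat_fact_form[of N s e1 idx id N, OF e1[OF that]] S(2)[OF that] by simp
  then have "sat N e1 \<chi>" unfolding \<chi>_def sat_foldr_Conj by (auto simp: ss)
  moreover have "e1 n = (h \<circ> e) n" if "n \<notin> set ns" for n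
  proof (cases "n \<in> idx ` E0")
    case True
    then obtain b where b: "b \<in> E0" "n = idx b" by auto
    then have "b \<in> h ` dom M" using that ns by auto
    then show ?thesis using b ie hhi by (simp add: e1_def e_def)
  qed (simp add: e1_def e_def)
  moreover have "\<forall>n\<in>set ns. e1 n \<in> dom N" using ns ie E0d by (auto simp: e1_def)
  ultimately have "sat N (h \<circ> e) (foldr Ex ns \<chi>)" unfolding sat_foldr_Ex by blast
  moreover have "range e \<subseteq> dom M" using hid a0 by (auto simp: e_def)
  moreover have "form_of L (foldr Ex ns \<chi>)" "existential (foldr Ex ns \<chi>)"
    using \<chi> by (simp_all add: form_of_foldr_Ex existential_foldr_Ex)
  ultimately have "sat M e (foldr Ex ns \<chi>)" using ec h unfolding ec_in_def by blast
  then obtain e' where e': "\<And>n. n \<notin> set ns \<Longrightarrow> e' n = e n" "\<And>n. n \<in> set ns \<Longrightarrow> e' n \<in> dom M" "sat M e' \<chi>"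
    unfolding sat_foldr_Ex by blast
  define g where "g b = (if b \<in> E0 then e' (idx b) else hi b)" for b
  have e'd: "e' n \<in> dom M" for n using e'(1,2)[of n] \<open>range e \<subseteq> dom M\<close> by (cases "n \<in> set ns") auto
  have "g b \<in> dom M" for b using e'd hid by (simp add: g_def)
  moreover have "g (h a) = a" if a: "a \<in> dom M" for a
  proof (cases "h a \<in> E0")
    case True
    have "idx (h a) \<notin> set ns"
    proof
      assume "idx (h a) \<in> set ns"
      then obtain b where "b \<in> E0" "b \<notin> h ` dom M" "idx (h a) = idx b" using ns by auto
      then show False using idx True a by (auto dest: inj_onD)
    qed
    then show ?thesis using True e'(1) ie[OF True] hih[OF a] by (simp add: g_def e_def)
  qed (simp add: g_def hih[OF a])
  moreover have "fact_holds N M g s" if s: "s \<in> S" for s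
  proof -
    have "sat M e' (fact_form N idx s)" using e'(3) s unfolding \<chi>_def sat_foldr_Conj by (auto simp: ss)
    moreover have "e' (idx b) = g b" if "b \<in> fact_elems N s" for b using that s by (auto simp: g_def E0_def)
    ultimately show ?thesis using sat_fact_form[of N s e' idx g M] by blast
  qed
  ultimately show ?thesis by blast
qed

text \<open>
  An existentially closed structure almost retracts every extension onto itself. The index
  set consists of maps of the type \<open>'u\<close>; the ultrafilter concentrates on those from \<open>N\<close>
  to \<open>M\<close> which are the identity on \<open>M\<close> and preserve a given finite part of the diagram
  of \<open>N\<close>. The map that sends \<open>b\<close> to the evaluation at \<open>b\<close> embeds \<open>N\<close> into the
  ultrapower of \<open>M\<close>.
\<close>

theorem ec_in_asymp:
  fixes M N :: "('f, 'r, 'u) struct"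
  assumes inf: "infinite (UNIV :: 'u set)" and F: "Funs L \<lesssim> (UNIV :: 'u set)" and R: "Rels L \<lesssim> (UNIV :: 'u set)"
    and ec: "ec_in L M N" and M: "structure_of L M" and N: "structure_of L N" and h: "embedding L M N h"
  obtains M2 :: "('f, 'r, 'u) struct" and k and U :: "('u \<Rightarrow> 'u) filter" and g where
    "structure_of L M2" "asymp_elem L U g M2 M" "embedding L N M2 k"
    "\<And>a. a \<in> dom M \<Longrightarrow> eventually (\<lambda>i. g i (k (h a)) = a) U"
proof -
  obtain U :: "('u \<Rightarrow> 'u) filter" where U: "ultrafilter U"
    and ev_base: "eventually (\<lambda>g. (\<forall>b. g b \<in> dom M) \<and> (\<forall>a\<in>dom M. g (h a) = a)) U"
    and ev_fact0: "\<And>s. s \<in> {s. valid_fact L N s} \<Longrightarrow> eventually (\<lambda>g. fact_holds N M g s) U"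
  proof (rule ex_ultrafilter_fip[where V = "{s. valid_fact L N s}"])
    fix S assume S: "finite S" "S \<subseteq> {s. valid_fact L N s}"
    then show "\<exists>g. ((\<forall>b. g b \<in> dom M) \<and> (\<forall>a\<in>dom M. g (h a) = a)) \<and> (\<forall>s\<in>S. fact_holds N M g s)"
      using ec_in_finite_facts[OF ec M N h S(1)] by auto
  qed blast
  have ev_dom: "eventually (\<lambda>i. i b \<in> dom M) U" for b using ev_base by eventually_elim simp
  have ev_h: "eventually (\<lambda>i. i (h a) = a) U" if "a \<in> dom M" for a using ev_base by eventually_elim (use that in simp)
  have ev_fact: "eventually (\<lambda>i. fact_holds N M i s) U" if "valid_fact L N s" for s by (rule ev_fact0) (use that in simp)
  obtain d where d: "d \<in> dom M" using M by (auto simp: structure_of_def)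
  \<comment> \<open>Evaluation at \<open>b\<close>, with a default value where it would leave \<open>M\<close>.\<close>
  define x where "x b = (\<lambda>i :: 'u \<Rightarrow> 'u. if i b \<in> dom M then i b else d)" for b
  have "x ` dom N \<lesssim> (UNIV :: 'u set)" by (rule image_lepoll_of) (rule subset_imp_lepoll, simp)
  then obtain M2 :: "('f, 'r, 'u) struct" and g where M2: "structure_of L M2" "asymp_elem L U g M2 M"
    and g: "\<And>y. y \<in> x ` dom N \<Longrightarrow> \<exists>a\<in>dom M2. eventually (\<lambda>i. g i a = y i) U"
    by (rule small_ultrapower[OF inf F R U M]) (use d in \<open>auto simp: x_def\<close>)
  have "\<forall>b\<in>dom N. \<exists>a\<in>dom M2. eventually (\<lambda>i. g i a = x b i) U" using g by blast
  then obtain k where k: "\<And>b. b \<in> dom N \<Longrightarrow> k b \<in> dom M2" "\<And>b. b \<in> dom N \<Longrightarrow> eventually (\<lambda>i. g i (k b) = x b i) U"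
    by metis
  have gk: "eventually (\<lambda>i. g i (k b) = i b) U" if "b \<in> dom N" for b
    using k(2)[OF that] ev_dom[of b] by eventually_elim (simp add: x_def)
  have gks: "eventually (\<lambda>i. map (g i) (map k xs) = map i xs) U" if "set xs \<subseteq> dom N" for xs
  proof -
    have "eventually (\<lambda>i. \<forall>b\<in>set xs. g i (k b) = i b) U" using that gk by (intro eventually_ball_finite) auto
    then show ?thesis by eventually_elim auto
  qed
  have "embedding L N M2 k"
  proof (rule embedding_from_asymp[OF M2(2,1) N k(1)])
    fix f xs assume f: "f \<in> Funs L" and xs: "xs \<in> tuples N (farity L f)"
    have fx: "funI N f xs \<in> dom N" using N f xs by (auto simp: structure_of_def)
    have xd: "set xs \<subseteq> dom N" using xs by (simp add: tuples_def)
    have "eventually (\<lambda>i. fact_holds N M i (FunFact f xs)) U" by (rule ev_fact) (use f xs in simp)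
    then show "eventually (\<lambda>i. g i (k (funI N f xs)) = funI M f (map (g i) (map k xs))) U"
      using gk[OF fx] gks[OF xd] by eventually_elim (simp only: fact_holds.simps)
  next
    fix r xs assume r: "r \<in> Rels L" and xs: "xs \<in> tuples N (rarity L r)"
    have "eventually (\<lambda>i. fact_holds N M i (RelFact r xs)) U" by (rule ev_fact) (use r xs in simp)
    moreover have "set xs \<subseteq> dom N" using xs by (simp add: tuples_def)
    note gks[OF this]
    ultimately show "eventually (\<lambda>i. relI M r (map (g i) (map k xs)) \<longleftrightarrow> relI N r xs) U"
      by eventually_elim (simp only: fact_holds.simps)
  next
    fix a b assume ab: "a \<in> dom N" "b \<in> dom N" "a \<noteq> b"
    have "eventually (\<lambda>i. fact_holds N M i (NeqFact a b)) U" by (rule ev_fact) (use ab in simp)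
    then show "eventually (\<lambda>i. g i (k a) \<noteq> g i (k b)) U"
      using gk[OF ab(1)] gk[OF ab(2)] by eventually_elim simp
  qed
  moreover have "eventually (\<lambda>i. g i (k (h a)) = a) U" if a: "a \<in> dom M" for a
  proof -
    have "h a \<in> dom N" using h a by (auto simp: embedding_def)
    then show ?thesis using gk[of "h a"] ev_h[OF a] by (auto elim: eventually_elim2)
  qed
  ultimately show thesis using that M2 by blast
qed

section \<open>Large elementary extensions\<close>

lemma lang_theta_lepoll:
  assumes inf: "infinite (UNIV :: 'u set)" and F: "Funs L \<lesssim> (UNIV :: 'u set)" and R: "Rels L \<lesssim> (UNIV :: 'u set)"
  shows "Funs (lang_theta L n) \<lesssim> (UNIV :: 'u set)" "Rels (lang_theta L n) \<lesssim> (UNIV :: 'u set)"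
  using R unfolding lang_theta_def
  by (auto intro!: Un_lepoll_infinite[OF inf] image_lepoll_of F nat_lepoll[OF inf])

lemma lang_V_lepoll:
  assumes inf: "infinite (UNIV :: 'u set)" and F: "Funs L \<lesssim> (UNIV :: 'u set)" and R: "Rels L \<lesssim> (UNIV :: 'u set)"
  shows "Funs (lang_V L n) \<lesssim> (UNIV :: 'u set)" "Rels (lang_V L n) \<lesssim> (UNIV :: 'u set)"
proof -
  have "Inl ` Rels L \<union> {Inr ()} \<lesssim> (UNIV :: 'u set)"
    by (rule Un_lepoll_infinite[OF inf image_lepoll_of[OF R] finite_lepoll_infinite[OF inf]]) simp
  then show "Rels (lang_V L n) \<lesssim> (UNIV :: 'u set)" by (simp add: lang_V_def)
  show "Funs (lang_V L n) \<lesssim> (UNIV :: 'u set)" using F by (simp add: lang_V_def)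
qed

text \<open>
  The hypotheses on the theory refer to models in the type \<open>'u\<close> only; \<open>ty\<close> makes this
  type part of the context.
\<close>

locale definable_vs =
  fixes ty :: "'u itself" and L :: "('f, 'r) lang" and T :: "('f, 'r) form set"
    and D :: "('f, 'r, 'k::field) vs_formulas"
  assumes inf: "infinite (UNIV :: 'u set)"
    and Funs_small: "Funs L \<lesssim> (UNIV :: 'u set)" and Rels_small: "Rels L \<lesssim> (UNIV :: 'u set)"
    and T_theory: "theory_of L T" and mc: "model_complete TYPE('u) L T" and D: "vs_formulas_of L D"
    and defines_vs: "\<And>N :: ('f, 'r, 'u) struct. model_of L T N \<Longrightarrow> defines_infinite_vs D N"
begin

lemma ops: "model_of L T (N :: ('f, 'r, 'u) struct) \<Longrightarrow> vs_ops D N"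
  by (rule defines_vs_ops[OF defines_vs])

lemma elementary:
  "model_of L T (M :: ('f, 'r, 'u) struct) \<Longrightarrow> model_of L T (N :: ('f, 'r, 'u) struct) \<Longrightarrow>
    embedding L M N h \<Longrightarrow> elementary_embedding L M N h"
  using mc unfolding model_complete_def by blast

lemma VV_iff_map:
  fixes N0 :: "('f, 'r, 'u) struct"
  assumes "asymp_elem L (principal {()}) (\<lambda>_. h) N0 N" "model_of L T N0" "set xs \<subseteq> dom N0"
  shows "xs \<in> VV D N0 \<longleftrightarrow> map h xs \<in> VV D N"
proof (cases "length xs = vdim D")
  case True
  then show ?thesis
    using asymp_elem_VV[OF assms(1) D, of xs] assms(3) ops[OF assms(2)]
    by (auto simp: tuples_def vs_ops_def eventually_principal)
next
  case False
  then show ?thesis using VV_len[of xs D N0] VV_len[of "map h xs" D N] by auto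
qed

text \<open>
  Models in other types are reached from those in \<open>'u\<close>: finitely many elements lie in an
  elementary substructure which can be copied into \<open>'u\<close>.
\<close>

lemma unique_vector_transfer:
  fixes N :: "('f, 'r, 'w) struct"
  assumes N: "model_of L T N" and \<psi>: "form_of L \<psi>" "fv \<psi> \<subseteq> {..<length xs + vdim D}" and xs: "set xs \<subseteq> dom N"
    and uniq: "\<And>(N0 :: ('f, 'r, 'u) struct) h xs0. model_of L T N0 \<Longrightarrow>
      asymp_elem L (principal {()}) (\<lambda>_. h) N0 N \<Longrightarrow> set xs0 \<subseteq> dom N0 \<Longrightarrow> map h xs0 = xs \<Longrightarrow>
      \<exists>!z. z \<in> VV D N0 \<and> sat_at N0 \<psi> (xs0 @ z)"
  shows "\<exists>!z. z \<in> VV D N \<and> sat_at N \<psi> (xs @ z)"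
proof -
  have sN: "structure_of L N" using N by (simp add: model_of_def)
  have small: "\<exists>(N0 :: ('f, 'r, 'u) struct) h. model_of L T N0 \<and> asymp_elem L (principal {()}) (\<lambda>_. h) N0 N \<and>
    X' \<subseteq> h ` dom N0" if X': "finite X'" "X' \<subseteq> dom N" for X'
  proof -
    have "(\<lambda>a (_ :: unit). a) ` X' \<lesssim> (UNIV :: 'u set)" by (rule finite_lepoll_infinite[OF inf]) (use X'(1) in simp)
    then obtain N0 :: "('f, 'r, 'u) struct" and g where N0: "structure_of L N0" "asymp_elem L (principal {()}) g N0 N"
      and g: "\<And>x. x \<in> (\<lambda>a (_ :: unit). a) ` X' \<Longrightarrow> \<exists>a\<in>dom N0. eventually (\<lambda>i. g i a = x i) (principal {()})"
      by (rule small_ultrapower[OF inf Funs_small Rels_small ultrafilter_principal sN]) (use X'(2) in auto)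
    have gc: "g = (\<lambda>_. g ())" by (rule ext) simp
    have "model_of L T N0" by (rule asymp_elem_model[OF N0(2) T_theory N N0(1)])
    moreover have "x \<in> g () ` dom N0" if "x \<in> X'" for x
      using g[of "\<lambda>_. x"] that by (auto simp: eventually_principal)
    ultimately show ?thesis using N0(2) gc by (metis subsetI)
  qed
  have lift: "\<exists>ys0. set ys0 \<subseteq> dom N0 \<and> map h ys0 = ys" if "set ys \<subseteq> h ` dom N0"
    for N0 :: "('f, 'r, 'u) struct" and h and ys :: "'w list"
  proof (intro exI[of _ "map (inv_into (dom N0) h) ys"] conjI)
    show "set (map (inv_into (dom N0) h) ys) \<subseteq> dom N0" using that by (auto intro: inv_into_into)
    show "map h (map (inv_into (dom N0) h) ys) = ys" using that by (auto simp: f_inv_into_f intro!: map_idI)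
  qed
  have sat: "sat_at N0 \<psi> (xs0 @ z0) \<longleftrightarrow> sat_at N \<psi> (xs @ map h z0)"
    if "model_of L T N0" "asymp_elem L (principal {()}) (\<lambda>_. h) N0 N" "set xs0 \<subseteq> dom N0" "map h xs0 = xs" "z0 \<in> VV D N0"
    for N0 :: "('f, 'r, 'u) struct" and h xs0 z0
  proof -
    have "length xs0 = length xs" using that(4) by auto
    then have "fv \<psi> \<subseteq> {..<length (xs0 @ z0)}" "set (xs0 @ z0) \<subseteq> dom N0" using VV_len[OF that(5)] that(3) \<psi>(2) by auto
    then show ?thesis
      using asymp_elem_sat_at[OF that(2) \<psi>(1), of "xs0 @ z0"] ops[OF that(1)] that(4)
      by (simp add: vs_ops_def eventually_principal)
  qed
  show ?thesis
  proof (rule ex_ex1I)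
    obtain N0 :: "('f, 'r, 'u) struct" and h where N0: "model_of L T N0" "asymp_elem L (principal {()}) (\<lambda>_. h) N0 N"
      and "set xs \<subseteq> h ` dom N0" using small[of "set xs"] xs by auto
    then obtain xs0 where x0: "set xs0 \<subseteq> dom N0" "map h xs0 = xs" using lift by blast
    obtain z where z: "z \<in> VV D N0" "sat_at N0 \<psi> (xs0 @ z)" using uniq[OF N0 x0] by blast
    have "map h z \<in> VV D N" using VV_iff_map[OF N0(2,1), of z] VV_len[OF z(1)] z(1) by simp
    then show "\<exists>z. z \<in> VV D N \<and> sat_at N \<psi> (xs @ z)" using sat[OF N0 x0 z(1)] z(2) by blast
  next
    fix z z' assume z: "z \<in> VV D N \<and> sat_at N \<psi> (xs @ z)" "z' \<in> VV D N \<and> sat_at N \<psi> (xs @ z')"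
    have "set z \<subseteq> dom N" "set z' \<subseteq> dom N" using z VV_len by blast+
    then obtain N0 :: "('f, 'r, 'u) struct" and h where N0: "model_of L T N0" "asymp_elem L (principal {()}) (\<lambda>_. h) N0 N"
      and h: "set xs \<union> set z \<union> set z' \<subseteq> h ` dom N0" using small[of "set xs \<union> set z \<union> set z'"] xs by auto
    obtain xs0 u u' where x0: "set xs0 \<subseteq> dom N0" "map h xs0 = xs"
      and u: "set u \<subseteq> dom N0" "map h u = z" "set u' \<subseteq> dom N0" "map h u' = z'"
      using lift[of xs h N0] lift[of z h N0] lift[of z' h N0] h by auto
    have V: "u \<in> VV D N0" "u' \<in> VV D N0" using VV_iff_map[OF N0(2,1)] u z by auto
    then have "u = u'" using uniq[OF N0 x0] sat[OF N0 x0 V(1)] sat[OF N0 x0 V(2)] u z by blast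
    then show "z = z'" using u by simp
  qed
qed

lemma vs_ops_model:
  fixes N :: "('f, 'r, 'w) struct"
  assumes N: "model_of L T N"
  shows "vs_ops D N"
  unfolding vs_ops_def
proof (intro conjI ballI allI)
  show "dom N \<noteq> {}" using N by (simp add: model_of_def structure_of_def)
  show "\<exists>!z. z \<in> VV D N \<and> sat_at N (fzero D) z"
    using unique_vector_transfer[OF N, of "fzero D" "[]"] D ops by (simp add: vs_formulas_of_def vs_ops_def)
  fix x assume x: "x \<in> VV D N"
  note xl = VV_len[OF x]
  show "\<exists>!y. y \<in> VV D N \<and> sat_at N (fscale D a) (x @ y)" for a
  proof (rule unique_vector_transfer[OF N])
    have "2 * vdim D = vdim D + vdim D" by simp
    moreover have "fv (fscale D a) \<subseteq> {..<2 * vdim D}" using D by (simp add: vs_formulas_of_def)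
    ultimately show "fv (fscale D a) \<subseteq> {..<length x + vdim D}" using xl by (simp only:)
    fix N0 :: "('f, 'r, 'u) struct" and h x0
    assume N0: "model_of L T N0" "asymp_elem L (principal {()}) (\<lambda>_. h) N0 N" and x0: "set x0 \<subseteq> dom N0" "map h x0 = x"
    have "x0 \<in> VV D N0" using VV_iff_map[OF N0(2,1) x0(1)] x0(2) x by simp
    then show "\<exists>!z. z \<in> VV D N0 \<and> sat_at N0 (fscale D a) (x0 @ z)" using ops[OF N0(1)] by (simp add: vs_ops_def)
  qed (use D xl in \<open>simp_all add: vs_formulas_of_def\<close>)
  fix y assume y: "y \<in> VV D N"
  note yl = VV_len[OF y]
  have "\<exists>!z. z \<in> VV D N \<and> sat_at N (fadd D) ((x @ y) @ z)"
  proof (rule unique_vector_transfer[OF N])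
    have "3 * vdim D = vdim D + vdim D + vdim D" by simp
    moreover have "fv (fadd D) \<subseteq> {..<3 * vdim D}" using D by (simp add: vs_formulas_of_def)
    ultimately show "fv (fadd D) \<subseteq> {..<length (x @ y) + vdim D}" using xl yl by (simp only: length_append)
    fix N0 :: "('f, 'r, 'u) struct" and h xy
    assume N0: "model_of L T N0" "asymp_elem L (principal {()}) (\<lambda>_. h) N0 N" and xy: "set xy \<subseteq> dom N0" "map h xy = x @ y"
    obtain x0 y0 where x0: "xy = x0 @ y0" "map h x0 = x" "map h y0 = y" using xy(2) by (auto simp: map_eq_append_conv)
    have "x0 \<in> VV D N0" "y0 \<in> VV D N0"
      using VV_iff_map[OF N0(2,1), of x0] VV_iff_map[OF N0(2,1), of y0] x0 xy(1) x y by auto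
    then show "\<exists>!z. z \<in> VV D N0 \<and> sat_at N0 (fadd D) (xy @ z)" using ops[OF N0(1)] by (simp add: vs_ops_def x0(1))
  qed (use D xl yl in \<open>simp_all add: vs_formulas_of_def\<close>)
  then show "\<exists>!z. z \<in> VV D N \<and> sat_at N (fadd D) (x @ y @ z)" by simp
qed

text \<open>
  The structure \<open>N2\<close> is a small elementary part of an ultrapower of \<open>N\<close>, taken with
  respect to an ultrafilter on sequences of vectors of \<open>M\<close>. The vector \<open>x n\<close> is the
  \<open>n\<close>-th entry of the sequence, and the ultrafilter is chosen such that nontrivial linear
  combinations of these vectors are almost never equal to a given vector of \<open>M\<close>.
\<close>

theorem large_extension:
  fixes M :: "('f, 'r, 'u) struct" and N :: "('f, 'r + unit, 'w) struct"
  assumes M: "model_of L T M" and N: "structure_of (lang_V L (vdim D)) N" "model_of L T (reduct_V N)"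
    and h: "embedding L M (reduct_V N) h"
  obtains N2 :: "('f, 'r + unit, 'u) struct" and \<pi> and U :: "(nat \<Rightarrow> 'u list) filter" and j and x where
    "structure_of (lang_V L (vdim D)) N2" "asymp_elem (lang_V L (vdim D)) U \<pi> N2 N"
    "model_of L T (reduct_V N2)" "elementary_embedding L M (reduct_V N2) j"
    "\<And>a. a \<in> dom M \<Longrightarrow> eventually (\<lambda>i. \<pi> i (j a) = h a) U"
    "\<And>n. x n \<in> VV D (reduct_V N2)"
    "\<And>m k w. k m \<noteq> 0 \<Longrightarrow> w \<in> VV D M \<Longrightarrow> lincomb D (reduct_V N2) k x (Suc m) \<noteq> map j w"
proof -
  let ?n = "vdim D"
  let ?Nr = "reduct_V N"
  have hd: "h ` dom M \<subseteq> dom N" and hinj: "inj_on h (dom M)" using h by (auto simp: embedding_def)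
  have sM: "structure_of L M" using M by (simp add: model_of_def)
  have dM: "defines_infinite_vs D M" by (rule defines_vs[OF M])
  note oM = ops[OF M]
  obtain \<iota> :: "'u list \<Rightarrow> ('u list \<Rightarrow>\<^sub>0 'k)" where \<iota>: "linearization D M \<iota>" using ex_linearization[OF dM] by blast
  have \<iota>inj: "inj_on \<iota> (VV D M)" using \<iota> by (simp add: linearization_def)
  let ?V = "{(m, k, w). k m \<noteq> (0 :: 'k) \<and> w \<in> VV D M} :: (nat \<times> (nat \<Rightarrow> 'k) \<times> 'u list) set"
  let ?Q = "\<lambda>(m, k, w) i. lincomb D M k i (Suc m) \<noteq> w"
  obtain U :: "(nat \<Rightarrow> 'u list) filter" where U: "ultrafilter U" and evV: "eventually (\<lambda>i. \<forall>n. i n \<in> VV D M) U"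
    and evQ: "\<And>z. z \<in> ?V \<Longrightarrow> eventually (?Q z) U"
  proof (rule ex_ultrafilter_fip[where V = ?V])
    fix Z assume Z: "finite Z" "Z \<subseteq> ?V"
    define Z' where "Z' = (\<lambda>(m, k, w). (m, k, \<iota> w)) ` Z"
    have sub: "E.subspace (\<iota> ` VV D M)" by (rule linearization_subspace[OF dM \<iota>])
    have infV: "infinite (\<iota> ` VV D M)" using dM \<iota>inj by (simp add: defines_infinite_vs_def finite_image_iff)
    have Z': "finite Z'" "\<And>m k w. (m, k, w) \<in> Z' \<Longrightarrow> k m \<noteq> 0" using Z by (auto simp: Z'_def)
    have "\<exists>i'. range i' \<subseteq> \<iota> ` VV D M \<and> (\<forall>(m, k, w)\<in>Z'. (\<Sum>n<Suc m. pmscale (k n) (i' n)) \<noteq> w)"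
      by (rule E.ex_generic_sequence[OF sub infV Z'(1)]) (rule Z'(2))
    then obtain i' where
      i': "range i' \<subseteq> \<iota> ` VV D M" "\<And>z. z \<in> Z' \<Longrightarrow> (case z of (m, k, w) \<Rightarrow> (\<Sum>n<Suc m. pmscale (k n) (i' n)) \<noteq> w)" by blast
    define i where "i n = inv_into (VV D M) \<iota> (i' n)" for n
    have i'V: "i' n \<in> \<iota> ` VV D M" for n using i'(1) by auto
    have iV: "i n \<in> VV D M" and \<iota>i: "\<iota> (i n) = i' n" for n
      using inv_into_into[OF i'V] f_inv_into_f[OF i'V] by (simp_all add: i_def)
    have "?Q z i" if z: "z \<in> Z" for z
    proof -
      obtain m k w where mkw: "z = (m, k, w)" by (cases z)
      have "\<iota> (lincomb D M k i (Suc m)) = (\<Sum>n<Suc m. pmscale (k n) (i' n))"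
        using linearization_lincomb[OF dM \<iota> iV] by (simp only: \<iota>i)
      moreover have "(m, k, \<iota> w) \<in> Z'" using z by (force simp: Z'_def mkw)
      ultimately show ?thesis using i'(2)[of "(m, k, \<iota> w)"] unfolding mkw by (auto simp del: lincomb.simps)
    qed
    then show "\<exists>i. (\<forall>n. i n \<in> VV D M) \<and> (\<forall>z\<in>Z. ?Q z i)" using iV by blast
  qed blast
  have bot: "U \<noteq> bot" using U by (simp add: ultrafilter_def)
  have evL: "eventually (\<lambda>i. lincomb D M k i (Suc m) \<noteq> w) U" if "k m \<noteq> 0" "w \<in> VV D M" for m k w
    using evQ[of "(m, k, w)"] that by simp
  obtain d where d: "d \<in> dom M" using sM by (auto simp: structure_of_def)
  \<comment> \<open>The coordinates of the vectors \<open>x n\<close>: the entry with index \<open>snd p\<close> of the vector with index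
    \<open>fst p\<close>.\<close>
  define c where "c p = (\<lambda>i :: nat \<Rightarrow> 'u list. if i (fst p) \<in> VV D M \<and> snd p < ?n then h (i (fst p) ! snd p) else h d)" for p :: "nat \<times> nat"
  let ?X = "(\<lambda>a _. h a) ` dom M \<union> c ` UNIV"
  have card: "?X \<lesssim> (UNIV :: 'u set)"
  proof (intro Un_lepoll_infinite[OF inf] image_lepoll_of)
    show "dom M \<lesssim> (UNIV :: 'u set)" by (rule subset_imp_lepoll) simp
    have "(UNIV :: nat set) \<times> (UNIV :: nat set) \<lesssim> (UNIV :: 'u set)"
      by (intro prod_lepoll_infinite inf nat_lepoll)
    then show "(UNIV :: (nat \<times> nat) set) \<lesssim> (UNIV :: 'u set)" by simp
  qed
  have Xd: "y i \<in> dom N" if y: "y \<in> ?X" for y i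
  proof -
    have hN: "h b \<in> dom N" if "b \<in> dom M" for b using hd that by auto
    from y consider (1) a where "a \<in> dom M" "y = (\<lambda>_. h a)" | (2) p where "y = c p" by blast
    then show ?thesis
    proof cases
      case (2 p)
      have "i (fst p) ! snd p \<in> dom M" if "i (fst p) \<in> VV D M" "snd p < ?n"
        using VV_len[OF that(1)] that(2) nth_mem[of "snd p" "i (fst p)"] by auto
      then show ?thesis using hN d by (simp add: 2 c_def)
    qed (simp add: hN)
  qed
  obtain N2 :: "('f, 'r + unit, 'u) struct" and \<pi> where N2: "structure_of (lang_V L ?n) N2" "asymp_elem (lang_V L ?n) U \<pi> N2 N"
    and rep: "\<And>y. y \<in> ?X \<Longrightarrow> \<exists>a\<in>dom N2. eventually (\<lambda>i. \<pi> i a = y i) U"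
  proof (rule small_ultrapower[OF inf lang_V_lepoll[OF inf Funs_small Rels_small] U N(1) card])
    show "y i \<in> dom N" if "y \<in> ?X" for y i by (rule Xd[OF that])
  qed blast
  let ?N2r = "reduct_V N2"
  have ar: "asymp_elem L U \<pi> ?N2r ?Nr" by (rule asymp_elem_reduct_V[OF N2(2)])
  have sN2r: "structure_of L ?N2r"
    using N2(1) by (auto simp: structure_of_def reduct_V_def lang_V_def tuples_def)
  have mN2: "model_of L T ?N2r" by (rule asymp_elem_model[OF ar T_theory N(2) sN2r])
  have "\<forall>a\<in>dom M. \<exists>b\<in>dom N2. eventually (\<lambda>i. \<pi> i b = h a) U" using rep[of "\<lambda>_. h _"] by blast
  then obtain j where j: "\<And>a. a \<in> dom M \<Longrightarrow> j a \<in> dom N2" "\<And>a. a \<in> dom M \<Longrightarrow> eventually (\<lambda>i. \<pi> i (j a) = h a) U" by metis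
  have "\<forall>p. \<exists>b\<in>dom N2. eventually (\<lambda>i. \<pi> i b = c p i) U" using rep by blast
  then obtain y where y: "\<And>p. y p \<in> dom N2" "\<And>p. eventually (\<lambda>i. \<pi> i (y p) = c p i) U" by metis
  define x where "x n = map (\<lambda>l. y (n, l)) [0..<?n]" for n
  have xd: "set (x n) \<subseteq> dom N2" "length (x n) = ?n" for n using y(1) by (auto simp: x_def)
  have \<pi>x: "eventually (\<lambda>i. map (\<pi> i) (x n) = map h (i n)) U" for n
  proof -
    have "eventually (\<lambda>i. \<forall>l\<in>{..<?n}. \<pi> i (y (n, l)) = c (n, l) i) U" using y(2) by (intro eventually_ball_finite) auto
    then show ?thesis using evV
    proof eventually_elim
      case (elim i)
      then have "length (i n) = ?n" using VV_len by blast
      then show ?case using elim by (intro nth_equalityI) (auto simp: x_def c_def)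
    qed
  qed
  have \<pi>j: "eventually (\<lambda>i. map (\<pi> i) (map j w) = map h w) U" if "set w \<subseteq> dom M" for w
  proof -
    have "eventually (\<lambda>i. \<forall>a\<in>set w. \<pi> i (j a) = h a) U" using that j(2) by (intro eventually_ball_finite) auto
    then show ?thesis by eventually_elim auto
  qed
  have emb: "embedding L M ?N2r j"
  proof (rule embedding_from_asymp[OF ar sN2r sM])
    show "j a \<in> dom ?N2r" if "a \<in> dom M" for a using j(1)[OF that] by simp
    fix f xs assume f: "f \<in> Funs L" and xs: "xs \<in> tuples M (farity L f)"
    have "funI M f xs \<in> dom M" using sM f xs by (auto simp: structure_of_def)
    moreover have "set xs \<subseteq> dom M" using xs by (simp add: tuples_def)
    moreover have "h (funI M f xs) = funI ?Nr f (map h xs)" using h f xs by (simp add: embedding_def)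
    ultimately show "eventually (\<lambda>i. \<pi> i (j (funI M f xs)) = funI ?Nr f (map (\<pi> i) (map j xs))) U"
      using eventually_conj[OF j(2)[of "funI M f xs"] \<pi>j[of xs]] by (auto elim!: eventually_mono simp del: map_map)
  next
    fix r xs assume r: "r \<in> Rels L" and xs: "xs \<in> tuples M (rarity L r)"
    have "set xs \<subseteq> dom M" using xs by (simp add: tuples_def)
    moreover have "relI M r xs \<longleftrightarrow> relI ?Nr r (map h xs)" using h r xs by (simp add: embedding_def)
    ultimately show "eventually (\<lambda>i. relI ?Nr r (map (\<pi> i) (map j xs)) \<longleftrightarrow> relI M r xs) U"
      using \<pi>j[of xs] by (auto elim!: eventually_mono simp del: map_map)
  next
    fix a b assume ab: "a \<in> dom M" "b \<in> dom M" "a \<noteq> b"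
    then have "h a \<noteq> h b" using hinj by (auto dest: inj_onD)
    then show "eventually (\<lambda>i. \<pi> i (j a) \<noteq> \<pi> i (j b)) U"
      using j(2)[OF ab(1)] j(2)[OF ab(2)] by (auto elim: eventually_elim2)
  qed
  have jel: "elementary_embedding L M ?N2r j" by (rule elementary[OF M mN2 emb])
  \<comment> \<open>Model completeness speaks about the type \<open>'u\<close> and does not apply to \<open>h\<close>, but to \<open>j\<close>.\<close>
  have hel: "elementary_embedding L M ?Nr h"
    unfolding elementary_embedding_def
  proof (intro conjI h allI impI; elim conjE)
    fix \<phi> and e :: "nat \<Rightarrow> 'u" assume \<phi>: "form_of L \<phi>" and e: "range e \<subseteq> dom M"
    have r: "range (j \<circ> e) \<subseteq> dom ?N2r" using e j(1) by auto
    have "eventually (\<lambda>i. \<forall>n\<in>fv \<phi>. \<pi> i (j (e n)) = h (e n)) U"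
      using e j(2) by (intro eventually_ball_finite finite_fv) auto
    then have "eventually (\<lambda>i. sat ?Nr (\<pi> i \<circ> (j \<circ> e)) \<phi> \<longleftrightarrow> sat ?Nr (h \<circ> e) \<phi>) U"
      by eventually_elim (rule sat_cong, simp)
    then have "eventually (\<lambda>i. sat ?Nr (\<pi> i \<circ> (j \<circ> e)) \<phi>) U \<longleftrightarrow> eventually (\<lambda>i. sat ?Nr (h \<circ> e) \<phi>) U"
      by (rule eventually_subst)
    moreover have "sat M e \<phi> \<longleftrightarrow> sat ?N2r (j \<circ> e) \<phi>" using jel \<phi> e unfolding elementary_embedding_def by blast
    ultimately show "sat M e \<phi> \<longleftrightarrow> sat ?Nr (h \<circ> e) \<phi>"
      using asymp_elem_iff[OF ar \<phi> r] bot by (simp add: eventually_const_iff)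
  qed
  note ah = asymp_elem_elementary[OF hel]
  note oN = vs_ops_model[OF N(2)]
  note oN2 = ops[OF mN2]
  have hV: "map h u \<in> VV D ?Nr" if "u \<in> VV D M" for u
    using asymp_elem_VV_ev[OF ah D oM that] by (simp add: eventually_principal)
  have xV: "x n \<in> VV D ?N2r" for n
  proof -
    have "x n \<in> tuples ?N2r ?n" using xd by (simp add: tuples_def)
    moreover have "eventually (\<lambda>i. map (\<pi> i) (x n) \<in> VV D ?Nr) U"
      using \<pi>x[of n] evV by eventually_elim (simp add: hV)
    moreover have "dom ?N2r \<noteq> {}" using oN2 by (simp add: vs_ops_def)
    ultimately show ?thesis using asymp_elem_VV[OF ar D] by blast
  qed
  have indep: "lincomb D ?N2r k x (Suc m) \<noteq> map j w" if k: "k m \<noteq> 0" and w: "w \<in> VV D M" for k m w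
  proof
    assume e: "lincomb D ?N2r k x (Suc m) = map j w"
    have wd: "set w \<subseteq> dom M" using VV_len[OF w] by simp
    have "eventually (\<lambda>i. \<forall>n\<in>{..<Suc m}. map (\<pi> i) (x n) = map h (i n)) U" using \<pi>x by (intro eventually_ball_finite) auto
    with asymp_elem_lincomb[OF ar D oN2 oN, where m = "Suc m" and k = k and x = x, OF xV] \<pi>j[OF wd] evV evL[of k m w, OF k w]
    have "eventually (\<lambda>i. False) U"
    proof eventually_elim
      case (elim i)
      have "map h w = lincomb D ?Nr k (\<lambda>n. map (\<pi> i) (x n)) (Suc m)" using elim(1,2) unfolding e by metis
      also have "\<dots> = lincomb D ?Nr k (\<lambda>n. map h (i n)) (Suc m)" by (rule lincomb_cong) (use elim(5) in auto)
      also have "\<dots> = map h (lincomb D M k i (Suc m))"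
        using asymp_elem_lincomb[OF ah D oM oN, where m = "Suc m" and k = k and x = i] elim(3) by (simp add: eventually_principal del: lincomb.simps)
      finally have "map h w = map h (lincomb D M k i (Suc m))" .
      moreover have "lincomb D M k i (Suc m) \<in> VV D M" by (rule lincomb_in_VV[OF oM]) (use elim(3) in auto)
      then have "set (lincomb D M k i (Suc m)) \<subseteq> dom M" using VV_len by blast
      ultimately have "w = lincomb D M k i (Suc m)" using wd hinj by (metis Un_subset_iff inj_on_map_eq_map inj_on_subset)
      then show False using elim(4) by simp
    qed
    then show False using bot by (simp add: trivial_limit_def)
  qed
  show thesis by (rule that[OF N2 mN2 jel]) (fact j(2) xV indep)+
qed

end

section \<open>Extending the endomorphism\<close>

text \<open>
  The value \<open>0\<close> outside \<open>VV D N\<close> is the one that models of \<open>T\<^sub>\<theta>\<close> require.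
\<close>

definition expand_theta :: "('f, 'r, 'k) vs_formulas \<Rightarrow> ('f, 'r, 'a) struct \<Rightarrow> ('a list \<Rightarrow> 'a list) \<Rightarrow> ('f + nat, 'r, 'a) struct" where
  "expand_theta D N \<theta> = \<lparr> dom = dom N,
     funI = case_sum (funI N) (\<lambda>i xs. (if xs \<in> VV D N then \<theta> xs else \<zero>\<^bsub>vs D N\<^esub>) ! i), relI = relI N \<rparr>"

lemma reduct_expand_theta [simp]: "reduct_theta (expand_theta D N \<theta>) = N"
  by (simp add: reduct_theta_def expand_theta_def comp_def)

lemma theta_expand_theta:
  assumes ops: "vs_ops D N" and \<theta>: "\<And>x. x \<in> VV D N \<Longrightarrow> \<theta> x \<in> VV D N"
  shows "theta (vdim D) (expand_theta D N \<theta>) xs = (if xs \<in> VV D N then \<theta> xs else \<zero>\<^bsub>vs D N\<^esub>)"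
proof -
  have "length (if xs \<in> VV D N then \<theta> xs else \<zero>\<^bsub>vs D N\<^esub>) = vdim D"
    using VV_len[of "\<theta> xs" D N] VV_len[OF vs_ops_zero(1)[OF ops]] \<theta> by auto
  then show ?thesis by (intro nth_equalityI) (auto simp: theta_def expand_theta_def)
qed

lemma linearization_elementary:
  assumes j: "elementary_embedding L M N j" and D: "vs_formulas_of L D" and ops: "vs_ops D M" "vs_ops D N"
    and l: "linearization D N \<iota>"
  shows "linearization D M (\<iota> \<circ> map j)" "x \<in> VV D M \<Longrightarrow> map j x \<in> VV D N"
proof -
  note a = asymp_elem_elementary[OF j]
  have V: "map j x \<in> VV D N" if "x \<in> VV D M" for x
    using asymp_elem_VV_ev[OF a D ops(1) that] by (simp add: eventually_principal)
  then show "x \<in> VV D M \<Longrightarrow> map j x \<in> VV D N" .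
  have inj: "inj_on j (dom M)" using j by (simp add: elementary_embedding_def embedding_def)
  show "linearization D M (\<iota> \<circ> map j)"
    unfolding linearization_def
  proof (intro conjI ballI allI)
    show "inj_on (\<iota> \<circ> map j) (VV D M)"
    proof (rule inj_onI)
      fix x y assume x: "x \<in> VV D M" and y: "y \<in> VV D M" and "(\<iota> \<circ> map j) x = (\<iota> \<circ> map j) y"
      then have "map j x = map j y" using l V unfolding linearization_def by (auto dest: inj_onD)
      moreover have "inj_on j (set x \<union> set y)" using inj VV_len[OF x] VV_len[OF y] by (auto intro: inj_on_subset)
      ultimately show "x = y" by (simp add: inj_on_map_eq_map)
    qed
    fix x assume x: "x \<in> VV D M"
    show "(\<iota> \<circ> map j) (k \<odot>\<^bsub>vs D M\<^esub> x) = pmscale k ((\<iota> \<circ> map j) x)" for k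
      using asymp_elem_smult[OF a D ops x, of k] l V[OF x] by (simp add: linearization_def eventually_principal)
    fix y assume y: "y \<in> VV D M"
    show "(\<iota> \<circ> map j) (x \<oplus>\<^bsub>vs D M\<^esub> y) = (\<iota> \<circ> map j) x + (\<iota> \<circ> map j) y"
      using asymp_elem_add[OF a D ops x y] l V[OF x] V[OF y] by (simp add: linearization_def eventually_principal)
  qed
qed

lemma root_adjoinable_linearization:
  assumes dM: "defines_infinite_vs D M" and l: "linearization D M \<iota>" and \<theta>: "vs_endo D M \<theta>" and w: "w \<in> VV D M"
  shows "E.root_adjoinable mo c (\<iota> ` VV D M) (lin_op D M \<iota> \<theta>) f (\<iota> w) \<longleftrightarrow> c f = \<infinity> \<or>
     (\<exists>k. c f = enat k \<and> mo = 0 \<and> (\<forall>z\<in>VV D M. poly_endo D M (f ^ Suc k) \<theta> z \<noteq> poly_endo D M (f ^ k) \<theta> w)) \<or>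
     (\<exists>k. c f = enat (Suc k) \<and> poly_endo D M (f ^ k) \<theta> w = \<zero>\<^bsub>vs D M\<^esub>)"
proof -
  have "E.pact p (lin_op D M \<iota> \<theta>) (\<iota> z) = E.pact q (lin_op D M \<iota> \<theta>) (\<iota> w) \<longleftrightarrow> poly_endo D M p \<theta> z = poly_endo D M q \<theta> w"
    if z: "z \<in> VV D M" for p q z
  proof -
    have "\<iota> (poly_endo D M p \<theta> z) = \<iota> (poly_endo D M q \<theta> w) \<longleftrightarrow> poly_endo D M p \<theta> z = poly_endo D M q \<theta> w"
      using l poly_endo_in_VV[OF dM \<theta> z, of p] poly_endo_in_VV[OF dM \<theta> w, of q] unfolding linearization_def by (auto dest: inj_onD)
    then show ?thesis unfolding linearization_poly_endo[OF dM l \<theta> z] linearization_poly_endo[OF dM l \<theta> w] .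
  qed
  then show ?thesis unfolding E.root_adjoinable_def linearization_poly_zero[OF dM l \<theta> w] by auto
qed

lemma embedding_reduct_theta:
  assumes "embedding (lang_theta L n) M N h"
  shows "embedding L (reduct_theta M) (reduct_theta N) h"
  using assms unfolding embedding_def lang_theta_def reduct_theta_def tuples_def by force

lemma embedding_reduct_V:
  assumes "embedding (lang_V L n) M N h"
  shows "embedding L (reduct_V M) (reduct_V N) h"
  using assms unfolding embedding_def lang_V_def reduct_V_def tuples_def by force

lemma reduct_expand_V [simp]: "reduct_V (expand_V M A) = M"
  by (simp add: reduct_V_def expand_V_def comp_def)

context definable_vs
begin

text \<open>
  Let \<open>P\<close> be a \<open>C\<close>-endomorphism of the vector space of \<open>N\<close> which extends \<open>\<theta>\<close>.
  Then \<open>(N, P)\<close> is an extension of \<open>(M, \<theta>)\<close> and so asymptotically retracts onto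
  it (\<open>ec_in_asymp\<close>). By this alone the maps respect quantifier-free formulas only; model
  completeness of \<open>T\<close>, applied to the embedding \<open>k\<close> of \<open>N\<close> into an elementary part of
  an ultrapower of \<open>M\<close>, makes them respect all \<open>L\<close>-formulas.
\<close>

theorem extend_endomorphism:
  fixes M\<theta> :: "('f + nat, 'r, 'u) struct" and N :: "('f, 'r, 'u) struct"
    and \<iota> :: "'u list \<Rightarrow> ('u list \<Rightarrow>\<^sub>0 'k)"
  defines "M \<equiv> reduct_theta M\<theta>" and "\<theta> \<equiv> theta (vdim D) M\<theta>"
  assumes C: "kernel_config C" and ec: "ec_model_C_theta TYPE('u) L T D C M\<theta>"
    and N: "model_of L T N" and j: "elementary_embedding L M N j" and l: "linearization D N \<iota>"
    and P: "E.C_op (config_poly C) (fst C) (\<iota> ` VV D N) P"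
    and ext: "\<And>x. x \<in> VV D M \<Longrightarrow> P (\<iota> (map j x)) = \<iota> (map j (\<theta> x))"
  obtains \<theta>s and F :: "('u \<Rightarrow> 'u) filter" and g where "asymp_elem L F g N M"
    "\<And>a. a \<in> dom M \<Longrightarrow> eventually (\<lambda>i. g i (j a) = a) F"
    "\<And>\<rho> x. x \<in> VV D N \<Longrightarrow> poly_endo D N \<rho> \<theta>s x \<in> VV D N \<and> \<iota> (poly_endo D N \<rho> \<theta>s x) = E.pact \<rho> P (\<iota> x)"
    "\<And>\<rho> x. x \<in> VV D N \<Longrightarrow> eventually (\<lambda>i. map (g i) (poly_endo D N \<rho> \<theta>s x) = poly_endo D M \<rho> \<theta> (map (g i) x)) F"
proof -
  let ?n = "vdim D"
  let ?LT = "lang_theta L ?n"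
  have mM: "model_C_theta L T D C M\<theta>" using ec by (simp add: ec_model_C_theta_def)
  then have mT: "model_of L T M" and sM\<theta>: "structure_of ?LT M\<theta>" and \<theta>e: "vs_endo D M \<theta>"
    and \<theta>out: "\<And>x. x \<in> tuples M\<theta> ?n - VV D M \<Longrightarrow> \<theta> x = \<zero>\<^bsub>vs D M\<^esub>"
    by (simp_all add: model_C_theta_def model_theta_def M_def \<theta>_def)
  have dN: "defines_infinite_vs D N" and dM: "defines_infinite_vs D M" using defines_vs N mT by auto
  note oN = ops[OF N] and oM = ops[OF mT]
  have sN: "structure_of L N" using N by (simp add: model_of_def)
  have Pe: "E.endo_on (\<iota> ` VV D N) P" using P by (simp add: E.C_op_def)
  obtain \<theta>1 where \<theta>1: "vs_endo D N \<theta>1" "\<And>x. x \<in> VV D N \<Longrightarrow> \<iota> (\<theta>1 x) = P (\<iota> x)"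
    using ex_endo_of_operator[OF dN l Pe] by blast
  have \<theta>1V: "\<theta>1 x \<in> VV D N" if "x \<in> VV D N" for x using \<theta>1(1) that by (simp add: vs_endo_def)
  define N\<theta> where "N\<theta> = expand_theta D N \<theta>1"
  define \<theta>s where "\<theta>s = theta ?n N\<theta>"
  have rN: "reduct_theta N\<theta> = N" by (simp add: N\<theta>_def)
  have \<theta>s_eq: "\<theta>s x = (if x \<in> VV D N then \<theta>1 x else \<zero>\<^bsub>vs D N\<^esub>)" for x
    unfolding \<theta>s_def N\<theta>_def by (rule theta_expand_theta[OF oN \<theta>1V])
  have \<theta>se: "vs_endo D N \<theta>s"
    using \<theta>1(1) vs_ops_add(1)[OF oN] vs_ops_smult(1)[OF oN] by (simp add: vs_endo_def \<theta>s_eq)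
  have \<theta>sP: "\<iota> (\<theta>s x) = P (\<iota> x)" if "x \<in> VV D N" for x using \<theta>1(2)[OF that] that by (simp add: \<theta>s_eq)
  have lop: "lin_op D N \<iota> \<theta>s e = P e" if "e \<in> \<iota> ` VV D N" for e using that lin_op_eq[OF l] \<theta>sP by auto
  have pc: "E.pact p (lin_op D N \<iota> \<theta>s) e = E.pact p P e" if "e \<in> \<iota> ` VV D N" for p e
    by (rule E.pact_cong[OF Pe lop that])
  have "E.C_op (config_poly C) (fst C) (\<iota> ` VV D N) (lin_op D N \<iota> \<theta>s)"
    using P lin_op_endo[OF dN l \<theta>se] pc unfolding E.C_op_def by simp
  then have Ce: "C_endo D N C \<theta>s" using C_endo_iff_C_op[OF dN l C] \<theta>se by blast
  have tN: "tuples N\<theta> m = tuples N m" for m by (simp add: tuples_def N\<theta>_def expand_theta_def)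
  have sN\<theta>: "structure_of ?LT N\<theta>"
    unfolding structure_of_def
  proof (intro conjI ballI)
    show "dom N\<theta> \<noteq> {}" using sN by (simp add: N\<theta>_def expand_theta_def structure_of_def)
    fix f xs assume f: "f \<in> Funs ?LT" and xs: "xs \<in> tuples N\<theta> (farity ?LT f)"
    show "funI N\<theta> f xs \<in> dom N\<theta>"
    proof (cases f)
      case (Inl f')
      then have "f' \<in> Funs L" "xs \<in> tuples N (farity L f')" using f xs unfolding tN by (auto simp: lang_theta_def)
      then have "funI N f' xs \<in> dom N" using sN by (simp add: structure_of_def)
      then show ?thesis by (simp add: Inl N\<theta>_def expand_theta_def)
    next
      case (Inr l)
      then have "l < ?n" using f by (auto simp: lang_theta_def)
      moreover have "length (\<theta>s xs) = ?n \<and> set (\<theta>s xs) \<subseteq> dom N"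
        using VV_len[of "\<theta>1 xs" D N] VV_len[OF vs_ops_zero(1)[OF oN]] \<theta>1V by (auto simp: \<theta>s_eq)
      moreover have "\<theta>s xs ! l = funI N\<theta> f xs" using \<open>l < ?n\<close> by (simp add: \<theta>s_def theta_def Inr)
      ultimately show ?thesis by (metis nth_mem subsetD rN dom_reduct_theta)
    qed
  qed
  have mN\<theta>: "model_C_theta L T D C N\<theta>"
    unfolding model_C_theta_def model_theta_def rN \<theta>s_def[symmetric]
    using sN\<theta> N \<theta>se Ce by (auto simp: \<theta>s_eq)
  have jV: "map j x \<in> VV D N" if "x \<in> VV D M" for x by (rule linearization_elementary(2)[OF j D oM oN l that])
  have jVr: "x \<in> VV D M" if "map j x \<in> VV D N" "x \<in> tuples M ?n" for x
    using asymp_elem_VV[OF asymp_elem_elementary[OF j] D that(2)] that(1) oM by (simp add: eventually_principal vs_ops_def)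
  have jemb: "embedding L M N j" using j by (simp add: elementary_embedding_def)
  have dMt: "dom M = dom M\<theta>" by (simp add: M_def)
  have j\<theta>: "map j (\<theta> x) = \<theta>s (map j x)" if x: "x \<in> tuples M\<theta> ?n" for x
  proof (cases "x \<in> VV D M")
    case True
    have "\<theta> x \<in> VV D M" using \<theta>e True by (simp add: vs_endo_def)
    then have "map j (\<theta> x) \<in> VV D N" by (rule jV)
    moreover have "\<theta>s (map j x) \<in> VV D N" using jV[OF True] \<theta>1V by (simp add: \<theta>s_eq)
    moreover have "\<iota> (map j (\<theta> x)) = \<iota> (\<theta>s (map j x))" using ext[OF True] \<theta>sP[OF jV[OF True]] by simp
    ultimately show ?thesis using l unfolding linearization_def by (auto dest: inj_onD)
  next
    case False
    have "x \<in> tuples M ?n" using x by (simp add: tuples_def dMt)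
    then have "map j x \<notin> VV D N" using jVr False by blast
    moreover have "map j \<zero>\<^bsub>vs D M\<^esub> = \<zero>\<^bsub>vs D N\<^esub>"
      using asymp_elem_zero[OF asymp_elem_elementary[OF j] D oM oN] by (simp add: eventually_principal)
    ultimately show ?thesis using \<theta>out[of x] x False by (simp add: \<theta>s_eq)
  qed
  have emb: "embedding ?LT M\<theta> N\<theta> j"
    unfolding embedding_def
  proof (intro conjI ballI)
    show "j ` dom M\<theta> \<subseteq> dom N\<theta>" "inj_on j (dom M\<theta>)"
      using jemb by (simp_all add: embedding_def dMt N\<theta>_def expand_theta_def)
    fix f xs assume f: "f \<in> Funs ?LT" and xs: "xs \<in> tuples M\<theta> (farity ?LT f)"
    show "j (funI M\<theta> f xs) = funI N\<theta> f (map j xs)"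
    proof (cases f)
      case (Inl f')
      then have "f' \<in> Funs L" "xs \<in> tuples M (farity L f')" using f xs by (auto simp: lang_theta_def tuples_def dMt)
      then have "j (funI M f' xs) = funI N f' (map j xs)" using jemb by (simp add: embedding_def)
      then show ?thesis by (simp add: Inl M_def reduct_theta_def N\<theta>_def expand_theta_def)
    next
      case (Inr l)
      then have l: "l < ?n" "xs \<in> tuples M\<theta> ?n" using f xs by (auto simp: lang_theta_def)
      have "map j (\<theta> xs) ! l = \<theta>s (map j xs) ! l" by (simp only: j\<theta>[OF l(2)])
      then show ?thesis using l(1) by (simp add: Inr \<theta>_def \<theta>s_def theta_def)
    qed
  next
    fix r xs assume "r \<in> Rels ?LT" "xs \<in> tuples M\<theta> (rarity ?LT r)"
    then have "relI M r xs \<longleftrightarrow> relI N r (map j xs)" using jemb by (simp add: embedding_def lang_theta_def tuples_def dMt)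
    then show "relI M\<theta> r xs \<longleftrightarrow> relI N\<theta> r (map j xs)" by (simp add: M_def reduct_theta_def N\<theta>_def expand_theta_def)
  qed
  have ecN: "ec_in ?LT M\<theta> N\<theta>" using ec mN\<theta> by (simp add: ec_model_C_theta_def)
  note small = lang_theta_lepoll[OF inf Funs_small Rels_small, of ?n]
  obtain M2 :: "('f + nat, 'r, 'u) struct" and k and U :: "('u \<Rightarrow> 'u) filter" and g where
    M2: "structure_of ?LT M2" "asymp_elem ?LT U g M2 M\<theta>" "embedding ?LT N\<theta> M2 k"
    and ret: "\<And>a. a \<in> dom M\<theta> \<Longrightarrow> eventually (\<lambda>i. g i (k (j a)) = a) U"
    by (rule ec_in_asymp[OF inf small ecN sM\<theta> sN\<theta> emb]) blast
  let ?M2r = "reduct_theta M2"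
  have ar: "asymp_elem L U g ?M2r M" unfolding M_def by (rule asymp_elem_reduct_theta[OF M2(2)])
  have sM2r: "structure_of L ?M2r" using M2(1) by (force simp: structure_of_def reduct_theta_def lang_theta_def tuples_def)
  have mM2: "model_of L T ?M2r" by (rule asymp_elem_model[OF ar T_theory mT sM2r])
  have "embedding L N ?M2r k" using embedding_reduct_theta[OF M2(3)] by (simp add: rN)
  then have kel: "elementary_embedding L N ?M2r k" by (rule elementary[OF N mM2])
  have a: "asymp_elem L U (\<lambda>i. g i \<circ> k) N M" by (rule asymp_elem_comp[OF ar kel])
  have comm: "eventually (\<lambda>i. map (g i \<circ> k) (\<theta>s x) = \<theta> (map (g i \<circ> k) x)) U" if x: "x \<in> VV D N" for x
  proof -
    have xt: "x \<in> tuples N\<theta> ?n" using VV_len[OF x] by (simp add: tN, simp add: tuples_def)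
    have kx: "map k x \<in> tuples M2 ?n" using xt M2(3) by (auto simp: embedding_def tuples_def)
    have kl: "k (funI N\<theta> (Inr l) x) = funI M2 (Inr l) (map k x)" if "l < ?n" for l
      using M2(3) that xt by (auto simp: embedding_def lang_theta_def)
    have "eventually (\<lambda>i. g i (funI M2 (Inr l) (map k x)) = funI M\<theta> (Inr l) (map (g i) (map k x))) U" if "l < ?n" for l
      by (rule asymp_elem_fun[OF M2(2,1)]) (use that kx in \<open>auto simp: lang_theta_def\<close>)
    then have "eventually (\<lambda>i. \<forall>l\<in>{..<?n}. g i (funI M2 (Inr l) (map k x)) = funI M\<theta> (Inr l) (map (g i) (map k x))) U"
      by (intro eventually_ball_finite) auto
    then show ?thesis
    proof eventually_elim
      case (elim i)
      show ?case
        using elim kl by (intro nth_equalityI) (auto simp: \<theta>s_def \<theta>_def theta_def)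
    qed
  qed
  have \<theta>sV: "\<And>x. x \<in> VV D N \<Longrightarrow> \<theta>s x \<in> VV D N" using \<theta>se by (simp add: vs_endo_def)
  have \<theta>V: "\<And>x. x \<in> VV D M \<Longrightarrow> \<theta> x \<in> VV D M" using \<theta>e by (simp add: vs_endo_def)
  show thesis
  proof (rule that[of U "\<lambda>i. g i \<circ> k" \<theta>s, OF a])
    show "eventually (\<lambda>i. (g i \<circ> k) (j b) = b) U" if "b \<in> dom M" for b using ret[of b] that dMt by simp
    show "poly_endo D N \<rho> \<theta>s x \<in> VV D N \<and> \<iota> (poly_endo D N \<rho> \<theta>s x) = E.pact \<rho> P (\<iota> x)" if "x \<in> VV D N" for \<rho> x
      using poly_endo_in_VV[OF dN \<theta>se that] linearization_poly_endo[OF dN l \<theta>se that] pc[of "\<iota> x"] that by simp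
    show "eventually (\<lambda>i. map (g i \<circ> k) (poly_endo D N \<rho> \<theta>s x) = poly_endo D M \<rho> \<theta> (map (g i \<circ> k) x)) U"
      if "x \<in> VV D N" for \<rho> x
      by (rule asymp_elem_poly_endo[OF a D dN dM \<theta>sV \<theta>V comm that])
  qed
qed

lemma adapted_basis_of_extension:
  fixes M N :: "('f, 'r, 'u) struct" and \<iota> :: "'u list \<Rightarrow> ('u list \<Rightarrow>\<^sub>0 'k)"
  assumes M: "model_of L T M" and N: "model_of L T N" and j: "elementary_embedding L M N j" and l: "linearization D N \<iota>"
    and x: "\<And>n. x n \<in> VV D N"
    and indep: "\<And>m k w. k m \<noteq> 0 \<Longrightarrow> w \<in> VV D M \<Longrightarrow> lincomb D N k x (Suc m) \<noteq> map j w"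
    and A: "A \<subseteq> VV D N"
  defines "Y0 \<equiv> (\<iota> \<circ> map j) ` VV D M" and "Y \<equiv> \<iota> ` VV D N"
  obtains GA GB where "GA \<subseteq> \<iota> ` A" "GA \<inter> GB = {}" "E.independent (GA \<union> GB)" "infinite (GA \<union> GB)"
    "E.span (GA \<union> GB) \<inter> Y0 \<subseteq> {0}" "Y = {y + g |y g. y \<in> Y0 \<and> g \<in> E.span (GA \<union> GB)}"
    "\<And>a. a \<in> \<iota> ` A \<Longrightarrow> a \<in> {y + g |y g. y \<in> Y0 \<and> g \<in> E.span GA}"
proof -
  note dN = defines_vs[OF N] and dM = defines_vs[OF M]
  note lM = linearization_elementary[OF j D ops[OF M] ops[OF N] l]
  have s0: "E.subspace Y0" unfolding Y0_def by (rule linearization_subspace[OF dM lM(1)])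
  have s: "E.subspace Y" unfolding Y_def by (rule linearization_subspace[OF dN l])
  have sub: "Y0 \<subseteq> Y" using lM(2) by (auto simp: Y0_def Y_def)
  have A': "\<iota> ` A \<subseteq> Y" using A by (auto simp: Y_def)
  have x': "\<iota> (x n) \<in> Y" for n using x by (simp add: Y_def)
  have ind: "(\<Sum>n<Suc m. pmscale (k n) (\<iota> (x n))) \<notin> Y0" if k: "k m \<noteq> 0" for m k
  proof
    assume "(\<Sum>n<Suc m. pmscale (k n) (\<iota> (x n))) \<in> Y0"
    then have "\<iota> (lincomb D N k x (Suc m)) \<in> Y0"
      unfolding linearization_lincomb[OF dN l, where m = "Suc m" and k = k and x = x, OF x] .
    then obtain w where w: "w \<in> VV D M" "\<iota> (lincomb D N k x (Suc m)) = \<iota> (map j w)"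
      unfolding Y0_def by auto
    have "lincomb D N k x (Suc m) \<in> VV D N" by (rule lincomb_in_VV[OF ops[OF N] x])
    then have "lincomb D N k x (Suc m) = map j w"
      using l w lM(2)[OF w(1)] unfolding linearization_def by (blast dest: inj_onD)
    then show False using indep[of k m w, OF k w(1)] by simp
  qed
  show thesis
  proof (rule E.adapted_basis[OF s0 s sub A', where x = "\<lambda>n. \<iota> (x n)"])
    show "\<iota> (x n) \<in> Y" for n by (rule x')
    show "(\<Sum>n<Suc m. pmscale (k n) (\<iota> (x n))) \<notin> Y0" if "k m \<noteq> 0" for m k by (rule ind[of k m, OF that])
  qed (rule that)
qed

text \<open>
  A large elementary extension of \<open>M\<close> has room for the root. The asymptotic retraction
  carries the root to \<open>M\<close>.
\<close>

theorem ec_root_closed: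
  fixes M\<theta> :: "('f + nat, 'r, 'u) struct" and \<iota>0 :: "'u list \<Rightarrow> ('u list \<Rightarrow>\<^sub>0 'k)"
  defines "M \<equiv> reduct_theta M\<theta>" and "\<theta> \<equiv> theta (vdim D) M\<theta>"
  assumes C: "kernel_config C" and ec: "ec_model_C_theta TYPE('u) L T D C M\<theta>" and l0: "linearization D M \<iota>0"
  shows "E.root_closed (fst C) (\<iota>0 ` VV D M) (lin_op D M \<iota>0 \<theta>)"
proof -
  have mM: "model_C_theta L T D C M\<theta>" using ec by (simp add: ec_model_C_theta_def)
  then have M: "model_of L T M" and \<theta>e: "vs_endo D M \<theta>" and Ce: "C_endo D M C \<theta>"
    by (simp_all add: model_C_theta_def model_theta_def M_def \<theta>_def)
  note dM = defines_vs[OF M] and oM = ops[OF M]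
  note cm = config_mod_config_poly[OF C]
  have Cop: "E.C_op (config_poly C) (fst C) (\<iota> ` VV D M) (lin_op D M \<iota> \<theta>)"
    if "linearization D M \<iota>" for \<iota> :: "'u list \<Rightarrow> ('u list \<Rightarrow>\<^sub>0 'k)"
    using C_endo_iff_C_op[OF dM that C] Ce by blast
  show ?thesis
  proof (rule E.root_closedI[OF cm Cop[OF l0]])
    fix f :: "'k poly" and w assume f: "f \<in> monic_irr" and "w \<in> \<iota>0 ` VV D M"
      and adj: "E.root_adjoinable (config_poly C) (fst C) (\<iota>0 ` VV D M) (lin_op D M \<iota>0 \<theta>) f w"
    then obtain u where u: "u \<in> VV D M" "w = \<iota>0 u" by auto
    let ?N = "expand_V M {}"
    have sM: "structure_of L M" using M by (simp add: model_of_def)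
    have sN: "structure_of (lang_V L (vdim D)) ?N"
      using sM by (auto simp: structure_of_def expand_V_def lang_V_def tuples_def)
    have id: "embedding L M (reduct_V ?N) id" by (simp add: embedding_def)
    have mN: "model_of L T (reduct_V ?N)" using M by simp
    obtain N2 :: "('f, 'r + unit, 'u) struct" and \<pi> and U :: "(nat \<Rightarrow> 'u list) filter" and j and x where
      N2: "model_of L T (reduct_V N2)" and j: "elementary_embedding L M (reduct_V N2) j"
      and x: "\<And>n. x n \<in> VV D (reduct_V N2)"
      and ind: "\<And>m k w. k m \<noteq> 0 \<Longrightarrow> w \<in> VV D M \<Longrightarrow> lincomb D (reduct_V N2) k x (Suc m) \<noteq> map j w"
      by (rule large_extension[OF M sN mN id]) blast
    let ?N2 = "reduct_V N2"
    note dN = defines_vs[OF N2]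
    obtain \<iota> :: "'u list \<Rightarrow> ('u list \<Rightarrow>\<^sub>0 'k)" where l: "linearization D ?N2 \<iota>" using ex_linearization[OF dN] by blast
    note l1 = linearization_elementary[OF j D oM ops[OF N2] l]
    let ?\<iota>1 = "\<iota> \<circ> map j"
    let ?Y0 = "?\<iota>1 ` VV D M"
    let ?S = "lin_op D M ?\<iota>1 \<theta>"
    obtain GA GB where G: "E.independent (GA \<union> GB)" "infinite (GA \<union> GB)" "E.span (GA \<union> GB) \<inter> ?Y0 \<subseteq> {0}"
      and Y: "\<iota> ` VV D ?N2 = {y + g |y g. y \<in> ?Y0 \<and> g \<in> E.span (GA \<union> GB)}"
    proof (rule adapted_basis_of_extension[OF M N2 j l x _ empty_subsetI])
      show "lincomb D ?N2 k x (Suc m) \<noteq> map j w" if "k m \<noteq> 0" "w \<in> VV D M" for m k w by (rule ind[of k m w, OF that])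
    qed blast
    have "E.root_adjoinable (config_poly C) (fst C) ?Y0 ?S f (?\<iota>1 u)"
      using adj unfolding u(2) root_adjoinable_linearization[OF dM l0 \<theta>e u(1)] root_adjoinable_linearization[OF dM l1(1) \<theta>e u(1)] .
    from E.root_extension[OF cm Cop[OF l1(1)] G f imageI[OF u(1)] this]
    obtain P where P: "E.C_op (config_poly C) (fst C) (\<iota> ` VV D ?N2) P" "\<And>y. y \<in> ?Y0 \<Longrightarrow> P y = ?S y"
      "\<exists>z\<in>\<iota> ` VV D ?N2. E.pact f P z = ?\<iota>1 u" unfolding Y by blast
    have ext: "P (\<iota> (map j y)) = \<iota> (map j (\<theta> y))" if "y \<in> VV D M" for y
      using P(2)[of "?\<iota>1 y"] lin_op_eq[OF l1(1) that, of \<theta>] that by simp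
    obtain \<theta>s and F :: "('u \<Rightarrow> 'u) filter" and g where a: "asymp_elem L F g ?N2 M"
      and ret: "\<And>a. a \<in> dom M \<Longrightarrow> eventually (\<lambda>i. g i (j a) = a) F"
      and pe: "\<And>\<rho> x. x \<in> VV D ?N2 \<Longrightarrow> poly_endo D ?N2 \<rho> \<theta>s x \<in> VV D ?N2 \<and> \<iota> (poly_endo D ?N2 \<rho> \<theta>s x) = E.pact \<rho> P (\<iota> x)"
      and com: "\<And>\<rho> x. x \<in> VV D ?N2 \<Longrightarrow> eventually (\<lambda>i. map (g i) (poly_endo D ?N2 \<rho> \<theta>s x) = poly_endo D M \<rho> \<theta> (map (g i) x)) F"
      by (rule extend_endomorphism[OF C ec N2 j[unfolded M_def] l P(1) ext[unfolded M_def \<theta>_def], folded M_def \<theta>_def]) blast+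
    obtain z where z: "z \<in> VV D ?N2" "E.pact f P (\<iota> z) = ?\<iota>1 u" using P(3) by auto
    have "poly_endo D ?N2 f \<theta>s z = map j u"
    proof -
      have "\<iota> (poly_endo D ?N2 f \<theta>s z) = \<iota> (map j u)" using pe[OF z(1), of f] z(2) by simp
      then show ?thesis using l pe[OF z(1), of f] l1(2)[OF u(1)] unfolding linearization_def by (blast dest: inj_onD)
    qed
    then have "eventually (\<lambda>i. map (g i) (map j u) = poly_endo D M f \<theta> (map (g i) z)) F" using com[OF z(1), of f] by simp
    moreover have "eventually (\<lambda>i. \<forall>a\<in>set u. g i (j a) = a) F"
      using ret VV_len[OF u(1)] by (intro eventually_ball_finite) auto
    ultimately have "eventually (\<lambda>i. u = poly_endo D M f \<theta> (map (g i) z) \<and> map (g i) z \<in> VV D M) F"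
      using asymp_elem_VV_ev[OF a D ops[OF N2] z(1)]
    proof eventually_elim
      case (elim i)
      have "map (g i) (map j u) = u" using elim(2) by (simp add: map_idI)
      then show ?case using elim by simp
    qed
    then obtain i where i: "u = poly_endo D M f \<theta> (map (g i) z)" "map (g i) z \<in> VV D M"
      using a by (auto simp: asymp_elem_def dest: eventually_happens)
    have "E.pact f (lin_op D M \<iota>0 \<theta>) (\<iota>0 (map (g i) z)) = w"
      using linearization_poly_endo[OF dM l0 \<theta>e i(2), of f] i(1) u(2) by simp
    then show "\<exists>z\<in>\<iota>0 ` VV D M. E.pact f (lin_op D M \<iota>0 \<theta>) z = w" using i(2) by blast
  qed
qed

end

section \<open>Separation in extensions\<close>

context kspace
begin

text \<open>
  The summand \<open>z\<close> of the presentation absorbs elements of the image.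
\<close>

lemma separated_add_image:
  assumes S: "endo_on Y S" and sep: "separated c \<rho> Y S y" and a: "a \<in> pact \<rho> S ` Y"
  shows "separated c \<rho> Y S (y + a)"
proof -
  obtain f n k x z where f: "f \<in> monic_irr" and x: "x \<in> Y" and z: "z \<in> Y" and k: "c f = enat k" "0 < n" "n \<le> k" "f ^ n dvd \<rho>"
    and y: "y = x + pact (f ^ n) S z" and x0: "pact (f ^ k) S x = 0" "pact (f ^ (k - n)) S x \<noteq> 0"
    using sep unfolding separated_def by blast
  obtain b where b: "b \<in> Y" "a = pact (f ^ n) S b" using image_pact_dvd[OF S k(4) a] by auto
  have "y + a = x + pact (f ^ n) S (z + b)" unfolding y b(2) pact_plus[OF S z b(1)] by simp
  moreover have "z + b \<in> Y" by (rule subspace_add[OF endo_onD(1)[OF S] z b(1)])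
  ultimately show ?thesis unfolding separated_def using f x k x0 by blast
qed

lemma separated_mono:
  assumes S: "endo_on Y0 S" and sub: "Y0 \<subseteq> Y" and eq: "\<And>y. y \<in> Y0 \<Longrightarrow> P y = S y" and sep: "separated c \<rho> Y0 S y"
  shows "separated c \<rho> Y P y"
proof -
  obtain f n k x z where f: "f \<in> monic_irr" and x: "x \<in> Y0" and z: "z \<in> Y0" and k: "c f = enat k" "0 < n" "n \<le> k" "f ^ n dvd \<rho>"
    and y: "y = x + pact (f ^ n) S z" and x0: "pact (f ^ k) S x = 0" "pact (f ^ (k - n)) S x \<noteq> 0"
    using sep unfolding separated_def by blast
  have "pact p P u = pact p S u" if "u \<in> Y0" for p u by (rule pact_cong[OF S eq that])
  then have "y = x + pact (f ^ n) P z" "pact (f ^ k) P x = 0" "pact (f ^ (k - n)) P x \<noteq> 0" "x \<in> Y" "z \<in> Y"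
    using x z y x0 sub by auto
  then show ?thesis unfolding separated_def using f k by blast
qed

lemma finite_span_support:
  assumes "finite V" "V \<subseteq> span B"
  shows "\<exists>B'. finite B' \<and> B' \<subseteq> B \<and> V \<subseteq> span B'"
  using assms
proof (induction V rule: finite_induct)
  case (insert v V)
  then obtain B1 where B1: "finite B1" "B1 \<subseteq> B" "V \<subseteq> span B1" by auto
  obtain t r where t: "finite t" "t \<subseteq> B" "v = (\<Sum>a\<in>t. r a *s a)" using insert.prems by (auto simp: span_explicit)
  have "v \<in> span t" unfolding t(3) by (intro span_sum span_scale span_base)
  then have "insert v V \<subseteq> span (B1 \<union> t)" using B1(3) span_mono[of B1 "B1 \<union> t"] span_mono[of t "B1 \<union> t"] by auto
  then show ?case using B1 t by (intro exI[of _ "B1 \<union> t"]) auto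
qed auto

end

section \<open>Quantifier-free formulas in the language with a subspace predicate\<close>

text \<open>
  The tuples to which a quantifier-free formula applies the subspace predicate.
\<close>

primrec V_atoms :: "('f, 'r + unit, 'a) struct \<Rightarrow> (nat \<Rightarrow> 'a) \<Rightarrow> ('f, 'r + unit) form \<Rightarrow> 'a list set" where
  "V_atoms N e (Equal s t) = {}"
| "V_atoms N e (Rel r ts) = (if r = Inr () then {map (val N e) ts} else {})"
| "V_atoms N e (Neg \<phi>) = V_atoms N e \<phi>"
| "V_atoms N e (Conj \<phi> \<psi>) = V_atoms N e \<phi> \<union> V_atoms N e \<psi>"
| "V_atoms N e (Ex i \<phi>) = {}"

lemma finite_V_atoms: "finite (V_atoms N e \<phi>)"
  by (induction \<phi>) auto

lemma V_atoms_tuples: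
  assumes N: "structure_of (lang_V L n) N" and e: "range e \<subseteq> dom N"
  shows "form_of (lang_V L n) \<phi> \<Longrightarrow> V_atoms N e \<phi> \<subseteq> tuples N n"
proof (induction \<phi>)
  case (Rel r ts)
  have "val N e t \<in> dom N" if "t \<in> set ts" for t
    using val_in_dom[OF N e] Rel that by auto
  then show ?case using Rel by (auto simp: tuples_def lang_V_def)
qed auto

text \<open>
  Atomic formulas of \<open>L\<close> are preserved anyway, so only the finitely many tuples in
  \<open>V_atoms\<close> have to be controlled.
\<close>

lemma qf_transfer:
  assumes a: "asymp_elem L F g (reduct_V N) M" and N: "structure_of L (reduct_V N)" and e: "range e \<subseteq> dom N"
    and qf: "quantifier_free \<chi>" "form_of (lang_V L n) \<chi>"
    and atoms: "\<And>xs. xs \<in> V_atoms N e \<chi> \<Longrightarrow> relI N (Inr ()) xs \<Longrightarrow> eventually (\<lambda>i. map (g i) xs \<in> A) F"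
      "\<And>xs. xs \<in> V_atoms N e \<chi> \<Longrightarrow> \<not> relI N (Inr ()) xs \<Longrightarrow> eventually (\<lambda>i. map (g i) xs \<notin> A) F"
  shows "eventually (\<lambda>i. sat (expand_V M A) (g i \<circ> e) \<chi> \<longleftrightarrow> sat N e \<chi>) F"
proof -
  have vM: "val (expand_V M A) e' t = val M e' t" for e' t using val_reduct_V[of "expand_V M A" e' t] by simp
  have e': "range e \<subseteq> dom (reduct_V N)" using e by simp
  have vals: "eventually (\<lambda>i. map (val M (g i \<circ> e)) ts = map (g i) (map (val N e) ts)) F" if "\<forall>t\<in>set ts. trm_of L t" for ts
  proof -
    have "eventually (\<lambda>i. g i (val N e t) = val M (g i \<circ> e) t) F" if "trm_of L t" for t
      using asymp_elem_val[OF a N that e'] by (simp only: val_reduct_V)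
    then have "eventually (\<lambda>i. \<forall>t\<in>set ts. g i (val N e t) = val M (g i \<circ> e) t) F"
      using that by (intro eventually_ball_finite) auto
    then show ?thesis by eventually_elim auto
  qed
  have dec: "eventually (\<lambda>i. sat M (g i \<circ> e) \<phi> \<longleftrightarrow> sat (reduct_V N) e \<phi>) F" if \<phi>: "form_of L \<phi>" for \<phi>
  proof (cases "sat (reduct_V N) e \<phi>")
    case True
    then show ?thesis using asymp_elem_iff[OF a \<phi> e'] by (auto elim: eventually_mono)
  next
    case False
    then have "sat (reduct_V N) e (Neg \<phi>)" by simp
    then have "eventually (\<lambda>i. sat M (g i \<circ> e) (Neg \<phi>)) F" using asymp_elem_iff[OF a _ e', of "Neg \<phi>"] \<phi> by simp
    then show ?thesis using False by (auto elim: eventually_mono)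
  qed
  show ?thesis
    using qf atoms
  proof (induction \<chi>)
    case (Equal s t)
    then have "form_of L (Equal s t)" by (simp add: trm_of_lang_V)
    from dec[OF this] show ?case by (simp only: sat.simps val_reduct_V vM)
  next
    case (Rel r ts)
    have ts: "\<forall>t\<in>set ts. trm_of L t" using Rel.prems(2) by (simp add: trm_of_lang_V)
    have vMs: "map (val (expand_V M A) e') ts = map (val M e') ts" for e' by (simp add: vM)
    show ?case
    proof (cases r)
      case (Inl r')
      have f: "form_of L (Rel r' ts)" using Rel.prems(2) ts Inl by (auto simp: lang_V_def)
      have "relI (expand_V M A) r xs = relI M r' xs" "relI (reduct_V N) r' ys = relI N r ys" for xs ys
        by (simp_all add: Inl expand_V_def reduct_V_def)
      moreover have "map (val (reduct_V N) e) ts = map (val N e) ts" by (simp add: val_reduct_V)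
      ultimately show ?thesis using dec[OF f] by (simp only: sat.simps vMs)
    next
      case (Inr u)
      have "r = Inr ()" by (simp add: Inr)
      then have xs: "map (val N e) ts \<in> V_atoms N e (Rel r ts)" by simp
      have rel: "relI (expand_V M A) r xs \<longleftrightarrow> xs \<in> A" for xs by (simp add: \<open>r = Inr ()\<close> expand_V_def)
      have "eventually (\<lambda>i. map (g i) (map (val N e) ts) \<in> A \<longleftrightarrow> relI N r (map (val N e) ts)) F"
      proof (cases "relI N r (map (val N e) ts)")
        case True
        then show ?thesis using Rel.prems(3)[OF xs] \<open>r = Inr ()\<close> by (auto elim: eventually_mono simp del: map_map)
      next
        case False
        then show ?thesis using Rel.prems(4)[OF xs] \<open>r = Inr ()\<close> by (auto elim: eventually_mono simp del: map_map)
      qed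
      then show ?thesis using vals[OF ts] by eventually_elim (simp only: sat.simps vMs rel)
    qed
  next
    case (Neg \<chi>)
    then show ?case by simp
  next
    case (Conj \<chi> \<psi>)
    have "eventually (\<lambda>i. sat (expand_V M A) (g i \<circ> e) \<chi> \<longleftrightarrow> sat N e \<chi>) F"
      by (rule Conj.IH(1)) (use Conj.prems in auto)
    moreover have "eventually (\<lambda>i. sat (expand_V M A) (g i \<circ> e) \<psi> \<longleftrightarrow> sat N e \<psi>) F"
      by (rule Conj.IH(2)) (use Conj.prems in auto)
    ultimately show ?case by eventually_elim (simp only: sat.simps)
  qed simp
qed

section \<open>The image of a polynomial\<close>

context definable_vs
begin

lemma asymp_elem_not_VV:
  assumes a: "asymp_elem L F g N M" and x: "x \<in> tuples N (vdim D)" "x \<notin> VV D N" and d: "dom N \<noteq> {}"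
  shows "eventually (\<lambda>i. map (g i) x \<notin> VV D M) F"
proof -
  have fV: "form_of L (Neg (fV D))" "fv (Neg (fV D)) \<subseteq> {..<length x}"
    using D x(1) by (auto simp: vs_formulas_of_def tuples_def)
  have "sat_at N (Neg (fV D)) x" using x by (simp add: VV_def sat_at_def)
  then have "eventually (\<lambda>i. sat_at M (Neg (fV D)) (map (g i) x)) F"
    using asymp_elem_sat_at[OF a fV _ d] x(1) by (simp add: tuples_def)
  then show ?thesis by eventually_elim (simp add: VV_def sat_at_def)
qed

text \<open>
  The closure of the subspace under the operations is a first-order property.
\<close>

lemma subspace_asymp:
  fixes N2 :: "('f, 'r + unit, 'u) struct" and N :: "('f, 'r + unit, 'w) struct"
  assumes a: "asymp_elem (lang_V L (vdim D)) F g N2 N" and s2: "structure_of (lang_V L (vdim D)) N2"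
    and m2: "model_of L T (reduct_V N2)" and N: "model_V L T D N"
  shows "V_of (vdim D) N2 \<subseteq> VV D (reduct_V N2)"
    "\<zero>\<^bsub>vs D (reduct_V N2)\<^esub> \<in> V_of (vdim D) N2"
    "x \<in> V_of (vdim D) N2 \<Longrightarrow> y \<in> V_of (vdim D) N2 \<Longrightarrow> x \<oplus>\<^bsub>vs D (reduct_V N2)\<^esub> y \<in> V_of (vdim D) N2"
    "x \<in> V_of (vdim D) N2 \<Longrightarrow> k \<odot>\<^bsub>vs D (reduct_V N2)\<^esub> x \<in> V_of (vdim D) N2"
proof -
  let ?n = "vdim D"
  let ?r = "reduct_V N2" and ?s = "reduct_V N"
  have mN: "model_of L T ?s" using N by (simp add: model_V_def)
  note o2 = ops[OF m2] and oN = vs_ops_model[OF mN]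
  interpret W: submodule "V_of ?n N" "ring_of_type_algebra :: 'k ring" "vs D ?s" using N by (simp add: model_V_def)
  have ar: "asymp_elem L F g ?r ?s" by (rule asymp_elem_reduct_V[OF a])
  have bot: "F \<noteq> bot" using a by (simp add: asymp_elem_def)
  have mem: "x \<in> V_of ?n N2 \<longleftrightarrow> eventually (\<lambda>i. map (g i) x \<in> V_of ?n N) F" if x: "x \<in> tuples N2 ?n" for x
  proof -
    have "map (g i) x \<in> tuples N ?n" for i using x a by (auto simp: asymp_elem_def tuples_def)
    moreover have "relI N2 (Inr ()) x \<longleftrightarrow> eventually (\<lambda>i. relI N (Inr ()) (map (g i) x)) F"
      by (rule asymp_elem_rel[OF a s2]) (use x in \<open>auto simp: lang_V_def\<close>)
    ultimately show ?thesis using x by (simp add: V_of_def)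
  qed
  have memE: "eventually (\<lambda>i. map (g i) x \<in> V_of ?n N) F" if "x \<in> V_of ?n N2" for x
    using mem[of x] that by (simp add: V_of_def)
  have VVt: "x \<in> tuples N2 ?n" if "x \<in> VV D ?r" for x using VV_len[OF that] by (simp add: tuples_def)
  have VsubN: "V_of ?n N \<subseteq> VV D ?s" using W.subset by simp
  show sub: "V_of ?n N2 \<subseteq> VV D ?r"
  proof
    fix x assume x: "x \<in> V_of ?n N2"
    then have "x \<in> tuples ?r ?n" by (simp add: V_of_def tuples_def)
    moreover have "eventually (\<lambda>i. map (g i) x \<in> VV D ?s) F" using memE[OF x] by eventually_elim (use VsubN in auto)
    moreover have "dom ?r \<noteq> {}" using o2 by (simp add: vs_ops_def)
    ultimately show "x \<in> VV D ?r" using asymp_elem_VV[OF ar D] by blast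
  qed
  have z: "\<zero>\<^bsub>vs D ?s\<^esub> \<in> V_of ?n N" using W.one_closed by simp
  show "\<zero>\<^bsub>vs D ?r\<^esub> \<in> V_of ?n N2"
    unfolding mem[OF VVt[OF vs_ops_zero(1)[OF o2]]]
    using asymp_elem_zero[OF ar D o2 oN] by eventually_elim (use z in simp)
  show "x \<oplus>\<^bsub>vs D ?r\<^esub> y \<in> V_of ?n N2" if x: "x \<in> V_of ?n N2" and y: "y \<in> V_of ?n N2" for x y
  proof -
    have V: "x \<in> VV D ?r" "y \<in> VV D ?r" using sub x y by auto
    show ?thesis
      unfolding mem[OF VVt[OF vs_ops_add(1)[OF o2 V]]]
      using asymp_elem_add[OF ar D o2 oN V] memE[OF x] memE[OF y]
      by eventually_elim (use W.m_closed in simp)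
  qed
  show "k \<odot>\<^bsub>vs D ?r\<^esub> x \<in> V_of ?n N2" if x: "x \<in> V_of ?n N2" for x
  proof -
    have V: "x \<in> VV D ?r" using sub x by auto
    show ?thesis
      unfolding mem[OF VVt[OF vs_ops_smult(1)[OF o2 V]]]
      using asymp_elem_smult[OF ar D o2 oN V, of k] memE[OF x]
      by eventually_elim (simp add: ring_of_type_algebra_def)
  qed
qed

text \<open>
  Given a quantifier-free formula with the subspace predicate, satisfied in an extension,
  pass to the large extension \<open>N2\<close> and write each of the finitely many vectors concerned
  as a sum of an old vector, a combination of \<open>GA\<close> inside the subspace, and a combination
  of \<open>GB\<close>, which is zero if the vector is in the subspace. The new endomorphism puts the
  second summand into the image and makes the third one a generic vector killed by
  \<open>f ^ k\<close>. Hence the vector is in the image if it belongs to the subspace, and otherwise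
  it is separated: by its third summand if this is nonzero, and by the old one if not.
\<close>

theorem ec_image:
  fixes M\<theta> :: "('f + nat, 'r, 'u) struct" and \<rho> :: "'k poly"
  defines "M \<equiv> reduct_theta M\<theta>" and "\<theta> \<equiv> theta (vdim D) M\<theta>"
  defines "A \<equiv> Im_poly D M \<rho> \<theta>"
  assumes C: "kernel_config C" and ec: "ec_model_C_theta TYPE('u) L T D C M\<theta>"
    and not0: "A \<noteq> {\<zero>\<^bsub>vs D M\<^esub>}" and notV: "A \<noteq> VV D M"
  shows "ec_model_V TYPE('w) L T D (expand_V M A)"
proof -
  let ?n = "vdim D"
  let ?c = "fst C" and ?mo = "config_poly C"
  have mM: "model_C_theta L T D C M\<theta>" using ec by (simp add: ec_model_C_theta_def)
  then have M: "model_of L T M" and \<theta>e: "vs_endo D M \<theta>" and Ce: "C_endo D M C \<theta>"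
    by (simp_all add: model_C_theta_def model_theta_def M_def \<theta>_def)
  have sM: "structure_of L M" using M by (simp add: model_of_def)
  note dM = defines_vs[OF M] and oM = ops[OF M]
  note cm = config_mod_config_poly[OF C]
  have Cop: "E.C_op ?mo ?c (\<iota> ` VV D M) (lin_op D M \<iota> \<theta>)"
    if "linearization D M \<iota>" for \<iota> :: "'u list \<Rightarrow> ('u list \<Rightarrow>\<^sub>0 'k)"
    using C_endo_iff_C_op[OF dM that C] Ce by blast
  have rc: "E.root_closed ?c (\<iota> ` VV D M) (lin_op D M \<iota> \<theta>)"
    if "linearization D M \<iota>" for \<iota> :: "'u list \<Rightarrow> ('u list \<Rightarrow>\<^sub>0 'k)"
    using ec_root_closed[OF C ec that[unfolded M_def]] by (simp add: M_def \<theta>_def)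
  obtain \<iota>0 :: "'u list \<Rightarrow> ('u list \<Rightarrow>\<^sub>0 'k)" where l0: "linearization D M \<iota>0" using ex_linearization[OF dM] by blast
  have endo: "E.endo_on (\<iota> ` VV D M) (lin_op D M \<iota> \<theta>)"
    if "linearization D M \<iota>" for \<iota> :: "'u list \<Rightarrow> ('u list \<Rightarrow>\<^sub>0 'k)"
    by (rule lin_op_endo[OF dM that \<theta>e])
  have Asub: "A \<subseteq> VV D M" using poly_endo_in_VV[OF dM \<theta>e] by (auto simp: A_def Im_poly_def)
  have Aim: "\<iota> u \<in> E.pact \<rho> (lin_op D M \<iota> \<theta>) ` (\<iota> ` VV D M) \<longleftrightarrow> u \<in> A"
    if l: "linearization D M \<iota>" and u: "u \<in> VV D M" for \<iota> :: "'u list \<Rightarrow> ('u list \<Rightarrow>\<^sub>0 'k)" and u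
  proof -
    have "E.pact \<rho> (lin_op D M \<iota> \<theta>) ` (\<iota> ` VV D M) = \<iota> ` A"
      unfolding A_def Im_poly_def image_image using linearization_poly_endo[OF dM l \<theta>e] by (intro image_cong) auto
    moreover have "\<iota> u \<in> \<iota> ` A \<longleftrightarrow> u \<in> A"
      using l u Asub unfolding linearization_def by (auto dest: inj_onD)
    ultimately show ?thesis by simp
  qed
  \<comment> \<open>A multiple of \<open>mo\<close> acts as zero.\<close>
  have nd: "\<not> ?mo dvd \<rho>"
  proof
    assume "?mo dvd \<rho>"
    then obtain q where q: "\<rho> = q * ?mo" by (metis dvd_def mult.commute)
    have "poly_endo D M \<rho> \<theta> x = \<zero>\<^bsub>vs D M\<^esub>" if x: "x \<in> VV D M" for x
    proof -
      have "E.pact \<rho> (lin_op D M \<iota>0 \<theta>) (\<iota>0 x) = E.pact q (lin_op D M \<iota>0 \<theta>) 0"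
        using E.pact_mult[OF endo[OF l0], of "\<iota>0 x" q ?mo] Cop[OF l0] x by (simp add: q E.C_op_def)
      then show ?thesis using linearization_poly_zero[OF dM l0 \<theta>e x] E.pact_zero[OF endo[OF l0]] by simp
    qed
    then have "A = {\<zero>\<^bsub>vs D M\<^esub>}" unfolding A_def Im_poly_def using vs_ops_zero(1)[OF oM] by force
    then show False using not0 by simp
  qed
  then have \<rho>nz: "\<rho> \<noteq> 0" by auto
  \<comment> \<open>A vector outside the image provides the prime \<open>f\<close> for the summands \<open>K[X]/(f ^ k)\<close>.\<close>
  obtain w0 where w0: "w0 \<in> VV D M" "w0 \<notin> A" using notV Asub by blast
  have "E.separated ?c \<rho> (\<iota>0 ` VV D M) (lin_op D M \<iota>0 \<theta>) (\<iota>0 w0)"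
    by (rule E.separated_if_not_in_image[OF endo[OF l0] rc[OF l0] _ _ \<rho>nz]) (use w0 Aim[OF l0 w0(1)] in auto)
  then obtain f n k where f: "f \<in> monic_irr" and k: "?c f = enat k" "0 < n" "n \<le> k" "f ^ n dvd \<rho>"
    unfolding E.separated_def by blast
  then have k0: "k > 0" by simp
  have submod: "submodule A (ring_of_type_algebra :: 'k ring) (vs D M)"
  proof -
    interpret W: module "ring_of_type_algebra :: 'k ring" "vs D M" using dM by (simp add: defines_infinite_vs_def)
    have sub: "E.subspace (\<iota>0 ` A)"
    proof -
      have "\<iota>0 ` A = E.pact \<rho> (lin_op D M \<iota>0 \<theta>) ` (\<iota>0 ` VV D M)"
        unfolding A_def Im_poly_def image_image using linearization_poly_endo[OF dM l0 \<theta>e] by (intro image_cong) auto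
      moreover have "E.subspace (E.pact \<rho> (lin_op D M \<iota>0 \<theta>) ` (\<iota>0 ` VV D M))"
        unfolding E.subspace_def
      proof (intro conjI ballI allI)
        note s = E.endo_onD(1)[OF endo[OF l0]]
        let ?p = "E.pact \<rho> (lin_op D M \<iota>0 \<theta>)"
        show "0 \<in> ?p ` (\<iota>0 ` VV D M)" using E.pact_zero[OF endo[OF l0], of \<rho>] E.subspace_0[OF s] by (metis imageI)
        show "x + y \<in> ?p ` (\<iota>0 ` VV D M)" if "x \<in> ?p ` (\<iota>0 ` VV D M)" "y \<in> ?p ` (\<iota>0 ` VV D M)" for x y
          by (rule E.image_pact_plus[OF endo[OF l0] that])
        show "pmscale a x \<in> ?p ` (\<iota>0 ` VV D M)" if x: "x \<in> ?p ` (\<iota>0 ` VV D M)" for a x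
        proof -
          obtain v where "v \<in> \<iota>0 ` VV D M" "x = ?p v" using x by auto
          then show ?thesis using E.pact_scale[OF endo[OF l0], of v \<rho> a] E.subspace_scale[OF s, of v a] by (metis imageI)
        qed
      qed
      ultimately show ?thesis by simp
    qed
    have mem: "u \<in> A" if "u \<in> VV D M" "\<iota>0 u \<in> \<iota>0 ` A" for u
      using l0 that Asub unfolding linearization_def by (auto dest: inj_onD)
    have sc: "a \<odot>\<^bsub>vs D M\<^esub> x \<in> A" if x: "x \<in> A" for a x
    proof (rule mem)
      have xV: "x \<in> VV D M" using x Asub by auto
      show "a \<odot>\<^bsub>vs D M\<^esub> x \<in> VV D M" by (rule vs_ops_smult(1)[OF oM xV])
      have "\<iota>0 (a \<odot>\<^bsub>vs D M\<^esub> x) = pmscale a (\<iota>0 x)" using l0 xV by (simp add: linearization_def)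
      then show "\<iota>0 (a \<odot>\<^bsub>vs D M\<^esub> x) \<in> \<iota>0 ` A" using E.subspace_scale[OF sub] x by simp
    qed
    show ?thesis
    proof (rule W.submoduleI)
      show "A \<subseteq> carrier (vs D M)" using Asub by simp
      show "\<zero>\<^bsub>vs D M\<^esub> \<in> A"
        using mem[OF vs_ops_zero(1)[OF oM]] E.subspace_0[OF sub] linearization_zero[OF oM defines_zero_add[OF dM] l0] by simp
      fix x assume x: "x \<in> A"
      then have xV: "x \<in> VV D M" using Asub by auto
      have "\<ominus>\<^bsub>vs D M\<^esub> x = (- 1) \<odot>\<^bsub>vs D M\<^esub> x"
      proof -
        have one: "\<one>\<^bsub>(ring_of_type_algebra :: 'k ring)\<^esub> = 1" by (simp add: ring_of_type_algebra_def)
        have cR: "carrier (ring_of_type_algebra :: 'k ring) = UNIV" by (simp add: ring_of_type_algebra_def)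
        have "x \<oplus>\<^bsub>vs D M\<^esub> ((- 1) \<odot>\<^bsub>vs D M\<^esub> x) = (1 \<odot>\<^bsub>vs D M\<^esub> x) \<oplus>\<^bsub>vs D M\<^esub> ((- 1) \<odot>\<^bsub>vs D M\<^esub> x)"
          using W.smult_one[of x] xV by (simp add: one)
        also have "\<dots> = (1 + (- 1)) \<odot>\<^bsub>vs D M\<^esub> x"
          using W.smult_l_distr[of 1 "- 1" x] xV by (simp add: ring_of_type_algebra_def)
        also have "\<dots> = \<zero>\<^bsub>vs D M\<^esub>" using W.smult_l_null[of x] xV by (simp add: ring_of_type_algebra_def)
        finally show ?thesis using W.M.minus_equality[of "(- 1) \<odot>\<^bsub>vs D M\<^esub> x" x] W.M.a_comm xV vs_ops_smult(1)[OF oM xV] by simp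
      qed
      then show "\<ominus>\<^bsub>vs D M\<^esub> x \<in> A" using sc[OF x] by simp
      show "a \<odot>\<^bsub>vs D M\<^esub> x \<in> A" for a by (rule sc[OF x])
      fix y assume y: "y \<in> A"
      then have yV: "y \<in> VV D M" using Asub by auto
      have "\<iota>0 (x \<oplus>\<^bsub>vs D M\<^esub> y) = \<iota>0 x + \<iota>0 y" using l0 xV yV by (simp add: linearization_def)
      then show "x \<oplus>\<^bsub>vs D M\<^esub> y \<in> A"
        using mem[OF vs_ops_add(1)[OF oM xV yV]] E.subspace_add[OF sub, of "\<iota>0 x" "\<iota>0 y"] x y by simp
    qed
  qed
  have VofA: "V_of ?n (expand_V M A) = A"
    using Asub VV_len[of _ D M] by (auto simp: V_of_def expand_V_def tuples_def)
  have modV: "model_V L T D (expand_V M A)"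
    unfolding model_V_def reduct_expand_V VofA
    using M sM submod by (auto simp: structure_of_def expand_V_def lang_V_def tuples_def)
  have "ec_in (lang_V L ?n) (expand_V M A) N" if N: "model_V L T D N" for N :: "('f, 'r + unit, 'w) struct"
    unfolding ec_in_def
  proof (intro allI impI, elim conjE)
    fix h \<phi> and e :: "nat \<Rightarrow> 'u"
    assume h: "embedding (lang_V L ?n) (expand_V M A) N h" and \<phi>: "form_of (lang_V L ?n) \<phi>" "existential \<phi>"
      and e: "range e \<subseteq> dom (expand_V M A)" and sat: "sat N (h \<circ> e) \<phi>"
    have e: "range e \<subseteq> dom M" using e by (simp add: expand_V_def)
    have hr: "embedding L M (reduct_V N) h" using embedding_reduct_V[OF h] by simp
    have sN: "structure_of (lang_V L ?n) N" and mN: "model_of L T (reduct_V N)" using N by (simp_all add: model_V_def)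
    obtain N2 :: "('f, 'r + unit, 'u) struct" and \<pi> and U :: "(nat \<Rightarrow> 'u list) filter" and j and x where
      s2: "structure_of (lang_V L ?n) N2" and a2: "asymp_elem (lang_V L ?n) U \<pi> N2 N"
      and m2: "model_of L T (reduct_V N2)" and j: "elementary_embedding L M (reduct_V N2) j"
      and \<pi>j: "\<And>a. a \<in> dom M \<Longrightarrow> eventually (\<lambda>i. \<pi> i (j a) = h a) U"
      and x: "\<And>n. x n \<in> VV D (reduct_V N2)"
      and ind: "\<And>m k w. k m \<noteq> 0 \<Longrightarrow> w \<in> VV D M \<Longrightarrow> lincomb D (reduct_V N2) k x (Suc m) \<noteq> map j w"
      by (rule large_extension[OF M sN mN hr]) blast
    let ?N = "reduct_V N2"
    note dN = defines_vs[OF m2] and oN = ops[OF m2]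
    have sr: "structure_of L ?N" using m2 by (simp add: model_of_def)
    have jd: "j ` dom M \<subseteq> dom N2" using j by (simp add: elementary_embedding_def embedding_def)
    have botU: "U \<noteq> bot" using a2 by (simp add: asymp_elem_def)
    obtain ns \<chi> where \<chi>: "quantifier_free \<chi>" "\<phi> = foldr Ex ns \<chi>" using existential_prenex[OF \<phi>(2)] by blast
    have \<chi>f: "form_of (lang_V L ?n) \<chi>" using \<phi>(1) by (simp add: \<chi>(2) form_of_foldr_Ex)
    have rj: "range (j \<circ> e) \<subseteq> dom N2" using e jd by auto
    have "sat N2 (j \<circ> e) \<phi>"
    proof -
      have "eventually (\<lambda>i. \<forall>m\<in>fv \<phi>. \<pi> i (j (e m)) = h (e m)) U" using e \<pi>j by (intro eventually_ball_finite finite_fv) auto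
      then have "eventually (\<lambda>i. sat N (\<pi> i \<circ> (j \<circ> e)) \<phi>) U"
      proof eventually_elim
        case (elim i)
        have "sat N (\<pi> i \<circ> (j \<circ> e)) \<phi> \<longleftrightarrow> sat N (h \<circ> e) \<phi>" by (rule sat_cong) (use elim in simp)
        then show ?case using sat by simp
      qed
      then show ?thesis using asymp_elem_iff[OF a2 \<phi>(1) rj] by simp
    qed
    then obtain e' where e': "\<And>m. m \<notin> set ns \<Longrightarrow> e' m = j (e m)" "\<And>m. m \<in> set ns \<Longrightarrow> e' m \<in> dom N2" "sat N2 e' \<chi>"
      unfolding \<chi>(2) sat_foldr_Ex by auto
    have re': "range e' \<subseteq> dom N2"
    proof
      fix y assume "y \<in> range e'"
      then obtain m where "y = e' m" by auto
      then show "y \<in> dom N2" using e'(1,2)[of m] rj by (cases "m \<in> set ns") auto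
    qed
    obtain \<iota> :: "'u list \<Rightarrow> ('u list \<Rightarrow>\<^sub>0 'k)" where l: "linearization D ?N \<iota>" using ex_linearization[OF dN] by blast
    note l1 = linearization_elementary[OF j D oM oN l]
    let ?\<iota>1 = "\<iota> \<circ> map j"
    let ?YM = "?\<iota>1 ` VV D M" and ?Y = "\<iota> ` VV D ?N"
    let ?S = "lin_op D M ?\<iota>1 \<theta>"
    define A2 where "A2 = V_of ?n N2"
    note A2 = subspace_asymp[OF a2 s2 m2 N, folded A2_def]
    have \<iota>inj: "u = v" if "\<iota> u = \<iota> v" "u \<in> VV D ?N" "v \<in> VV D ?N" for u v
      using l that unfolding linearization_def by (auto dest: inj_onD)
    have sub0: "E.subspace ?YM" by (rule linearization_subspace[OF dM l1(1)])
    have subY: "E.subspace ?Y" by (rule linearization_subspace[OF dN l])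
    have subA: "E.subspace (\<iota> ` A2)"
      unfolding E.subspace_def
    proof (intro conjI ballI allI)
      show "0 \<in> \<iota> ` A2" using A2(2) linearization_zero[OF oN defines_zero_add[OF dN] l] by (metis imageI)
      show "u + v \<in> \<iota> ` A2" if "u \<in> \<iota> ` A2" "v \<in> \<iota> ` A2" for u v
      proof -
        obtain u' v' where "u' \<in> A2" "u = \<iota> u'" "v' \<in> A2" "v = \<iota> v'" using \<open>u \<in> \<iota> ` A2\<close> \<open>v \<in> \<iota> ` A2\<close> by auto
        moreover from this have "u' \<in> VV D ?N" "v' \<in> VV D ?N" using A2(1) by blast+
        moreover from this have "\<iota> (u' \<oplus>\<^bsub>vs D ?N\<^esub> v') = \<iota> u' + \<iota> v'" using l by (simp add: linearization_def)
        ultimately show ?thesis using A2(3) by (metis imageI)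
      qed
      show "pmscale c u \<in> \<iota> ` A2" if "u \<in> \<iota> ` A2" for c u
      proof -
        obtain u' where "u' \<in> A2" "u = \<iota> u'" using \<open>u \<in> \<iota> ` A2\<close> by auto
        moreover from this have "u' \<in> VV D ?N" using A2(1) by blast
        moreover from this have "\<iota> (c \<odot>\<^bsub>vs D ?N\<^esub> u') = pmscale c (\<iota> u')" using l by (simp add: linearization_def)
        ultimately show ?thesis using A2(4) by (metis imageI)
      qed
    qed
    have jA: "map j u \<in> A2 \<longleftrightarrow> u \<in> A" if u: "u \<in> VV D M" for u
    proof -
      have ud: "set u \<subseteq> dom M" "length u = ?n" using VV_len[OF u] by auto
      have ut: "map j u \<in> tuples N2 ?n" using ud jd by (auto simp: tuples_def)
      have "relI N2 (Inr ()) (map j u) \<longleftrightarrow> eventually (\<lambda>i. relI N (Inr ()) (map (\<pi> i) (map j u))) U"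
        by (rule asymp_elem_rel[OF a2 s2]) (use ut in \<open>auto simp: lang_V_def\<close>)
      also have "\<dots> \<longleftrightarrow> eventually (\<lambda>i. relI N (Inr ()) (map h u)) U"
      proof (rule eventually_subst)
        have "eventually (\<lambda>i. \<forall>a\<in>set u. \<pi> i (j a) = h a) U" using ud \<pi>j by (intro eventually_ball_finite) auto
        then show "eventually (\<lambda>i. relI N (Inr ()) (map (\<pi> i) (map j u)) = relI N (Inr ()) (map h u)) U"
        proof eventually_elim
          case (elim i)
          then have "map (\<pi> i) (map j u) = map h u" by simp
          then show ?case by (simp only:)
        qed
      qed
      also have "\<dots> \<longleftrightarrow> relI N (Inr ()) (map h u)" using botU by (simp add: eventually_const_iff)
      also have "\<dots> \<longleftrightarrow> relI (expand_V M A) (Inr ()) u"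
        using h ud by (auto simp: embedding_def lang_V_def tuples_def expand_V_def)
      also have "\<dots> \<longleftrightarrow> u \<in> A" by (simp add: expand_V_def)
      finally show ?thesis using ut by (simp add: A2_def V_of_def)
    qed
    obtain GA GB where GA: "GA \<subseteq> \<iota> ` A2" and GAB: "GA \<inter> GB = {}"
      and G: "E.independent (GA \<union> GB)" "infinite (GA \<union> GB)" "E.span (GA \<union> GB) \<inter> ?YM \<subseteq> {0}"
      and Y: "?Y = {y + g |y g. y \<in> ?YM \<and> g \<in> E.span (GA \<union> GB)}"
      and AY: "\<And>a. a \<in> \<iota> ` A2 \<Longrightarrow> a \<in> {y + g |y g. y \<in> ?YM \<and> g \<in> E.span GA}"
    proof (rule adapted_basis_of_extension[OF M m2 j l x _ A2(1)])
      show "lincomb D ?N k x (Suc m) \<noteq> map j w" if "k m \<noteq> 0" "w \<in> VV D M" for m k w by (rule ind[of k m w, OF that])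
    qed blast
    have spanGA: "E.span GA \<subseteq> \<iota> ` A2" by (rule E.span_minimal[OF GA subA])
    \<comment> \<open>The finitely many vectors in question, and their decomposition.\<close>
    define TT where "TT = V_atoms N2 e' \<chi> \<inter> VV D ?N"
    have finTT: "finite TT" using finite_V_atoms by (auto simp: TT_def)
    have "\<exists>y a b. y \<in> ?YM \<and> a \<in> E.span GA \<and> b \<in> E.span GB \<and> \<iota> xs = y + a + b \<and> (xs \<in> A2 \<longrightarrow> b = 0)"
      if xs: "xs \<in> VV D ?N" for xs
    proof (cases "xs \<in> A2")
      case True
      then obtain y a where "y \<in> ?YM" "a \<in> E.span GA" "\<iota> xs = y + a" using AY[of "\<iota> xs"] by blast
      then show ?thesis using E.span_zero by (intro exI[of _ y] exI[of _ a] exI[of _ 0]) auto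
    next
      case False
      have "\<iota> xs \<in> ?Y" using xs by simp
      then obtain y g where y: "y \<in> ?YM" "g \<in> E.span (GA \<union> GB)" "\<iota> xs = y + g" unfolding Y by blast
      then obtain a b where "a \<in> E.span GA" "b \<in> E.span GB" "g = a + b" unfolding E.span_Un by blast
      then show ?thesis using y False by (intro exI[of _ y] exI[of _ a] exI[of _ b]) (simp add: add.assoc)
    qed
    then obtain ty ta tb where t: "\<And>xs. xs \<in> VV D ?N \<Longrightarrow> ty xs \<in> ?YM" "\<And>xs. xs \<in> VV D ?N \<Longrightarrow> ta xs \<in> E.span GA"
      "\<And>xs. xs \<in> VV D ?N \<Longrightarrow> tb xs \<in> E.span GB" "\<And>xs. xs \<in> VV D ?N \<Longrightarrow> \<iota> xs = ty xs + ta xs + tb xs"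
      "\<And>xs. xs \<in> VV D ?N \<Longrightarrow> xs \<in> A2 \<Longrightarrow> tb xs = 0" by metis
    obtain G1 where G1: "finite G1" "G1 \<subseteq> GA" "ta ` TT \<subseteq> E.span G1"
      using E.finite_span_support[of "ta ` TT" GA] finTT t(2) by (auto simp: TT_def)
    obtain G2 where G2: "finite G2" "G2 \<subseteq> GB" "tb ` TT \<subseteq> E.span G2"
      using E.finite_span_support[of "tb ` TT" GB] finTT t(3) by (auto simp: TT_def)
    have G12: "G1 \<subseteq> GA \<union> GB" "G2 \<subseteq> GA \<union> GB" "G1 \<inter> G2 = {}" using G1(2) G2(2) GAB by auto
    obtain P where P: "E.C_op ?mo ?c ?Y P" and PS: "\<And>y. y \<in> ?YM \<Longrightarrow> P y = ?S y"
      and P1: "\<And>b. b \<in> E.span G1 \<Longrightarrow> \<exists>z\<in>?Y. E.pact \<rho> P z = b"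
      and P2: "\<And>b. b \<in> E.span G2 \<Longrightarrow> E.pact (f ^ k) P b = 0"
      and P3: "\<And>b p. b \<in> E.span G2 \<Longrightarrow> \<not> f ^ k dvd p \<Longrightarrow> E.pact p P b \<in> ?YM \<Longrightarrow> b = 0"
      by (rule E.free_extension[OF cm Cop[OF l1(1)] G f k(1) k0 G1(1) G12(1) nd G2(1) G12(2,3), folded Y]) blast
    have Pe: "E.endo_on ?Y P" using P by (simp add: E.C_op_def)
    note Se = endo[OF l1(1)]
    have Y0Y: "?YM \<subseteq> ?Y" using l1(2) by auto
    have pc: "E.pact p P y = E.pact p ?S y" if "y \<in> ?YM" for p y by (rule E.pact_cong[OF Se PS that])
    have ext: "P (\<iota> (map j y)) = \<iota> (map j (\<theta> y))" if "y \<in> VV D M" for y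
      using PS[of "?\<iota>1 y"] lin_op_eq[OF l1(1) that, of \<theta>] that by simp
    obtain \<theta>s and F :: "('u \<Rightarrow> 'u) filter" and g where a: "asymp_elem L F g ?N M"
      and ret: "\<And>a. a \<in> dom M \<Longrightarrow> eventually (\<lambda>i. g i (j a) = a) F"
      and pe: "\<And>\<rho> x. x \<in> VV D ?N \<Longrightarrow> poly_endo D ?N \<rho> \<theta>s x \<in> VV D ?N \<and> \<iota> (poly_endo D ?N \<rho> \<theta>s x) = E.pact \<rho> P (\<iota> x)"
      and com: "\<And>\<rho> x. x \<in> VV D ?N \<Longrightarrow> eventually (\<lambda>i. map (g i) (poly_endo D ?N \<rho> \<theta>s x) = poly_endo D M \<rho> \<theta> (map (g i) x)) F"
      by (rule extend_endomorphism[OF C ec m2 j[unfolded M_def] l P ext[unfolded M_def \<theta>_def], folded M_def \<theta>_def]) blast+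
    have VVg: "eventually (\<lambda>i. map (g i) x \<in> VV D M) F" if "x \<in> VV D ?N" for x
      by (rule asymp_elem_VV_ev[OF a D oN that])
    \<comment> \<open>The old summand of a vector in the subspace lies in \<open>Im \<rho>[\<theta>]\<close>, the subspace
      extends this image.\<close>
    have pos: "eventually (\<lambda>i. map (g i) xs \<in> A) F" if xs: "xs \<in> TT" "xs \<in> A2" for xs
    proof -
      have xV: "xs \<in> VV D ?N" using xs(1) by (simp add: TT_def)
      have e1: "\<iota> xs = ty xs + ta xs" using t(4,5)[OF xV] xs(2) by simp
      obtain u where u: "u \<in> VV D M" "ty xs = \<iota> (map j u)" using t(1)[OF xV] by auto
      have "ty xs = \<iota> xs - ta xs" using e1 by simp
      moreover have "\<iota> xs - ta xs \<in> \<iota> ` A2" by (rule E.subspace_diff[OF subA]) (use xs(2) spanGA t(2)[OF xV] in auto)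
      ultimately have "\<iota> (map j u) \<in> \<iota> ` A2" using u(2) by simp
      then have "map j u \<in> A2" using \<iota>inj[of "map j u"] l1(2)[OF u(1)] A2(1) by blast
      then have "?\<iota>1 u \<in> E.pact \<rho> ?S ` ?YM" using jA[OF u(1)] Aim[OF l1(1) u(1)] by simp
      then obtain v where v: "v \<in> ?YM" "ty xs = E.pact \<rho> P v" using u(2) pc by auto
      obtain z where z: "z \<in> ?Y" "E.pact \<rho> P z = ta xs" using P1[of "ta xs"] G1(3) xs(1) by blast
      have vY: "v \<in> ?Y" using v(1) Y0Y by blast
      have "\<iota> xs = E.pact \<rho> P (v + z)" using e1 v(2) z(2) E.pact_plus[OF Pe vY z(1)] by simp
      moreover have "v + z \<in> ?Y" by (rule E.subspace_add[OF subY vY z(1)])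
      ultimately obtain q where q: "q \<in> VV D ?N" "\<iota> xs = E.pact \<rho> P (\<iota> q)" by auto
      then have e: "xs = poly_endo D ?N \<rho> \<theta>s q" using pe[OF q(1), of \<rho>] \<iota>inj[OF _ xV] by simp
      from com[OF q(1), of \<rho>] VVg[OF q(1)] show ?thesis
        by eventually_elim (simp add: e A_def Im_poly_def)
    qed
    have sepY: "E.separated ?c \<rho> ?Y P (\<iota> xs)" if xs: "xs \<in> TT" "xs \<notin> A2" for xs
    proof -
      have xV: "xs \<in> VV D ?N" using xs(1) by (simp add: TT_def)
      obtain z where z: "z \<in> ?Y" "E.pact \<rho> P z = ta xs" using P1[of "ta xs"] G1(3) xs(1) by blast
      have im: "ta xs \<in> E.pact \<rho> P ` ?Y" using imageI[OF z(1), of "E.pact \<rho> P"] z(2) by simp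
      have yY: "ty xs \<in> ?YM" by (rule t(1)[OF xV])
      \<comment> \<open>Adding \<open>ta xs\<close>, an element of the image, will preserve separation.\<close>
      have "E.separated ?c \<rho> ?Y P (ty xs + tb xs)"
      proof (cases "tb xs = 0")
        case True
        obtain u where u: "u \<in> VV D M" "ty xs = ?\<iota>1 u" using yY by auto
        have "u \<notin> A"
        proof
          assume "u \<in> A"
          then have "ty xs \<in> \<iota> ` A2" using jA[OF u(1)] u(2) by simp
          moreover have "ta xs \<in> \<iota> ` A2" using spanGA t(2)[OF xV] by blast
          ultimately have "\<iota> xs \<in> \<iota> ` A2" using E.subspace_add[OF subA] t(4)[OF xV] True by simp
          then have "xs \<in> A2" using \<iota>inj[of xs] xV A2(1) by blast
          then show False using xs(2) by simp
        qed
        then have "E.separated ?c \<rho> ?YM ?S (ty xs)"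
          using E.separated_if_not_in_image[OF Se rc[OF l1(1)] yY _ \<rho>nz] Aim[OF l1(1) u(1)] u(2) by simp
        then show ?thesis using E.separated_mono[OF Se Y0Y PS] True by simp
      next
        case False
        \<comment> \<open>\<open>x0 + tb xs\<close> is the required element of the kernel of \<open>f ^ k\<close>: the genericity of
          \<open>tb xs\<close> over the old space prevents cancellation.\<close>
        obtain x0 z0 where x0: "x0 \<in> ?YM" "z0 \<in> ?YM" "ty xs = x0 + E.pact (f ^ k) ?S z0" "E.pact (f ^ k) ?S x0 = 0"
          using E.root_closed_decompose[OF Se rc[OF l1(1)] f k(1) yY] by blast
        have bG2: "tb xs \<in> E.span G2" using G2(3) xs(1) by blast
        have "tb xs \<in> E.span (GA \<union> GB)" using t(3)[OF xV] E.span_mono[of GB "GA \<union> GB"] by blast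
        then have bY: "tb xs \<in> ?Y" unfolding Y using E.subspace_0[OF sub0] by (intro CollectI exI[of _ 0] exI[of _ "tb xs"]) simp
        have xY: "x0 \<in> ?Y" and zY: "z0 \<in> ?Y" using x0(1,2) Y0Y by blast+
        have "E.pact (f ^ k) P z0 = E.pact (f ^ n) P (E.pact (f ^ (k - n)) P z0)"
          using E.pact_mult[OF Pe zY, of "f ^ n" "f ^ (k - n)"] k(3) by (simp add: power_add[symmetric])
        then have d: "ty xs + tb xs = (x0 + tb xs) + E.pact (f ^ n) P (E.pact (f ^ (k - n)) P z0)"
          using x0(3) pc[OF x0(2)] by (simp add: algebra_simps)
        have d0: "E.pact (f ^ k) P (x0 + tb xs) = 0"
          using E.pact_plus[OF Pe xY bY, of "f ^ k"] pc[OF x0(1)] x0(4) P2[OF bG2] by simp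
        have "E.pact (f ^ (k - n)) P (x0 + tb xs) \<noteq> 0"
        proof
          assume "E.pact (f ^ (k - n)) P (x0 + tb xs) = 0"
          then have "E.pact (f ^ (k - n)) P (tb xs) = - E.pact (f ^ (k - n)) ?S x0"
            using E.pact_plus[OF Pe xY bY] pc[OF x0(1)] by (simp add: eq_neg_iff_add_eq_0 add.commute)
          also have "\<dots> \<in> ?YM" by (rule E.subspace_neg[OF sub0 E.pact_in[OF Se x0(1)]])
          finally have "E.pact (f ^ (k - n)) P (tb xs) \<in> ?YM" .
          moreover have "\<not> f ^ k dvd f ^ (k - n)"
          proof
            assume "f ^ k dvd f ^ (k - n)"
            moreover have "f ^ k = f ^ (k - n) * f ^ n" using k(3) by (simp add: power_add[symmetric])
            ultimately have "f ^ n dvd 1" using monic_irr_nz[OF f] by (simp add: dvd_mult_cancel_left)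
            moreover have "f dvd f ^ n" using k(2) by simp
            ultimately show False using monic_irr_not_unit[OF f] dvd_trans by blast
          qed
          ultimately show False using P3[OF bG2] False by blast
        qed
        moreover have "x0 + tb xs \<in> ?Y" by (rule E.subspace_add[OF subY xY bY])
        moreover have "E.pact (f ^ (k - n)) P z0 \<in> ?Y" by (rule E.pact_in[OF Pe zY])
        ultimately show ?thesis unfolding E.separated_def using f k d d0 by blast
      qed
      then have "E.separated ?c \<rho> ?Y P (ty xs + tb xs + ta xs)" by (rule E.separated_add_image[OF Pe _ im])
      moreover have "ty xs + tb xs + ta xs = \<iota> xs" using t(4)[OF xV] by (simp add: algebra_simps)
      ultimately show ?thesis by simp
    qed
    \<comment> \<open>The separating presentation is carried to \<open>M\<close> by almost all of the maps.\<close>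
    have neg: "eventually (\<lambda>i. map (g i) xs \<notin> A) F" if xs: "xs \<in> TT" "xs \<notin> A2" for xs
    proof -
      have xV: "xs \<in> VV D ?N" using xs(1) by (simp add: TT_def)
      obtain f' n' k' u v where f': "f' \<in> monic_irr" and u: "u \<in> ?Y" and v: "v \<in> ?Y"
        and k': "?c f' = enat k'" "0 < n'" "n' \<le> k'" "f' ^ n' dvd \<rho>"
        and eq: "\<iota> xs = u + E.pact (f' ^ n') P v" "E.pact (f' ^ k') P u = 0" "E.pact (f' ^ (k' - n')) P u \<noteq> 0"
        using sepY[OF xs] unfolding E.separated_def by blast
      obtain u' v' where u': "u' \<in> VV D ?N" "u = \<iota> u'" and v': "v' \<in> VV D ?N" "v = \<iota> v'" using u v by auto
      let ?p = "\<lambda>q. poly_endo D ?N q \<theta>s" and ?q = "\<lambda>q. poly_endo D M q \<theta>"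
      have z0: "\<iota> \<zero>\<^bsub>vs D ?N\<^esub> = 0" by (rule linearization_zero[OF oN defines_zero_add[OF dN] l])
      have zV: "\<zero>\<^bsub>vs D ?N\<^esub> \<in> VV D ?N" by (rule vs_ops_zero(1)[OF oN])
      note pv = pe[OF v'(1), of "f' ^ n'"]
      have s1: "xs = u' \<oplus>\<^bsub>vs D ?N\<^esub> ?p (f' ^ n') v'"
      proof (rule \<iota>inj[OF _ xV])
        show "\<iota> xs = \<iota> (u' \<oplus>\<^bsub>vs D ?N\<^esub> ?p (f' ^ n') v')"
          using l u'(1) pv eq(1) u'(2) v'(2) by (simp add: linearization_def)
        show "u' \<oplus>\<^bsub>vs D ?N\<^esub> ?p (f' ^ n') v' \<in> VV D ?N" using vs_ops_add(1)[OF oN u'(1)] pv by blast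
      qed
      have s2: "?p (f' ^ k') u' = \<zero>\<^bsub>vs D ?N\<^esub>"
        using \<iota>inj[OF _ _ zV] pe[OF u'(1), of "f' ^ k'"] eq(2) u'(2) z0 by simp
      have s3: "?p (f' ^ (k' - n')) u' \<noteq> \<zero>\<^bsub>vs D ?N\<^esub>"
        using pe[OF u'(1), of "f' ^ (k' - n')"] eq(3) u'(2) z0 by auto
      have s3': "eventually (\<lambda>i. map (g i) (?p (f' ^ (k' - n')) u') \<noteq> map (g i) \<zero>\<^bsub>vs D ?N\<^esub>) F"
        by (rule asymp_elem_neq_list[OF a _ _ s3]) (use pe[OF u'(1), of "f' ^ (k' - n')"] VV_len zV in blast)+
      have pvV: "?p (f' ^ n') v' \<in> VV D ?N" using pv by blast
      show ?thesis
        using asymp_elem_add[OF a D oN oM u'(1) pvV] com[OF v'(1), of "f' ^ n'"] com[OF u'(1), of "f' ^ k'"]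
          com[OF u'(1), of "f' ^ (k' - n')"] s3' asymp_elem_zero[OF a D oN oM] VVg[OF u'(1)] VVg[OF v'(1)] VVg[OF xV]
      proof eventually_elim
        case (elim i)
        let ?u = "map (g i) u'" and ?v = "map (g i) v'" and ?x = "map (g i) xs"
        let ?SM = "lin_op D M \<iota>0 \<theta>"
        have x1: "?x = ?u \<oplus>\<^bsub>vs D M\<^esub> ?q (f' ^ n') ?v" using elim(1,2) s1 by simp
        have "?q (f' ^ k') ?u = \<zero>\<^bsub>vs D M\<^esub>" using elim(3,6) s2 by simp
        then have x2: "E.pact (f' ^ k') ?SM (\<iota>0 ?u) = 0" using linearization_poly_zero[OF dM l0 \<theta>e elim(7)] by blast
        have "?q (f' ^ (k' - n')) ?u \<noteq> \<zero>\<^bsub>vs D M\<^esub>" using elim(4,5,6) by simp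
        then have x3: "E.pact (f' ^ (k' - n')) ?SM (\<iota>0 ?u) \<noteq> 0" using linearization_poly_zero[OF dM l0 \<theta>e elim(7)] by blast
        have "\<iota>0 ?x = \<iota>0 ?u + \<iota>0 (?q (f' ^ n') ?v)"
          using l0 elim(7) poly_endo_in_VV[OF dM \<theta>e elim(8)] unfolding x1 linearization_def by blast
        then have "\<iota>0 ?x = \<iota>0 ?u + E.pact (f' ^ n') ?SM (\<iota>0 ?v)" using linearization_poly_endo[OF dM l0 \<theta>e elim(8)] by simp
        then have "E.separated ?c \<rho> (\<iota>0 ` VV D M) ?SM (\<iota>0 ?x)"
          unfolding E.separated_def using f' k' x2 x3 elim(7,8) by blast
        then have "\<iota>0 ?x \<notin> E.pact \<rho> ?SM ` (\<iota>0 ` VV D M)" by (rule E.not_in_image_if_separated[OF Cop[OF l0]])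
        then show ?case using Aim[OF l0 elim(9)] by simp
      qed
    qed
    have atoms_t: "V_atoms N2 e' \<chi> \<subseteq> tuples N2 ?n" by (rule V_atoms_tuples[OF s2 re' \<chi>f])
    have "eventually (\<lambda>i. sat (expand_V M A) (g i \<circ> e') \<chi> \<longleftrightarrow> sat N2 e' \<chi>) F"
    proof (rule qf_transfer[OF a sr re' \<chi>(1) \<chi>f])
      fix xs assume xs: "xs \<in> V_atoms N2 e' \<chi>"
      then have xt: "xs \<in> tuples N2 ?n" using atoms_t by blast
      show "eventually (\<lambda>i. map (g i) xs \<in> A) F" if "relI N2 (Inr ()) xs"
      proof -
        have "xs \<in> A2" using that xt by (simp add: A2_def V_of_def)
        moreover then have "xs \<in> TT" using xs A2(1) by (auto simp: TT_def)
        ultimately show ?thesis using pos by blast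
      qed
      show "eventually (\<lambda>i. map (g i) xs \<notin> A) F" if "\<not> relI N2 (Inr ()) xs"
      proof (cases "xs \<in> VV D ?N")
        case True
        then have "xs \<in> TT" "xs \<notin> A2" using xs that by (auto simp: TT_def A2_def V_of_def)
        then show ?thesis by (rule neg)
      next
        case False
        have "xs \<in> tuples ?N ?n" using xt by (simp add: tuples_def)
        moreover have "dom ?N \<noteq> {}" using oN by (simp add: vs_ops_def)
        ultimately have "eventually (\<lambda>i. map (g i) xs \<notin> VV D M) F" using asymp_elem_not_VV[OF a _ False] by blast
        then show ?thesis by eventually_elim (use Asub in blast)
      qed
    qed
    moreover have "eventually (\<lambda>i. \<forall>m\<in>fv \<phi>. g i (j (e m)) = e m) F"
      using e ret by (intro eventually_ball_finite finite_fv) auto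
    ultimately have "eventually (\<lambda>i. sat (expand_V M A) (g i \<circ> e') \<chi> \<and> (\<forall>m\<in>fv \<phi>. g i (j (e m)) = e m)) F"
      by eventually_elim (use e'(3) in simp)
    then obtain i where i: "sat (expand_V M A) (g i \<circ> e') \<chi>" "\<And>m. m \<in> fv \<phi> \<Longrightarrow> g i (j (e m)) = e m"
      using a by (auto simp: asymp_elem_def dest: eventually_happens)
    have gd: "g i b \<in> dom M" if "b \<in> dom N2" for b using a that by (simp add: asymp_elem_def)
    let ?e = "\<lambda>m. if m \<in> set ns then g i (e' m) else e m"
    have "sat (expand_V M A) ?e \<chi> \<longleftrightarrow> sat (expand_V M A) (g i \<circ> e') \<chi>"
    proof (rule sat_cong)
      fix m assume "m \<in> fv \<chi>"
      then show "?e m = (g i \<circ> e') m" using i(2)[of m] e'(1)[of m] by (auto simp: \<chi>(2) fv_foldr_Ex)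
    qed
    then have "sat (expand_V M A) ?e \<chi>" using i(1) by simp
    moreover have "\<forall>m\<in>set ns. ?e m \<in> dom (expand_V M A)" using gd re' by (auto simp: expand_V_def)
    ultimately show "sat (expand_V M A) e \<phi>"
      unfolding \<chi>(2) sat_foldr_Ex by (intro exI[of _ ?e]) simp
  qed
  then show ?thesis using modV by (simp add: ec_model_V_def)
qed

end

theorem theorem5p6:
  fixes L :: "('f, 'r) lang"
    and T :: "('f, 'r) form set"
    and D :: "('f, 'r, 'k::field) vs_formulas"
    and C :: "'k kernel_config"
    and \<rho> :: "'k poly"
    and M\<theta> :: "('f + nat, 'r, 'u) struct"
  defines "M \<equiv> reduct_theta M\<theta>"
    and "\<theta> \<equiv> theta (vdim D) M\<theta>"
  assumes "Funs L \<lesssim> (UNIV :: 'u set)"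
    and "Rels L \<lesssim> (UNIV :: 'u set)"
    and "theory_of L T"
    and "model_complete TYPE('u) L T"
    and "vs_formulas_of L D"
    and "\<And>N :: ('f, 'r, 'u) struct. model_of L T N \<Longrightarrow> defines_infinite_vs D N"
    and "kernel_config C"
    and "ec_model_C_theta TYPE('u) L T D C M\<theta>"
  shows "expand_V M (Im_poly D M \<rho> \<theta>) = expand_V M {\<zero>\<^bsub>vs D M\<^esub>}
       \<or> expand_V M (Im_poly D M \<rho> \<theta>) = expand_V M (VV D M)
       \<or> ec_model_V TYPE('w) L T D (expand_V M (Im_poly D M \<rho> \<theta>))"
proof -
  have ec: "ec_model_C_theta TYPE('u) L T D C M\<theta>" and C: "kernel_config C"
    and vs: "\<And>N :: ('f, 'r, 'u) struct. model_of L T N \<Longrightarrow> defines_infinite_vs D N" by fact+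
  have "model_of L T M"
    using ec by (simp add: ec_model_C_theta_def model_C_theta_def model_theta_def M_def)
  then have "infinite (dom M)" by (intro defines_vs_infinite_dom[of D] vs)
  then have inf: "infinite (UNIV :: 'u set)" by (rule infinite_super[OF subset_UNIV])
  interpret definable_vs "TYPE('u)" L T D
    by unfold_locales (fact inf assms vs)+
  show ?thesis
  proof (cases "Im_poly D M \<rho> \<theta> = {\<zero>\<^bsub>vs D M\<^esub>} \<or> Im_poly D M \<rho> \<theta> = VV D M")
    case True
    then show ?thesis
    proof
      assume "Im_poly D M \<rho> \<theta> = {\<zero>\<^bsub>vs D M\<^esub>}"
      then show ?thesis by (intro disjI1) (rule arg_cong)
    next
      assume "Im_poly D M \<rho> \<theta> = VV D M"
      then show ?thesis by (intro disjI2[OF disjI1]) (rule arg_cong)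
    qed
  next
    case False
    have "ec_model_V TYPE('w) L T D (expand_V (reduct_theta M\<theta>)
        (Im_poly D (reduct_theta M\<theta>) \<rho> (theta (vdim D) M\<theta>)))"
      by (rule ec_image[OF C ec]) (use False in \<open>simp_all only: M_def \<theta>_def not_False_eq_True de_Morgan_disj\<close>)
    then have "ec_model_V TYPE('w) L T D (expand_V M (Im_poly D M \<rho> \<theta>))" unfolding M_def \<theta>_def .
    then show ?thesis by (intro disjI2)
  qed
qed


end
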